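(* Let $\mathscr I=\mathscr I_\star\cap G_b\cap E$ and $\hat\Phi$ be as in the context. The ICA-solution $(\mathscr I,\hat\Phi)$ is robust in the following sense: both the map $\mathfrak I:(\mathfrak C,\tau_{\mathfrak C})\to(\mathfrak F,\mathfrak d)$, $(\mu,f)\mapsto\hat\Phi(f_\ast\mu)$, and the deviance $\partial_{\hat\Phi}:(\mathfrak C,\tau_{\mathfrak C})\to\mathbb R_+$ are continuous at every point of $\mathscr I$. In fact, for each $(\mu_\star,A)\in\mathscr I$ there are constants $\tilde c_0,\dots,\tilde c_4>0$, explicit and depending only on $(\mu_\star,A,c_{\mathfrak S},\tilde\kappa_0)$, with the following property. Given $\varepsilon>0$ let $$\tilde\delta:=\min\Big\{\tilde c_0,\ \tilde c_1^{2/\alpha}\Big(\frac{\varepsilon}{\tilde c_2+\varepsilon}\Big)^{2/\alpha}\Big\}.$$ Then for each $\mathfrak c=(\mu,f)\in\mathbb B_{\tilde\delta}(\mu_\star,A)$: (1) for every $\theta\in\mathfrak I(\mathfrak c)$ there are $M=M(\theta)\in\mathrm M_d$ with $\|M\|\le\tilde c_3$ and $E=E(\theta)\in\mathbb R^{d\times d}$ with $\|E\|\le\varepsilon$ such that $\theta=M(\mathrm I+E)A^{-1}$; (2) $\partial_{\hat\Phi}(\mathfrak c)\le\tilde c_4\big(\varepsilon+\bar d(A,f)(1+\varepsilon)\big)$. If only causes $(\mu,f)$ with $f\equiv A$ and $\mu\in\dot{\mathfrak D}$ (not necessarily in $\mathfrak S$) are considered, then for each $(\mu_\star,A)\in\mathscr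 I$ there are (simpler explicit) constants $\tilde c_0,\dots,\tilde c_4>0$, each of which can be chosen independently of $c_{\mathfrak S}$ (that is, depending only on $(\mu_\star,A,\tilde\kappa_0)$), with the following property. Given $\varepsilon>0$ let $$\tilde\delta:=\min\Big\{\tilde c_0,\ \tilde c_1^{2}\Big(\frac{\varepsilon}{\tilde c_2+\varepsilon}\Big)^{2}\Big\}.$$ Then for each $\mu\in\dot{\mathfrak D}$ with $\delta(\mu_\star,\mu)<\tilde\delta$: for every $\theta\in\hat\Phi(A_\ast\mu)$ there are $M=M(\theta)\in\mathrm M_d$ with $\|M\|\le\tilde c_3$ and $E=E(\theta)\in\mathbb R^{d\times d}$ with $\|E\|\le\varepsilon$ such that $\theta=M(\mathrm I+E)A^{-1}$; and $\partial_{\hat\Phi}(\mu,A)\le\tilde c_4\big(\varepsilon+\bar d(A,A)(1+\varepsilon)\big)=\tilde c_4\,\varepsilon$.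
   Context: Signals. Fix $d\ge2$. $\mathcal C_d$: continuous paths $[0,1]\to\mathbb R^d$ with the sup-norm; $\mathcal C^1\subset\mathcal C_d$: absolutely continuous paths; $\|x\|_{1\text{-var}}=|x_0|+\int_0^1|\dot x_s|ds$; $\mathcal M_1$: Borel probability measures on $\mathcal C_d$; $\mathfrak D=\{\mu\in\mathcal M_1\mid\mu(\mathcal C^1)=1\}$. For a word $w=i_1\cdots i_m$ over $[d]$: $\mathfrak{sig}_w(x)=\int_{0\le t_1\le\cdots\le t_m\le1}dx^{i_1}_{t_1}\cdots dx^{i_m}_{t_m}$ ($\mathfrak{sig}_\emptyset=1$), $\langle\mu\rangle_w=\int\mathfrak{sig}_wd\mu$. $[\mu]_0=(\langle\mu\rangle_{ij})_{ij}$, $[\mu]_\nu=(\langle\mu\rangle_{ij\nu})_{ij}$ ($\nu\in[d]$). $\dot{\mathfrak D}$: those $\mu\in\mathfrak D$ with all these entries existing in $\mathbb R$ and $\langle\mu\rangle_{ii}\ne0$ for all $i$. $f_\ast\mu$ is the push-forward under $x\mapsto(f(x_t))_t$, also written $f(\mu)$, $A\mu$. $D_\mu$: closure of $\bigcup_t\mathrm{supp}(\mu_t)$. $\|\cdot\|$: Frobenius norm, $\|\cdot\|_2$: spectral norm, $\kappa_2(B)=\|B\|_2\|B^{-1}\|_2$; $\mathrm M_d$: monomial matrices (invertible diagonal times permutation). $\mu$ is orthogonal if $\langle\mu\rangle_{ij}=\delta_{ij}\langle\mu\rangle_{ij}$, $\langle\mu\rangle_{ijk}=\delta_{ijk}\langle\mu\rangle_{ijk}$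 for all $i,j,k$. Premetrics: with $N_\mu=\mathrm{diag}(\langle\mu\rangle_{11},\dots,\langle\mu\rangle_{dd})^{1/2}$, $$\delta(\mu,\tilde\mu)^2=\|N_\mu^{-1}([\tilde\mu]_0-[\mu]_0)N_\mu^{-1}\|^2+\sum_{\nu=1}^d\langle\mu\rangle_{\nu\nu}^{-1}\|N_\mu^{-1}([\tilde\mu]_\nu-[\mu]_\nu)N_\mu^{-1}\|^2\quad(\mu,\tilde\mu\in\dot{\mathfrak D}).$$ On the group $C^{1,1}$ of $C^1$-diffeomorphisms of $\mathbb R^d$: $\bar d(\theta_1,\theta_2)=\min\{(\|\theta_1^{-1}\circ\theta_2-\mathrm{id}\|_\infty+1)\,\|D(\theta_1^{-1}\circ\theta_2-\mathrm{id})\|_\infty,\,1\}$, where $\|D_R\|_\infty=\sup_x\|D_R(x)\|_2$ for the Jacobian. Domain $E$: a set $\mathfrak U\subseteq\mathfrak D$ is core-integrable as per $(K,\beta,p,\alpha)$ if $\inf_{a>0}\sup_{\mu\in\mathfrak U}\int_{\{|\mathfrak{sig}_w|>a\}}|\mathfrak{sig}_w|d\mu=0$ for all words $w$ of length $\le3$, and $K=\sup_{\mu\in\mathfrak U}\int\|x\|_{1\text{-var}}^\beta\mu(dx)<\infty$ for the fixed $\beta\in(5/2,3)$, where $p=(\beta-2)^{-1}$ and $\alpha=1-1/p$. Fix $\mathfrak S\subseteq\dot{\mathfrak D}$ core-integrable as per $c_{\mathfrak S}=(K_{\mathfrak S},\beta,p,\alpha)$ and let $E=\mathfrak S\times C^{1,1}$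 with premetric $\mathbf d((\mu_1,\theta_1),(\mu_2,\theta_2))=\delta(\mu_1,\mu_2)+\bar d(\theta_1,\theta_2)$ and balls $\mathbb B_r(\mu_\star,A)=\{\mathfrak p\in E\mid\mathbf d((\mu_\star,A),\mathfrak p)<r\}$. The topology $\tau_{\mathbf d}$ on $E$: a set is open iff it contains with each of its points some $\mathbf d$-ball centred there. Causal space: $\mathfrak C$ is the set of pairs $(S,f)$ with $S\in\mathcal M_1$, $f:\mathbb R^d\to\mathbb R^d$ such that $f|_{D_S}$ is a homeomorphism onto its image. $\tau_{\mathfrak C}$ is the disjoint union topology of $(E,\tau_{\mathbf d})$ and $\mathfrak C\setminus E$ with the trivial topology. Inversion map: $C_\mu=\frac12([\mu]_0+[\mu]_0^\top)$; for invertible $C_\mu$, $R_{(\mu)}=C_\mu^{-1/2}$. For $\theta\in\mathrm{GL}_d$: $\mathfrak x_0(\theta)=N_{\theta\mu}^{-1}[\theta\mu]_0N_{\theta\mu}^{-1}$, $\mathfrak x_\nu(\theta)=\langle\theta\mu\rangle_{\nu\nu}^{-1/2}N_{\theta\mu}^{-1}[\theta\mu]_\nu N_{\theta\mu}^{-1}$ ($\nu\in[d]$); $\phi_\mu(\theta)=\sum_{\nu=0}^d\|\mathfrak x_\nu(\theta R_{(\mu)})\|_\times^2$, where $\|T\|_\times$ is the Frobenius norm of $T$ minus its diagonal part. Fix $b\ge1$, $\Delta_\kappa>0$, $\tilde\kappa_0=b+\Delta_\kappa$; $\tilde\Xi_1$ is the set of $\theta\in\mathrm{GL}_d$ with rows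 of Euclidean norm $1$ and $\kappa_2(\theta)\le\tilde\kappa_0$. $\hat\Phi(\mu)=\{\theta R_{(\mu)}\mid\theta\in\arg\min_{\tilde\Xi_1}\phi_\mu\}$ for $\mu\in\dot{\mathfrak D}$ with $C_\mu$ invertible, extended arbitrarily to a map $\hat\Phi:\mathcal M_1\to\mathfrak F$. $\mathfrak F$ is the set of non-empty compact subsets of $\mathrm{GL}_d$ and $\mathfrak d$ the Hausdorff distance on $\mathfrak F$ (with respect to $\|\cdot\|$). Causes: $\mathscr I_\star=\mathscr S_\star\times\mathrm{GL}_d$, where $\mathscr S_\star$ is the set of orthogonal $\mu\in\dot{\mathfrak D}$ with $C_\mu$ invertible and $\langle\mu\rangle_{iii}=0$ for at most one $i$. (By re-enumeration convention this index, if it exists, is $i=1$.) $G_b$ is the set of $(\mu,A)\in\mathfrak D\times\mathrm{GL}_d$ with $\kappa_2(\bar B_{(A,\mu)})\le b$, where $\bar B_{(A,\mu)}$ is $(R_{(A\mu)}A)^{-1}$ with rows rescaled to Euclidean norm one. Deviance: $$\partial_{\hat\Phi}(S,f)=\sup_{B\in\hat\Phi(f(S))}\ \inf_{(M,v)\in\mathrm M_d\times\mathbb R^d}\ \sup_{u\in v+D_S}\frac{|Bf(u-v)-Mu|}{|Mu|}\mathbf 1_{\{Mu\ne0\}}$$ (quotient read as $0$ if $Mu=0$). *)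

theory Defs
  imports "HOL-Probability.Probability"
begin

section \<open>Path space and signature moments\<close>

text \<open>
  A continuous path on the unit interval is identified with its extension to the real line that is
  constant to the left of 0 and to the right of 1. On these extensions the sup-norm of the library
  type of bounded continuous functions is the sup-norm over the unit interval.
\<close>

type_synonym 'd curve = "real \<Rightarrow>\<^sub>C (real^'d)"
type_synonym 'd law = "'d curve measure"

definition paths :: "('d::finite) curve set" where
  "paths = {x. \<forall>t. apply_bcontfun x t = apply_bcontfun x (clamp 0 1 t)}"

definition path_space :: "('d::finite) law" where
  "path_space = restrict_space borel paths"

definition laws :: "('d::finite) law set" where
  "laws = {\<mu>. sets \<mu> = sets path_space \<and> prob_space \<mu>}"

definition absolutely_continuous_01 :: "(real \<Rightarrow> 'a::metric_space) \<Rightarrow> bool" where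
  "absolutely_continuous_01 x \<longleftrightarrow>
    (\<forall>\<epsilon>>0. \<exists>\<delta>>0. \<forall>P. finite P \<and> (\<forall>(s, t)\<in>P. 0 \<le> s \<and> s \<le> t \<and> t \<le> 1) \<and>
        disjoint_family_on (\<lambda>(s, t). {s<..<t}) P \<and> (\<Sum>(s, t)\<in>P. t - s) < \<delta> \<longrightarrow>
        (\<Sum>(s, t)\<in>P. dist (x s) (x t)) < \<epsilon>)"

definition ac_paths :: "('d::finite) curve set" where
  "ac_paths = {x \<in> paths. absolutely_continuous_01 (apply_bcontfun x)}"

text \<open>The derivative of an absolutely continuous path; only its values almost everywhere matter.\<close>

definition path_deriv :: "('d::finite) curve \<Rightarrow> real \<Rightarrow> real^'d" where
  "path_deriv x t = vector_derivative (apply_bcontfun x) (at t)"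

text \<open>Functionals of absolutely continuous paths are set to 0 at all other paths; for the measures
  considered below these form a null set.\<close>

definition one_var :: "('d::finite) curve \<Rightarrow> real" where
  "one_var x = (if x \<in> ac_paths
     then norm (apply_bcontfun x 0) + (LBINT s:{0..1}. norm (path_deriv x s)) else 0)"

text \<open>\<open>iter_int x [i1, ..., im] s\<close> is the iterated integral over the simplex
  \<open>s \<le> t1 \<le> ... \<le> tm \<le> 1\<close>; the outermost integration variable is \<open>t1\<close>.\<close>

primrec iter_int :: "('d::finite) curve \<Rightarrow> 'd list \<Rightarrow> real \<Rightarrow> real" where
  "iter_int x [] s = 1"
| "iter_int x (i # w) s = (LBINT t:{s..1}. path_deriv x t $ i * iter_int x w t)"

definition sig :: "('d::finite) list \<Rightarrow> 'd curve \<Rightarrow> real" where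
  "sig w x = (if x \<in> ac_paths then iter_int x w 0 else 0)"

definition esig :: "('d::finite) law \<Rightarrow> 'd list \<Rightarrow> real" where
  "esig \<mu> w = (\<integral>x. sig w x \<partial>\<mu>)"

definition coord0 :: "('d::finite) law \<Rightarrow> real^'d^'d" where
  "coord0 \<mu> = (\<chi> i j. esig \<mu> [i, j])"

definition coord :: "('d::finite) law \<Rightarrow> 'd \<Rightarrow> real^'d^'d" where
  "coord \<mu> \<nu> = (\<chi> i j. esig \<mu> [i, j, \<nu>])"

definition ac_laws :: "('d::finite) law set" where
  "ac_laws = {\<mu> \<in> laws. emeasure \<mu> ac_paths = 1}"

definition dot_laws :: "('d::finite) law set" where
  "dot_laws = {\<mu> \<in> ac_laws. (\<forall>w. length w \<in> {2, 3} \<longrightarrow> integrable \<mu> (sig w)) \<and>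
     (\<forall>i. esig \<mu> [i, i] \<noteq> 0)}"

definition measure_supp :: "('a::topological_space) measure \<Rightarrow> 'a set" where
  "measure_supp M = {z. \<forall>U. open U \<and> z \<in> U \<longrightarrow> emeasure M U > 0}"

definition marginal :: "('d::finite) law \<Rightarrow> real \<Rightarrow> (real^'d) measure" where
  "marginal \<mu> t = distr \<mu> borel (\<lambda>x. apply_bcontfun x t)"

definition spatial_supp :: "('d::finite) law \<Rightarrow> (real^'d) set" where
  "spatial_supp \<mu> = closure (\<Union>t\<in>{0..1}. measure_supp (marginal \<mu> t))"

text \<open>The transformation \<open>f\<close> need only be continuous on \<open>spatial_supp \<mu>\<close>, so \<open>f \<circ> x\<close> may fail to be
  continuous for the \<open>\<mu>\<close>-null set of paths \<open>x\<close> that leave \<open>spatial_supp \<mu>\<close>. Those are mapped to the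
  zero path, which keeps the push-forward map measurable.\<close>

definition pushforward :: "(real^'d \<Rightarrow> real^'d) \<Rightarrow> ('d::finite) law \<Rightarrow> 'd law" where
  "pushforward f \<mu> = distr \<mu> path_space
     (\<lambda>x. if range (apply_bcontfun x) \<subseteq> spatial_supp \<mu>
          then Bcontfun (\<lambda>t. f (apply_bcontfun x t)) else 0)"

definition orthogonal_law :: "('d::finite) law \<Rightarrow> bool" where
  "orthogonal_law \<mu> \<longleftrightarrow>
    (\<forall>i j. esig \<mu> [i, j] = of_bool (i = j) * esig \<mu> [i, j]) \<and>
    (\<forall>i j k. esig \<mu> [i, j, k] = of_bool (i = j \<and> j = k) * esig \<mu> [i, j, k])"


section \<open>Matrices\<close>

text \<open>The norm of the type \<open>real^'d^'d\<close> is the Frobenius norm.\<close>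

definition GL :: "(real^'d^'d) set" where
  "GL = {A. invertible A}"

definition spectral_norm :: "real^'d^'d \<Rightarrow> real" where
  "spectral_norm A = onorm ((*v) A)"

definition cond2 :: "real^'d^'d \<Rightarrow> real" where
  "cond2 B = spectral_norm B * spectral_norm (matrix_inv B)"

definition diag_mat :: "real^'d \<Rightarrow> real^'d^'d" where
  "diag_mat v = (\<chi> i j. if i = j then v $ i else 0)"

definition perm_mat :: "('d \<Rightarrow> 'd) \<Rightarrow> real^'d^'d" where
  "perm_mat \<pi> = (\<chi> i j. if j = \<pi> i then 1 else 0)"

definition monomial_mats :: "(real^'d^'d) set" where
  "monomial_mats = {diag_mat v ** perm_mat \<pi> | v \<pi>. (\<forall>i. v $ i \<noteq> 0) \<and> \<pi> permutes UNIV}"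

definition normalize_rows :: "real^'d^'d \<Rightarrow> real^'d^'d" where
  "normalize_rows B = (\<chi> i. (1 / norm (B $ i)) *\<^sub>R (B $ i))"

definition offdiag_norm :: "real^'d^'d \<Rightarrow> real" where
  "offdiag_norm T = norm (T - diag_mat (\<chi> i. T $ i $ i))"


section \<open>Premetrics and the domain\<close>

definition Nmat :: "('d::finite) law \<Rightarrow> real^'d^'d" where
  "Nmat \<mu> = diag_mat (\<chi> i. sqrt (esig \<mu> [i, i]))"

definition law_premetric :: "('d::finite) law \<Rightarrow> 'd law \<Rightarrow> real" where
  "law_premetric \<mu> \<mu>' = sqrt
     ((norm (matrix_inv (Nmat \<mu>) ** (coord0 \<mu>' - coord0 \<mu>) ** matrix_inv (Nmat \<mu>)))\<^sup>2 +
      (\<Sum>\<nu>\<in>UNIV. inverse (esig \<mu> [\<nu>, \<nu>]) *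
        (norm (matrix_inv (Nmat \<mu>) ** (coord \<mu>' \<nu> - coord \<mu> \<nu>) ** matrix_inv (Nmat \<mu>)))\<^sup>2))"

definition C1_map :: "(real^'d \<Rightarrow> real^'d) \<Rightarrow> bool" where
  "C1_map f \<longleftrightarrow> (\<forall>x. f differentiable (at x)) \<and> continuous_on UNIV (\<lambda>x. jacobian f (at x))"

definition C1_diffeos :: "(real^'d \<Rightarrow> real^'d) set" where
  "C1_diffeos = {f. bij f \<and> C1_map f \<and> C1_map (inv f)}"

definition sup_norm :: "(real^'d \<Rightarrow> real^'d) \<Rightarrow> ennreal" where
  "sup_norm R = (SUP x. ennreal (norm (R x)))"

definition jac_sup_norm :: "(real^'d \<Rightarrow> real^'d) \<Rightarrow> ennreal" where
  "jac_sup_norm R = (SUP x. ennreal (spectral_norm (jacobian R (at x))))"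

definition diffeo_premetric :: "(real^'d \<Rightarrow> real^'d) \<Rightarrow> (real^'d \<Rightarrow> real^'d) \<Rightarrow> real" where
  "diffeo_premetric \<theta>1 \<theta>2 =
     (let R = (\<lambda>x. (inv \<theta>1 \<circ> \<theta>2) x - x)
      in enn2real (min ((sup_norm R + 1) * jac_sup_norm R) 1))"

definition core_integrable :: "('d::finite) law set \<Rightarrow> real \<Rightarrow> real \<Rightarrow> real \<Rightarrow> real \<Rightarrow> bool" where
  "core_integrable \<UU> K \<beta> p \<alpha> \<longleftrightarrow>
     \<UU> \<subseteq> ac_laws \<and> \<beta> \<in> {5/2<..<3} \<and> p = inverse (\<beta> - 2) \<and> \<alpha> = 1 - 1 / p \<and>
     (\<forall>w. length w \<le> 3 \<longrightarrow>
        (INF a\<in>{0<..}. SUP \<mu>\<in>\<UU>.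
           \<integral>\<^sup>+x. ennreal \<bar>sig w x\<bar> * indicator {x. \<bar>sig w x\<bar> > a} x \<partial>\<mu>) = 0) \<and>
     0 \<le> K \<and> (SUP \<mu>\<in>\<UU>. \<integral>\<^sup>+x. ennreal (one_var x powr \<beta>) \<partial>\<mu>) = ennreal K"

type_synonym 'd cause = "'d law \<times> (real^'d \<Rightarrow> real^'d)"

definition domain_E :: "('d::finite) law set \<Rightarrow> 'd cause set" where
  "domain_E \<SS> = \<SS> \<times> C1_diffeos"

definition cause_premetric :: "('d::finite) cause \<Rightarrow> 'd cause \<Rightarrow> real" where
  "cause_premetric p q = law_premetric (fst p) (fst q) + diffeo_premetric (snd p) (snd q)"

definition cause_ball :: "('d::finite) law set \<Rightarrow> 'd cause \<Rightarrow> real \<Rightarrow> 'd cause set" where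
  "cause_ball \<SS> p r = {q \<in> domain_E \<SS>. cause_premetric p q < r}"

definition E_topology :: "('d::finite) law set \<Rightarrow> 'd cause topology" where
  "E_topology \<SS> =
     topology (\<lambda>U. U \<subseteq> domain_E \<SS> \<and> (\<forall>p\<in>U. \<exists>r>0. cause_ball \<SS> p r \<subseteq> U))"

lemma openin_E_topology:
  "openin (E_topology \<SS>) U \<longleftrightarrow> U \<subseteq> domain_E \<SS> \<and> (\<forall>p\<in>U. \<exists>r>0. cause_ball \<SS> p r \<subseteq> U)"
proof -
  have "istopology (\<lambda>U. U \<subseteq> domain_E \<SS> \<and> (\<forall>p\<in>U. \<exists>r>0. cause_ball \<SS> p r \<subseteq> U))"
    unfolding istopology_def
  proof (intro conjI allI impI ballI)
    fix S T p
    assume S: "S \<subseteq> domain_E \<SS> \<and> (\<forall>p\<in>S. \<exists>r>0. cause_ball \<SS> p r \<subseteq> S)"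
      and T: "T \<subseteq> domain_E \<SS> \<and> (\<forall>p\<in>T. \<exists>r>0. cause_ball \<SS> p r \<subseteq> T)"
    show "S \<inter> T \<subseteq> domain_E \<SS>" using S by blast
    assume "p \<in> S \<inter> T"
    then obtain r s where "r > 0" "cause_ball \<SS> p r \<subseteq> S" "s > 0" "cause_ball \<SS> p s \<subseteq> T"
      using S T by blast
    then have "min r s > 0 \<and> cause_ball \<SS> p (min r s) \<subseteq> S \<inter> T"
      unfolding cause_ball_def by auto
    then show "\<exists>r>0. cause_ball \<SS> p r \<subseteq> S \<inter> T" by blast
  next
    fix \<K>
    assume K: "\<forall>k\<in>\<K>. k \<subseteq> domain_E \<SS> \<and> (\<forall>p\<in>k. \<exists>r>0. cause_ball \<SS> p r \<subseteq> k)"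
    then show "\<Union>\<K> \<subseteq> domain_E \<SS>" by blast
    fix p assume "p \<in> \<Union>\<K>"
    then obtain k where "k \<in> \<K>" "p \<in> k" by blast
    with K obtain r where "r > 0" "cause_ball \<SS> p r \<subseteq> k" by blast
    with \<open>k \<in> \<K>\<close> show "\<exists>r>0. cause_ball \<SS> p r \<subseteq> \<Union>\<K>" by blast
  qed
  then show ?thesis by (simp add: E_topology_def)
qed


section \<open>The causal space\<close>

definition causal_space :: "('d::finite) cause set" where
  "causal_space = {(S, f). S \<in> laws \<and>
     (\<exists>g. homeomorphism (spatial_supp S) (f ` spatial_supp S) f g)}"

definition causal_topology :: "('d::finite) law set \<Rightarrow> 'd cause topology" where
  "causal_topology \<SS> = topology (\<lambda>U. U \<subseteq> causal_space \<and>
     openin (E_topology \<SS>) (U \<inter> domain_E \<SS>) \<and>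
     (U - domain_E \<SS> = {} \<or> U - domain_E \<SS> = causal_space - domain_E \<SS>))"

lemma openin_causal_topology:
  "openin (causal_topology \<SS>) U \<longleftrightarrow> U \<subseteq> causal_space \<and>
     openin (E_topology \<SS>) (U \<inter> domain_E \<SS>) \<and>
     (U - domain_E \<SS> = {} \<or> U - domain_E \<SS> = causal_space - domain_E \<SS>)"
proof -
  have "istopology (\<lambda>U. U \<subseteq> causal_space \<and>
     openin (E_topology \<SS>) (U \<inter> domain_E \<SS>) \<and>
     (U - domain_E \<SS> = {} \<or> U - domain_E \<SS> = causal_space - domain_E \<SS>))" (is "istopology ?P")
    unfolding istopology_def
  proof (intro conjI allI impI)
    fix S T assume S: "?P S" and T: "?P T"
    show "S \<inter> T \<subseteq> causal_space" using S by blast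
    have "(S \<inter> T) \<inter> domain_E \<SS> = (S \<inter> domain_E \<SS>) \<inter> (T \<inter> domain_E \<SS>)" by blast
    then show "openin (E_topology \<SS>) ((S \<inter> T) \<inter> domain_E \<SS>)"
      using S T by (metis openin_Int)
    show "(S \<inter> T) - domain_E \<SS> = {} \<or> (S \<inter> T) - domain_E \<SS> = causal_space - domain_E \<SS>"
      using S T by blast
  next
    fix \<K> assume K: "\<forall>k\<in>\<K>. ?P k"
    then show "\<Union>\<K> \<subseteq> causal_space" by blast
    have "\<Union>\<K> \<inter> domain_E \<SS> = \<Union>((\<lambda>k. k \<inter> domain_E \<SS>) ` \<K>)" by blast
    then show "openin (E_topology \<SS>) (\<Union>\<K> \<inter> domain_E \<SS>)"
      using K by (simp only:) (rule openin_Union, blast)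
    show "\<Union>\<K> - domain_E \<SS> = {} \<or> \<Union>\<K> - domain_E \<SS> = causal_space - domain_E \<SS>"
    proof (cases "\<forall>k\<in>\<K>. k - domain_E \<SS> = {}")
      case True
      then show ?thesis by blast
    next
      case False
      then obtain k where "k \<in> \<K>" "k - domain_E \<SS> = causal_space - domain_E \<SS>"
        using K by blast
      then show ?thesis using K by blast
    qed
  qed
  then show ?thesis by (simp add: causal_topology_def)
qed


section \<open>The inversion map\<close>

definition Cmat :: "('d::finite) law \<Rightarrow> real^'d^'d" where
  "Cmat \<mu> = (1/2) *\<^sub>R (coord0 \<mu> + transpose (coord0 \<mu>))"

text \<open>\<open>Rmat \<mu>\<close> is the symmetric positive definite square root of \<open>matrix_inv (Cmat \<mu>)\<close>; note that
  \<open>Cmat \<mu>\<close> is half the second moment matrix of the increment of the path over the unit interval.\<close>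

definition Rmat :: "('d::finite) law \<Rightarrow> real^'d^'d" where
  "Rmat \<mu> = (THE R. transpose R = R \<and> (\<forall>v. v \<noteq> 0 \<longrightarrow> 0 < v \<bullet> (R *v v)) \<and>
     R ** R = matrix_inv (Cmat \<mu>))"

definition x0_mat :: "('d::finite) law \<Rightarrow> real^'d^'d \<Rightarrow> real^'d^'d" where
  "x0_mat \<mu> \<theta> = (let \<mu>' = pushforward ((*v) \<theta>) \<mu> in
     matrix_inv (Nmat \<mu>') ** coord0 \<mu>' ** matrix_inv (Nmat \<mu>'))"

definition x_mat :: "('d::finite) law \<Rightarrow> 'd \<Rightarrow> real^'d^'d \<Rightarrow> real^'d^'d" where
  "x_mat \<mu> \<nu> \<theta> = (let \<mu>' = pushforward ((*v) \<theta>) \<mu> in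
     (1 / sqrt (esig \<mu>' [\<nu>, \<nu>])) *\<^sub>R
       (matrix_inv (Nmat \<mu>') ** coord \<mu>' \<nu> ** matrix_inv (Nmat \<mu>')))"

definition contrast :: "('d::finite) law \<Rightarrow> real^'d^'d \<Rightarrow> real" where
  "contrast \<mu> \<theta> = (offdiag_norm (x0_mat \<mu> (\<theta> ** Rmat \<mu>)))\<^sup>2 +
     (\<Sum>\<nu>\<in>UNIV. (offdiag_norm (x_mat \<mu> \<nu> (\<theta> ** Rmat \<mu>)))\<^sup>2)"

definition Xi1 :: "real \<Rightarrow> (real^'d^'d) set" where
  "Xi1 \<kappa>0 = {\<theta> \<in> GL. (\<forall>i. norm (\<theta> $ i) = 1) \<and> cond2 \<theta> \<le> \<kappa>0}"

definition compact_GL_sets :: "(real^'d^'d) set set" where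
  "compact_GL_sets = {K. K \<noteq> {} \<and> compact K \<and> K \<subseteq> GL}"

text \<open>The Hausdorff distance is only needed for non-empty compact sets; the value 0 elsewhere is what
  the library's locale of metric spaces asks for outside the carrier.\<close>

definition hausdorff_dist :: "('a::metric_space) set \<Rightarrow> 'a set \<Rightarrow> real" where
  "hausdorff_dist K L = (if compact K \<and> K \<noteq> {} \<and> compact L \<and> L \<noteq> {}
     then max (SUP a\<in>K. infdist a L) (SUP b\<in>L. infdist b K) else 0)"

lemma hausdorff_bdd:
  assumes "compact K" "L \<noteq> {}"
  shows "bdd_above ((\<lambda>a. infdist a L) ` K)"
proof -
  have "compact ((\<lambda>a. infdist a L) ` K)"
    using assms by (intro compact_continuous_image continuous_intros)
  then show ?thesis by (simp add: compact_imp_bounded bounded_imp_bdd_above)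
qed

lemma hausdorff_one_sided_triangle:
  fixes K L M :: "('a::heine_borel) set"
  assumes "compact K" "K \<noteq> {}" "compact L" "L \<noteq> {}" "compact M" "M \<noteq> {}"
  shows "(SUP a\<in>K. infdist a M) \<le> (SUP a\<in>K. infdist a L) + (SUP b\<in>L. infdist b M)"
proof (rule cSUP_least)
  show "K \<noteq> {}" by fact
  fix a assume a: "a \<in> K"
  obtain b where b: "b \<in> L" "infdist a L = dist a b"
    using infdist_attains_inf[of L a] assms by (auto simp: compact_imp_closed)
  have "infdist a M \<le> infdist b M + dist a b" by (rule infdist_triangle)
  also have "infdist b M \<le> (SUP b\<in>L. infdist b M)"
    by (rule cSUP_upper[OF b(1) hausdorff_bdd]) (use assms in auto)
  also have "dist a b \<le> (SUP a\<in>K. infdist a L)"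
    unfolding b(2)[symmetric] by (rule cSUP_upper[OF a hausdorff_bdd]) (use assms in auto)
  finally show "infdist a M \<le> (SUP a\<in>K. infdist a L) + (SUP b\<in>L. infdist b M)" by simp
qed

lemma hausdorff_zero_subset:
  assumes "compact K" "compact L" "L \<noteq> {}" "(SUP a\<in>K. infdist a L) \<le> 0"
  shows "K \<subseteq> L"
proof
  fix a assume a: "a \<in> K"
  have "infdist a L \<le> (SUP a\<in>K. infdist a L)"
    by (rule cSUP_upper[OF a hausdorff_bdd]) (use assms in auto)
  then have "infdist a L = 0" using assms(4) infdist_nonneg[of a L] by linarith
  then show "a \<in> L" using assms in_closed_iff_infdist_zero compact_imp_closed by blast
qed

lemma hausdorff_nonneg:
  assumes "compact K" "K \<noteq> {}" "L \<noteq> {}"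
  shows "0 \<le> (SUP a\<in>K. infdist a L)"
proof -
  obtain a where "a \<in> K" using assms by blast
  then have "infdist a L \<le> (SUP a\<in>K. infdist a L)"
    by (rule cSUP_upper[OF _ hausdorff_bdd]) (use assms in auto)
  then show ?thesis using infdist_nonneg[of a L] by linarith
qed

lemma Metric_space_hausdorff:
  "Metric_space (compact_GL_sets :: (real^'d^'d) set set) hausdorff_dist"
proof
  fix K L M :: "(real^'d^'d) set"
  show "0 \<le> hausdorff_dist K L"
    using hausdorff_nonneg[of K L] by (simp add: hausdorff_dist_def le_max_iff_disj)
  show "hausdorff_dist K L = hausdorff_dist L K"
    by (auto simp: hausdorff_dist_def max.commute)
  assume KL: "K \<in> compact_GL_sets" "L \<in> compact_GL_sets"
  show "hausdorff_dist K L = 0 \<longleftrightarrow> K = L"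
  proof
    assume "hausdorff_dist K L = 0"
    then have "(SUP a\<in>K. infdist a L) \<le> 0" "(SUP b\<in>L. infdist b K) \<le> 0"
      using KL by (auto simp: hausdorff_dist_def compact_GL_sets_def max_def split: if_splits)
    then show "K = L"
      using hausdorff_zero_subset[of K L] hausdorff_zero_subset[of L K] KL
      by (auto simp: compact_GL_sets_def)
  next
    assume "K = L"
    then have "(SUP a\<in>K. infdist a L) = (SUP a\<in>K. 0)" by (intro SUP_cong) auto
    then show "hausdorff_dist K L = 0"
      using \<open>K = L\<close> KL by (simp add: hausdorff_dist_def compact_GL_sets_def)
  qed
  assume M: "M \<in> compact_GL_sets"
  show "hausdorff_dist K M \<le> hausdorff_dist K L + hausdorff_dist L M"
    using hausdorff_one_sided_triangle[of K L M] hausdorff_one_sided_triangle[of M L K] KL M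
    by (auto simp: hausdorff_dist_def compact_GL_sets_def)
qed

definition hausdorff_topology :: "(real^'d^'d) set topology" where
  "hausdorff_topology = Metric_space.mtopology compact_GL_sets hausdorff_dist"

text \<open>Outside of the laws in \<open>dot_laws\<close> with invertible \<open>Cmat\<close>, the value of an inversion map is an
  arbitrary non-empty compact set of invertible matrices.\<close>

definition inversion_map :: "real \<Rightarrow> (('d::finite) law \<Rightarrow> (real^'d^'d) set) \<Rightarrow> bool" where
  "inversion_map \<kappa>0 \<Phi> \<longleftrightarrow> \<Phi> \<in> laws \<rightarrow> compact_GL_sets \<and>
     (\<forall>\<mu>\<in>dot_laws. invertible (Cmat \<mu>) \<longrightarrow>
        \<Phi> \<mu> = {\<theta> ** Rmat \<mu> | \<theta>. is_arg_min (contrast \<mu>) (\<lambda>\<theta>. \<theta> \<in> Xi1 \<kappa>0) \<theta>})"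

definition inversion :: "(('d::finite) law \<Rightarrow> (real^'d^'d) set) \<Rightarrow> 'd cause \<Rightarrow> (real^'d^'d) set" where
  "inversion \<Phi> c = \<Phi> (pushforward (snd c) (fst c))"


section \<open>Identifiable causes and the deviance\<close>

definition S_star :: "('d::finite) law set" where
  "S_star = {\<mu> \<in> dot_laws. orthogonal_law \<mu> \<and> invertible (Cmat \<mu>) \<and>
     card {i. esig \<mu> [i, i, i] = 0} \<le> 1}"

definition I_star :: "(('d::finite) law \<times> (real^'d^'d)) set" where
  "I_star = S_star \<times> GL"

definition Bbar :: "real^'d^'d \<Rightarrow> ('d::finite) law \<Rightarrow> real^'d^'d" where
  "Bbar A \<mu> = normalize_rows (matrix_inv (Rmat (pushforward ((*v) A) \<mu>) ** A))"

definition G_set :: "real \<Rightarrow> (('d::finite) law \<times> (real^'d^'d)) set" where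
  "G_set b = {(\<mu>, A) \<in> ac_laws \<times> GL. cond2 (Bbar A \<mu>) \<le> b}"

text \<open>A matrix \<open>A\<close> is identified with the linear map \<open>(*v) A\<close> when a pair is read as a point of the
  causal space.\<close>

definition ica_causes :: "real \<Rightarrow> ('d::finite) law set \<Rightarrow> ('d law \<times> (real^'d^'d)) set" where
  "ica_causes b \<SS> = {(\<mu>, A). (\<mu>, A) \<in> I_star \<inter> G_set b \<and> (\<mu>, (*v) A) \<in> domain_E \<SS>}"

text \<open>The suprema may be infinite at a general point of the causal space, hence the values in
  \<open>ennreal\<close>.\<close>

definition deviance :: "(('d::finite) law \<Rightarrow> (real^'d^'d) set) \<Rightarrow> 'd cause \<Rightarrow> ennreal" where
  "deviance \<Phi> c = (case c of (S, f) \<Rightarrow>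
     SUP B \<in> \<Phi> (pushforward f S).
     INF (M, v) \<in> monomial_mats \<times> UNIV.
     SUP u \<in> (\<lambda>z. v + z) ` spatial_supp S.
       ennreal (if M *v u = 0 then 0 else norm (B *v f (u - v) - M *v u) / norm (M *v u)))"

definition ica_setting ::
  "('d::finite) law set \<Rightarrow> real \<Rightarrow> real \<Rightarrow> real \<Rightarrow> real \<Rightarrow> real \<Rightarrow> real \<Rightarrow>
   ('d law \<Rightarrow> (real^'d^'d) set) \<Rightarrow> bool" where
  "ica_setting \<SS> K \<beta> p \<alpha> b \<Delta> \<Phi> \<longleftrightarrow>
     \<SS> \<subseteq> dot_laws \<and> core_integrable \<SS> K \<beta> p \<alpha> \<and> 1 \<le> b \<and> 0 < \<Delta> \<and> inversion_map (b + \<Delta>) \<Phi>"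

end

theory Submission imports Defs
begin

text \<open>
  Near a cause \<open>(\<mu>\<^sub>*, A)\<close> write \<open>f = A \<circ> (id + R)\<close>. A bound on \<open>diffeo_premetric\<close> makes \<open>R\<close> Lipschitz with a small
  constant and \<open>(1 - \<alpha>)\<close>-Hoelder with a constant of order \<open>\<delta>\<^sup>\<alpha>\<close>. The signature integrals of \<open>(id + R)(x)\<close> and
  \<open>x\<close> differ by the oscillation of \<open>R(x)\<close> times powers of the 1-variation \<open>L\<close> of \<open>x\<close>, hence by a multiple of
  \<open>1 + L\<^sup>\<beta>\<close>, which is integrable; so the second and third moments of the push-forward are close to the linear images of those of
  \<open>\<mu>\<^sub>*\<close>. For exact moments the contrast vanishes at the orthogonal whitened mixing matrix, and small contrast
  forces \<open>\<theta> R A \<Lambda>\<^sup>1\<^sup>/\<^sup>2\<close> (with \<open>\<Lambda>\<close> the diagonal of second moments) to be close to a signed permutation \<open>W\<close>, because at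
  most one third moment vanishes. This gives \<open>M = W \<Lambda>\<^sup>-\<^sup>1\<^sup>/\<^sup>2\<close>, the bound for the error matrix \<open>E\<close>, and the deviance bound with the
  shift \<open>v = -z\<close>, where \<open>z\<close> is the zero of \<open>id + R\<close>.
\<close>

section \<open>Absolutely continuous functions\<close>

text \<open>The exponents come from one count. In a word of length 3, one letter is paid for by the
  oscillation of \<open>R(x)\<close>, at the price \<open>L powr (1 - \<alpha>)\<close>, and the
  other two by the variation, at the price \<open>L ^ 2\<close>; since \<beta> = 3 - \<alpha>, this
  is exactly the available moment. The Hoelder bound is an interpolation: the premetric controls the
  Lipschitz constant of \<open>R\<close> and its product with the sup-norm, but not the sup-norm.
  The resulting rate is \<open>\<delta> powr \<alpha>\<close>; the exponent
  \<open>2 / \<alpha>\<close> of the statement leaves a square to spare.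

  Two obstacles shape the rest. The derivative of a path is the pointwise vector derivative, so
  absolutely continuous paths must be shown to be differentiable almost everywhere and to be
  recovered from their derivatives. And the constants precede the choice of \<open>\<SS>\<close>,
  \<open>b\<close>, \<open>\<Delta>\<close> and \<open>\<Phi>\<close>, so the contrast is analysed
  for arbitrary moment functionals near the exact ones, and the inversion map enters only
  afterwards. For \<open>f = A\<close> the Hoelder constant is 0, which removes every reference to
  the moment bound.\<close>

lemma ac_dyadic:
  fixes F :: "real \<Rightarrow> real"
  assumes "absolutely_continuous_01 F" "0 < \<epsilon>"
  shows "\<exists>\<delta>>0. \<forall>n I. I \<subseteq> {..<2 ^ n} \<and> real (card I) < \<delta> * 2 ^ n \<longrightarrow>
       (\<Sum>k\<in>I. \<bar>F (real (Suc k) / 2 ^ n) - F (real k / 2 ^ n)\<bar>) < \<epsilon>"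
proof -
  obtain \<delta> where d: "\<delta> > 0"
    "\<And>P. finite P \<and> (\<forall>(s, t)\<in>P. 0 \<le> s \<and> s \<le> t \<and> t \<le> 1) \<and>
        disjoint_family_on (\<lambda>(s, t). {s<..<t}) P \<and> (\<Sum>(s, t)\<in>P. t - s) < \<delta> \<longrightarrow>
        (\<Sum>(s, t)\<in>P. dist (F s) (F t)) < \<epsilon>"
    using assms unfolding absolutely_continuous_01_def by blast
  show ?thesis
  proof (intro exI[of _ \<delta>] conjI d(1) allI impI)
    fix n :: nat and I :: "nat set" assume "I \<subseteq> {..<2 ^ n} \<and> real (card I) < \<delta> * 2 ^ n"
    then have I: "I \<subseteq> {..<2 ^ n}" and c: "real (card I) < \<delta> * 2 ^ n" by auto
    define p where "p = (\<lambda>k::nat. (real k / 2 ^ n, real (Suc k) / 2 ^ n))"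
    have fin: "finite I" using I finite_subset by blast
    have inj: "inj_on p I" by (auto simp: p_def inj_on_def)
    have "disjoint_family_on (\<lambda>(s, t). {s<..<t}) (p ` I)"
    proof (unfold disjoint_family_on_def, intro ballI impI)
      fix u v assume "u \<in> p ` I" "v \<in> p ` I" "u \<noteq> v"
      then obtain k l where kl: "u = p k" "v = p l" "k \<noteq> l" by auto
      then have "Suc k \<le> l \<or> Suc l \<le> k" by auto
      then have "real (Suc k) / 2 ^ n \<le> real l / 2 ^ n \<or> real (Suc l) / 2 ^ n \<le> real k / 2 ^ n"
        by (auto simp: divide_right_mono)
      then show "(case u of (s, t) \<Rightarrow> {s<..<t}) \<inter> (case v of (s, t) \<Rightarrow> {s<..<t}) = {}"
        by (auto simp: p_def kl)
    qed
    moreover have "\<forall>(s, t)\<in>p ` I. 0 \<le> s \<and> s \<le> t \<and> t \<le> 1"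
    proof (clarsimp simp: p_def divide_right_mono)
      fix k assume "k \<in> I"
      then have "Suc k \<le> 2 ^ n" using I by auto
      then have "real (Suc k) \<le> 2 ^ n" by (metis numeral_power_le_of_nat_cancel_iff of_nat_le_iff of_nat_numeral of_nat_power)
      then show "1 + real k \<le> 2 ^ n" by simp
    qed
    moreover have "(\<Sum>(s, t)\<in>p ` I. t - s) = real (card I) / 2 ^ n"
      by (simp add: sum.reindex[OF inj]) (simp add: p_def diff_divide_distrib[symmetric])
    moreover have "real (card I) / 2 ^ n < \<delta>" using c by (simp add: divide_less_eq)
    ultimately have "(\<Sum>(s, t)\<in>p ` I. dist (F s) (F t)) < \<epsilon>"
      using d(2)[of "p ` I"] fin by simp
    then show "(\<Sum>k\<in>I. \<bar>F (real (Suc k) / 2 ^ n) - F (real k / 2 ^ n)\<bar>) < \<epsilon>"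
      by (simp add: sum.reindex[OF inj]) (simp add: p_def dist_real_def abs_minus_commute)
  qed
qed

lemma clamp_real: "clamp 0 1 (t::real) = max 0 (min 1 t)"
  unfolding clamp_def max_def min_def Basis_real_def by simp

lemma clamp_real_ge_1: "1 \<le> t \<Longrightarrow> clamp 0 1 (t::real) = 1"
  by (simp add: clamp_real)

text \<open>A locale, because \<open>ftc\<close> interprets it a second time for \<open>- F\<close>.
  The clamping assumption makes every dyadic increment beyond 1 vanish, so that sums over dyadic
  intervals never have to be cut off at 1.\<close>

locale ac_function =
  fixes F :: "real \<Rightarrow> real"
  assumes ac: "absolutely_continuous_01 F"
    and cont: "continuous_on UNIV F"
    and clamped: "F t = F (clamp 0 1 t)"
begin

definition pd :: "nat \<Rightarrow> nat \<Rightarrow> real" where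
  "pd n k = max 0 (F (real (Suc k) / 2 ^ n) - F (real k / 2 ^ n))"

text \<open>Only the dyadic intervals of level \<open>n\<close> that lie inside
  \<open>[0, t]\<close> are counted; \<open>nat\<close> turns a negative \<open>t\<close> into the
  empty sum.\<close>

definition psum :: "nat \<Rightarrow> real \<Rightarrow> real" where
  "psum n t = (\<Sum>k<nat \<lfloor>t * 2 ^ n\<rfloor>. pd n k)"

lemma pd_nonneg [simp]: "0 \<le> pd n k" by (simp add: pd_def)

lemma pd_le: "pd n k \<le> \<bar>F (real (Suc k) / 2 ^ n) - F (real k / 2 ^ n)\<bar>"
  by (simp add: pd_def)

lemma F_ge_1: "1 \<le> t \<Longrightarrow> F t = F 1"
  using clamped[of t] clamp_real_ge_1[of t] by simp

lemma pd_zero: "2 ^ n \<le> k \<Longrightarrow> pd n k = 0"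
proof -
  assume "2 ^ n \<le> k"
  then have "(2::real) ^ n \<le> real k" by (metis of_nat_le_iff of_nat_numeral of_nat_power)
  then have "1 \<le> real k / 2 ^ n" "1 \<le> real (Suc k) / 2 ^ n"
    by (simp_all add: le_divide_eq del: numeral_power_le_of_nat_cancel_iff)
  then show ?thesis by (simp only: pd_def F_ge_1[of "real k / 2 ^ n"] F_ge_1[of "real (Suc k) / 2 ^ n"])
qed

lemma pd_support: "pd n k \<noteq> 0 \<Longrightarrow> k < 2 ^ n"
  using pd_zero[of n k] by (cases "k < 2 ^ n") auto

lemma pd_refine: "pd n k \<le> pd (Suc n) (2 * k) + pd (Suc n) (Suc (2 * k))"
proof -
  have 1: "real (2 * k) / 2 ^ Suc n = real k / 2 ^ n" by simp
  have 2: "real (Suc (Suc (2 * k))) / 2 ^ Suc n = real (Suc k) / 2 ^ n" by (simp add: field_simps)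
  show ?thesis unfolding pd_def 1 2 by (simp add: max_def)
qed

lemma pd_sum_refine: "(\<Sum>k<m. pd n k) \<le> (\<Sum>k<2 * m. pd (Suc n) k)"
proof (induction m)
  case (Suc m)
  have "(\<Sum>k<2 * Suc m. pd (Suc n) k) = (\<Sum>k<2 * m. pd (Suc n) k) + (pd (Suc n) (2 * m) + pd (Suc n) (Suc (2 * m)))"
    by simp
  then show ?case using Suc pd_refine[of n m] by simp
qed simp

text \<open>Halving an interval can only increase the sum, because the positive part is subadditive,
  and the halves of the intervals inside \<open>[0, t]\<close> still lie inside
  \<open>[0, t]\<close>.\<close>

lemma psum_incseq: "incseq (\<lambda>n. psum n t)"
proof (rule incseq_SucI)
  fix n
  have "2 * of_int \<lfloor>t * 2 ^ n\<rfloor> \<le> t * 2 ^ Suc n"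
    using of_int_floor_le[of "t * 2 ^ n"] by simp
  then have "2 * \<lfloor>t * 2 ^ n\<rfloor> \<le> \<lfloor>t * 2 ^ Suc n\<rfloor>"
    by (simp add: le_floor_iff)
  then have "2 * nat \<lfloor>t * 2 ^ n\<rfloor> \<le> nat \<lfloor>t * 2 ^ Suc n\<rfloor>" by linarith
  then have "(\<Sum>k<2 * nat \<lfloor>t * 2 ^ n\<rfloor>. pd (Suc n) k) \<le> psum (Suc n) t"
    unfolding psum_def by (intro sum_mono2) auto
  then show "psum n t \<le> psum (Suc n) t"
    using pd_sum_refine[where m = "nat \<lfloor>t * 2 ^ n\<rfloor>" and n = n] unfolding psum_def by linarith
qed

lemma ac_pd:
  assumes "0 < \<epsilon>"
  shows "\<exists>\<delta>>0. \<forall>n I. finite I \<and> real (card I) < \<delta> * 2 ^ n \<longrightarrow> (\<Sum>k\<in>I. pd n k) \<le> \<epsilon>"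
proof -
  obtain \<delta> where d: "0 < \<delta>"
    "\<forall>n I. I \<subseteq> {..<2 ^ n} \<and> real (card I) < \<delta> * 2 ^ n \<longrightarrow>
       (\<Sum>k\<in>I. \<bar>F (real (Suc k) / 2 ^ n) - F (real k / 2 ^ n)\<bar>) < \<epsilon>"
    using ac_dyadic[OF ac assms] by blast
  show ?thesis
  proof (intro exI[of _ \<delta>] conjI d(1) allI impI)
    fix n :: nat and I :: "nat set" assume "finite I \<and> real (card I) < \<delta> * 2 ^ n"
    then have I: "finite I" "real (card I) < \<delta> * 2 ^ n" by auto
    let ?J = "I \<inter> {..<2 ^ n}"
    have "card ?J \<le> card I" by (rule card_mono) (use I in auto)
    then have c: "real (card ?J) < \<delta> * 2 ^ n" using I(2) by linarith
    have "(\<Sum>k\<in>I. pd n k) = (\<Sum>k\<in>?J. pd n k)"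
      by (rule sum.mono_neutral_right) (use I in \<open>auto dest: pd_support\<close>)
    also have "\<dots> \<le> (\<Sum>k\<in>?J. \<bar>F (real (Suc k) / 2 ^ n) - F (real k / 2 ^ n)\<bar>)"
      by (intro sum_mono pd_le)
    also have "\<dots> < \<epsilon>" using d(2) c by simp
    finally show "(\<Sum>k\<in>I. pd n k) \<le> \<epsilon>" by simp
  qed
qed

text \<open>Chop \<open>[0, 1]\<close> into \<open>2 ^ n0\<close> blocks shorter than \<delta>.
  Absolute continuity with tolerance 1 bounds the sum over each block by 1, whatever the level;
  levels below \<open>n0\<close> follow by monotonicity.\<close>

lemma psum_bounded: "\<exists>B. \<forall>n t. psum n t \<le> B"
proof -
  obtain \<delta> where d: "0 < \<delta>"
    "\<forall>n I. finite I \<and> real (card I) < \<delta> * 2 ^ n \<longrightarrow> (\<Sum>k\<in>I. pd n k) \<le> 1"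
    using ac_pd[OF zero_less_one] by blast
  have "(1/2::real) < 1" by simp
  then obtain n0 where n0: "(1/2) ^ n0 < \<delta>"
    by (rule exE[OF real_arch_pow_inv[OF d(1)]])
  have B: "psum n t \<le> 2 ^ n0" if le: "n0 \<le> n" for n t
  proof -
    obtain j where j: "n = n0 + j" using le_Suc_ex[OF le] by blast
    have "psum n t = (\<Sum>k\<in>{..<nat \<lfloor>t * 2 ^ n\<rfloor>} \<inter> {..<2 ^ n}. pd n k)"
      unfolding psum_def by (rule sum.mono_neutral_right) (auto dest: pd_support)
    also have "\<dots> \<le> (\<Sum>k<2 ^ n0 * 2 ^ j. pd n k)"
      by (intro sum_mono2) (auto simp: j power_add)
    also have "\<dots> = (\<Sum>m<(2::nat) ^ n0. sum (pd n) {m * 2 ^ j..<m * 2 ^ j + 2 ^ j})"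
      by (rule sum.nat_group[symmetric])
    also have "\<dots> \<le> (\<Sum>m<(2::nat) ^ n0. 1)"
    proof (intro sum_mono d(2)[rule_format] conjI)
      fix m :: nat
      have "1 < \<delta> * 2 ^ n0" using n0 by (simp add: field_simps)
      then have "1 * (2::real) ^ j < \<delta> * 2 ^ n0 * 2 ^ j" by (intro mult_strict_right_mono) auto
      then show "real (card {m * 2 ^ j..<m * 2 ^ j + 2 ^ j}) < \<delta> * 2 ^ n"
        by (simp add: j power_add mult.assoc)
    qed auto
    also have "\<dots> = 2 ^ n0" by simp
    finally show ?thesis .
  qed
  show ?thesis
  proof (intro exI allI)
    fix n t
    have "psum n t \<le> psum (max n n0) t" by (rule incseqD[OF psum_incseq]) simp
    also have "\<dots> \<le> 2 ^ n0" by (rule B) simp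
    finally show "psum n t \<le> 2 ^ n0" .
  qed
qed

text \<open>The positive variation of \<open>F\<close>, along dyadic partitions only. Its Radon--Nikodym density gives the
  positive part of a density of \<open>F\<close>, since \<open>F\<close> is the difference of \<open>pvar\<close> for \<open>F\<close> and for \<open>- F\<close>.\<close>

definition pvar :: "real \<Rightarrow> real" where "pvar t = lim (\<lambda>n. psum n t)"

lemma psum_tendsto: "(\<lambda>n. psum n t) \<longlonglongrightarrow> pvar t"
proof -
  obtain B where B: "\<forall>n t. psum n t \<le> B" using psum_bounded by blast
  obtain L where "(\<lambda>n. psum n t) \<longlonglongrightarrow> L" using incseq_convergent[OF psum_incseq] B by metis
  then show ?thesis unfolding pvar_def by (simp add: limI)
qed

lemma pvar_mono: "s \<le> t \<Longrightarrow> pvar s \<le> pvar t"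
proof (rule LIMSEQ_le[OF psum_tendsto psum_tendsto], intro exI allI impI)
  fix n assume "s \<le> t"
  then have "\<lfloor>s * 2 ^ n\<rfloor> \<le> \<lfloor>t * 2 ^ n\<rfloor>" by (intro floor_mono mult_right_mono) auto
  then show "psum n s \<le> psum n t" unfolding psum_def by (intro sum_mono2) auto
qed

lemma pvar_nonpos: "t \<le> 0 \<Longrightarrow> pvar t = 0"
proof -
  assume "t \<le> 0"
  then have "\<lfloor>t * 2 ^ n\<rfloor> \<le> 0" for n :: nat
    by (metis floor_mono floor_zero mult_nonpos_nonneg zero_le_numeral zero_le_power)
  then have "psum n t = 0" for n by (simp add: psum_def)
  then show ?thesis using psum_tendsto[of t] by (simp add: LIMSEQ_const_iff)
qed

lemma pvar_ge_1: "1 \<le> t \<Longrightarrow> pvar t = pvar 1"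
proof -
  assume t: "1 \<le> t"
  have "psum n t = psum n 1" for n
  proof -
    have f: "\<lfloor>1 * 2 ^ n::real\<rfloor> = 2 ^ n" by (metis floor_of_int mult_1 of_int_numeral of_int_power)
    have "\<lfloor>1 * 2 ^ n::real\<rfloor> \<le> \<lfloor>t * 2 ^ n\<rfloor>" using t by (intro floor_mono mult_right_mono) auto
    then have "nat \<lfloor>1 * 2 ^ n::real\<rfloor> \<le> nat \<lfloor>t * 2 ^ n\<rfloor>" by linarith
    then show ?thesis unfolding psum_def
      by (intro sum.mono_neutral_right) (auto intro!: pd_zero simp: f nat_power_eq)
  qed
  then show ?thesis unfolding pvar_def by simp
qed

lemma psum_diff:
  assumes "s \<le> t"
  shows "psum n t - psum n s = (\<Sum>k\<in>{nat \<lfloor>s * 2 ^ n\<rfloor>..<nat \<lfloor>t * 2 ^ n\<rfloor>}. pd n k)"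
proof -
  have "\<lfloor>s * 2 ^ n\<rfloor> \<le> \<lfloor>t * 2 ^ n\<rfloor>" using assms by (intro floor_mono mult_right_mono) auto
  then have le: "nat \<lfloor>s * 2 ^ n\<rfloor> \<le> nat \<lfloor>t * 2 ^ n\<rfloor>" by linarith
  show ?thesis unfolding psum_def
    using sum.atLeastLessThan_concat[of 0 "nat \<lfloor>s * 2 ^ n\<rfloor>" "nat \<lfloor>t * 2 ^ n\<rfloor>" "pd n"] le
    by (simp add: atLeast0LessThan)
qed

text \<open>At level \<open>n\<close> at most \<open>(t - s) * 2 ^ n + 1\<close> increments separate
  \<open>s\<close> from \<open>t\<close>. Asking for \<open>t - s < \<delta> / 2\<close> leaves the
  other half of \<delta> to absorb the stray 1 at all fine levels.\<close>

lemma pvar_cont: "continuous_on UNIV pvar"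
proof (simp add: continuous_on_iff, intro allI impI)
  fix a \<epsilon> :: real assume "0 < \<epsilon>"
  obtain \<delta> where d: "0 < \<delta>"
    "\<forall>n I. finite I \<and> real (card I) < \<delta> * 2 ^ n \<longrightarrow> (\<Sum>k\<in>I. pd n k) \<le> \<epsilon> / 2"
    using ac_pd[OF half_gt_zero[OF \<open>0 < \<epsilon>\<close>]] by blast
  have "(1/2::real) < 1" by simp
  from real_arch_pow_inv[OF half_gt_zero[OF d(1)] this] obtain n0 where n0: "(1/2) ^ n0 < \<delta> / 2" by blast
  have main: "pvar t - pvar s \<le> \<epsilon> / 2" if "s \<le> t" "t - s < \<delta> / 2" for s t
  proof (rule LIMSEQ_le_const2[OF tendsto_diff[OF psum_tendsto psum_tendsto]], intro exI allI impI)
    fix n assume "n0 \<le> n"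
    then have "(1/2::real) ^ n \<le> (1/2) ^ n0" by (intro power_decreasing) auto
    then have "(1/2) ^ n < \<delta> / 2" using n0 by linarith
    then have 1: "1 < \<delta> / 2 * 2 ^ n" by (simp add: field_simps)
    have 2: "(t - s) * 2 ^ n < \<delta> / 2 * 2 ^ n" using that by (intro mult_strict_right_mono) auto
    have "real (card {nat \<lfloor>s * 2 ^ n\<rfloor>..<nat \<lfloor>t * 2 ^ n\<rfloor>}) \<le> (t - s) * 2 ^ n + 1"
    proof -
      have "s * 2 ^ n \<le> t * 2 ^ n" using that by (intro mult_right_mono) auto
      then have "0 \<le> (t - s) * 2 ^ n" by (simp add: algebra_simps)
      moreover have "of_int \<lfloor>t * 2 ^ n\<rfloor> - of_int \<lfloor>s * 2 ^ n\<rfloor> \<le> (t - s) * 2 ^ n + (1::real)"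
        using floor_correct[of "t * 2 ^ n"] floor_correct[of "s * 2 ^ n"] by (simp add: algebra_simps) linarith
      moreover have "real (nat \<lfloor>t * 2 ^ n\<rfloor> - nat \<lfloor>s * 2 ^ n\<rfloor>) \<le> max 0 (of_int \<lfloor>t * 2 ^ n\<rfloor> - of_int \<lfloor>s * 2 ^ n\<rfloor>)"
        by linarith
      ultimately show ?thesis by simp
    qed
    then have "real (card {nat \<lfloor>s * 2 ^ n\<rfloor>..<nat \<lfloor>t * 2 ^ n\<rfloor>}) < \<delta> * 2 ^ n"
      using 1 2 by linarith
    then show "psum n t - psum n s \<le> \<epsilon> / 2"
      unfolding psum_diff[OF that(1)] by (intro d(2)[rule_format] conjI) auto
  qed
  show "\<exists>d>0. \<forall>x'. dist x' a < d \<longrightarrow> dist (pvar x') (pvar a) < \<epsilon>"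
  proof (intro exI[of _ "\<delta> / 2"] conjI allI impI)
    show "0 < \<delta> / 2" using d(1) by simp
    fix x assume "dist x a < \<delta> / 2"
    then show "dist (pvar x) (pvar a) < \<epsilon>"
      using main[of x a] main[of a x] pvar_mono[of x a] pvar_mono[of a x] \<open>0 < \<epsilon>\<close>
      by (cases "x \<le> a") (auto simp: dist_real_def abs_if split: if_splits)
  qed
qed

lemma psum_dyadic: "psum (n + j) (real k / 2 ^ n) = (\<Sum>l<k * 2 ^ j. pd (n + j) l)"
proof -
  have "real k / 2 ^ n * 2 ^ (n + j) = real (k * 2 ^ j)" by (simp add: power_add)
  then have "nat \<lfloor>real k / 2 ^ n * 2 ^ (n + j)\<rfloor> = k * 2 ^ j" by (simp only: floor_of_nat nat_int)
  then show ?thesis by (simp add: psum_def)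
qed

text \<open>The smallness condition is scale free: refining by \<open>j\<close> levels multiplies
  the number of intervals and \<open>2 ^ n\<close> by the same factor \<open>2 ^ j\<close>. So the
  bound for \<open>pd\<close> holds at every finer level and passes to the limit.\<close>

lemma pvar_dyadic_small:
  assumes "0 < \<epsilon>"
  shows "\<exists>\<delta>>0. \<forall>n I. finite I \<and> real (card I) < \<delta> * 2 ^ n \<longrightarrow> (\<Sum>k\<in>I. pvar (real (Suc k) / 2 ^ n) - pvar (real k / 2 ^ n)) \<le> \<epsilon>"
proof -
  obtain \<delta> where d: "0 < \<delta>"
    "\<forall>n I. finite I \<and> real (card I) < \<delta> * 2 ^ n \<longrightarrow> (\<Sum>k\<in>I. pd n k) \<le> \<epsilon>"
    using ac_pd[OF assms] by blast
  show ?thesis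
  proof (intro exI[of _ \<delta>] conjI d(1) allI impI)
    fix n :: nat and I :: "nat set" assume "finite I \<and> real (card I) < \<delta> * 2 ^ n"
    then have I: "finite I" "real (card I) < \<delta> * 2 ^ n" by auto
    have "(\<lambda>j. \<Sum>k\<in>I. psum (j + n) (real (Suc k) / 2 ^ n) - psum (j + n) (real k / 2 ^ n))
        \<longlonglongrightarrow> (\<Sum>k\<in>I. pvar (real (Suc k) / 2 ^ n) - pvar (real k / 2 ^ n))"
      by (intro tendsto_sum tendsto_diff LIMSEQ_ignore_initial_segment psum_tendsto)
    then show "(\<Sum>k\<in>I. pvar (real (Suc k) / 2 ^ n) - pvar (real k / 2 ^ n)) \<le> \<epsilon>"
    proof (rule LIMSEQ_le_const2, intro exI allI impI)
      fix j :: nat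
      let ?B = "\<lambda>k. {k * 2 ^ j..<k * 2 ^ j + 2 ^ j}"
      have "psum (j + n) (real (Suc k) / 2 ^ n) - psum (j + n) (real k / 2 ^ n) = (\<Sum>l\<in>?B k. pd (n + j) l)" for k
        using sum.atLeastLessThan_concat[of 0 "k * 2 ^ j" "k * 2 ^ j + 2 ^ j" "pd (n + j)"]
        unfolding add.commute[of j n] psum_dyadic by (simp add: atLeast0LessThan add.commute)
      then have "(\<Sum>k\<in>I. psum (j + n) (real (Suc k) / 2 ^ n) - psum (j + n) (real k / 2 ^ n))
          = (\<Sum>k\<in>I. \<Sum>l\<in>?B k. pd (n + j) l)" by simp
      also have "\<dots> = (\<Sum>l\<in>(\<Union>k\<in>I. ?B k). pd (n + j) l)"
      proof (rule sum.UNION_disjoint[symmetric])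
        show "\<forall>k\<in>I. \<forall>k'\<in>I. k \<noteq> k' \<longrightarrow> ?B k \<inter> ?B k' = {}"
        proof (intro ballI impI)
          fix k k' :: nat assume "k \<noteq> k'"
          then have "Suc k \<le> k' \<or> Suc k' \<le> k" by auto
          then have "Suc k * 2 ^ j \<le> k' * 2 ^ j \<or> Suc k' * 2 ^ j \<le> k * 2 ^ j" using mult_le_mono1 by blast
          then show "?B k \<inter> ?B k' = {}" by auto
        qed
      qed (use I in auto)
      also have "\<dots> \<le> \<epsilon>"
      proof (rule d(2)[rule_format], intro conjI)
        have "card (\<Union>k\<in>I. ?B k) \<le> (\<Sum>k\<in>I. card (?B k))" by (rule card_UN_le) fact
        then have "card (\<Union>k\<in>I. ?B k) \<le> card I * 2 ^ j" by simp
        then have "real (card (\<Union>k\<in>I. ?B k)) \<le> real (card I * 2 ^ j)" by (rule of_nat_mono)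
        also have "\<dots> = real (card I) * 2 ^ j" by simp
        also have "\<dots> < \<delta> * 2 ^ n * 2 ^ j" using I by (intro mult_strict_right_mono) auto
        finally show "real (card (\<Union>k\<in>I. ?B k)) < \<delta> * 2 ^ (n + j)" by (simp add: power_add mult.assoc)
      qed (use I in auto)
      finally show "(\<Sum>k\<in>I. psum (j + n) (real (Suc k) / 2 ^ n) - psum (j + n) (real k / 2 ^ n)) \<le> \<epsilon>" .
    qed
  qed
qed

end

section \<open>The measure of the positive variation, its density, and the fundamental theorem of
  calculus\<close>

context ac_function begin

lemma emeasure_pvar_Ioc: "s \<le> t \<Longrightarrow> emeasure (interval_measure pvar) {s<..t} = ennreal (pvar t - pvar s)"
proof (rule emeasure_interval_measure_Ioc)
  show "continuous (at_right a) pvar" for a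
    using pvar_cont continuous_within_subset[of a UNIV pvar "{a<..}"]
    by (simp add: continuous_on_eq_continuous_within)
qed (auto intro: pvar_mono)

lemma emeasure_pvar_outside:
  "emeasure (interval_measure pvar) {..0} = 0" "emeasure (interval_measure pvar) {1<..} = 0"
proof -
  have "(\<Union>n::nat. {- real n<..0}) = {..0}" using reals_Archimedean2 by (auto simp: minus_less_iff)
  moreover have "emeasure (interval_measure pvar) (\<Union>n::nat. {- real n<..0}) = 0"
    by (rule emeasure_UN_eq_0) (auto simp: emeasure_pvar_Ioc pvar_nonpos)
  ultimately show "emeasure (interval_measure pvar) {..0} = 0" by simp
  have "(\<Union>n::nat. {1<..1 + real n}) = {1<..}"
  proof (intro equalityI subsetI)
    fix x :: real assume "x \<in> {1<..}"
    obtain n :: nat where "x < real n" using reals_Archimedean2 by blast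
    then show "x \<in> (\<Union>n::nat. {1<..1 + real n})" using \<open>x \<in> {1<..}\<close> by (intro UN_I[of n]) auto
  qed auto
  moreover have "pvar (1 + real n) = pvar 1" for n by (rule pvar_ge_1) simp
  then have "emeasure (interval_measure pvar) (\<Union>n::nat. {1<..1 + real n}) = 0"
    by (intro emeasure_UN_eq_0) (auto simp: emeasure_pvar_Ioc)
  ultimately show "emeasure (interval_measure pvar) {1<..} = 0" by simp
qed

lemma dyadic_cover:
  fixes U :: "real set"
  assumes "open U" "x \<in> U" "0 < x" "x \<le> 1"
  shows "\<exists>n k. k < 2 ^ n \<and> {real k / 2 ^ n<..real (Suc k) / 2 ^ n} \<subseteq> U \<and>
    x \<in> {real k / 2 ^ n<..real (Suc k) / 2 ^ n}"
proof -
  obtain e where e: "0 < e" "ball x e \<subseteq> U" using assms openE by blast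
  have "(1/2::real) < 1" by simp
  from real_arch_pow_inv[OF e(1) this] obtain n where n: "(1/2) ^ n < e" by blast
  \<comment> \<open>The intervals are open on the left and closed on the right, hence the ceiling
    minus 1 instead of the floor.\<close>
  define k where "k = nat (\<lceil>x * 2 ^ n\<rceil> - 1)"
  have x0: "0 < x * 2 ^ n" using assms by simp
  have "0 < \<lceil>x * 2 ^ n\<rceil>" using x0 by simp
  then have rk: "real k = of_int \<lceil>x * 2 ^ n\<rceil> - 1" by (simp add: k_def)
  have k: "real k < x * 2 ^ n" "x * 2 ^ n \<le> real k + 1" unfolding rk by linarith+
  have "x * 2 ^ n \<le> 2 ^ n" using assms by (simp add: mult_left_le_one_le)
  then have "real k < 2 ^ n" using k by linarith
  then have "k < 2 ^ n" by simp
  moreover have "{real k / 2 ^ n<..real (Suc k) / 2 ^ n} \<subseteq> ball x e"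
  proof
    fix y assume "y \<in> {real k / 2 ^ n<..real (Suc k) / 2 ^ n}"
    then have y: "real k < y * 2 ^ n" "y * 2 ^ n \<le> real k + 1" by (auto simp: divide_less_eq le_divide_eq)
    then have "\<bar>x * 2 ^ n - y * 2 ^ n\<bar> < 1" using k by linarith
    then have "\<bar>(x - y) * 2 ^ n\<bar> < 1" by (simp add: algebra_simps)
    then have "\<bar>x - y\<bar> * 2 ^ n < 1" by (simp add: abs_mult)
    then have "\<bar>x - y\<bar> < (1/2) ^ n" by (simp add: field_simps)
    then show "y \<in> ball x e" using n by (simp add: dist_real_def)
  qed
  moreover have "x \<in> {real k / 2 ^ n<..real (Suc k) / 2 ^ n}"
    using k by (auto simp: divide_less_eq le_divide_eq)
  ultimately show ?thesis using e(2) by blast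
qed

text \<open>Outer regularity puts a null set into an open \<open>U\<close> of measure below
  \<delta>. The dyadic intervals of level \<open>n\<close> inside \<open>U\<close> number fewer than
  \<open>\<delta> * 2 ^ n\<close>, so their \<open>pvar\<close>-mass is at most \<epsilon>; their
  unions increase with \<open>n\<close> and exhaust the part of \<open>U\<close> in
  \<open>(0, 1]\<close>. Outside \<open>(0, 1]\<close> the measure has no mass.\<close>

lemma absolutely_continuous_pvar: "absolutely_continuous lborel (interval_measure pvar)"
  unfolding absolutely_continuous_def
proof
  let ?mu = "interval_measure pvar"
  fix N assume N: "N \<in> null_sets (lborel :: real measure)"
  then have Nb: "N \<in> sets borel" by (auto simp: null_sets_def)
  have small: "emeasure ?mu (N \<inter> {0<..1}) \<le> ennreal \<epsilon>" if "0 < \<epsilon>" for \<epsilon>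
  proof -
    obtain \<delta> where d: "0 < \<delta>" "\<forall>n I. finite I \<and> real (card I) < \<delta> * 2 ^ n \<longrightarrow>
      (\<Sum>k\<in>I. pvar (real (Suc k) / 2 ^ n) - pvar (real k / 2 ^ n)) \<le> \<epsilon>"
      using pvar_dyadic_small[OF \<open>0 < \<epsilon>\<close>] by blast
    obtain U where U: "open U" "N \<subseteq> U" "emeasure lborel (U - N) < ennreal \<delta>"
      using outer_regular_lborel[OF Nb, of \<delta>] d(1) by auto
    have "emeasure lborel U \<le> emeasure lborel (U - N) + emeasure lborel N"
    proof -
      have "emeasure lborel U = emeasure lborel ((U - N) \<union> N)" using U by (simp add: Un_absorb2)
      also have "\<dots> \<le> emeasure lborel (U - N) + emeasure lborel N"
        by (rule emeasure_subadditive) (use U Nb in auto)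
      finally show ?thesis .
    qed
    then have lU: "emeasure lborel U < ennreal \<delta>" using U(3) N by (auto simp: null_sets_def)
    define D where "D = (\<lambda>n k::nat. {real k / 2 ^ n<..real (Suc k) / 2 ^ n})"
    define I where "I = (\<lambda>n::nat. {k. k < 2 ^ n \<and> D n k \<subseteq> U})"
    define W where "W = (\<lambda>n. \<Union>k\<in>I n. D n k)"
    have finI: "finite (I n)" for n by (simp add: I_def)
    have Dle: "real k / 2 ^ n \<le> real (Suc k) / 2 ^ n" for k n by (simp add: divide_right_mono)
    have disj: "disjoint_family_on (D n) (I n)" for n
    proof (unfold disjoint_family_on_def, intro ballI impI)
      fix k l :: nat assume "k \<noteq> l"
      then have "Suc k \<le> l \<or> Suc l \<le> k" by auto
      then have "real (Suc k) / 2 ^ n \<le> real l / 2 ^ n \<or> real (Suc l) / 2 ^ n \<le> real k / 2 ^ n"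
        by (auto simp: divide_right_mono)
      then show "D n k \<inter> D n l = {}" by (auto simp: D_def)
    qed
    have W: "emeasure ?mu (W n) \<le> ennreal \<epsilon>" for n
    proof -
      have "emeasure lborel (D n k) = ennreal (1 / 2 ^ n)" for k
        unfolding D_def by (subst emeasure_lborel_Ioc[OF Dle]) (simp add: diff_divide_distrib[symmetric])
      then have "(\<Sum>k\<in>I n. emeasure lborel (D n k)) = (\<Sum>k\<in>I n. ennreal (1 / 2 ^ n))" by simp
      also have "\<dots> = ennreal (real (card (I n)) / 2 ^ n)"
        by (subst sum_ennreal) auto
      finally have "(\<Sum>k\<in>I n. emeasure lborel (D n k)) = ennreal (real (card (I n)) / 2 ^ n)" .
      moreover have "(\<Sum>k\<in>I n. emeasure lborel (D n k)) = emeasure lborel (W n)"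
        unfolding W_def by (rule sum_emeasure[OF _ disj finI]) (auto simp: D_def)
      moreover have "emeasure lborel (W n) \<le> emeasure lborel U"
        by (rule emeasure_mono) (use U in \<open>auto simp: W_def I_def\<close>)
      ultimately have "ennreal (real (card (I n)) / 2 ^ n) < ennreal \<delta>" using lU by simp
      then have c: "real (card (I n)) < \<delta> * 2 ^ n"
        by (subst (asm) ennreal_less_iff) (auto simp: divide_less_eq)
      have "emeasure ?mu (W n) \<le> (\<Sum>k\<in>I n. emeasure ?mu (D n k))"
        unfolding W_def by (rule emeasure_subadditive_finite) (auto simp: finI D_def)
      also have "\<dots> = (\<Sum>k\<in>I n. ennreal (pvar (real (Suc k) / 2 ^ n) - pvar (real k / 2 ^ n)))"
        unfolding D_def by (intro sum.cong refl emeasure_pvar_Ioc Dle)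
      also have "\<dots> = ennreal (\<Sum>k\<in>I n. pvar (real (Suc k) / 2 ^ n) - pvar (real k / 2 ^ n))"
        by (rule sum_ennreal) (simp only: diff_ge_0_iff_ge pvar_mono[OF Dle])
      also have "\<dots> \<le> ennreal \<epsilon>" using d(2) c finI by (intro ennreal_leI) blast
      finally show ?thesis .
    qed
    have inc: "incseq W"
    proof (rule incseq_SucI, rule subsetI)
      fix n x assume "x \<in> W n"
      then obtain k where k: "k < 2 ^ n" "D n k \<subseteq> U" "x \<in> D n k" by (auto simp: W_def I_def)
      have e: "D n k = D (Suc n) (2 * k) \<union> D (Suc n) (Suc (2 * k))"
        by (auto simp: D_def field_simps)
      show "x \<in> W (Suc n)"
      proof (cases "x \<in> D (Suc n) (2 * k)")
        case True
        then have "2 * k \<in> I (Suc n)" using k e by (auto simp: I_def)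
        then show ?thesis using True unfolding W_def by blast
      next
        case False
        then have "x \<in> D (Suc n) (Suc (2 * k))" using k e by auto
        moreover have "Suc (2 * k) \<in> I (Suc n)" using k e by (auto simp: I_def)
        ultimately show ?thesis unfolding W_def by blast
      qed
    qed
    have sub: "N \<inter> {0<..1} \<subseteq> (\<Union>n. W n)"
    proof
      fix x assume x: "x \<in> N \<inter> {0<..1}"
      then obtain n k where "k < 2 ^ n" "D n k \<subseteq> U" "x \<in> D n k"
        using dyadic_cover[OF U(1), of x] U(2) unfolding D_def by auto
      then show "x \<in> (\<Union>n. W n)" unfolding W_def I_def by blast
    qed
    have Wsets: "W n \<in> sets borel" for n unfolding W_def by (auto simp: finI D_def)
    have "emeasure ?mu (N \<inter> {0<..1}) \<le> emeasure ?mu (\<Union>n. W n)"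
      by (rule emeasure_mono[OF sub]) (use Wsets in auto)
    also have "\<dots> = (SUP n. emeasure ?mu (W n))"
      by (rule SUP_emeasure_incseq[symmetric]) (use Wsets inc in auto)
    also have "\<dots> \<le> ennreal \<epsilon>" using W by (rule SUP_least)
    finally show ?thesis .
  qed
  have "emeasure ?mu (N \<inter> {0<..1}) \<le> 0"
    by (rule ennreal_le_epsilon) (use small in auto)
  then have 1: "emeasure ?mu (N \<inter> {0<..1}) = 0" by simp
  have "emeasure ?mu N \<le> emeasure ?mu (N \<inter> {0<..1} \<union> ({..0} \<union> {1<..}))"
    by (rule emeasure_mono) (use Nb in auto)
  also have "\<dots> \<le> emeasure ?mu (N \<inter> {0<..1}) + emeasure ?mu ({..0} \<union> {1<..})"
    by (rule emeasure_subadditive) (use Nb in auto)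
  also have "emeasure ?mu ({..0} \<union> {1<..}) \<le> emeasure ?mu {..0} + emeasure ?mu {1<..}"
    by (rule emeasure_subadditive) auto
  finally have "emeasure ?mu N = 0" using 1 emeasure_pvar_outside by (simp add: add_mono)
  then show "N \<in> null_sets ?mu" using Nb by (auto simp: null_sets_def)
qed

lemma pvar_density:
  "\<exists>g. integrable lborel g \<and> (\<forall>t\<in>{0..1}. pvar t = (LBINT u:{0..t}. g u))"
proof -
  obtain f where f: "f \<in> borel_measurable lborel" "density lborel f = interval_measure pvar"
    using sigma_finite_measure.Radon_Nikodym[OF lborel.sigma_finite_measure_axioms absolutely_continuous_pvar] by auto
  have fm [measurable]: "f \<in> borel_measurable borel" using f(1) by simp
  have f_Ioc: "(\<integral>\<^sup>+u. f u * indicator {0<..t} u \<partial>lborel) = ennreal (pvar t)" if "0 \<le> t" for t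
    using emeasure_density[OF f(1), of "{0<..t}"] emeasure_pvar_Ioc[of 0 t] that
    by (simp add: f(2) pvar_nonpos)
  \<comment> \<open>The density takes values in \<open>ennreal\<close>. It has finite integral over
    \<open>(0, 1]\<close>, namely \<open>pvar 1\<close>, so it is finite almost everywhere there and
    \<open>enn2real\<close> loses nothing.\<close>
  define g where "g = (\<lambda>u. enn2real (f u) * indicator {0<..1} u)"
  have gm [measurable]: "g \<in> borel_measurable borel" unfolding g_def by measurable
  have "AE u in lborel. f u * indicator {0<..1} u \<noteq> \<infinity>"
    by (rule nn_integral_PInf_AE) (use f_Ioc[of 1] in auto)
  then have fin: "AE u in lborel. u \<in> {0<..1} \<longrightarrow> f u \<noteq> \<infinity>"
    by eventually_elim (auto simp: indicator_def)
  have nn: "(\<integral>\<^sup>+u. ennreal (indicator {0..t} u * g u) \<partial>lborel) = ennreal (pvar t)" if "t \<in> {0..1}" for t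
  proof -
    have "(\<integral>\<^sup>+u. ennreal (indicator {0..t} u * g u) \<partial>lborel) = (\<integral>\<^sup>+u. f u * indicator {0<..t} u \<partial>lborel)"
      by (rule nn_integral_cong_AE, use fin in eventually_elim)
         (use that in \<open>auto simp: g_def indicator_def less_top\<close>)
    then show ?thesis using f_Ioc[of t] that by simp
  qed
  have "(\<integral>\<^sup>+u. ennreal (norm (g u)) \<partial>lborel) = (\<integral>\<^sup>+u. ennreal (indicator {0..1} u * g u) \<partial>lborel)"
    by (rule nn_integral_cong) (auto simp: g_def indicator_def)
  then have gi: "integrable lborel g"
    using nn[of 1] by (intro integrableI_bounded) auto
  have "pvar t = (LBINT u:{0..t}. g u)" if "t \<in> {0..1}" for t
  proof -
    have "(LBINT u:{0..t}. g u) = enn2real (\<integral>\<^sup>+u. ennreal (indicator {0..t} u * g u) \<partial>lborel)"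
      unfolding set_lebesgue_integral_def real_scaleR_def
      by (rule integral_eq_nn_integral) (auto simp: g_def)
    also have "\<dots> = pvar t" using nn[OF that] pvar_mono[of 0 t] pvar_nonpos[of 0] that by simp
    finally show ?thesis by simp
  qed
  then show ?thesis using gi by blast
qed

lemma ac_function_uminus: "ac_function (\<lambda>t. - F t)"
proof
  show "absolutely_continuous_01 (\<lambda>t. - F t)"
    using ac unfolding absolutely_continuous_01_def by (simp add: dist_real_def abs_minus_commute)
  show "continuous_on UNIV (\<lambda>t. - F t)" using cont by (rule continuous_on_minus)
  show "- F t = - F (clamp 0 1 t)" for t using clamped[of t] by simp
qed

text \<open>Since \<open>max 0 x - max 0 (- x) = x\<close>, the dyadic sums for \<open>F\<close> and
  \<open>- F\<close> differ by a telescoping sum. It stops at the last dyadic point of level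
  \<open>n\<close> not beyond \<open>t\<close>, and these points converge to
  \<open>t\<close>.\<close>

lemma ftc:
  "\<exists>g. integrable lborel g \<and> (\<forall>t\<in>{0..1}. F t - F 0 = (LBINT u:{0..t}. g u))"
proof -
  interpret neg: ac_function "\<lambda>t. - F t" by (rule ac_function_uminus)
  have diff: "pvar t - neg.pvar t = F t - F 0" if "0 \<le> t" for t
  proof (rule LIMSEQ_unique[OF tendsto_diff[OF psum_tendsto neg.psum_tendsto]])
    have eq: "psum n t - neg.psum n t = F (of_int \<lfloor>t * 2 ^ n\<rfloor> / 2 ^ n) - F 0" for n
    proof -
      have "psum n t - neg.psum n t = (\<Sum>k<nat \<lfloor>t * 2 ^ n\<rfloor>. F (real (Suc k) / 2 ^ n) - F (real k / 2 ^ n))"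
        unfolding psum_def neg.psum_def sum_subtractf[symmetric]
        by (rule sum.cong) (auto simp: pd_def neg.pd_def max_def)
      also have "\<dots> = F (real (nat \<lfloor>t * 2 ^ n\<rfloor>) / 2 ^ n) - F (real 0 / 2 ^ n)"
        by (rule sum_lessThan_telescope)
      finally show ?thesis using that by simp
    qed
    have "(\<lambda>n. of_int \<lfloor>t * 2 ^ n\<rfloor> / 2 ^ n) \<longlonglongrightarrow> t"
    proof (rule tendsto_sandwich[where h = "\<lambda>n. t"])
      have "(\<lambda>n. (1/2::real) ^ n) \<longlonglongrightarrow> 0" by (rule LIMSEQ_power_zero) simp
      from tendsto_diff[OF tendsto_const this] show "(\<lambda>n. t - (1/2) ^ n) \<longlonglongrightarrow> t" by simp
      show "\<forall>\<^sub>F n in sequentially. t - (1/2) ^ n \<le> of_int \<lfloor>t * 2 ^ n\<rfloor> / 2 ^ n"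
      proof (intro always_eventually allI)
        fix n :: nat
        have "t * 2 ^ n - 1 \<le> of_int \<lfloor>t * 2 ^ n\<rfloor>" by linarith
        then have "(t * 2 ^ n - 1) / 2 ^ n \<le> of_int \<lfloor>t * 2 ^ n\<rfloor> / 2 ^ n"
          by (intro divide_right_mono) auto
        then show "t - (1/2) ^ n \<le> of_int \<lfloor>t * 2 ^ n\<rfloor> / 2 ^ n"
          by (simp add: diff_divide_distrib power_one_over)
      qed
      show "\<forall>\<^sub>F n in sequentially. of_int \<lfloor>t * 2 ^ n\<rfloor> / 2 ^ n \<le> t"
        by (intro always_eventually allI) (simp add: divide_le_eq)
    qed simp
    moreover have "isCont F t" using cont by (simp add: continuous_on_eq_continuous_at)
    ultimately have "(\<lambda>n. F (of_int \<lfloor>t * 2 ^ n\<rfloor> / 2 ^ n)) \<longlonglongrightarrow> F t"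
      by (rule isCont_tendsto_compose[rotated])
    from tendsto_diff[OF this tendsto_const]
    show "(\<lambda>n. psum n t - neg.psum n t) \<longlonglongrightarrow> F t - F 0" unfolding eq .
  qed
  obtain g1 g2 where g1: "integrable lborel g1" "\<forall>t\<in>{0..1}. pvar t = (LBINT u:{0..t}. g1 u)"
    and g2: "integrable lborel g2" "\<forall>t\<in>{0..1}. neg.pvar t = (LBINT u:{0..t}. g2 u)"
    using pvar_density neg.pvar_density by blast
  have si: "set_integrable lborel {0..t} g" if "integrable lborel g" for t :: real and g :: "real \<Rightarrow> real"
    unfolding set_integrable_def by (rule integrable_mult_indicator) (use that in auto)
  show ?thesis
  proof (intro exI[of _ "\<lambda>u. g1 u - g2 u"] conjI ballI)
    show "integrable lborel (\<lambda>u. g1 u - g2 u)" using g1 g2 by auto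
    fix t :: real assume "t \<in> {0..1}"
    then show "F t - F 0 = (LBINT u:{0..t}. g1 u - g2 u)"
      using diff[of t] g1 g2 by (simp add: set_integral_diff[OF si si])
  qed
qed

end

section \<open>Differentiation of the primitive almost everywhere\<close>

lemma AE_right_derivative:
  fixes g :: "real \<Rightarrow> real"
  assumes "integrable lborel g"
  shows "AE x in lborel. \<forall>e>0. \<exists>d>0. \<forall>h. 0 < h \<and> h < d \<longrightarrow>
    \<bar>(LBINT u:{x..x + h}. g u) / h - g x\<bar> < e"
proof -
  have si: "set_integrable lborel {a..b} g" for a b
    unfolding set_integrable_def by (rule integrable_mult_indicator) (use assms in auto)
  have int: "g integrable_on cbox a b" for a b
    using set_borel_integral_eq_integral(1)[OF si[of a b]] by simp
  have eq: "(LBINT u:{a..b}. g u) = integral {a..b} g" for a b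
    by (rule set_borel_integral_eq_integral(2)[OF si])
  \<comment> \<open>The differentiation theorem averages over cubes whose lower corner is
    \<open>x\<close>; on the line these are the intervals to the right of \<open>x\<close>.\<close>
  obtain N where N: "negligible N" "\<And>x e. x \<notin> N \<Longrightarrow> 0 < e \<Longrightarrow>
       \<exists>d>0. \<forall>h. 0 < h \<and> h < d \<longrightarrow>
          norm (integral (cbox x (x + h *\<^sub>R One)) g /\<^sub>R h ^ DIM(real) - g x) < e"
    using integrable_ccontinuous_explicit[OF int] by blast
  have "AE x in lebesgue. x \<notin> N" using N(1) by (auto simp: negligible_iff_null_sets intro: AE_not_in)
  then have "AE x in lborel. x \<notin> N" by (simp only: AE_completion_iff)
  then show ?thesis
  proof eventually_elim
    case (elim x)
    then show ?case using N(2)[OF elim] by (simp add: eq divide_inverse_commute)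
  qed
qed

lemma (in ac_function) AE_derivative:
  "\<exists>g. integrable lborel g \<and> (\<forall>s t. 0 \<le> s \<and> s \<le> t \<and> t \<le> 1 \<longrightarrow> (LBINT u:{s..t}. g u) = F t - F s)
     \<and> (AE t in lborel. 0 < t \<and> t < 1 \<longrightarrow> (F has_real_derivative g t) (at t))"
proof -
  obtain g where g: "integrable lborel g" "\<forall>t\<in>{0..1}. F t - F 0 = (LBINT u:{0..t}. g u)"
    using ftc by blast
  have si: "set_integrable lborel {a..b} f" if "integrable lborel f" for a b and f :: "real \<Rightarrow> real"
    unfolding set_integrable_def by (rule integrable_mult_indicator) (use that in auto)
  have int: "(LBINT u:{s..t}. g u) = F t - F s" if "0 \<le> s" "s \<le> t" "t \<le> 1" for s t
  proof -
    have "integral {0..s} g + integral {s..t} g = integral {0..t} g"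
      by (rule Henstock_Kurzweil_Integration.integral_combine)
         (use that set_borel_integral_eq_integral(1)[OF si[OF g(1)]] in auto)
    then have "(LBINT u:{0..s}. g u) + (LBINT u:{s..t}. g u) = (LBINT u:{0..t}. g u)"
      by (simp only: set_borel_integral_eq_integral(2)[OF si[OF g(1)]])
    moreover have "F t - F 0 = (LBINT u:{0..t}. g u)" "F s - F 0 = (LBINT u:{0..s}. g u)"
      using g(2) that by auto
    ultimately show ?thesis by linarith
  qed
  \<comment> \<open>The averages to the left of a point are the averages to the right for the
    reflected function, so the one-sided result is applied twice. Reflection preserves null sets,
    which is \<open>AE_neg\<close> below.\<close>
  have g': "integrable lborel (\<lambda>u. g (- u))"
    using lborel_integrable_real_affine[OF g(1), of "-1" 0] by simp
  have refl: "(LBINT u:{a..b}. g (- u)) = (LBINT u:{- b..- a}. g u)" for a b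
  proof -
    have "(LBINT u:{- b..- a}. g u) = (\<integral>u. indicator {- b..- a} (- u) * g (- u) \<partial>lborel)"
      unfolding set_lebesgue_integral_def
      using lborel_integral_real_affine[of "-1" "\<lambda>u. indicator {- b..- a} u * g u" 0] by simp
    also have "\<dots> = (LBINT u:{a..b}. g (- u))"
      unfolding set_lebesgue_integral_def by (rule Bochner_Integration.integral_cong) (auto simp: indicator_def)
    finally show ?thesis by simp
  qed
  have AE_neg: "AE x in lborel. P (- x)" if ae: "AE x in lborel. P x" for P :: "real \<Rightarrow> bool"
  proof -
    obtain N where N: "{x. \<not> P x} \<subseteq> N" "N \<in> null_sets lborel"
      using ae by (auto simp: eventually_ae_filter)
    then have [measurable]: "N \<in> sets borel" by (auto simp: null_sets_def)
    have "Measurable.pred borel (\<lambda>x. x \<notin> N)" by measurable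
    then have "AE x in lborel. - x \<notin> N"
      using AE_borel_affine[of "-1" "\<lambda>x. x \<notin> N" 0] AE_not_in[OF N(2)] by simp
    then show ?thesis by eventually_elim (use N(1) in auto)
  qed
  have L: "AE x in lborel. \<forall>e>0. \<exists>d>0. \<forall>h. 0 < h \<and> h < d \<longrightarrow>
      \<bar>(LBINT u:{x - h..x}. g u) / h - g x\<bar> < e"
    using AE_neg[OF AE_right_derivative[OF g']] by eventually_elim (simp add: refl)
  have "AE t in lborel. 0 < t \<and> t < 1 \<longrightarrow> (F has_real_derivative g t) (at t)"
    using L AE_right_derivative[OF g(1)]
  proof eventually_elim
    case (elim t)
    show ?case
    proof (intro impI, unfold has_field_derivative_iff LIM_eq, intro allI impI)
      fix e :: real assume t: "0 < t \<and> t < 1" and e: "0 < e"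
      obtain d1 where d1: "0 < d1" "\<forall>h. 0 < h \<and> h < d1 \<longrightarrow> \<bar>(LBINT u:{t - h..t}. g u) / h - g t\<bar> < e"
        using elim(1) e by blast
      obtain d2 where d2: "0 < d2" "\<forall>h. 0 < h \<and> h < d2 \<longrightarrow> \<bar>(LBINT u:{t..t + h}. g u) / h - g t\<bar> < e"
        using elim(2) e by blast
      let ?d = "min (min d1 d2) (min t (1 - t))"
      show "\<exists>s>0. \<forall>x. x \<noteq> t \<and> norm (x - t) < s \<longrightarrow> norm ((F x - F t) / (x - t) - g t) < e"
      proof (intro exI[of _ ?d] conjI allI impI)
        show "0 < ?d" using d1 d2 t by auto
        fix x assume x: "x \<noteq> t \<and> norm (x - t) < ?d"
        show "norm ((F x - F t) / (x - t) - g t) < e"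
        proof (cases "x < t")
          case True
          then have "\<bar>(LBINT u:{t - (t - x)..t}. g u) / (t - x) - g t\<bar> < e"
            using d1(2)[rule_format, of "t - x"] x by auto
          moreover have "(LBINT u:{t - (t - x)..t}. g u) = F t - F x" using int[of x t] True x t by auto
          moreover have "(F x - F t) / (x - t) = (F t - F x) / (t - x)"
            by (metis minus_diff_eq minus_divide_divide)
          ultimately show ?thesis by simp
        next
          case False
          then have "\<bar>(LBINT u:{t..t + (x - t)}. g u) / (x - t) - g t\<bar> < e"
            using d2(2)[rule_format, of "x - t"] x by auto
          moreover have "(LBINT u:{t..t + (x - t)}. g u) = F x - F t" using int[of t x] False x t by auto
          ultimately show ?thesis by simp
        qed
      qed
    qed
  qed
  then show ?thesis using g(1) int by blast
qed

section \<open>Derivatives of absolutely continuous paths\<close>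

text \<open>A Cauchy criterion shaped for measurability: the outer quantifiers range over naturals,
  and the final inequality is not strict, so that for continuous \<open>y\<close> each inner
  condition defines a closed set of points \<open>t\<close>.\<close>

lemma has_real_derivative_Cauchy:
  fixes y :: "real \<Rightarrow> real" and t :: real
  defines "q \<equiv> \<lambda>h. (y (t + h) - y t) / h"
  shows "(\<exists>l. (y has_real_derivative l) (at t)) \<longleftrightarrow>
    (\<forall>n::nat. \<exists>m::nat. \<forall>h k. 0 < \<bar>h\<bar> \<and> \<bar>h\<bar> < 1 / real (Suc m) \<and> 0 < \<bar>k\<bar> \<and> \<bar>k\<bar> < 1 / real (Suc m) \<longrightarrow>
       \<bar>q h - q k\<bar> \<le> 1 / real (Suc n))" (is "?L \<longleftrightarrow> ?R")
proof
  assume ?L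
  then obtain l where "(q \<longlongrightarrow> l) (at 0)" unfolding q_def DERIV_def by blast
  then have lim: "\<And>e. 0 < e \<Longrightarrow> \<exists>s>0. \<forall>h. h \<noteq> 0 \<and> \<bar>h\<bar> < s \<longrightarrow> \<bar>q h - l\<bar> < e"
    by (simp add: LIM_eq)
  show ?R
  proof
    fix n :: nat
    obtain s where s: "0 < s" "\<And>h. h \<noteq> 0 \<Longrightarrow> \<bar>h\<bar> < s \<Longrightarrow> \<bar>q h - l\<bar> < 1 / real (Suc n) / 2"
      using lim[of "1 / real (Suc n) / 2"] by auto
    obtain m where m: "1 / real (Suc m) < s" using nat_approx_posE[OF s(1)] by blast
    show "\<exists>m::nat. \<forall>h k. 0 < \<bar>h\<bar> \<and> \<bar>h\<bar> < 1 / real (Suc m) \<and> 0 < \<bar>k\<bar> \<and> \<bar>k\<bar> < 1 / real (Suc m) \<longrightarrow>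
       \<bar>q h - q k\<bar> \<le> 1 / real (Suc n)"
    proof (intro exI[of _ m] allI impI)
      fix h k assume "0 < \<bar>h\<bar> \<and> \<bar>h\<bar> < 1 / real (Suc m) \<and> 0 < \<bar>k\<bar> \<and> \<bar>k\<bar> < 1 / real (Suc m)"
      then have "\<bar>q h - l\<bar> < 1 / real (Suc n) / 2" "\<bar>q k - l\<bar> < 1 / real (Suc n) / 2"
        using s(2) m by auto
      moreover have "1 / real (Suc n) / 2 + 1 / real (Suc n) / 2 = 1 / real (Suc n)"
        by (rule field_sum_of_halves)
      ultimately show "\<bar>q h - q k\<bar> \<le> 1 / real (Suc n)" unfolding abs_less_iff abs_le_iff by linarith
    qed
  qed
next
  assume R: ?R
  have R': "\<exists>m::nat. \<forall>h k. 0 < \<bar>h\<bar> \<and> \<bar>h\<bar> < 1 / real (Suc m) \<and> 0 < \<bar>k\<bar> \<and> \<bar>k\<bar> < 1 / real (Suc m) \<longrightarrow>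
       \<bar>q h - q k\<bar> < e" if "0 < e" for e
  proof -
    obtain n where "1 / real (Suc n) < e" using nat_approx_posE[OF \<open>0 < e\<close>] by blast
    then show ?thesis using R by (meson le_less_trans)
  qed
  let ?s = "\<lambda>m::nat. q (1 / real (Suc (Suc m)))"
  have "Cauchy ?s"
  proof (rule metric_CauchyI)
    fix e :: real assume "0 < e"
    then obtain m :: nat where m: "\<And>h k. 0 < \<bar>h\<bar> \<and> \<bar>h\<bar> < 1 / real (Suc m) \<and> 0 < \<bar>k\<bar> \<and> \<bar>k\<bar> < 1 / real (Suc m) \<Longrightarrow>
       \<bar>q h - q k\<bar> < e" using R' by blast
    show "\<exists>M. \<forall>i\<ge>M. \<forall>j\<ge>M. dist (?s i) (?s j) < e"
      by (intro exI[of _ m] allI impI) (auto simp: dist_real_def intro!: m frac_less2)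
  qed
  then obtain l where l: "?s \<longlonglongrightarrow> l" using Cauchy_convergent_iff convergent_def by blast
  have "(q \<longlongrightarrow> l) (at 0)"
  proof (unfold LIM_eq, intro allI impI)
    fix e :: real assume "0 < e"
    then obtain m :: nat where m: "\<And>h k. 0 < \<bar>h\<bar> \<and> \<bar>h\<bar> < 1 / real (Suc m) \<and> 0 < \<bar>k\<bar> \<and> \<bar>k\<bar> < 1 / real (Suc m) \<Longrightarrow>
       \<bar>q h - q k\<bar> < e / 2" using R'[of "e / 2"] by auto
    show "\<exists>s>0. \<forall>x. x \<noteq> 0 \<and> norm (x - 0) < s \<longrightarrow> norm (q x - l) < e"
    proof (intro exI[of _ "1 / real (Suc m)"] conjI allI impI)
      fix x :: real assume x: "x \<noteq> 0 \<and> norm (x - 0) < 1 / real (Suc m)"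
      have "(\<lambda>i. \<bar>q x - ?s i\<bar>) \<longlonglongrightarrow> \<bar>q x - l\<bar>" by (intro tendsto_intros l)
      then have "\<bar>q x - l\<bar> \<le> e / 2"
      proof (rule LIMSEQ_le_const2, intro exI[of _ m] allI impI)
        fix i assume "m \<le> i"
        then show "\<bar>q x - ?s i\<bar> \<le> e / 2"
          using x by (intro less_imp_le m) (auto intro!: frac_less2)
      qed
      then show "norm (q x - l) < e" using \<open>0 < e\<close> by simp
    qed simp
  qed
  then show ?L unfolding q_def DERIV_def by blast
qed

lemma
  fixes y :: "real \<Rightarrow> real"
  assumes cont: "continuous_on UNIV y"
  shows sets_differentiable: "{t. \<exists>l. (y has_real_derivative l) (at t)} \<in> sets borel"
    and borel_measurable_real_deriv:
      "(\<lambda>t. if \<exists>l. (y has_real_derivative l) (at t) then deriv y t else 0) \<in> borel_measurable borel"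
proof -
  define q where "q = (\<lambda>t h. (y (t + h) - y t) / h)"
  define C where "C = (\<lambda>n m::nat. {t. \<forall>h k. 0 < \<bar>h\<bar> \<and> \<bar>h\<bar> < 1 / real (Suc m) \<and> 0 < \<bar>k\<bar> \<and> \<bar>k\<bar> < 1 / real (Suc m) \<longrightarrow>
       \<bar>q t h - q t k\<bar> \<le> 1 / real (Suc n)})"
  have cq: "continuous_on UNIV (\<lambda>t. q t h)" for h
    unfolding q_def using cont
    by (cases "h = 0") (auto intro!: continuous_intros continuous_on_compose2[OF cont])
  have eq: "{t. \<exists>l. (y has_real_derivative l) (at t)} = (\<Inter>n. \<Union>m. C n m)"
    by (auto simp: has_real_derivative_Cauchy C_def q_def)
  have "closed (C n m)" for n m
  proof -
    \<comment> \<open>The quantifiers over \<open>h\<close> and \<open>k\<close> are uncountable,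
      which is harmless for an intersection of closed sets.\<close>
    have "C n m = (\<Inter>h. \<Inter>k. if 0 < \<bar>h\<bar> \<and> \<bar>h\<bar> < 1 / real (Suc m) \<and> 0 < \<bar>k\<bar> \<and> \<bar>k\<bar> < 1 / real (Suc m)
       then {t. \<bar>q t h - q t k\<bar> \<le> 1 / real (Suc n)} else UNIV)"
      unfolding C_def by (auto split: if_splits)
    moreover have "closed {t. \<bar>q t h - q t k\<bar> \<le> 1 / real (Suc n)}" for h k
      by (intro closed_Collect_le continuous_intros cq)
    ultimately show ?thesis by (simp only:) (intro closed_INT ballI, auto)
  qed
  then have [measurable]: "C n m \<in> sets borel" for n m by (rule borel_closed)
  show D: "{t. \<exists>l. (y has_real_derivative l) (at t)} \<in> sets borel"
    unfolding eq by measurable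
  let ?f = "\<lambda>i::nat. \<lambda>t. q t (1 / real (Suc i))"
  have fm: "?f i \<in> borel_measurable borel" for i
    by (rule borel_measurable_continuous_onI[OF cq])
  have "(\<lambda>t. if \<exists>l. (y has_real_derivative l) (at t) then deriv y t else 0)
      = (\<lambda>t. if t \<in> {t. \<exists>l. (y has_real_derivative l) (at t)} then lim (\<lambda>i. ?f i t) else 0)"
  proof
    fix t
    have "deriv y t = lim (\<lambda>i. ?f i t)" if l: "(y has_real_derivative l) (at t)" for l
    proof -
      have "((\<lambda>h. q t h) \<longlongrightarrow> l) (at 0)" using l unfolding q_def DERIV_def .
      moreover have "filterlim (\<lambda>i::nat. 1 / real (Suc i)) (at 0) sequentially"
        unfolding filterlim_at using LIMSEQ_inverse_real_of_nat by (simp add: inverse_eq_divide)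
      ultimately have "(\<lambda>i. ?f i t) \<longlonglongrightarrow> l" by (rule filterlim_compose)
      then show ?thesis using DERIV_imp_deriv[OF l] by (simp add: limI)
    qed
    then show "(if \<exists>l. (y has_real_derivative l) (at t) then deriv y t else 0)
      = (if t \<in> {t. \<exists>l. (y has_real_derivative l) (at t)} then lim (\<lambda>i. ?f i t) else 0)"
      by auto
  qed
  \<comment> \<open>Where the derivative exists it is the limit of the difference quotients along
    \<open>1 / (i + 1)\<close>, a sequence of continuous functions of \<open>t\<close>.\<close>
  also have "\<dots> \<in> borel_measurable borel"
    by (rule measurable_If_set) (use D fm in \<open>auto intro: borel_measurable_lim_metric\<close>)
  finally show "(\<lambda>t. if \<exists>l. (y has_real_derivative l) (at t) then deriv y t else 0) \<in> borel_measurable borel" .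
qed

lemma has_vector_derivative_vec_iff:
  fixes f :: "real \<Rightarrow> real^'n"
  shows "(f has_vector_derivative v) (at t) \<longleftrightarrow> (\<forall>i. ((\<lambda>t. f t $ i) has_vector_derivative v $ i) (at t))"
proof
  assume "(f has_vector_derivative v) (at t)"
  then show "\<forall>i. ((\<lambda>t. f t $ i) has_vector_derivative v $ i) (at t)"
    using bounded_linear.has_vector_derivative[OF bounded_linear_vec_nth] by blast
next
  assume "\<forall>i. ((\<lambda>t. f t $ i) has_vector_derivative v $ i) (at t)"
  then show "(f has_vector_derivative v) (at t)"
    unfolding has_vector_derivative_def
    by (subst has_derivative_componentwise_within) (auto simp: Basis_vec_def inner_axis) 
qed

lemma borel_measurable_path_deriv:
  "(\<lambda>t. path_deriv x t $ i) \<in> borel_measurable borel"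
proof -
  let ?y = "\<lambda>i t. apply_bcontfun x t $ i"
  let ?D = "\<lambda>i. {t. \<exists>l. (?y i has_real_derivative l) (at t)}"
  have c: "continuous_on UNIV (?y i)" for i by (intro continuous_intros) auto
  have D: "(\<Inter>i. ?D i) \<in> sets borel"
    by (rule sets.countable_INT') (use sets_differentiable[OF c] in auto)
  \<comment> \<open>The value that \<open>vector_derivative\<close> takes where no derivative
    exists: the predicate under the choice operator is then constantly false, so the same vector is
    chosen at all such times. A path is differentiable only where all its components are, hence the
    intersection of the sets \<open>?D i\<close> even though a single component is measured.\<close>
  define a where "a = (SOME v::real^'a. False)"
  have "path_deriv x t $ i =
    (if t \<in> (\<Inter>i. ?D i) then if \<exists>l. (?y i has_real_derivative l) (at t) then deriv (?y i) t else 0 else a $ i)" for t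
  proof (cases "t \<in> (\<Inter>i. ?D i)")
    case True
    then obtain l where l: "\<And>i. (?y i has_real_derivative l i) (at t)" by simp metis
    then have "(apply_bcontfun x has_vector_derivative (\<chi> i. l i)) (at t)"
      by (subst has_vector_derivative_vec_iff) (simp add: has_real_derivative_iff_has_vector_derivative)
    then have "path_deriv x t = (\<chi> i. l i)" unfolding path_deriv_def by (rule vector_derivative_at)
    moreover have "deriv (?y i) t = l i" by (rule DERIV_imp_deriv[OF l])
    ultimately show ?thesis using True l[of i] by auto
  next
    case False
    have "\<not> (apply_bcontfun x has_vector_derivative v) (at t)" for v
      using False unfolding has_vector_derivative_vec_iff
      by (auto simp: has_real_derivative_iff_has_vector_derivative)
    then have "path_deriv x t = a" unfolding path_deriv_def vector_derivative_def a_def by simp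
    then show ?thesis by (simp only: False if_False)
  qed
  then have "(\<lambda>t. path_deriv x t $ i) = (\<lambda>t. if t \<in> (\<Inter>i. ?D i) then
      if \<exists>l. (?y i has_real_derivative l) (at t) then deriv (?y i) t else 0 else a $ i)" by blast
  also have "\<dots> \<in> borel_measurable borel"
    by (rule measurable_If_set) (use D borel_measurable_real_deriv[OF c] in auto)
  finally show ?thesis .
qed

lemma ac_function_component:
  assumes "x \<in> ac_paths"
  shows "ac_function (\<lambda>t. apply_bcontfun x t $ i)"
proof
  have ac: "absolutely_continuous_01 (apply_bcontfun x)" and p: "x \<in> paths"
    using assms by (auto simp: ac_paths_def)
  show "absolutely_continuous_01 (\<lambda>t. apply_bcontfun x t $ i)"
    unfolding absolutely_continuous_01_def
  proof (intro allI impI)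
    fix \<epsilon> :: real assume "0 < \<epsilon>"
    then obtain \<delta> where d: "\<delta> > 0" "\<forall>P. finite P \<and> (\<forall>(s, t)\<in>P. 0 \<le> s \<and> s \<le> t \<and> t \<le> 1) \<and>
        disjoint_family_on (\<lambda>(s, t). {s<..<t}) P \<and> (\<Sum>(s, t)\<in>P. t - s) < \<delta> \<longrightarrow>
        (\<Sum>(s, t)\<in>P. dist (apply_bcontfun x s) (apply_bcontfun x t)) < \<epsilon>"
      using ac unfolding absolutely_continuous_01_def by blast
    have le: "(\<Sum>(s, t)\<in>P. dist (apply_bcontfun x s $ i) (apply_bcontfun x t $ i))
      \<le> (\<Sum>(s, t)\<in>P. dist (apply_bcontfun x s) (apply_bcontfun x t))" for P
      by (rule sum_mono) (auto simp: dist_vec_nth_le)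
    show "\<exists>\<delta>>0. \<forall>P. finite P \<and> (\<forall>(s, t)\<in>P. 0 \<le> s \<and> s \<le> t \<and> t \<le> 1) \<and>
        disjoint_family_on (\<lambda>(s, t). {s<..<t}) P \<and> (\<Sum>(s, t)\<in>P. t - s) < \<delta> \<longrightarrow>
        (\<Sum>(s, t)\<in>P. dist (apply_bcontfun x s $ i) (apply_bcontfun x t $ i)) < \<epsilon>"
      using d le by (intro exI[of _ \<delta>]) (meson le_less_trans)
  qed
  show "continuous_on UNIV (\<lambda>t. apply_bcontfun x t $ i)" by (intro continuous_intros) auto
  show "apply_bcontfun x t $ i = apply_bcontfun x (clamp 0 1 t) $ i" for t
    using p by (auto simp: paths_def)
qed

lemma ac_path_AE_derivative:
  assumes "x \<in> ac_paths"
  shows "AE t in lborel. 0 < t \<and> t < 1 \<longrightarrow> (apply_bcontfun x has_vector_derivative path_deriv x t) (at t)"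
proof -
  have "AE t in lborel. 0 < t \<and> t < 1 \<longrightarrow> (\<exists>l. ((\<lambda>t. apply_bcontfun x t $ i) has_real_derivative l) (at t))" for i
    using ac_function.AE_derivative[OF ac_function_component[OF assms, of i]] by (auto elim: eventually_mono)
  then have "AE t in lborel. \<forall>i. 0 < t \<and> t < 1 \<longrightarrow> (\<exists>l. ((\<lambda>t. apply_bcontfun x t $ i) has_real_derivative l) (at t))"
    by (subst AE_finite_all[OF finite_class.finite_UNIV, simplified ball_UNIV]) blast
  then show ?thesis
  proof eventually_elim
    case (elim t)
    show ?case
    proof
      assume "0 < t \<and> t < 1"
      then obtain l where l: "\<And>i. ((\<lambda>t. apply_bcontfun x t $ i) has_real_derivative l i) (at t)"
        using elim by metis
      then have "(apply_bcontfun x has_vector_derivative (\<chi> i. l i)) (at t)"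
        by (subst has_vector_derivative_vec_iff) (simp add: has_real_derivative_iff_has_vector_derivative)
      then show "(apply_bcontfun x has_vector_derivative path_deriv x t) (at t)"
        unfolding path_deriv_def using vector_derivative_works differentiableI_vector by blast
    qed
  qed
qed

lemma AE_not_endpoints: "AE t in (lborel :: real measure). t \<noteq> 0 \<and> t \<noteq> 1"
  using AE_lborel_singleton[of 0] AE_lborel_singleton[of 1] by eventually_elim auto

text \<open>The density \<open>g\<close> of a component is its derivative almost everywhere, hence
  agrees almost everywhere with that component of \<open>path_deriv\<close>. Integrability and the
  increment formula are inherited from \<open>g\<close>.\<close>

lemma
  assumes "x \<in> ac_paths"
  shows path_deriv_integrable: "set_integrable lborel {0..1} (\<lambda>t. path_deriv x t $ i)"
    and path_deriv_ftc: "0 \<le> s \<Longrightarrow> s \<le> t \<Longrightarrow> t \<le> 1 \<Longrightarrow>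
      (LBINT u:{s..t}. path_deriv x u $ i) = apply_bcontfun x t $ i - apply_bcontfun x s $ i"
proof -
  obtain g where g: "integrable lborel g"
    "\<forall>s t. 0 \<le> s \<and> s \<le> t \<and> t \<le> 1 \<longrightarrow> (LBINT u:{s..t}. g u) = apply_bcontfun x t $ i - apply_bcontfun x s $ i"
    "AE t in lborel. 0 < t \<and> t < 1 \<longrightarrow> ((\<lambda>t. apply_bcontfun x t $ i) has_real_derivative g t) (at t)"
    using ac_function.AE_derivative[OF ac_function_component[OF assms]] by blast
  have gm: "g \<in> borel_measurable borel" using borel_measurable_integrable[OF g(1)] by simp
  have ae: "AE t in lborel. t \<in> {0..1} \<longrightarrow> path_deriv x t $ i = g t"
    using g(3) ac_path_AE_derivative[OF assms] AE_not_endpoints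
  proof eventually_elim
    case (elim t)
    show ?case
    proof
      assume "t \<in> {0..1}"
      then have t: "0 < t \<and> t < 1" using elim by auto
      have "((\<lambda>t. apply_bcontfun x t $ i) has_vector_derivative path_deriv x t $ i) (at t)"
        using elim(2) t by (simp add: has_vector_derivative_vec_iff)
      then show "path_deriv x t $ i = g t"
        using elim(1) t vector_derivative_unique_at
        unfolding has_real_derivative_iff_has_vector_derivative by blast
    qed
  qed
  have "integrable lborel (\<lambda>t. indicator {0..1} t *\<^sub>R g t)"
    by (rule integrable_mult_indicator) (use g in auto)
  moreover have "AE t in lborel. indicator {0..1} t *\<^sub>R g t = indicator {0..1} t *\<^sub>R path_deriv x t $ i"
    using ae by eventually_elim (auto simp: indicator_def)
  ultimately show "set_integrable lborel {0..1} (\<lambda>t. path_deriv x t $ i)"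
    unfolding set_integrable_def
    by (subst integrable_cong_AE[where g = "\<lambda>t. indicator {0..1} t *\<^sub>R g t"])
       (auto intro!: borel_measurable_times borel_measurable_path_deriv gm elim: eventually_mono)
  assume st: "0 \<le> s" "s \<le> t" "t \<le> 1"
  have "(LBINT u:{s..t}. path_deriv x u $ i) = (LBINT u:{s..t}. g u)"
    by (rule set_lebesgue_integral_cong_AE)
       (use ae st gm borel_measurable_path_deriv in \<open>auto elim: eventually_mono\<close>)
  then show "(LBINT u:{s..t}. path_deriv x u $ i) = apply_bcontfun x t $ i - apply_bcontfun x s $ i"
    using g(2) st by simp
qed

lemma path_deriv_le_one_var:
  assumes "x \<in> ac_paths"
  shows "set_integrable lborel {0..1} (\<lambda>t. norm (path_deriv x t))"
    and "(LBINT t:{0..1}. norm (path_deriv x t)) \<le> one_var x"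
    and "(LBINT t:{0..1}. \<bar>path_deriv x t $ i\<bar>) \<le> one_var x"
proof -
  have m: "path_deriv x \<in> borel_measurable borel"
  proof (rule borel_measurable_euclidean_space[THEN iffD2], intro ballI)
    fix b :: "real^'a" assume "b \<in> Basis"
    then obtain i where "b = axis i 1" by (auto simp: Basis_vec_def)
    then show "(\<lambda>t. path_deriv x t \<bullet> b) \<in> borel_measurable borel"
      using borel_measurable_path_deriv by (simp add: inner_axis)
  qed
  have "set_integrable lborel {0..1} (\<lambda>t. \<Sum>i\<in>UNIV. \<bar>path_deriv x t $ i\<bar>)"
    using set_integrable_abs[OF path_deriv_integrable[OF assms]]
    unfolding set_integrable_def scaleR_sum_right by (intro Bochner_Integration.integrable_sum) auto
  then show si: "set_integrable lborel {0..1} (\<lambda>t. norm (path_deriv x t))"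
    unfolding set_integrable_def
  proof (rule Bochner_Integration.integrable_bound)
    show "AE t in lborel. norm (indicator {0..1} t *\<^sub>R norm (path_deriv x t)) \<le>
      norm (indicator {0..1} t *\<^sub>R (\<Sum>i\<in>UNIV. \<bar>path_deriv x t $ i\<bar>))"
      by (intro AE_I2) (auto simp: indicator_def norm_le_l1_cart abs_of_nonneg sum_nonneg)
  qed (use m in auto)
  show 1: "(LBINT t:{0..1}. norm (path_deriv x t)) \<le> one_var x"
    using assms by (simp add: one_var_def)
  have "(LBINT t:{0..1}. \<bar>path_deriv x t $ i\<bar>) \<le> (LBINT t:{0..1}. norm (path_deriv x t))"
    by (rule set_integral_mono)
       (use si path_deriv_integrable[OF assms] in \<open>auto intro: set_integrable_abs component_le_norm_cart\<close>)
  then show "(LBINT t:{0..1}. \<bar>path_deriv x t $ i\<bar>) \<le> one_var x" using 1 by linarith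
qed

section \<open>Iterated integrals of integrable functions\<close>

definition L1_01 :: "(real \<Rightarrow> real) \<Rightarrow> bool" where
  "L1_01 a \<longleftrightarrow> a \<in> borel_measurable borel \<and> set_integrable lborel {0..1} a"

definition norm1 :: "(real \<Rightarrow> real) \<Rightarrow> real" where
  "norm1 a = (LBINT t:{0..1}. \<bar>a t\<bar>)"

text \<open>Words of functions instead of words of indices. A single letter can then be replaced, by
  a sum of functions or by the derivative of another path, while the remaining letters stay as they
  are.\<close>

primrec simplex_int :: "(real \<Rightarrow> real) list \<Rightarrow> real \<Rightarrow> real" where
  "simplex_int [] s = 1"
| "simplex_int (a # w) s = (LBINT t:{s..1}. a t * simplex_int w t)"

lemma iter_int_eq_simplex_int:
  "iter_int x w s = simplex_int (map (\<lambda>i t. path_deriv x t $ i) w) s"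
  by (induction w arbitrary: s) auto

lemma norm1_nonneg: "0 \<le> norm1 a"
  unfolding norm1_def set_lebesgue_integral_def by (rule integral_nonneg_AE) auto

lemma L1_01_measurable: "L1_01 a \<Longrightarrow> a \<in> borel_measurable borel"
  by (simp add: L1_01_def)

lemma L1_01_subset: "L1_01 a \<Longrightarrow> 0 \<le> s \<Longrightarrow> t \<le> 1 \<Longrightarrow> set_integrable lborel {s..t} a"
  unfolding L1_01_def by (rule set_integrable_subset[of _ "{0..1}"]) auto

lemma L1_01_sum:
  assumes "\<And>k. k \<in> S \<Longrightarrow> L1_01 (a k)"
  shows "L1_01 (\<lambda>t. \<Sum>k\<in>S. c k * a k t)"
proof -
  have "integrable lborel (\<lambda>t. \<Sum>k\<in>S. c k * (indicator {0..1} t *\<^sub>R a k t))"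
    by (rule Bochner_Integration.integrable_sum)
       (use assms in \<open>auto simp: L1_01_def set_integrable_def\<close>)
  moreover have "(\<lambda>t. \<Sum>k\<in>S. c k * (indicator {0..1} t *\<^sub>R a k t)) =
      (\<lambda>t. indicator {0..1} t *\<^sub>R (\<Sum>k\<in>S. c k * a k t))"
    by (auto simp: sum_distrib_left fun_eq_iff intro!: sum.cong)
  ultimately show ?thesis
    unfolding L1_01_def set_integrable_def using assms
    by (auto simp: L1_01_def intro!: borel_measurable_sum borel_measurable_times)
qed

lemma
  assumes a: "L1_01 a" and G: "G \<in> borel_measurable borel" and B: "\<And>t. t \<in> {0..1} \<Longrightarrow> \<bar>G t\<bar> \<le> B"
  shows L1_01_mult: "L1_01 (\<lambda>t. a t * G t)"
    and norm1_mult: "norm1 (\<lambda>t. a t * G t) \<le> B * norm1 a"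
proof -
  have le: "\<bar>indicator {0..1} t * (a t * G t)\<bar> \<le> B * \<bar>indicator {0..1} t * a t\<bar>" for t
    using mult_right_mono[OF B, of t "\<bar>a t\<bar>"] by (auto simp: indicator_def abs_mult mult.commute)
  have ia: "integrable lborel (\<lambda>t. B * \<bar>indicator {0..1} t * a t\<bar>)"
    using a by (auto simp: L1_01_def set_integrable_def)
  have am: "a \<in> borel_measurable borel" using a by (rule L1_01_measurable)
  have "integrable lborel (\<lambda>t. indicator {0..1} t *\<^sub>R (a t * G t))"
  proof (rule Bochner_Integration.integrable_bound[OF ia])
    show "AE t in lborel. norm (indicator {0..1} t *\<^sub>R (a t * G t)) \<le> norm (B * \<bar>indicator {0..1} t * a t\<bar>)"
      using le by (intro AE_I2) (auto intro: order_trans[OF _ abs_ge_self])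
  qed (use am G in auto)
  then show L: "L1_01 (\<lambda>t. a t * G t)"
    unfolding L1_01_def set_integrable_def using am G by auto
  have "norm1 (\<lambda>t. a t * G t) = (\<integral>t. \<bar>indicator {0..1} t * (a t * G t)\<bar> \<partial>lborel)"
    unfolding norm1_def set_lebesgue_integral_def
    by (rule Bochner_Integration.integral_cong) (auto simp: indicator_def)
  also have "\<dots> \<le> (\<integral>t. B * \<bar>indicator {0..1} t * a t\<bar> \<partial>lborel)"
    by (rule integral_mono) (use L ia le in \<open>auto simp: L1_01_def set_integrable_def\<close>)
  also have "\<dots> = B * norm1 a"
    unfolding norm1_def set_lebesgue_integral_def
    by (subst integral_mult_right_zero, rule arg_cong[where f = "(*) B"], rule Bochner_Integration.integral_cong)
       (auto simp: indicator_def)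
  finally show "norm1 (\<lambda>t. a t * G t) \<le> B * norm1 a" .
qed

lemma abs_integral_le_norm1:
  assumes "L1_01 a" "0 \<le> s" "t \<le> 1"
  shows "\<bar>LBINT u:{s..t}. a u\<bar> \<le> norm1 a"
proof -
  have "\<bar>LBINT u:{s..t}. a u\<bar> \<le> (\<integral>u. \<bar>indicator {s..t} u * a u\<bar> \<partial>lborel)"
    unfolding set_lebesgue_integral_def real_scaleR_def by (rule integral_abs_bound)
  also have "\<dots> \<le> (\<integral>u. \<bar>indicator {0..1} u * a u\<bar> \<partial>lborel)"
    by (rule integral_mono)
       (use assms L1_01_subset[OF assms] in \<open>auto simp: L1_01_def set_integrable_def indicator_def\<close>)
  also have "\<dots> = norm1 a"
    unfolding norm1_def set_lebesgue_integral_def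
    by (rule Bochner_Integration.integral_cong) (auto simp: indicator_def)
  finally show ?thesis .
qed

lemma borel_measurable_tail_integral:
  fixes b :: "real \<Rightarrow> real"
  assumes [measurable]: "b \<in> borel_measurable borel"
  shows "(\<lambda>t. LBINT u:{t..1}. b u) \<in> borel_measurable borel"
proof -
  have "(\<lambda>t. LBINT u:{t..1}. b u) = (\<lambda>t. \<integral>u. (if t \<le> u \<and> u \<le> 1 then b u else 0) \<partial>lborel)"
    unfolding set_lebesgue_integral_def
    by (intro ext Bochner_Integration.integral_cong) (auto simp: indicator_def)
  also have "\<dots> \<in> borel_measurable borel"
    by measurable
  finally show ?thesis .
qed

lemma
  assumes "\<And>a. a \<in> set w \<Longrightarrow> L1_01 a"
  shows borel_measurable_simplex_int: "simplex_int w \<in> borel_measurable borel"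
    and simplex_int_bound: "s \<in> {0..1} \<Longrightarrow> \<bar>simplex_int w s\<bar> \<le> prod_list (map norm1 w)"
proof -
  have "simplex_int w \<in> borel_measurable borel \<and> (\<forall>s\<in>{0..1}. \<bar>simplex_int w s\<bar> \<le> prod_list (map norm1 w))"
    using assms
  proof (induction w)
    case Nil
    have "simplex_int [] = (\<lambda>s. 1)" by auto
    then show ?case by simp
  next
    case (Cons a w)
    have a: "L1_01 a" and w: "simplex_int w \<in> borel_measurable borel"
      "\<And>s. s \<in> {0..1} \<Longrightarrow> \<bar>simplex_int w s\<bar> \<le> prod_list (map norm1 w)"
      using Cons by auto
    have eq: "simplex_int (a # w) = (\<lambda>s. LBINT t:{s..1}. a t * simplex_int w t)" by auto
    have "simplex_int (a # w) \<in> borel_measurable borel"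
      unfolding eq by (rule borel_measurable_tail_integral) (use L1_01_measurable[OF a] w(1) in auto)
    moreover have "\<bar>simplex_int (a # w) s\<bar> \<le> prod_list (map norm1 (a # w))" if "s \<in> {0..1}" for s
      using abs_integral_le_norm1[OF L1_01_mult[OF a w], of s 1] norm1_mult[OF a w] that
      by (simp add: mult.commute)
    ultimately show ?case by blast
  qed
  then show "simplex_int w \<in> borel_measurable borel"
    "s \<in> {0..1} \<Longrightarrow> \<bar>simplex_int w s\<bar> \<le> prod_list (map norm1 w)" by auto
qed

lemma L1_01_simplex_int:
  assumes "L1_01 a" "\<And>b. b \<in> set w \<Longrightarrow> L1_01 b"
  shows "L1_01 (\<lambda>t. a t * simplex_int w t)"
  by (rule L1_01_mult[OF assms(1) borel_measurable_simplex_int simplex_int_bound]) (use assms(2) in auto)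

lemma simplex_int_cong_AE:
  assumes "list_all2 (\<lambda>a b. L1_01 a \<and> L1_01 b \<and> (AE t in lborel. t \<in> {0..1} \<longrightarrow> a t = b t)) v w"
    and "s \<in> {0..1}"
  shows "simplex_int v s = simplex_int w s"
  using assms
proof (induction v w arbitrary: s rule: list_all2_induct)
  case (Cons a v b w)
  have v: "\<And>a. a \<in> set v \<Longrightarrow> L1_01 a" and w: "\<And>a. a \<in> set w \<Longrightarrow> L1_01 a"
    using Cons(2) by (auto simp: list_all2_conv_all_nth in_set_conv_nth)
  have [measurable]: "a \<in> borel_measurable borel" "b \<in> borel_measurable borel"
    "simplex_int v \<in> borel_measurable borel" "simplex_int w \<in> borel_measurable borel"
    using Cons(1) borel_measurable_simplex_int[OF v] borel_measurable_simplex_int[OF w]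
    by (auto simp: L1_01_def)
  have "AE t in lborel. t \<in> {0..1} \<longrightarrow> a t = b t" using Cons(1) by auto
  then have "AE t in lborel. t \<in> {s..1} \<longrightarrow> a t * simplex_int v t = b t * simplex_int w t"
    by eventually_elim (use Cons(3,4) in auto)
  then show ?case
    by (simp del: atLeastAtMost_iff) (rule set_lebesgue_integral_cong_AE, auto)
qed simp

lemma simplex_int_linear:
  assumes "\<And>b. b \<in> set v \<union> set w \<Longrightarrow> L1_01 b" "\<And>k. k \<in> S \<Longrightarrow> L1_01 (a k)" "s \<in> {0..1}"
  shows "simplex_int (v @ (\<lambda>t. \<Sum>k\<in>S. c k * a k t) # w) s = (\<Sum>k\<in>S. c k * simplex_int (v @ a k # w) s)"
  using assms
proof (induction v arbitrary: s)
  case Nil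
  have i: "set_integrable lborel {s..1} (\<lambda>t. a k t * simplex_int w t)" if "k \<in> S" for k
    using L1_01_subset[OF L1_01_simplex_int[of "a k" w]] Nil that by auto
  have "simplex_int ([] @ (\<lambda>t. \<Sum>k\<in>S. c k * a k t) # w) s
    = (\<integral>t. (\<Sum>k\<in>S. c k * (indicator {s..1} t *\<^sub>R (a k t * simplex_int w t))) \<partial>lborel)"
    by (auto simp: set_lebesgue_integral_def sum_distrib_left sum_distrib_right mult_ac
        intro!: Bochner_Integration.integral_cong sum.cong)
  also have "\<dots> = (\<Sum>k\<in>S. c k * simplex_int ([] @ a k # w) s)"
    using i by (subst Bochner_Integration.integral_sum) (auto simp: set_lebesgue_integral_def set_integrable_def)
  finally show ?case .
next
  case (Cons b v)
  have b: "L1_01 b" using Cons(2) by auto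
  have i: "set_integrable lborel {s..1} (\<lambda>t. b t * simplex_int (v @ a k # w) t)" if "k \<in> S" for k
    using L1_01_subset[OF L1_01_simplex_int[of b "v @ a k # w"]] Cons(2-4) that by auto
  have "simplex_int ((b # v) @ (\<lambda>t. \<Sum>k\<in>S. c k * a k t) # w) s
    = (\<integral>t. (\<Sum>k\<in>S. c k * (indicator {s..1} t *\<^sub>R (b t * simplex_int (v @ a k # w) t))) \<partial>lborel)"
    unfolding append_Cons simplex_int.simps set_lebesgue_integral_def
  proof (rule Bochner_Integration.integral_cong[OF refl])
    fix t
    show "indicator {s..1} t *\<^sub>R (b t * simplex_int (v @ (\<lambda>t. \<Sum>k\<in>S. c k * a k t) # w) t) =
      (\<Sum>k\<in>S. c k * (indicator {s..1} t *\<^sub>R (b t * simplex_int (v @ a k # w) t)))"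
    proof (cases "t \<in> {s..1}")
      case True
      then have "simplex_int (v @ (\<lambda>t. \<Sum>k\<in>S. c k * a k t) # w) t = (\<Sum>k\<in>S. c k * simplex_int (v @ a k # w) t)"
        using Cons by (intro Cons.IH) auto
      then show ?thesis using True by (simp add: sum_distrib_left mult_ac)
    qed simp
  qed
  also have "\<dots> = (\<Sum>k\<in>S. c k * simplex_int ((b # v) @ a k # w) s)"
    using i by (subst Bochner_Integration.integral_sum) (auto simp: set_lebesgue_integral_def set_integrable_def)
  finally show ?case .
qed

text \<open>Fubini on the triangle \<open>s \<le> t \<le> u \<le> 1\<close>.\<close>

lemma simplex_int_swap:
  assumes r: "L1_01 r" and b: "L1_01 b" and s: "0 \<le> s"
  shows "(LBINT t:{s..1}. r t * (LBINT u:{t..1}. b u)) = (LBINT u:{s..1}. b u * (LBINT t:{s..u}. r t))"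
proof -
  have [measurable]: "r \<in> borel_measurable borel" "b \<in> borel_measurable borel"
    using r b by (auto simp: L1_01_def)
  define f where "f = (\<lambda>(t, u). if s \<le> t \<and> t \<le> u \<and> u \<le> 1 then r t * b u else 0)"
  \<comment> \<open>A product of integrable functions on the unit square that dominates
    \<open>f\<close>; this gives the integrability needed to exchange the integrals.\<close>
  define g where "g = (\<lambda>(t, u). (indicator {0..1} t * r t) * (indicator {0..1} u * b u))"
  have [measurable]: "f \<in> borel_measurable (lborel \<Otimes>\<^sub>M lborel)" "g \<in> borel_measurable (lborel \<Otimes>\<^sub>M lborel)"
    unfolding f_def g_def by measurable
  have ri: "integrable lborel (\<lambda>t. indicator {0..1} t * r t)" and bi: "integrable lborel (\<lambda>t. indicator {0..1} t * b t)"
    using r b by (auto simp: L1_01_def set_integrable_def)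
  have "integrable (lborel \<Otimes>\<^sub>M lborel) g"
  proof (rule lborel_pair.Fubini_integrable)
    show "integrable lborel (\<lambda>t. \<integral>u. norm (g (t, u)) \<partial>lborel)"
      using integrable_abs[OF ri] bi by (simp add: g_def abs_mult)
    show "AE t in lborel. integrable lborel (\<lambda>u. g (t, u))" using bi by (simp add: g_def)
  qed measurable
  then have fi: "integrable (lborel \<Otimes>\<^sub>M lborel) f"
    by (rule Bochner_Integration.integrable_bound) (use s in \<open>auto simp: f_def g_def indicator_def\<close>)
  have "(LBINT t:{s..1}. r t * (LBINT u:{t..1}. b u)) = (\<integral>t. (\<integral>u. f (t, u) \<partial>lborel) \<partial>lborel)"
    unfolding set_lebesgue_integral_def
  proof (intro Bochner_Integration.integral_cong refl)
    fix t
    have "indicator {s..1} t *\<^sub>R (r t * (\<integral>u. indicator {t..1} u *\<^sub>R b u \<partial>lborel)) =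
       (\<integral>u. (indicator {s..1} t * r t) * (indicator {t..1} u *\<^sub>R b u) \<partial>lborel)"
      by (subst integral_mult_right_zero) simp
    also have "\<dots> = (\<integral>u. f (t, u) \<partial>lborel)"
      by (intro Bochner_Integration.integral_cong refl) (auto simp: f_def indicator_def)
    finally show "indicator {s..1} t *\<^sub>R (r t * (\<integral>u. indicator {t..1} u *\<^sub>R b u \<partial>lborel)) =
       (\<integral>u. f (t, u) \<partial>lborel)" .
  qed
  also have "\<dots> = (\<integral>u. (\<integral>t. f (t, u) \<partial>lborel) \<partial>lborel)"
    using lborel_pair.Fubini_integral[of "\<lambda>t u. f (t, u)"] fi by simp
  also have "\<dots> = (LBINT u:{s..1}. b u * (LBINT t:{s..u}. r t))"
    unfolding set_lebesgue_integral_def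
  proof (intro Bochner_Integration.integral_cong refl)
    fix u
    have "indicator {s..1} u *\<^sub>R (b u * (\<integral>t. indicator {s..u} t *\<^sub>R r t \<partial>lborel)) =
       (\<integral>t. (indicator {s..1} u * b u) * (indicator {s..u} t *\<^sub>R r t) \<partial>lborel)"
      by (subst integral_mult_right_zero) simp
    also have "\<dots> = (\<integral>t. f (t, u) \<partial>lborel)"
      by (intro Bochner_Integration.integral_cong refl) (auto simp: f_def indicator_def)
    finally show "(\<integral>t. f (t, u) \<partial>lborel) =
      indicator {s..1} u *\<^sub>R (b u * (\<integral>t. indicator {s..u} t *\<^sub>R r t \<partial>lborel))" by simp
  qed
  finally show ?thesis .
qed

text \<open>Only the oscillation of the primitive of one letter enters, not its variation: integrate that
  letter first, after exchanging it with the next one.\<close>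

lemma simplex_int_oscillation:
  assumes "\<And>a. a \<in> set v \<union> set w \<Longrightarrow> L1_01 a" and r: "L1_01 r"
    and osc: "\<And>s t. 0 \<le> s \<Longrightarrow> s \<le> t \<Longrightarrow> t \<le> 1 \<Longrightarrow> \<bar>LBINT u:{s..t}. r u\<bar> \<le> \<rho>"
    and "s \<in> {0..1}"
  shows "\<bar>simplex_int (v @ r # w) s\<bar> \<le> \<rho> * prod_list (map norm1 (v @ w))"
  using assms(1,4)
proof (induction v arbitrary: s)
  case Nil
  show ?case
  proof (cases w)
    case Nil
    then show ?thesis using osc[of s 1] \<open>s \<in> {0..1}\<close> by simp
  next
    case (Cons b w')
    have b: "L1_01 b" and w': "\<And>a. a \<in> set w' \<Longrightarrow> L1_01 a" using Nil(1) Cons by auto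
    define c where "c = (\<lambda>t. b t * simplex_int w' t)"
    define G where "G = (\<lambda>u. if s \<le> u then LBINT t:{s..u}. r t else 0)"
    have c: "L1_01 c" unfolding c_def by (rule L1_01_simplex_int[OF b w'])
    have nc: "norm1 c \<le> prod_list (map norm1 w') * norm1 b"
      unfolding c_def by (rule norm1_mult[OF b borel_measurable_simplex_int simplex_int_bound]) (use w' in auto)
    have [measurable]: "r \<in> borel_measurable borel" using r by (rule L1_01_measurable)
    have "G = (\<lambda>u. \<integral>t. (if s \<le> t \<and> t \<le> u then r t else 0) \<partial>lborel)"
    proof
      fix u
      show "G u = (\<integral>t. (if s \<le> t \<and> t \<le> u then r t else 0) \<partial>lborel)"
      proof (cases "s \<le> u")
        case True
        then show ?thesis unfolding G_def set_lebesgue_integral_def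
          by (auto intro!: Bochner_Integration.integral_cong simp: indicator_def)
      next
        case False
        then have "(\<lambda>t. if s \<le> t \<and> t \<le> u then r t else 0) = (\<lambda>t. 0)" by auto
        then show ?thesis using False by (simp add: G_def)
      qed
    qed
    also have "\<dots> \<in> borel_measurable borel"
      by measurable
    finally have G: "G \<in> borel_measurable borel" .
    have \<rho>: "0 \<le> \<rho>" using osc[of 0 0] by linarith
    have GB: "\<bar>G u\<bar> \<le> \<rho>" if "u \<in> {0..1}" for u
      using osc[of s u] \<rho> that Nil(2) by (auto simp: G_def)
    have "simplex_int ([] @ r # w) s = (LBINT u:{s..1}. c u * (LBINT t:{s..u}. r t))"
      using simplex_int_swap[OF r c, of s] Nil(2) by (simp add: Cons c_def)
    also have "\<dots> = (LBINT u:{s..1}. c u * G u)"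
      by (rule set_lebesgue_integral_cong) (auto simp: G_def)
    finally have "\<bar>simplex_int ([] @ r # w) s\<bar> \<le> norm1 (\<lambda>u. c u * G u)"
      using abs_integral_le_norm1[OF L1_01_mult[OF c G GB], of s 1] Nil(2) by simp
    also have "\<dots> \<le> \<rho> * norm1 c" by (rule norm1_mult[OF c G GB])
    also have "\<dots> \<le> \<rho> * (prod_list (map norm1 w') * norm1 b)" using nc \<rho> by (rule mult_left_mono)
    finally show ?thesis by (simp add: Cons mult_ac)
  qed
next
  case (Cons a v)
  have a: "L1_01 a" and l: "\<And>b. b \<in> set (v @ r # w) \<Longrightarrow> L1_01 b" using Cons(2) r by auto
  have B: "\<And>t. t \<in> {0..1} \<Longrightarrow> \<bar>simplex_int (v @ r # w) t\<bar> \<le> \<rho> * prod_list (map norm1 (v @ w))"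
    using Cons by auto
  note m = borel_measurable_simplex_int[of "v @ r # w", OF l]
  show ?case
    using abs_integral_le_norm1[OF L1_01_mult[OF a m B], of s 1] norm1_mult[OF a m B] Cons(3)
    by (simp add: mult_ac)
qed

section \<open>Images of paths\<close>

definition path_map :: "(real^'d \<Rightarrow> real^'d) \<Rightarrow> 'd::finite curve \<Rightarrow> 'd curve" where
  "path_map f x = Bcontfun (\<lambda>t. f (apply_bcontfun x t))"

lemma compact_range_path:
  assumes "x \<in> paths"
  shows "compact (range (apply_bcontfun x))"
proof -
  have "range (apply_bcontfun x) = apply_bcontfun x ` {0..1}"
  proof (intro equalityI subsetI)
    fix y assume "y \<in> range (apply_bcontfun x)"
    then obtain t where "y = apply_bcontfun x t" by auto
    then have "y = apply_bcontfun x (clamp 0 1 t)" using assms unfolding paths_def by auto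
    moreover have "clamp 0 1 t \<in> {0..1}" unfolding clamp_real by auto
    ultimately show "y \<in> apply_bcontfun x ` {0..1}" by blast
  qed auto
  then show ?thesis by (simp add: compact_continuous_image)
qed

text \<open>\<open>Bcontfun\<close> requires a bounded function. No bound on \<open>f\<close> is
  assumed: the range of a path is compact, so its continuous image is bounded.\<close>

lemma apply_path_map:
  assumes x: "x \<in> paths" and f: "continuous_on D f" "range (apply_bcontfun x) \<subseteq> D"
  shows "apply_bcontfun (path_map f x) t = f (apply_bcontfun x t)"
proof -
  have "continuous_on UNIV (\<lambda>t. f (apply_bcontfun x t))"
    by (rule continuous_on_compose2[OF f(1)]) (use f(2) in auto)
  moreover have "range (\<lambda>t. f (apply_bcontfun x t)) = f ` range (apply_bcontfun x)" by auto
  moreover have "compact (f ` range (apply_bcontfun x))"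
    by (rule compact_continuous_image[OF continuous_on_subset[OF f] compact_range_path[OF x]])
  ultimately have "(\<lambda>t. f (apply_bcontfun x t)) \<in> bcontfun"
    by (auto simp: bcontfun_def intro: compact_imp_bounded)
  then show ?thesis unfolding path_map_def by (simp add: Bcontfun_inverse)
qed

lemma path_map_in_paths:
  assumes "x \<in> paths" "continuous_on D f" "range (apply_bcontfun x) \<subseteq> D"
  shows "path_map f x \<in> paths"
proof -
  have "apply_bcontfun x t = apply_bcontfun x (clamp 0 1 t)" for t using assms(1) unfolding paths_def by blast
  then show ?thesis unfolding paths_def apply_path_map[OF assms] mem_Collect_eq by metis
qed

lemma absolutely_continuous_01_lipschitz:
  assumes ac: "absolutely_continuous_01 x" and c: "0 < c" "\<And>s t. dist (y s) (y t) \<le> c * dist (x s) (x t)"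
  shows "absolutely_continuous_01 y"
  unfolding absolutely_continuous_01_def
proof (intro allI impI)
  fix \<epsilon> :: real assume "0 < \<epsilon>"
  then have "0 < \<epsilon> / c" using c by simp
  then obtain \<delta> where d: "\<delta> > 0" "\<forall>P. finite P \<and> (\<forall>(s, t)\<in>P. 0 \<le> s \<and> s \<le> t \<and> t \<le> 1) \<and>
      disjoint_family_on (\<lambda>(s, t). {s<..<t}) P \<and> (\<Sum>(s, t)\<in>P. t - s) < \<delta> \<longrightarrow>
      (\<Sum>(s, t)\<in>P. dist (x s) (x t)) < \<epsilon> / c"
    using ac unfolding absolutely_continuous_01_def by blast
  have le: "(\<Sum>(s, t)\<in>P. dist (y s) (y t)) \<le> c * (\<Sum>(s, t)\<in>P. dist (x s) (x t))" for P
    unfolding sum_distrib_left by (rule sum_mono) (use c in auto)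
  have iff: "(\<Sum>(s, t)\<in>P. dist (x s) (x t)) < \<epsilon> / c \<longleftrightarrow> c * (\<Sum>(s, t)\<in>P. dist (x s) (x t)) < \<epsilon>" for P
    using c by (simp add: field_simps)
  show "\<exists>\<delta>>0. \<forall>P. finite P \<and> (\<forall>(s, t)\<in>P. 0 \<le> s \<and> s \<le> t \<and> t \<le> 1) \<and>
      disjoint_family_on (\<lambda>(s, t). {s<..<t}) P \<and> (\<Sum>(s, t)\<in>P. t - s) < \<delta> \<longrightarrow>
      (\<Sum>(s, t)\<in>P. dist (y s) (y t)) < \<epsilon>"
    using d le unfolding iff by (intro exI[of _ \<delta>]) (meson le_less_trans)
qed

lemma L1_01_path_deriv: "x \<in> ac_paths \<Longrightarrow> L1_01 (\<lambda>t. path_deriv x t $ i)"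
  by (simp add: L1_01_def borel_measurable_path_deriv path_deriv_integrable)

lemma norm1_path_deriv: "x \<in> ac_paths \<Longrightarrow> norm1 (\<lambda>t. path_deriv x t $ i) \<le> one_var x"
  unfolding norm1_def by (rule path_deriv_le_one_var(3))

lemma one_var_nonneg: "0 \<le> one_var x"
proof -
  have "0 \<le> (LBINT s:{0..1}. norm (path_deriv x s))"
    unfolding set_lebesgue_integral_def by (rule integral_nonneg_AE) auto
  then show ?thesis by (simp add: one_var_def)
qed

lemma path_increment_le_one_var:
  assumes x: "x \<in> ac_paths" and st: "0 \<le> s" "s \<le> t" "t \<le> 1"
  shows "norm (apply_bcontfun x t - apply_bcontfun (x :: 'd::finite curve) s) \<le> real CARD('d) * one_var x"
proof -
  have "norm (apply_bcontfun x t - apply_bcontfun x s) \<le> (\<Sum>i\<in>UNIV. \<bar>(apply_bcontfun x t - apply_bcontfun x s) $ i\<bar>)"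
    by (rule norm_le_l1_cart)
  also have "\<dots> \<le> (\<Sum>i\<in>(UNIV :: 'd set). one_var x)"
  proof (rule sum_mono)
    fix i
    have "\<bar>(apply_bcontfun x t - apply_bcontfun x s) $ i\<bar> = \<bar>LBINT u:{s..t}. path_deriv x u $ i\<bar>"
      by (simp add: path_deriv_ftc[OF x st])
    also have "\<dots> \<le> norm1 (\<lambda>t. path_deriv x t $ i)"
      by (rule abs_integral_le_norm1[OF L1_01_path_deriv[OF x] st(1,3)])
    also have "\<dots> \<le> one_var x" by (rule norm1_path_deriv[OF x])
    finally show "\<bar>(apply_bcontfun x t - apply_bcontfun x s) $ i\<bar> \<le> one_var x" .
  qed
  finally show ?thesis by simp
qed

lemma has_vector_derivative_tendsto:
  fixes x :: "real \<Rightarrow> 'a::real_normed_vector"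
  assumes "(x has_vector_derivative u) (at t)"
  shows "((\<lambda>s. (x s - x t) /\<^sub>R (s - t)) \<longlongrightarrow> u) (at t)"
proof -
  have "((\<lambda>s. norm (x s - x t - (s - t) *\<^sub>R u) / norm (s - t)) \<longlongrightarrow> 0) (at t)"
    using assms by (simp add: has_vector_derivative_def has_derivative_iff_norm)
  moreover have "\<forall>\<^sub>F s in at t. norm (x s - x t - (s - t) *\<^sub>R u) / norm (s - t) = norm ((x s - x t) /\<^sub>R (s - t) - u)"
    unfolding eventually_at_filter
  proof (intro always_eventually allI impI)
    fix s assume "s \<noteq> t"
    then have "(x s - x t) /\<^sub>R (s - t) - u = (x s - x t - (s - t) *\<^sub>R u) /\<^sub>R (s - t)"
      by (simp add: scaleR_diff_right)
    then show "norm (x s - x t - (s - t) *\<^sub>R u) / norm (s - t) = norm ((x s - x t) /\<^sub>R (s - t) - u)"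
      by (simp add: divide_inverse_commute)
  qed
  ultimately have "((\<lambda>s. norm ((x s - x t) /\<^sub>R (s - t) - u)) \<longlongrightarrow> 0) (at t)"
    by (rule Lim_transform_eventually)
  then show ?thesis by (simp add: tendsto_norm_zero_iff LIM_zero_iff)
qed

lemma norm_vector_derivative_le:
  fixes x y :: "real \<Rightarrow> 'a::real_normed_vector"
  assumes y: "(y has_vector_derivative v) (at t)" and x: "(x has_vector_derivative u) (at t)"
    and le: "\<And>s. norm (y s - y t) \<le> c * norm (x s - x t)"
  shows "norm v \<le> c * norm u"
proof -
  have lim: "((\<lambda>s. (x s - x t) /\<^sub>R (s - t)) \<longlongrightarrow> u) (at t)" "((\<lambda>s. (y s - y t) /\<^sub>R (s - t)) \<longlongrightarrow> v) (at t)"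
    using x y by (simp_all add: has_vector_derivative_tendsto)
  show ?thesis
  proof (rule tendsto_le[of "at t"])
    show "((\<lambda>s. c * norm ((x s - x t) /\<^sub>R (s - t))) \<longlongrightarrow> c * norm u) (at t)"
      "((\<lambda>s. norm ((y s - y t) /\<^sub>R (s - t))) \<longlongrightarrow> norm v) (at t)"
      by (intro tendsto_intros lim)+
    show "\<forall>\<^sub>F s in at t. norm ((y s - y t) /\<^sub>R (s - t)) \<le> c * norm ((x s - x t) /\<^sub>R (s - t))"
    proof (intro always_eventually allI)
      fix s
      show "norm ((y s - y t) /\<^sub>R (s - t)) \<le> c * norm ((x s - x t) /\<^sub>R (s - t))"
        using mult_left_mono[OF le[of s], of "inverse \<bar>s - t\<bar>"] by (simp add: mult_ac)
    qed
  qed simp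
qed

lemma ac_path_map:
  assumes x: "x \<in> ac_paths" and c: "\<And>u v. norm (f u - f v) \<le> c * norm (u - v)"
  shows "path_map f x \<in> ac_paths"
    and "AE t in lborel. t \<in> {0..1} \<longrightarrow> norm (path_deriv (path_map f x) t) \<le> c * norm (path_deriv x t)"
proof -
  have xp: "x \<in> paths" using x by (simp add: ac_paths_def)
  \<comment> \<open>The Lipschitz constant \<open>c\<close> carries no sign condition; the maximum
    with 1 makes it positive for the transfer of absolute continuity. The derivative bound keeps
    \<open>c\<close> itself.\<close>
  have c': "norm (f u - f v) \<le> max c 1 * norm (u - v)" for u v
    using c[of u v] mult_right_mono[of c "max c 1" "norm (u - v)"] by auto
  have cont: "continuous_on UNIV f"
    by (rule lipschitz_on_continuous_on[of "max c 1"])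
       (use c' in \<open>auto simp: lipschitz_on_def dist_norm\<close>)
  note ap = apply_path_map[OF xp cont subset_UNIV]
  show y: "path_map f x \<in> ac_paths"
  proof -
    have "absolutely_continuous_01 (apply_bcontfun (path_map f x))"
      by (rule absolutely_continuous_01_lipschitz[of "apply_bcontfun x" "max c 1"])
         (use x c' in \<open>auto simp: ap dist_norm ac_paths_def\<close>)
    then show ?thesis using path_map_in_paths[OF xp cont subset_UNIV] by (simp add: ac_paths_def)
  qed
  show "AE t in lborel. t \<in> {0..1} \<longrightarrow> norm (path_deriv (path_map f x) t) \<le> c * norm (path_deriv x t)"
    using ac_path_AE_derivative[OF x] ac_path_AE_derivative[OF y] AE_not_endpoints
  proof eventually_elim
    case (elim t)
    show ?case
    proof
      assume "t \<in> {0..1}"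
      then have t: "0 < t \<and> t < 1" using elim(3) by auto
      show "norm (path_deriv (path_map f x) t) \<le> c * norm (path_deriv x t)"
      proof (rule norm_vector_derivative_le)
        show "(apply_bcontfun (path_map f x) has_vector_derivative path_deriv (path_map f x) t) (at t)"
          "(apply_bcontfun x has_vector_derivative path_deriv x t) (at t)"
          using elim(1,2) t by blast+
        show "norm (apply_bcontfun (path_map f x) s - apply_bcontfun (path_map f x) t)
          \<le> c * norm (apply_bcontfun x s - apply_bcontfun x t)" for s
          unfolding ap by (rule c)
      qed
    qed
  qed
qed

lemma sig_eq_simplex_int:
  "x \<in> ac_paths \<Longrightarrow> sig w x = simplex_int (map (\<lambda>i t. path_deriv x t $ i) w) 0"
  by (simp add: sig_def iter_int_eq_simplex_int)

text \<open>The letters \<open>z i\<close> are replaced by \<open>x i\<close> one at a time, and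
  \<open>p\<close> collects the letters already treated. Each replacement changes the integral by
  that of a word containing one letter \<open>y i\<close>, which costs \<rho>, while all other
  letters cost at most \<open>N\<close>.\<close>

lemma simplex_int_telescope:
  assumes p: "\<And>b. b \<in> set p \<Longrightarrow> L1_01 b \<and> norm1 b \<le> N" and x: "\<And>i. L1_01 (x i) \<and> norm1 (x i) \<le> N"
    and z: "\<And>i. L1_01 (z i) \<and> norm1 (z i) \<le> N" and y: "\<And>i. L1_01 (y i)"
    and ae: "\<And>i. AE t in lborel. t \<in> {0..1} \<longrightarrow> z i t = x i t + y i t"
    and osc: "\<And>i s t. 0 \<le> s \<Longrightarrow> s \<le> t \<Longrightarrow> t \<le> 1 \<Longrightarrow> \<bar>LBINT u:{s..t}. y i u\<bar> \<le> \<rho>"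
    and s: "s \<in> {0..1}"
  shows "\<bar>simplex_int (p @ map z w) s - simplex_int (p @ map x w) s\<bar>
    \<le> real (length w) * \<rho> * N ^ (length p + length w - 1)"
  using p
proof (induction w arbitrary: p)
  case (Cons i w)
  have N: "0 \<le> N" using x[of i] norm1_nonneg[of "x i"] by linarith
  have \<rho>: "0 \<le> \<rho>" using osc[of 0 0 i] by linarith
  have prod: "prod_list (map norm1 q) \<le> N ^ length q" if "\<And>b. b \<in> set q \<Longrightarrow> norm1 b \<le> N" for q
    using that
  proof (induction q)
    case (Cons b q)
    have "0 \<le> prod_list (map norm1 q)" by (rule prod_list_nonneg) (auto simp: norm1_nonneg)
    then show ?case using Cons N norm1_nonneg[of b] by (auto intro!: mult_mono)
  qed simp
  have L: "\<And>b. b \<in> set p \<union> set (map z w) \<Longrightarrow> L1_01 b" using Cons.prems z by auto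
  have "simplex_int (p @ map z (i # w)) s = simplex_int (p @ (\<lambda>t. \<Sum>k\<in>{True, False}. 1 * (if k then x i else y i) t) # map z w) s"
  proof (rule simplex_int_cong_AE[OF _ s])
    have "L1_01 (\<lambda>t. \<Sum>k\<in>{True, False}. 1 * (if k then x i else y i) t)"
      by (rule L1_01_sum) (use x y in auto)
    then show "list_all2 (\<lambda>a b. L1_01 a \<and> L1_01 b \<and> (AE t in lborel. t \<in> {0..1} \<longrightarrow> a t = b t))
      (p @ map z (i # w)) (p @ (\<lambda>t. \<Sum>k\<in>{True, False}. 1 * (if k then x i else y i) t) # map z w)"
      using L z[of i] ae[of i] by (auto simp: list_all2_same intro!: list_all2_appendI)
  qed
  also have "\<dots> = simplex_int (p @ x i # map z w) s + simplex_int (p @ y i # map z w) s"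
    by (subst simplex_int_linear) (use L x y s in auto)
  finally have 1: "simplex_int (p @ map z (i # w)) s - simplex_int (p @ x i # map z w) s = simplex_int (p @ y i # map z w) s"
    by simp
  have "\<bar>simplex_int (p @ y i # map z w) s\<bar> \<le> \<rho> * prod_list (map norm1 (p @ map z w))"
    by (rule simplex_int_oscillation[OF L y osc s])
  also have "\<dots> \<le> \<rho> * N ^ length (p @ map z w)"
    by (rule mult_left_mono[OF prod \<rho>]) (use Cons.prems z in auto)
  finally have 2: "\<bar>simplex_int (p @ y i # map z w) s\<bar> \<le> \<rho> * N ^ (length p + length w)" by simp
  have "\<bar>simplex_int ((p @ [x i]) @ map z w) s - simplex_int ((p @ [x i]) @ map x w) s\<bar>
    \<le> real (length w) * \<rho> * N ^ (length (p @ [x i]) + length w - 1)"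
    by (rule Cons.IH) (use Cons.prems x in auto)
  then have 3: "\<bar>simplex_int (p @ x i # map z w) s - simplex_int (p @ map x (i # w)) s\<bar>
    \<le> real (length w) * \<rho> * N ^ (length p + length w)" by simp
  have "\<bar>simplex_int (p @ map z (i # w)) s - simplex_int (p @ map x (i # w)) s\<bar>
     \<le> \<rho> * N ^ (length p + length w) + real (length w) * \<rho> * N ^ (length p + length w)"
    using 1 2 3 by linarith
  then show ?case by (simp add: algebra_simps)
qed simp

text \<open>With \<open>L\<close> the 1-variation, the Hoelder bound makes the oscillation of
  \<open>R(x)\<close> of order \<open>L powr \<gamma>\<close>, and each of the at most two other
  letters contributes at most \<open>2 * L\<close>. The factor 12 is \<open>3 * 2 ^ 2\<close>: three
  letters to replace, two factors 2.\<close>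

lemma sig_perturbation:
  fixes x :: "'d::finite curve"
  assumes x: "x \<in> ac_paths" and lip: "\<And>u v. norm (R u - R v) \<le> norm (u - v)"
    and hoelder: "\<And>u v. norm (R u - R v) \<le> H * norm (u - v) powr \<gamma>"
    and H: "0 \<le> H" and \<gamma>: "0 \<le> \<gamma>" "\<gamma> \<le> 1"
    and w: "length w \<in> {2, 3}"
  shows "\<bar>sig w (path_map (\<lambda>u. u + R u) x) - sig w x\<bar>
    \<le> 12 * real CARD('d) * H * (1 + one_var x powr (2 + \<gamma>))"
proof -
  define L where "L = one_var x"
  have L0: "0 \<le> L" by (simp add: L_def one_var_nonneg)
  have xp: "x \<in> paths" using x by (simp add: ac_paths_def)
  have zl: "norm ((u + R u) - (v + R v)) \<le> 2 * norm (u - v)" for u v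
    using norm_triangle_ineq[of "u - v" "R u - R v"] lip[of u v] by (simp add: algebra_simps)
  have Rc: "continuous_on UNIV R"
    by (rule lipschitz_on_continuous_on[of 1]) (use lip in \<open>auto simp: lipschitz_on_def dist_norm\<close>)
  define y where "y = path_map R x"
  define z where "z = path_map (\<lambda>u. u + R u) x"
  have y: "y \<in> ac_paths" unfolding y_def by (rule ac_path_map(1)[OF x, of R 1]) (simp add: lip)
  have z: "z \<in> ac_paths" unfolding z_def by (rule ac_path_map(1)[OF x zl])
  have ay: "apply_bcontfun y t = R (apply_bcontfun x t)" for t
    unfolding y_def by (rule apply_path_map[OF xp Rc subset_UNIV])
  have az: "apply_bcontfun z t = apply_bcontfun x t + R (apply_bcontfun x t)" for t
    unfolding z_def by (rule apply_path_map[OF xp _ subset_UNIV]) (intro continuous_intros Rc)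
  have zeq: "apply_bcontfun z = (\<lambda>t. apply_bcontfun x t + apply_bcontfun y t)" by (auto simp: ay az)
  have ae: "AE t in lborel. t \<in> {0..1} \<longrightarrow> path_deriv z t $ i = path_deriv x t $ i + path_deriv y t $ i" for i
    using ac_path_AE_derivative[OF x] ac_path_AE_derivative[OF y] ac_path_AE_derivative[OF z] AE_not_endpoints
  proof eventually_elim
    case (elim t)
    show ?case
    proof
      assume "t \<in> {0..1}"
      then have t: "0 < t \<and> t < 1" using elim by auto
      have "(apply_bcontfun z has_vector_derivative (path_deriv x t + path_deriv y t)) (at t)"
        using has_vector_derivative_add[OF elim(1)[rule_format, OF t] elim(2)[rule_format, OF t]]
        by (simp add: zeq)
      then have "path_deriv z t = path_deriv x t + path_deriv y t"
        using elim(3) t vector_derivative_unique_at by blast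
      then show "path_deriv z t $ i = path_deriv x t $ i + path_deriv y t $ i" by simp
    qed
  qed
  have nz: "norm1 (\<lambda>t. path_deriv z t $ i) \<le> 2 * L" for i
  proof -
    have ae2: "AE t in lborel. t \<in> {0..1} \<longrightarrow> \<bar>path_deriv z t $ i\<bar> \<le> 2 * norm (path_deriv x t)"
      using ac_path_map(2)[OF x zl, folded z_def]
      by eventually_elim (use component_le_norm_cart order_trans in blast)
    have "norm1 (\<lambda>t. path_deriv z t $ i) \<le> (LBINT t:{0..1}. 2 * norm (path_deriv x t))"
      unfolding norm1_def
      by (rule set_integral_mono_AE)
         (use ae2 path_deriv_le_one_var(1)[OF x] path_deriv_integrable[OF z] in \<open>auto intro: set_integrable_abs\<close>)
    also have "\<dots> \<le> 2 * L" using path_deriv_le_one_var(2)[OF x] by (simp add: L_def)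
    finally show ?thesis .
  qed
  define \<rho> where "\<rho> = H * (real CARD('d) * L powr \<gamma>)"
  have osc: "\<bar>LBINT u:{s..t}. path_deriv y u $ i\<bar> \<le> \<rho>" if st: "0 \<le> s" "s \<le> t" "t \<le> 1" for i s t
  proof -
    have "\<bar>LBINT u:{s..t}. path_deriv y u $ i\<bar> = \<bar>(R (apply_bcontfun x t) - R (apply_bcontfun x s)) $ i\<bar>"
      by (simp add: path_deriv_ftc[OF y st] ay)
    also have "\<dots> \<le> norm (R (apply_bcontfun x t) - R (apply_bcontfun x s))" by (rule component_le_norm_cart)
    also have "\<dots> \<le> H * norm (apply_bcontfun x t - apply_bcontfun x s) powr \<gamma>" by (rule hoelder)
    also have "\<dots> \<le> H * (real CARD('d) * L) powr \<gamma>"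
      by (intro mult_left_mono powr_mono2 H \<gamma>) (use path_increment_le_one_var[OF x st] in \<open>auto simp: L_def\<close>)
    also have "(real CARD('d) * L) powr \<gamma> = real CARD('d) powr \<gamma> * L powr \<gamma>"
      using L0 by (simp add: powr_mult)
    also have "real CARD('d) powr \<gamma> \<le> real CARD('d) powr 1"
      using \<gamma> by (intro powr_mono) (auto simp: Suc_leI)
    finally show ?thesis unfolding \<rho>_def using H by (simp add: mult_left_mono mult_right_mono)
  qed
  have \<rho>0: "0 \<le> \<rho>" unfolding \<rho>_def using H by simp
  have main: "\<bar>sig w z - sig w x\<bar> \<le> real (length w) * \<rho> * (2 * L) ^ (length w - 1)"
  proof -
    have nx: "norm1 (\<lambda>t. path_deriv x t $ i) \<le> 2 * L" for i
      using norm1_path_deriv[OF x, of i] L0 unfolding L_def by linarith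
    have "\<bar>simplex_int ([] @ map (\<lambda>i t. path_deriv z t $ i) w) 0 - simplex_int ([] @ map (\<lambda>i t. path_deriv x t $ i) w) 0\<bar>
      \<le> real (length w) * \<rho> * (2 * L) ^ (length ([] :: (real \<Rightarrow> real) list) + length w - 1)"
      by (rule simplex_int_telescope[where y = "\<lambda>i t. path_deriv y t $ i"])
         (simp_all only: nx nz ae[unfolded atLeastAtMost_iff] osc L1_01_path_deriv[OF x] L1_01_path_deriv[OF y] L1_01_path_deriv[OF z]
           simp_thms list.set empty_iff atLeastAtMost_iff order_refl zero_le_one)
    then show ?thesis unfolding sig_eq_simplex_int[OF x] sig_eq_simplex_int[OF z] by simp
  qed
  \<comment> \<open>Words of length 2 and 3 produce different powers of \<open>L\<close>. The
    summand 1 takes care of \<open>L \<le> 1\<close>; above 1 the larger power dominates.\<close>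
  have pw: "L powr \<gamma> * L ^ n \<le> 1 + L powr (2 + \<gamma>)" if "n \<in> {1, 2}" for n
  proof (cases "L \<le> 1")
    case True
    have "L powr \<gamma> \<le> 1" using True L0 \<gamma> by (simp add: powr_le1)
    moreover have "L ^ n \<le> 1" using True L0 by (rule power_le_one[rotated])
    ultimately have "L powr \<gamma> * L ^ n \<le> 1 * 1" using L0 by (intro mult_mono) auto
    then show ?thesis using powr_ge_zero[of L "2 + \<gamma>"] by linarith
  next
    case False
    have "L ^ n \<le> L ^ 2" using that False by (intro power_increasing) auto
    then have "L powr \<gamma> * L ^ n \<le> L powr \<gamma> * L ^ 2" by (intro mult_left_mono) auto
    also have "\<dots> = L powr (2 + \<gamma>)" using False by (simp add: powr_add powr_numeral mult.commute)
    finally show ?thesis by simp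
  qed
  have "real (length w) * \<rho> * (2 * L) ^ (length w - 1) =
     real (length w) * 2 ^ (length w - 1) * real CARD('d) * H * (L powr \<gamma> * L ^ (length w - 1))"
    by (simp add: \<rho>_def power_mult_distrib)
  also have "\<dots> \<le> 12 * real CARD('d) * H * (1 + L powr (2 + \<gamma>))"
    using w by (intro mult_mono pw) (auto simp: H L0)
  finally show ?thesis using main by (simp add: z_def L_def)
qed

section \<open>Linear images of signature moments\<close>

text \<open>The tensor power of \<open>A\<close>, one copy for each letter of the word, acting on
  the functional \<open>m\<close>. The recursion on the word lets the multilinear expansion of an
  iterated integral proceed letter by letter.\<close>

primrec lin_mom :: "real^'d^'d \<Rightarrow> ('d list \<Rightarrow> real) \<Rightarrow> ('d::finite) list \<Rightarrow> real" where
  "lin_mom A m [] = m []"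
| "lin_mom A m (i # w) = (\<Sum>k\<in>UNIV. A $ i $ k * lin_mom A (\<lambda>v. m (k # v)) w)"

lemma lin_mom_diff_le:
  fixes A :: "real^'d^'d::finite"
  assumes "\<And>i. (\<Sum>k\<in>UNIV. \<bar>A $ i $ k\<bar>) \<le> a" "\<And>v. length v = length w \<Longrightarrow> \<bar>m v - m' v\<bar> \<le> \<eta>"
  shows "\<bar>lin_mom A m w - lin_mom A m' w\<bar> \<le> a ^ length w * \<eta>"
  using assms(2)
proof (induction w arbitrary: m m')
  case (Cons i w)
  have le: "\<bar>lin_mom A (\<lambda>v. m (k # v)) w - lin_mom A (\<lambda>v. m' (k # v)) w\<bar> \<le> a ^ length w * \<eta>" for k
    by (rule Cons.IH) (use Cons.prems in auto)
  then have nn: "0 \<le> a ^ length w * \<eta>" using abs_ge_zero order_trans by blast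
  have "\<bar>lin_mom A m (i # w) - lin_mom A m' (i # w)\<bar> =
     \<bar>\<Sum>k\<in>UNIV. A $ i $ k * (lin_mom A (\<lambda>v. m (k # v)) w - lin_mom A (\<lambda>v. m' (k # v)) w)\<bar>"
    by (simp add: sum_subtractf[symmetric] algebra_simps)
  also have "\<dots> \<le> (\<Sum>k\<in>UNIV. \<bar>A $ i $ k\<bar> * (a ^ length w * \<eta>))"
    by (rule order_trans[OF sum_abs sum_mono]) (simp add: abs_mult mult_left_mono le)
  also have "\<dots> \<le> a * (a ^ length w * \<eta>)"
    unfolding sum_distrib_right[symmetric] using assms(1) nn by (intro mult_right_mono) auto
  finally show ?case by (simp add: mult.assoc)
qed simp

lemma
  assumes "\<And>v. length v = length w \<Longrightarrow> integrable M (\<lambda>x. F v x)"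
  shows integrable_lin_mom: "integrable M (\<lambda>x. lin_mom A (\<lambda>v. F v x) w)"
    and integral_lin_mom: "(\<integral>x. lin_mom A (\<lambda>v. F v x) w \<partial>M) = lin_mom A (\<lambda>v. \<integral>x. F v x \<partial>M) w"
proof -
  have "integrable M (\<lambda>x. lin_mom A (\<lambda>v. F v x) w) \<and>
    (\<integral>x. lin_mom A (\<lambda>v. F v x) w \<partial>M) = lin_mom A (\<lambda>v. \<integral>x. F v x \<partial>M) w"
    using assms
  proof (induction w arbitrary: F)
    case (Cons i w)
    have "integrable M (\<lambda>x. lin_mom A (\<lambda>v. F (k # v) x) w) \<and>
      (\<integral>x. lin_mom A (\<lambda>v. F (k # v) x) w \<partial>M) = lin_mom A (\<lambda>v. \<integral>x. F (k # v) x \<partial>M) w" for k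
      by (rule Cons.IH) (use Cons.prems in auto)
    then show ?case by (simp add: Bochner_Integration.integral_sum)
  qed simp
  then show "integrable M (\<lambda>x. lin_mom A (\<lambda>v. F v x) w)"
    "(\<integral>x. lin_mom A (\<lambda>v. F v x) w \<partial>M) = lin_mom A (\<lambda>v. \<integral>x. F v x \<partial>M) w" by auto
qed

lemma matrix_vector_mult_lipschitz:
  fixes A :: "real^'d^'d::finite"
  shows "norm (A *v u - A *v v) \<le> onorm ((*v) A) * norm (u - v)"
  unfolding matrix_vector_mult_diff_distrib[symmetric]
  by (rule onorm) simp

text \<open>Almost everywhere the derivative of the image path is \<open>A\<close> applied to the
  derivative of \<open>x\<close>. The induction carries a prefix \<open>p\<close> of letters already
  expressed through \<open>x\<close>, because linearity is available at one position of the word at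
  a time.\<close>

lemma sig_linear:
  assumes x: "x \<in> ac_paths"
  shows "sig w (path_map ((*v) A) x) = lin_mom A (\<lambda>v. sig v x) w"
proof -
  define y where "y = path_map ((*v) A) x"
  have y: "y \<in> ac_paths" unfolding y_def by (rule ac_path_map(1)[OF x matrix_vector_mult_lipschitz])
  have yeq: "apply_bcontfun y = (\<lambda>t. A *v apply_bcontfun x t)"
    unfolding y_def using x by (intro ext apply_path_map[of _ UNIV]) (auto simp: ac_paths_def intro: linear_continuous_on)
  have ae: "AE t in lborel. t \<in> {0..1} \<longrightarrow> path_deriv y t $ i = (\<Sum>k\<in>UNIV. A $ i $ k * path_deriv x t $ k)" for i
    using ac_path_AE_derivative[OF x] ac_path_AE_derivative[OF y] AE_not_endpoints
  proof eventually_elim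
    case (elim t)
    show ?case
    proof
      assume "t \<in> {0..1}"
      then have t: "0 < t \<and> t < 1" using elim(3) by auto
      have "(apply_bcontfun y has_vector_derivative A *v path_deriv x t) (at t)"
        unfolding yeq
        by (rule bounded_linear.has_vector_derivative) (use elim(1) t in auto)
      then have "path_deriv y t = A *v path_deriv x t"
        using elim(2) t vector_derivative_unique_at by blast
      then show "path_deriv y t $ i = (\<Sum>k\<in>UNIV. A $ i $ k * path_deriv x t $ k)"
        by (simp add: matrix_vector_mult_def)
    qed
  qed
  let ?x = "\<lambda>i t. path_deriv x t $ i" and ?y = "\<lambda>i t. path_deriv y t $ i"
  have "simplex_int (map ?x p @ map ?y w) 0 = lin_mom A (\<lambda>v. simplex_int (map ?x (p @ v)) 0) w" for p
  proof (induction w arbitrary: p)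
    case (Cons i w)
    have "simplex_int (map ?x p @ map ?y (i # w)) 0 =
        simplex_int (map ?x p @ (\<lambda>t. \<Sum>k\<in>UNIV. A $ i $ k * path_deriv x t $ k) # map ?y w) 0"
    proof (rule simplex_int_cong_AE)
      have "L1_01 (\<lambda>t. \<Sum>k\<in>UNIV. A $ i $ k * path_deriv x t $ k)"
        by (rule L1_01_sum) (rule L1_01_path_deriv[OF x])
      then show "list_all2 (\<lambda>a b. L1_01 a \<and> L1_01 b \<and> (AE t in lborel. t \<in> {0..1} \<longrightarrow> a t = b t))
        (map ?x p @ map ?y (i # w)) (map ?x p @ (\<lambda>t. \<Sum>k\<in>UNIV. A $ i $ k * path_deriv x t $ k) # map ?y w)"
        using ae[of i] L1_01_path_deriv[OF x] L1_01_path_deriv[OF y]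
        by (auto simp: list_all2_same intro!: list_all2_appendI)
    qed simp
    also have "\<dots> = (\<Sum>k\<in>UNIV. A $ i $ k * simplex_int (map ?x p @ ?x k # map ?y w) 0)"
      by (rule simplex_int_linear) (use L1_01_path_deriv[OF x] L1_01_path_deriv[OF y] in auto)
    also have "\<dots> = (\<Sum>k\<in>UNIV. A $ i $ k * lin_mom A (\<lambda>v. simplex_int (map ?x (p @ k # v)) 0) w)"
    proof (rule sum.cong[OF refl])
      fix k
      show "A $ i $ k * simplex_int (map ?x p @ ?x k # map ?y w) 0
        = A $ i $ k * lin_mom A (\<lambda>v. simplex_int (map ?x (p @ k # v)) 0) w"
        using Cons.IH[of "p @ [k]"] by simp
    qed
    finally show ?case by simp
  qed simp
  from this[of "[]"] show ?thesis
    unfolding y_def[symmetric] by (simp add: sig_eq_simplex_int[OF x] sig_eq_simplex_int[OF y])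
qed

section \<open>Push-forward of laws\<close>

lemma continuous_on_eval: "continuous_on S (\<lambda>x. apply_bcontfun x t)"
proof -
  have "\<forall>x\<in>S. \<forall>e>0. \<exists>d>0. \<forall>x'\<in>S. dist x' x < d \<longrightarrow> dist (apply_bcontfun x' t) (apply_bcontfun x t) < e"
    using dist_fun_lt_imp_dist_val_lt by blast
  then show ?thesis by (simp add: continuous_on_iff)
qed

lemma closed_paths: "closed (paths :: 'd::finite curve set)"
proof -
  have "(paths :: 'd curve set) = (\<Inter>t. {x. apply_bcontfun x t = apply_bcontfun x (clamp 0 1 t)})"
    by (auto simp: paths_def)
  moreover have "closed (\<Inter>t. {x :: 'd curve. apply_bcontfun x t = apply_bcontfun x (clamp 0 1 t)})"
    by (intro closed_INT ballI closed_Collect_eq continuous_on_eval)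
  ultimately show ?thesis by (simp only:)
qed

lemma space_path_space [simp]: "space path_space = paths"
  by (simp add: path_space_def space_restrict_space)

lemma measurable_eval: "(\<lambda>x. apply_bcontfun x t) \<in> borel_measurable path_space"
  unfolding path_space_def
  by (intro measurable_restrict_space1 borel_measurable_continuous_onI continuous_on_eval)

lemma closed_spatial_supp: "closed (spatial_supp \<mu>)"
  by (simp add: spatial_supp_def)

text \<open>The map inside \<open>pushforward\<close>, with the spatial support replaced by an
  arbitrary set \<open>D\<close>; for its measurability only closedness of \<open>D\<close> and
  continuity of \<open>f\<close> on \<open>D\<close> matter.\<close>

definition image_path :: "(real^'d \<Rightarrow> real^'d) \<Rightarrow> (real^'d) set \<Rightarrow> ('d::finite) curve \<Rightarrow> 'd curve" where
  "image_path f D x = (if range (apply_bcontfun x) \<subseteq> D then path_map f x else 0)"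

lemma pushforward_eq: "pushforward f \<mu> = distr \<mu> path_space (image_path f (spatial_supp \<mu>))"
  unfolding pushforward_def image_path_def[abs_def] path_map_def ..

text \<open>Paths within sup-distance 1 of \<open>x\<close> stay in a fixed ball, whose intersection
  with \<open>D\<close> is compact; there \<open>f\<close> is uniformly continuous.\<close>

lemma continuous_on_path_map:
  assumes D: "closed D" and f: "continuous_on D f"
  shows "continuous_on {x \<in> paths. range (apply_bcontfun x) \<subseteq> D} (path_map f)"
  unfolding continuous_on_iff
proof (intro ballI allI impI)
  fix x :: "'a curve" and e :: real
  assume x: "x \<in> {x \<in> paths. range (apply_bcontfun x) \<subseteq> D}" and e: "0 < e"
  let ?K = "D \<inter> cball 0 (norm x + 1)"
  have "compact ?K" using D by (simp add: closed_Int_compact)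
  then have "uniformly_continuous_on ?K f"
    using f by (intro compact_uniformly_continuous) (auto intro: continuous_on_subset)
  then obtain d where d: "0 < d" "\<And>u v. u \<in> ?K \<Longrightarrow> v \<in> ?K \<Longrightarrow> dist u v < d \<Longrightarrow> dist (f u) (f v) < e / 2"
    unfolding uniformly_continuous_on_def using e by (metis half_gt_zero)
  show "\<exists>d>0. \<forall>x'\<in>{x \<in> paths. range (apply_bcontfun x) \<subseteq> D}. dist x' x < d \<longrightarrow> dist (path_map f x') (path_map f x) < e"
  proof (intro exI[of _ "min d 1"] conjI ballI impI)
    fix y assume y: "y \<in> {x \<in> paths. range (apply_bcontfun x) \<subseteq> D}" and dy: "dist y x < min d 1"
    have "dist (path_map f y) (path_map f x) \<le> e / 2"
    proof (rule dist_bound)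
      fix t
      have xD: "range (apply_bcontfun x) \<subseteq> D" and yD: "range (apply_bcontfun y) \<subseteq> D" using x y by auto
      have xt: "norm (apply_bcontfun x t) \<le> norm x" by (rule norm_bounded)
      have dt: "dist (apply_bcontfun y t) (apply_bcontfun x t) < min d 1"
        using dist_fun_lt_imp_dist_val_lt[OF dy] .
      then have "norm (apply_bcontfun y t) \<le> norm x + 1"
        using xt norm_triangle_sub[of "apply_bcontfun y t" "apply_bcontfun x t"] by (simp add: dist_norm)
      then have "dist (f (apply_bcontfun y t)) (f (apply_bcontfun x t)) < e / 2"
        using xD yD xt dt by (intro d(2)) auto
      then show "dist (apply_bcontfun (path_map f y) t) (apply_bcontfun (path_map f x) t) \<le> e / 2"
        using x y by (simp add: apply_path_map[OF _ f])
    qed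
    then show "dist (path_map f y) (path_map f x) < e" using e by simp
  qed (use d in auto)
qed

lemma measurable_image_path:
  assumes D: "closed D" and f: "continuous_on D f"
  shows "image_path f D \<in> measurable path_space path_space"
proof -
  let ?S = "{x \<in> paths. range (apply_bcontfun x) \<subseteq> D}"
  have "?S = paths \<inter> (\<Inter>t. {x. apply_bcontfun x t \<in> D})" by auto
  moreover have "closed {x. apply_bcontfun x t \<in> D}" for t :: real
    using closed_vimage[OF D continuous_on_eval[of UNIV t]] by (simp add: vimage_def)
  then have "closed (paths \<inter> (\<Inter>t. {x. apply_bcontfun x t \<in> D}))"
    by (intro closed_Int closed_INT ballI closed_paths)
  ultimately have S: "closed ?S" by (simp only:)
  \<comment> \<open>The default value 0 for paths leaving \<open>D\<close> pays off here:
    \<open>image_path\<close> is the indicator of a closed set times a map continuous on that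
    set.\<close>
  have "(\<lambda>x. indicator ?S x *\<^sub>R path_map f x) \<in> borel_measurable borel"
    by (rule borel_measurable_continuous_on_indicator[OF borel_closed[OF S] continuous_on_path_map[OF D f]])
  then have "(\<lambda>x. indicator ?S x *\<^sub>R path_map f x) \<in> borel_measurable path_space"
    unfolding path_space_def by (rule measurable_restrict_space1)
  then have "image_path f D \<in> borel_measurable path_space"
    by (rule measurable_cong[THEN iffD1, rotated]) (auto simp: image_path_def indicator_def)
  moreover have "image_path f D x \<in> paths" if "x \<in> paths" for x
  proof (cases "range (apply_bcontfun x) \<subseteq> D")
    case True
    then show ?thesis using path_map_in_paths[OF \<open>x \<in> paths\<close> f] by (simp only: image_path_def if_True)
  next
    case False
    then show ?thesis by (simp only: image_path_def if_False) (simp add: paths_def)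
  qed
  ultimately show ?thesis
    by (subst (2) path_space_def, intro measurable_restrict_space2) auto
qed

lemma laws_prob: "\<mu> \<in> laws \<Longrightarrow> prob_space \<mu>" and laws_sets: "\<mu> \<in> laws \<Longrightarrow> sets \<mu> = sets path_space"
  by (auto simp: laws_def)

lemma laws_space: "\<mu> \<in> laws \<Longrightarrow> space \<mu> = paths"
  using sets_eq_imp_space_eq[OF laws_sets] by simp

lemma measurable_image_path_law:
  assumes "\<mu> \<in> laws" "continuous_on (spatial_supp \<mu>) f"
  shows "image_path f (spatial_supp \<mu>) \<in> measurable \<mu> path_space"
  using measurable_image_path[OF closed_spatial_supp assms(2)] measurable_cong_sets[OF laws_sets[OF assms(1)] refl]
  by blast

lemma pushforward_in_laws:
  assumes "\<mu> \<in> laws" "continuous_on (spatial_supp \<mu>) f"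
  shows "pushforward f \<mu> \<in> laws"
  unfolding pushforward_eq laws_def
  using prob_space.prob_space_distr[OF laws_prob[OF assms(1)] measurable_image_path_law[OF assms]] by simp

text \<open>The complement of the support is the union of all open null sets. By the Lindelof
  property countably many of them have the same union, which is therefore null.\<close>

lemma AE_in_measure_supp:
  fixes M :: "'a::second_countable_topology measure"
  assumes "sets M = sets borel"
  shows "AE z in M. z \<in> measure_supp M"
proof -
  let ?F = "{U. open U \<and> emeasure M U = 0}"
  obtain F' where F': "F' \<subseteq> ?F" "countable F'" "\<Union>F' = \<Union>?F"
    using Lindelof[of ?F] by auto
  have "\<Union>F' \<in> null_sets M"
    using F' assms by (intro null_sets_UN'[of F' id, simplified]) (auto simp: null_sets_def)
  moreover have "measure_supp M = - \<Union>?F" by (auto simp: measure_supp_def zero_less_iff_neq_zero)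
  ultimately show ?thesis using F'(3) by (auto intro!: AE_I'[of "\<Union>F'"])
qed

text \<open>Rational times suffice: the exceptional null sets are then countably many, and a
  continuous path that lies in a closed set at all rational times lies in it always. Clamping brings
  every time back to the unit interval, where the marginals enter
  \<open>spatial_supp\<close>.\<close>

lemma AE_range_subset_spatial_supp:
  assumes "\<mu> \<in> laws"
  shows "AE x in \<mu>. range (apply_bcontfun x) \<subseteq> spatial_supp \<mu>"
proof -
  have m: "(\<lambda>x. apply_bcontfun x t) \<in> measurable \<mu> borel" for t
    using measurable_eval measurable_cong_sets[OF laws_sets[OF assms] refl] by blast
  have "AE x in \<mu>. apply_bcontfun x t \<in> measure_supp (marginal \<mu> t)" for t
    using AE_in_measure_supp[of "marginal \<mu> t"] AE_distrD[OF m] unfolding marginal_def by simp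
  then have ae: "AE x in \<mu>. apply_bcontfun x (clamp 0 1 q) \<in> spatial_supp \<mu>" for q :: real
  proof (rule eventually_mono)
    fix x assume "apply_bcontfun x (clamp 0 1 q) \<in> measure_supp (marginal \<mu> (clamp 0 1 q))"
    moreover have "clamp 0 1 q \<in> {0..1}" unfolding clamp_real by auto
    ultimately show "apply_bcontfun x (clamp 0 1 q) \<in> spatial_supp \<mu>"
      unfolding spatial_supp_def by (intro subsetD[OF closure_subset] UN_I)
  qed
  have "AE x in \<mu>. \<forall>q\<in>\<rat>. apply_bcontfun x (clamp 0 1 q) \<in> spatial_supp \<mu>"
    by (rule AE_ball_countable'[OF ae countable_rat])
  then show ?thesis using AE_space
  proof eventually_elim
    case (elim x)
    have "x \<in> paths" using elim(2) laws_space[OF assms] by auto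
    then have q: "apply_bcontfun x ` \<rat> \<subseteq> spatial_supp \<mu>" using elim(1) by (auto simp: paths_def)
    have "apply_bcontfun x ` closure \<rat> \<subseteq> spatial_supp \<mu>"
      by (rule image_closure_subset[OF _ closed_spatial_supp q]) auto
    then show ?case by (simp add: Rats_closure_real)
  qed
qed

lemma AE_image_path:
  assumes "\<mu> \<in> laws"
  shows "AE x in \<mu>. image_path f (spatial_supp \<mu>) x = path_map f x"
  using AE_range_subset_spatial_supp[OF assms] by eventually_elim (simp add: image_path_def)

text \<open>Nothing is known about the measurability of \<open>F\<close> (below, a power of the 1-variation), so its
  \<open>nn_integral\<close> is a lower integral and not additive; only the measurable \<open>h\<close> may be integrated.\<close>

lemma nn_integral_affine_bound:
  assumes "prob_space M" and h: "h \<in> borel_measurable M" and c: "0 \<le> c"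
    and le: "AE x in M. 0 \<le> h x \<and> h x \<le> c * (1 + F x)"
    and K: "c = 0 \<or> (\<integral>\<^sup>+x. ennreal (F x) \<partial>M) \<le> ennreal K" "0 \<le> K"
  shows "(\<integral>\<^sup>+x. ennreal (h x) \<partial>M) \<le> ennreal (c * (1 + K))"
proof (cases "c = 0")
  case True
  have "(\<integral>\<^sup>+x. ennreal (h x) \<partial>M) \<le> (\<integral>\<^sup>+x. 0 \<partial>M)"
    by (rule nn_integral_mono_AE, use le in eventually_elim) (simp add: True)
  then show ?thesis by simp
next
  case False
  then have c0: "0 < c" using c by simp
  interpret prob_space M by fact
  \<comment> \<open>Measurable, and almost everywhere below the positive part of \<open>F\<close>,
    so its integral inherits the bound \<open>K\<close>; and \<open>h\<close> is at most
    \<open>c * (1 + u)\<close> everywhere.\<close>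
  define u where "u = (\<lambda>x. max 0 (h x / c - 1))"
  have um: "u \<in> borel_measurable M" unfolding u_def using h by measurable
  have "(\<integral>\<^sup>+x. ennreal (u x) \<partial>M) \<le> (\<integral>\<^sup>+x. ennreal (F x) \<partial>M)"
  proof (rule nn_integral_mono_AE, use le in eventually_elim)
    fix x assume "0 \<le> h x \<and> h x \<le> c * (1 + F x)"
    then have "h x / c \<le> 1 + F x" using c0 by (simp add: field_simps)
    then show "ennreal (u x) \<le> ennreal (F x)" by (cases "0 \<le> F x") (auto simp: u_def max_def ennreal_neg intro!: ennreal_leI)
  qed
  then have uK: "(\<integral>\<^sup>+x. ennreal (u x) \<partial>M) \<le> ennreal K" using K False by (auto intro: order_trans)
  have "(\<integral>\<^sup>+x. ennreal (h x) \<partial>M) \<le> (\<integral>\<^sup>+x. ennreal c * (1 + ennreal (u x)) \<partial>M)"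
  proof (rule nn_integral_mono)
    fix x
    have "h x \<le> c * (1 + u x)"
    proof -
      have "h x / c \<le> 1 + u x" by (simp add: u_def)
      then show ?thesis using c0 by (simp add: field_simps)
    qed
    moreover have "ennreal (c * (1 + u x)) = ennreal c * (1 + ennreal (u x))"
      using c by (simp add: u_def ennreal_mult)
    ultimately show "ennreal (h x) \<le> ennreal c * (1 + ennreal (u x))" by (metis ennreal_leI)
  qed
  also have "\<dots> = ennreal c * (1 + (\<integral>\<^sup>+x. ennreal (u x) \<partial>M))"
    using um by (subst nn_integral_cmult) (auto simp: nn_integral_add emeasure_space_1)
  also have "\<dots> \<le> ennreal c * (1 + ennreal K)" using uK by (intro mult_left_mono add_left_mono) auto
  also have "\<dots> = ennreal (c * (1 + K))" using c K by (simp add: ennreal_mult)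
  finally show ?thesis .
qed

text \<open>Pathwise, \<open>f\<close> acts as \<open>A\<close> after \<open>id + R\<close>: the
  linear part acts exactly on the signature by \<open>sig_linear\<close>, the perturbation costs at
  most a multiple of \<open>1 + one_var x powr (2 + \<gamma>)\<close>. The alternative
  \<open>H = 0\<close> admits linear maps of laws whose 1-variation has no such moment.\<close>

lemma pushforward_moments:
  fixes \<mu> :: "'d::finite law"
  assumes \<mu>: "\<mu> \<in> dot_laws"
    and A: "\<And>i. (\<Sum>k\<in>UNIV. \<bar>A $ i $ k\<bar>) \<le> a"
    and f: "\<And>u. f u = A *v (u + R u)"
    and lip: "\<And>u v. norm (R u - R v) \<le> norm (u - v)"
    and hoelder: "\<And>u v. norm (R u - R v) \<le> H * norm (u - v) powr \<gamma>"
    and H: "0 \<le> H" and \<gamma>: "0 \<le> \<gamma>" "\<gamma> \<le> 1"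
    and K: "H = 0 \<or> (\<integral>\<^sup>+x. ennreal (one_var x powr (2 + \<gamma>)) \<partial>\<mu>) \<le> ennreal K" "0 \<le> K"
  shows "pushforward f \<mu> \<in> ac_laws"
    and "length w \<in> {2, 3} \<Longrightarrow> integrable (pushforward f \<mu>) (sig w)"
    and "length w \<in> {2, 3} \<Longrightarrow>
      \<bar>esig (pushforward f \<mu>) w - lin_mom A (esig \<mu>) w\<bar> \<le> a ^ length w * (12 * real CARD('d) * H) * (1 + K)"
proof -
  have \<mu>l: "\<mu> \<in> laws" and ac1: "emeasure \<mu> ac_paths = 1"
    and int: "\<And>w. length w \<in> {2, 3} \<Longrightarrow> integrable \<mu> (sig w)"
    using \<mu> by (auto simp: dot_laws_def ac_laws_def)
  interpret prob_space \<mu> by (rule laws_prob[OF \<mu>l])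
  define g where "g = image_path f (spatial_supp \<mu>)"
  have Rc: "continuous_on UNIV R"
    by (rule lipschitz_on_continuous_on[of 1]) (use lip in \<open>auto simp: lipschitz_on_def dist_norm\<close>)
  have fc: "continuous_on S f" for S
    unfolding f by (intro continuous_intros continuous_on_subset[OF Rc] linear_continuous_on_compose[OF _ matrix_vector_mul_linear]) auto
  have zl: "norm ((u + R u) - (v + R v)) \<le> 2 * norm (u - v)" for u v
    using norm_triangle_ineq[of "u - v" "R u - R v"] lip[of u v] by (simp add: algebra_simps)
  have gm: "g \<in> measurable \<mu> path_space" unfolding g_def by (rule measurable_image_path_law[OF \<mu>l fc])
  have push: "pushforward f \<mu> = distr \<mu> path_space g" by (simp add: pushforward_eq g_def)
  \<comment> \<open>A set outside the sigma-algebra would have \<open>emeasure\<close> 0, so the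
    value 1 shows that \<open>ac_paths\<close> is measurable.\<close>
  have acs: "ac_paths \<in> sets \<mu>" using ac1 emeasure_notin_sets by fastforce
  have ae_ac: "AE x in \<mu>. x \<in> ac_paths" using AE_in_set_eq_1[OF acs] ac1 by (simp add: measure_def)
  have eq: "path_map f x = path_map ((*v) A) (path_map (\<lambda>u. u + R u) x)"
    and z: "path_map (\<lambda>u. u + R u) x \<in> ac_paths" if x: "x \<in> ac_paths" for x
  proof -
    show z: "path_map (\<lambda>u. u + R u) x \<in> ac_paths" by (rule ac_path_map(1)[OF x zl])
    have p: "x \<in> paths" "path_map (\<lambda>u. u + R u) x \<in> paths" using x z by (auto simp: ac_paths_def)
    show "path_map f x = path_map ((*v) A) (path_map (\<lambda>u. u + R u) x)"
      by (rule bcontfun_eqI)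
         (simp add: apply_path_map[OF p(1) fc subset_UNIV] apply_path_map[OF p(2) _ subset_UNIV]
           apply_path_map[OF p(1) continuous_on_add[OF continuous_on_id Rc] subset_UNIV] f linear_continuous_on)
  qed
  have ae_g: "AE x in \<mu>. x \<in> ac_paths \<and> g x = path_map ((*v) A) (path_map (\<lambda>u. u + R u) x)"
    using ae_ac AE_image_path[OF \<mu>l, of f] by eventually_elim (simp add: eq g_def)
  have gac: "AE x in \<mu>. g x \<in> ac_paths"
    using ae_g by eventually_elim (use ac_path_map(1)[OF z matrix_vector_mult_lipschitz] in auto)
  have pl: "pushforward f \<mu> \<in> laws" by (rule pushforward_in_laws[OF \<mu>l fc])
  have acs': "(ac_paths :: 'd curve set) \<in> sets path_space" using acs laws_sets[OF \<mu>l] by simp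
  have "emeasure (pushforward f \<mu>) ac_paths = emeasure \<mu> (g -` ac_paths \<inter> space \<mu>)"
    unfolding push by (rule emeasure_distr[OF gm acs'])
  also have "\<dots> = 1"
    using gac by (intro emeasure_eq_1_AE measurable_sets[OF gm acs']) (auto elim: eventually_mono)
  finally show "pushforward f \<mu> \<in> ac_laws" using pl by (simp add: ac_laws_def)
  assume w: "length w \<in> {2, 3}"
  \<comment> \<open>Measurability of the signature functional is read off from its integrability
    under \<mu>: all laws share the sigma-algebra of \<open>path_space\<close>.\<close>
  have sigm: "sig w \<in> borel_measurable path_space"
    using borel_measurable_integrable[OF int[OF w]] measurable_cong_sets[OF laws_sets[OF \<mu>l] refl] by blast
  have sgm: "(\<lambda>x. sig w (g x)) \<in> borel_measurable \<mu>"
    by (rule measurable_compose[OF gm sigm])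
  have li: "integrable \<mu> (\<lambda>x. lin_mom A (\<lambda>v. sig v x) w)"
    by (rule integrable_lin_mom) (use int w in auto)
  define c where "c = a ^ length w * (12 * real CARD('d) * H)"
  have a0: "0 \<le> a" using A[of undefined] by (meson abs_ge_zero order_trans sum_nonneg)
  have c0: "0 \<le> c" unfolding c_def using a0 H by simp
  define dev where "dev = (\<lambda>x. sig w (g x) - lin_mom A (\<lambda>v. sig v x) w)"
  have dm: "dev \<in> borel_measurable \<mu>" unfolding dev_def using sgm li by measurable
  have ae: "AE x in \<mu>. 0 \<le> \<bar>dev x\<bar> \<and> \<bar>dev x\<bar> \<le> c * (1 + one_var x powr (2 + \<gamma>))"
    using ae_g
  proof eventually_elim
    case (elim x)
    then have x: "x \<in> ac_paths" by simp
    have "sig w (g x) = lin_mom A (\<lambda>v. sig v (path_map (\<lambda>u. u + R u) x)) w"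
      using elim sig_linear[OF z[OF x]] by simp
    then have "\<bar>dev x\<bar> \<le> a ^ length w * (12 * real CARD('d) * H * (1 + one_var x powr (2 + \<gamma>)))"
      unfolding dev_def using sig_perturbation[OF x lip hoelder H \<gamma>] w
      by (simp only:) (intro lin_mom_diff_le[OF A], simp)
    then show ?case by (simp add: c_def mult.assoc)
  qed
  have nn: "(\<integral>\<^sup>+x. ennreal \<bar>dev x\<bar> \<partial>\<mu>) \<le> ennreal (c * (1 + K))"
    by (rule nn_integral_affine_bound[OF prob_space_axioms _ c0 ae])
       (use dm K in \<open>auto simp: c_def\<close>)
  have di: "integrable \<mu> dev"
    using dm nn by (intro integrableI_bounded) (auto intro: le_less_trans)
  have "integrable \<mu> (\<lambda>x. dev x + lin_mom A (\<lambda>v. sig v x) w)" using di li by (rule Bochner_Integration.integrable_add)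
  then have si: "integrable \<mu> (\<lambda>x. sig w (g x))" by (simp add: dev_def)
  then show "integrable (pushforward f \<mu>) (sig w)"
    unfolding push using integrable_distr_eq[OF gm sigm] by simp
  have "esig (pushforward f \<mu>) w = (\<integral>x. sig w (g x) \<partial>\<mu>)"
    unfolding esig_def push by (rule integral_distr[OF gm sigm])
  moreover have "lin_mom A (esig \<mu>) w = (\<integral>x. lin_mom A (\<lambda>v. sig v x) w \<partial>\<mu>)"
    unfolding esig_def[abs_def] by (rule integral_lin_mom[symmetric]) (use int w in auto)
  ultimately have "esig (pushforward f \<mu>) w - lin_mom A (esig \<mu>) w = (\<integral>x. dev x \<partial>\<mu>)"
    unfolding dev_def using si li by simp
  also have "\<bar>\<dots>\<bar> \<le> (\<integral>x. \<bar>dev x\<bar> \<partial>\<mu>)" by (rule integral_abs_bound)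
  also have "\<dots> \<le> c * (1 + K)"
    using nn c0 K(2) di by (subst (asm) nn_integral_eq_integral) (auto simp: ennreal_le_iff)
  finally show "\<bar>esig (pushforward f \<mu>) w - lin_mom A (esig \<mu>) w\<bar> \<le> a ^ length w * (12 * real CARD('d) * H) * (1 + K)"
    by (simp add: c_def)
qed

section \<open>Matrix norms and positive definite matrices\<close>

lemma norm_vec_sq: "(norm x)\<^sup>2 = (\<Sum>i\<in>UNIV. (norm (x $ i))\<^sup>2)"
  by (simp add: norm_vec_def L2_set_def sum_nonneg)

lemma norm_matrix_vector_le:
  fixes A :: "real^'n^'m"
  shows "norm (A *v x) \<le> norm A * norm x"
proof -
  have "(norm (A *v x))\<^sup>2 = (\<Sum>i\<in>UNIV. (A $ i \<bullet> x)\<^sup>2)"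
    unfolding norm_vec_sq[of "A *v x"] by (simp add: matrix_vector_mul_component)
  also have "\<dots> \<le> (\<Sum>i\<in>UNIV. (norm (A $ i))\<^sup>2 * (norm x)\<^sup>2)"
    by (rule sum_mono) (metis Cauchy_Schwarz_ineq2 abs_ge_zero power2_abs power_mono power_mult_distrib)
  also have "\<dots> = (norm A * norm x)\<^sup>2"
    by (simp add: norm_vec_sq[of A] power_mult_distrib sum_distrib_right)
  finally show ?thesis by (rule power2_le_imp_le) simp
qed

lemma matrix_mult_row: "(A ** B) $ i = transpose B *v (A $ i)" for A :: "real^'n^'m" and B :: "real^'k^'n"
  by (simp add: vec_eq_iff matrix_matrix_mult_def matrix_vector_mult_def transpose_def mult.commute)

lemma norm_transpose: "norm (transpose A) = norm (A :: real^'n^'m)"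
proof -
  have "(norm (transpose A))\<^sup>2 = (norm A)\<^sup>2"
    unfolding norm_vec_sq[of "transpose A"] norm_vec_sq[of A] norm_vec_sq
    by (simp add: transpose_def) (rule sum.swap)
  then show ?thesis by simp
qed

lemma norm_matrix_mult_le:
  fixes A :: "real^'n^'m" and B :: "real^'k^'n"
  shows "norm (A ** B) \<le> norm A * norm B"
proof -
  have "(norm (A ** B))\<^sup>2 \<le> (\<Sum>i\<in>UNIV. (norm B * norm (A $ i))\<^sup>2)"
    unfolding norm_vec_sq[of "A ** B"] matrix_mult_row
    by (intro sum_mono power_mono) (metis norm_matrix_vector_le norm_transpose, simp)
  also have "\<dots> = (norm A * norm B)\<^sup>2"
    by (simp add: norm_vec_sq[of A] power_mult_distrib sum_distrib_left sum_distrib_right mult.commute)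
  finally show ?thesis by (rule power2_le_imp_le) simp
qed

lemma abs_entry_le_norm: "\<bar>A $ i $ j\<bar> \<le> norm (A :: real^'n^'m)"
  by (rule order_trans[OF component_le_norm_cart Finite_Cartesian_Product.norm_nth_le])

lemma norm_le_entries:
  fixes A :: "real^'d^'d::finite"
  assumes "\<And>i j. \<bar>A $ i $ j\<bar> \<le> e"
  shows "norm A \<le> (real CARD('d))\<^sup>2 * e"
proof -
  have "norm A \<le> (\<Sum>i\<in>UNIV. norm (A $ i))" unfolding norm_vec_def by (rule L2_set_le_sum) simp
  also have "\<dots> \<le> (\<Sum>i\<in>(UNIV::'d set). \<Sum>j\<in>(UNIV::'d set). e)"
    by (intro sum_mono order_trans[OF norm_le_l1_cart]) (rule assms)
  finally show ?thesis by (simp add: power2_eq_square)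
qed

lemma norm_le_operator:
  fixes A :: "real^'d^'d::finite"
  assumes "\<And>v. norm (A *v v) \<le> c * norm v"
  shows "norm A \<le> (real CARD('d))\<^sup>2 * c"
proof (rule norm_le_entries)
  fix i j
  have "\<bar>A $ i $ j\<bar> = \<bar>(A *v axis j 1) $ i\<bar>" by (simp add: matrix_vector_mul_component inner_axis)
  also have "\<dots> \<le> norm (A *v axis j 1)" by (rule component_le_norm_cart)
  also have "\<dots> \<le> c" using assms[of "axis j 1"] by simp
  finally show "\<bar>A $ i $ j\<bar> \<le> c" .
qed

lemma inner_transpose: "transpose A \<bullet> transpose B = A \<bullet> (B :: real^'n^'m)"
  by (simp add: inner_vec_def transpose_def) (rule sum.swap)

lemma inner_symmetric_matrix: "transpose S = S \<Longrightarrow> (S *v u) \<bullet> v = u \<bullet> (S *v (v :: real^'n))"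
  by (metis dot_lmul_matrix vector_transpose_matrix)

lemma
  fixes A :: "'a::semiring_1^'d^'d"
  assumes "invertible A"
  shows matrix_inv_right: "A ** matrix_inv A = mat 1" and matrix_inv_left: "matrix_inv A ** A = mat 1"
  using someI_ex[OF assms[unfolded invertible_def]] by (simp_all add: matrix_inv_def)

lemma matrix_inv_unique:
  fixes A :: "'a::semiring_1^'d^'d"
  assumes "A ** B = mat 1" "B ** A = mat 1"
  shows "matrix_inv A = B"
proof -
  have "invertible A" using assms by (auto simp: invertible_def)
  then show ?thesis by (metis assms(1) matrix_inv_left matrix_mul_assoc matrix_mul_lid matrix_mul_rid)
qed

lemma invertible_transpose: "invertible A \<Longrightarrow> invertible (transpose (A :: real^'d^'d))"
  unfolding invertible_def by (metis matrix_transpose_mul transpose_mat)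

lemma matrix_diff_ldistrib: "A ** (B - C) = A ** B - A ** (C :: real^'k^'n)" for A :: "real^'n^'m"
  by (simp add: vec_eq_iff matrix_matrix_mult_def algebra_simps sum_subtractf)

lemma matrix_diff_rdistrib: "(A - B) ** C = A ** C - B ** (C :: real^'k^'n)" for A :: "real^'n^'m"
  by (simp add: vec_eq_iff matrix_matrix_mult_def algebra_simps sum_subtractf)

section \<open>Positive definite matrices, their inverses and square roots\<close>

definition posdef :: "real^'d^'d \<Rightarrow> bool" where
  "posdef S \<longleftrightarrow> transpose S = S \<and> (\<forall>v. v \<noteq> 0 \<longrightarrow> 0 < v \<bullet> (S *v v))"

lemma posdef_lower_bound:
  fixes S :: "real^'d^'d::finite"
  assumes "posdef S"
  shows "\<exists>c>0. \<forall>v. c * (norm v)\<^sup>2 \<le> v \<bullet> (S *v v)"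
proof -
  have "continuous_on (sphere 0 1) (\<lambda>v. v \<bullet> (S *v v))"
    by (intro continuous_intros linear_continuous_on) auto
  moreover have "sphere 0 1 \<noteq> ({} :: (real^'d) set)" by simp
  ultimately have "\<exists>u\<in>sphere 0 1. \<forall>v\<in>sphere 0 1. u \<bullet> (S *v u) \<le> v \<bullet> (S *v v)"
    by (intro continuous_attains_inf compact_sphere)
  then obtain u where u: "u \<in> sphere 0 1" "\<And>v. v \<in> sphere 0 1 \<Longrightarrow> u \<bullet> (S *v u) \<le> v \<bullet> (S *v v)"
    by blast
  have "u \<noteq> 0" using u(1) by auto
  then have c: "0 < u \<bullet> (S *v u)" using assms by (simp add: posdef_def)
  have "u \<bullet> (S *v u) * (norm v)\<^sup>2 \<le> v \<bullet> (S *v v)" for v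
  proof (cases "v = 0")
    case False
    then have "u \<bullet> (S *v u) \<le> (v /\<^sub>R norm v) \<bullet> (S *v (v /\<^sub>R norm v))" by (intro u) simp
    also have "\<dots> = (v \<bullet> (S *v v)) / (norm v)\<^sup>2"
      by (simp add: matrix_vector_mult_scaleR power2_eq_square divide_inverse mult_ac)
    finally show ?thesis using False by (simp add: field_simps)
  qed simp
  then show ?thesis using c by blast
qed

lemma lower_bound_norm:
  assumes "\<And>v. c * (norm v)\<^sup>2 \<le> v \<bullet> (S *v v)"
  shows "c * norm v \<le> norm (S *v (v :: real^'d::finite))"
proof (cases "v = 0")
  case False
  have "c * (norm v)\<^sup>2 \<le> norm v * norm (S *v v)"
    using assms[of v] norm_cauchy_schwarz[of v "S *v v"] by linarith
  then have "(c * norm v) * norm v \<le> norm (S *v v) * norm v" by (simp add: power2_eq_square mult_ac)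
  then show ?thesis using False by (simp add: mult_le_cancel_right)
qed simp

lemma invertible_lower_bound:
  fixes S :: "real^'d^'d::finite"
  assumes "0 < c" "\<And>v. c * norm v \<le> norm (S *v v)"
  shows "invertible S" and "norm (matrix_inv S *v v) \<le> norm v / c"
proof -
  have "v = 0" if "S *v v = 0" for v
    using assms(2)[of v] \<open>0 < c\<close> that by (simp add: mult_le_0_iff)
  then show i: "invertible S"
    by (metis invertible_left_inverse matrix_left_invertible_ker)
  have "c * norm (matrix_inv S *v v) \<le> norm (S *v (matrix_inv S *v v))" by (rule assms)
  also have "\<dots> = norm v" using i by (simp add: matrix_vector_mul_assoc matrix_inv_right)
  finally show "norm (matrix_inv S *v v) \<le> norm v / c" using assms(1) by (simp add: field_simps)
qed

lemma posdef_invertible: "posdef (S :: real^'d^'d::finite) \<Longrightarrow> invertible S"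
  using posdef_lower_bound lower_bound_norm invertible_lower_bound(1) by metis

lemma transpose_matrix_inv:
  fixes S :: "real^'d^'d"
  assumes "invertible S"
  shows "transpose (matrix_inv S) = matrix_inv (transpose S)"
proof -
  have "transpose S ** transpose (matrix_inv S) = mat 1" "transpose (matrix_inv S) ** transpose S = mat 1"
    using assms by (simp_all add: matrix_transpose_mul[symmetric] matrix_inv_left matrix_inv_right transpose_mat)
  then show ?thesis by (rule matrix_inv_unique[symmetric])
qed

lemma posdef_matrix_inv:
  fixes S :: "real^'d^'d::finite"
  assumes "posdef S"
  shows "posdef (matrix_inv S)"
  unfolding posdef_def
proof (intro conjI allI impI)
  have i: "invertible S" by (rule posdef_invertible[OF assms])
  show "transpose (matrix_inv S) = matrix_inv S"
    using assms by (simp add: transpose_matrix_inv[OF i] posdef_def)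
  fix v :: "real^'d" assume "v \<noteq> 0"
  define u where "u = matrix_inv S *v v"
  have v: "S *v u = v" unfolding u_def using i by (simp add: matrix_vector_mul_assoc matrix_inv_right)
  then have "u \<noteq> 0" using \<open>v \<noteq> 0\<close> by auto
  then have "0 < u \<bullet> (S *v u)" using assms by (simp add: posdef_def)
  then show "0 < v \<bullet> (matrix_inv S *v v)" unfolding v u_def[symmetric] by (simp add: inner_commute)
qed

lemma matrix_inv_diff_le:
  fixes S T :: "real^'d^'d::finite"
  assumes c: "0 < c" "\<And>v. c * norm v \<le> norm (S *v v)" "\<And>v. c * norm v \<le> norm (T *v v)"
  shows "norm (matrix_inv S - matrix_inv T) \<le> ((real CARD('d))\<^sup>2 / c)\<^sup>2 * norm (S - T)"
proof -
  have iS: "invertible S" and iT: "invertible T" using c by (auto intro: invertible_lower_bound(1))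
  have n: "norm (matrix_inv S) \<le> (real CARD('d))\<^sup>2 / c" "norm (matrix_inv T) \<le> (real CARD('d))\<^sup>2 / c"
    using norm_le_operator[of "matrix_inv S" "1 / c"] norm_le_operator[of "matrix_inv T" "1 / c"]
      invertible_lower_bound(2)[OF c(1,2)] invertible_lower_bound(2)[OF c(1,3)] by simp_all
  have "matrix_inv S - matrix_inv T = matrix_inv S ** (T - S) ** matrix_inv T"
    using iS iT by (simp add: matrix_diff_ldistrib matrix_diff_rdistrib matrix_inv_left)
      (simp add: matrix_mul_assoc[symmetric] matrix_inv_right)
  then have "norm (matrix_inv S - matrix_inv T) \<le> norm (matrix_inv S) * norm (T - S) * norm (matrix_inv T)"
    by (simp only:) (rule order_trans[OF norm_matrix_mult_le mult_right_mono[OF norm_matrix_mult_le norm_ge_zero]])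
  also have "\<dots> \<le> ((real CARD('d))\<^sup>2 / c) * norm (T - S) * ((real CARD('d))\<^sup>2 / c)"
    using n c(1) by (intro mult_mono) auto
  finally show ?thesis by (simp add: norm_minus_commute power2_eq_square mult_ac)
qed

text \<open>With \<open>X = S - T\<close> one has \<open>S X + X T = S\<^sup>2 - T\<^sup>2\<close>; take the Frobenius inner product with \<open>X\<close>.\<close>

lemma sqrt_lipschitz:
  fixes S T :: "real^'d^'d::finite"
  assumes S: "transpose S = S" "\<And>v. c * (norm v)\<^sup>2 \<le> v \<bullet> (S *v v)"
    and T: "transpose T = T" "\<And>v. 0 \<le> v \<bullet> (T *v v)"
  shows "c * norm (S - T) \<le> norm (S ** S - T ** T)"
proof -
  define X where "X = S - T"
  \<comment> \<open>Turns a Frobenius inner product into a sum of quadratic forms over the rows of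
    \<open>X\<close>; for the product with \<open>S\<close> on the left it is applied to the
    transpose, that is, to the columns.\<close>
  have rows: "X \<bullet> (X ** U) = (\<Sum>i\<in>UNIV. X $ i \<bullet> (U *v X $ i))" if "transpose U = U" for X U :: "real^'d^'d"
    unfolding inner_vec_def[of X] matrix_mult_row that ..
  have "X \<bullet> (S ** X) = transpose X \<bullet> (transpose X ** S)"
    using inner_transpose[of X "S ** X"] S(1) by (simp add: matrix_transpose_mul)
  also have "\<dots> = (\<Sum>i\<in>UNIV. transpose X $ i \<bullet> (S *v transpose X $ i))" by (rule rows[OF S(1)])
  also have "\<dots> \<ge> (\<Sum>i\<in>UNIV. c * (norm (transpose X $ i))\<^sup>2)" by (rule sum_mono) (rule S(2))
  also have "(\<Sum>i\<in>UNIV. c * (norm (transpose X $ i))\<^sup>2) = c * (norm X)\<^sup>2"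
    by (simp add: sum_distrib_left[symmetric] norm_vec_sq[symmetric] norm_transpose)
  finally have 1: "c * (norm X)\<^sup>2 \<le> X \<bullet> (S ** X)" .
  have 2: "0 \<le> X \<bullet> (X ** T)" unfolding rows[OF T(1)] by (intro sum_nonneg T(2))
  have "S ** X + X ** T = S ** S - T ** T"
    by (simp add: X_def matrix_diff_ldistrib matrix_diff_rdistrib)
  then have "X \<bullet> (S ** X) + X \<bullet> (X ** T) \<le> norm X * norm (S ** S - T ** T)"
    by (metis inner_add_right norm_cauchy_schwarz)
  then have "(c * norm X) * norm X \<le> norm (S ** S - T ** T) * norm X"
    using 1 2 by (simp add: power2_eq_square mult_ac)
  then have "X = 0 \<or> c * norm X \<le> norm (S ** S - T ** T)" by (auto simp: mult_le_cancel_right)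
  then show ?thesis unfolding X_def by auto
qed

lemma posdef_sqrt_unique:
  fixes S T :: "real^'d^'d::finite"
  assumes "posdef S" "posdef T" "S ** S = T ** T"
  shows "S = T"
proof -
  obtain c where c: "0 < c" "\<And>v. c * (norm v)\<^sup>2 \<le> v \<bullet> (S *v v)"
    using posdef_lower_bound[OF assms(1)] by blast
  have "0 \<le> v \<bullet> (T *v v)" for v
    using assms(2) by (cases "v = 0") (auto simp: posdef_def intro: less_imp_le)
  then have "c * norm (S - T) \<le> norm (S ** S - T ** T)"
    using assms c(2) by (intro sqrt_lipschitz) (auto simp: posdef_def)
  then have "c * norm (S - T) \<le> 0" using assms(3) by simp
  then show ?thesis using c(1) by (simp add: mult_le_0_iff)
qed

text \<open>For \<open>X = 1 - s C\<close> with small \<open>s > 0\<close> the map \<open>Y \<mapsto> (X + Y\<^sup>2)/2\<close> is a contraction of a ball of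
  symmetric operators; at its fixed point \<open>(1 - Y)\<^sup>2 = s C\<close>.\<close>

lemma posdef_sqrt_exists:
  fixes C :: "real^'d^'d::finite"
  assumes "posdef C"
  shows "\<exists>R. posdef R \<and> R ** R = C"
proof -
  obtain c where c: "0 < c" "\<And>v. c * (norm v)\<^sup>2 \<le> v \<bullet> (C *v v)"
    using posdef_lower_bound[OF assms] by blast
  have symC: "(C *v u) \<bullet> v = u \<bullet> (C *v v)" for u v
    using assms inner_symmetric_matrix by (auto simp: posdef_def)
  define M where "M = norm C + c"
  have M: "0 < M" "c \<le> M" "norm C \<le> M" using c by (auto simp: M_def intro: add_nonneg_pos)
  \<comment> \<open>This choice minimises \<open>1 - 2 * s * c + s ^ 2 * M ^ 2\<close>, the bound
    for the squared norm of \<open>1 - s C\<close>; the minimum is the \<open>r ^ 2\<close> below,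
    and \<open>c \<le> M\<close> keeps it nonnegative.\<close>
  define s where "s = c / M\<^sup>2"
  have s: "0 < s" using c M by (simp add: s_def)
  define r where "r = sqrt (1 - c\<^sup>2 / M\<^sup>2)"
  have "c\<^sup>2 / M\<^sup>2 \<le> 1" "0 < c\<^sup>2 / M\<^sup>2" using c M by (auto simp: divide_le_eq power_mono)
  then have r: "0 \<le> r" "r < 1" "r\<^sup>2 = 1 - c\<^sup>2 / M\<^sup>2" by (auto simp: r_def)
  define X where "X = Blinfun (\<lambda>v. v - s *\<^sub>R (C *v v))"
  have bl: "bounded_linear (\<lambda>v. v - s *\<^sub>R (C *v v))"
    by (intro bounded_linear_intros matrix_vector_mul_bounded_linear)
  have X: "blinfun_apply X v = v - s *\<^sub>R (C *v v)" for v
    unfolding X_def by (simp add: bounded_linear_Blinfun_apply[OF bl])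
  have nX: "norm X \<le> r"
  proof (rule norm_blinfun_bound[OF r(1)])
    fix v
    have "(norm (X v))\<^sup>2 = (norm v)\<^sup>2 - 2 * s * (v \<bullet> (C *v v)) + s\<^sup>2 * (norm (C *v v))\<^sup>2"
      unfolding power2_norm_eq_inner X
      by (simp add: inner_diff_left inner_diff_right inner_commute[of "C *v v" v] power2_eq_square algebra_simps)
    also have "\<dots> \<le> (norm v)\<^sup>2 - 2 * s * (c * (norm v)\<^sup>2) + s\<^sup>2 * (M * norm v)\<^sup>2"
    proof -
      have "2 * s * (c * (norm v)\<^sup>2) \<le> 2 * s * (v \<bullet> (C *v v))" using s c(2)[of v] by (intro mult_left_mono) auto
      moreover have "norm (C *v v) \<le> M * norm v"
        using norm_matrix_vector_le[of C v] mult_right_mono[OF M(3), of "norm v"] by simp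
      then have "s\<^sup>2 * (norm (C *v v))\<^sup>2 \<le> s\<^sup>2 * (M * norm v)\<^sup>2" by (intro mult_left_mono power_mono) auto
      ultimately show ?thesis by linarith
    qed
    also have "\<dots> = (1 - c\<^sup>2 / M\<^sup>2) * (norm v)\<^sup>2"
      using M by (simp add: s_def field_simps power2_eq_square)
    also have "\<dots> = (r * norm v)\<^sup>2" by (simp only: power_mult_distrib r(3))
    finally show "norm (X v) \<le> r * norm v" by (rule power2_le_imp_le) (simp add: r)
  qed
  define F where "F = (\<lambda>Y :: (real^'d) \<Rightarrow>\<^sub>L (real^'d). (1/2) *\<^sub>R (X + (Y o\<^sub>L Y)))"
  \<comment> \<open>Symmetry is part of the closed set so that the fixed point inherits it. The
    radius \<open>r < 1\<close> makes \<open>F\<close> a contraction and later gives positivity of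
    \<open>1 - Y\<close>.\<close>
  let ?S = "{Y :: (real^'d) \<Rightarrow>\<^sub>L (real^'d). norm Y \<le> r \<and> (\<forall>u v. blinfun_apply Y u \<bullet> v = u \<bullet> blinfun_apply Y v)}"
  have "\<exists>!Y\<in>?S. F Y = Y"
  proof (rule Banach_fix[of _ r])
    have "closed ?S"
    proof -
      have "?S = cball 0 r \<inter> (\<Inter>u. \<Inter>v. {Y. blinfun_apply Y u \<bullet> v = u \<bullet> blinfun_apply Y v})" by auto
      moreover have "closed {Y :: (real^'d) \<Rightarrow>\<^sub>L (real^'d). blinfun_apply Y u \<bullet> v = u \<bullet> blinfun_apply Y v}" for u v
        by (intro closed_Collect_eq continuous_intros)
      then have "closed (cball 0 r \<inter> (\<Inter>u. \<Inter>v. {Y :: (real^'d) \<Rightarrow>\<^sub>L (real^'d). blinfun_apply Y u \<bullet> v = u \<bullet> blinfun_apply Y v}))"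
        by (intro closed_Int closed_INT ballI closed_cball)
      ultimately show ?thesis by simp
    qed
    then show "Topological_Spaces.complete ?S" by (simp add: complete_eq_closed)
    show "?S \<noteq> {}" using r by (auto intro!: exI[of _ 0])
    show "F ` ?S \<subseteq> ?S"
    proof (rule image_subsetI)
      fix Y assume Y: "Y \<in> ?S"
      have "norm (Y o\<^sub>L Y) \<le> norm Y * norm Y" by (rule norm_blinfun_compose)
      also have "\<dots> \<le> r * 1" using Y r by (intro mult_mono) auto
      finally have "norm (X + (Y o\<^sub>L Y)) \<le> 2 * r" using nX norm_triangle_ineq[of X "Y o\<^sub>L Y"] by linarith
      then have "norm (F Y) \<le> r" by (simp add: F_def)
      moreover have "blinfun_apply (F Y) u \<bullet> v = u \<bullet> blinfun_apply (F Y) v" for u v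
        using Y by (simp add: F_def X blinfun.bilinear_simps inner_add_left inner_add_right
            inner_diff_left inner_diff_right symC)
      ultimately show "F Y \<in> ?S" by simp
    qed
    show "dist (F Y) (F Z) \<le> r * dist Y Z" if "Y \<in> ?S" "Z \<in> ?S" for Y Z
    proof -
      have "F Y - F Z = (1/2) *\<^sub>R ((Y o\<^sub>L (Y - Z)) + ((Y - Z) o\<^sub>L Z))"
        by (rule blinfun_eqI) (simp add: F_def blinfun.bilinear_simps algebra_simps)
      then have "norm (F Y - F Z) \<le> (1/2) * (norm (Y o\<^sub>L (Y - Z)) + norm ((Y - Z) o\<^sub>L Z))"
        by (simp add: norm_triangle_ineq)
      also have "\<dots> \<le> (1/2) * (norm Y * norm (Y - Z) + norm (Y - Z) * norm Z)"
        by (intro mult_left_mono add_mono norm_blinfun_compose) auto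
      also have "\<dots> \<le> (1/2) * (r * norm (Y - Z) + norm (Y - Z) * r)"
        using that by (intro mult_left_mono add_mono mult_right_mono) (auto intro: mult_left_mono)
      finally show ?thesis by (simp add: dist_norm mult.commute)
    qed
  qed (use r in auto)
  then obtain Y where Y: "norm Y \<le> r" "\<And>u v. blinfun_apply Y u \<bullet> v = u \<bullet> blinfun_apply Y v" "F Y = Y" by auto
  have Y2: "Y (Y v) = 2 *\<^sub>R Y v - v + s *\<^sub>R (C *v v)" for v
  proof -
    have "Y v = F Y v" by (simp add: Y(3))
    also have "\<dots> = (1/2) *\<^sub>R (v - s *\<^sub>R (C *v v) + Y (Y v))" by (simp add: F_def X blinfun.bilinear_simps)
    finally have "2 *\<^sub>R blinfun_apply Y v = 2 *\<^sub>R ((1/2) *\<^sub>R (v - s *\<^sub>R (C *v v) + Y (Y v)))"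
      by (rule arg_cong)
    also have "\<dots> = v - s *\<^sub>R (C *v v) + Y (Y v)" by simp
    finally show ?thesis by (simp add: algebra_simps)
  qed
  define R where "R = matrix (\<lambda>v. (1 / sqrt s) *\<^sub>R (v - Y v))"
  have lin: "linear (\<lambda>v. (1 / sqrt s) *\<^sub>R (v - Y v))"
    by (intro bounded_linear.linear bounded_linear_intros blinfun.bounded_linear_right)
  have R: "R *v v = (1 / sqrt s) *\<^sub>R (v - Y v)" for v 
    unfolding R_def by (rule matrix_works) (simp only: linear_matrix_vector_mul_eq lin)
  have "R ** R = C"
  proof (rule matrix_eq[THEN iffD2], intro allI)
    fix v
    have "(R ** R) *v v = (1 / sqrt s) *\<^sub>R ((1 / sqrt s) *\<^sub>R (v - Y v) - Y ((1 / sqrt s) *\<^sub>R (v - Y v)))"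
      by (simp only: matrix_vector_mul_assoc[symmetric] R)
    also have "\<dots> = (1 / sqrt s * (1 / sqrt s)) *\<^sub>R (v - Y v - (Y v - Y (Y v)))"
      by (simp only: blinfun.scaleR_right blinfun.diff_right scaleR_diff_right[symmetric] scaleR_scaleR)
    also have "1 / sqrt s * (1 / sqrt s) = 1 / s" using s by simp
    also have "v - Y v - (Y v - Y (Y v)) = s *\<^sub>R (C *v v)" by (simp add: Y2 scaleR_2)
    finally show "(R ** R) *v v = C *v v" using s by simp
  qed
  moreover have "posdef R"
    unfolding posdef_def
  proof (intro conjI allI impI)
    have "(R *v u) \<bullet> v = u \<bullet> (R *v v)" for u v
      using Y(2)[of u v] by (simp add: R inner_diff_left inner_diff_right)
    then have "(transpose R *v u) \<bullet> v = (R *v u) \<bullet> v" for u v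
      by (metis dot_lmul_matrix inner_commute vector_transpose_matrix transpose_matrix_vector)
    then have "transpose R *v u = R *v u" for u by (metis vector_eq_rdot)
    then show "transpose R = R" by (simp add: matrix_eq)
    fix v :: "real^'d" assume v: "v \<noteq> 0"
    have "v \<bullet> Y v \<le> norm v * norm (Y v)" by (rule norm_cauchy_schwarz)
    also have "\<dots> \<le> norm v * (r * norm v)"
      by (intro mult_left_mono order_trans[OF norm_blinfun mult_right_mono[OF Y(1)]]) auto
    also have "\<dots> < norm v * (1 * norm v)" using v r by (intro mult_strict_left_mono mult_strict_right_mono) auto
    also have "\<dots> = v \<bullet> v" by (simp add: norm_eq_sqrt_inner)
    finally show "0 < v \<bullet> (R *v v)" using s by (simp add: R inner_diff_right)
  qed
  ultimately show ?thesis by blast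
qed

section \<open>Approximate joint diagonalisation\<close>

lemma column_big_entry:
  fixes G :: "real^'d^'d::finite"
  assumes "\<And>v. g * norm v \<le> norm (G *v v)"
  shows "\<exists>i. g / real CARD('d) \<le> \<bar>G $ i $ k\<bar>"
proof (rule ccontr)
  assume "\<not> ?thesis"
  then have lt: "\<bar>G $ i $ k\<bar> < g / real CARD('d)" for i by (simp add: not_le)
  have "g \<le> norm (G *v axis k 1)" using assms[of "axis k 1"] by simp
  also have "\<dots> \<le> (\<Sum>i\<in>UNIV. \<bar>(G *v axis k 1) $ i\<bar>)" by (rule norm_le_l1_cart)
  also have "\<dots> = (\<Sum>i\<in>UNIV. \<bar>G $ i $ k\<bar>)" by (simp add: matrix_vector_mul_component inner_axis)
  also have "\<dots> < (\<Sum>i\<in>(UNIV::'d set). g / real CARD('d))" by (intro sum_strict_mono lt) auto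
  also have "\<dots> = g" by simp
  finally show False by simp
qed

text \<open>If \<open>\<kappa> k \<noteq> 0\<close>, the third-order conditions force column \<open>k\<close> to have a single large entry; the
  second-order conditions then extend this to the remaining column.\<close>

lemma near_signed_permutation:
  fixes \<kappa> :: "'d::finite \<Rightarrow> real"
  assumes \<kappa>: "card {k. \<kappa> k = 0} \<le> 1" and g: "0 < g" and \<Gamma>: "0 \<le> \<Gamma>"
  shows "\<exists>c>0. \<exists>\<eta>0>0. \<forall>(G::real^'d^'d) \<eta>. 0 \<le> \<eta> \<and> \<eta> \<le> \<eta>0 \<and> (\<forall>i k. \<bar>G $ i $ k\<bar> \<le> \<Gamma>) \<and>
     (\<forall>v. g * norm v \<le> norm (G *v v)) \<and>
     (\<forall>i j. \<bar>(\<Sum>k\<in>UNIV. G $ i $ k * G $ j $ k) - of_bool (i = j)\<bar> \<le> \<eta>) \<and>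
     (\<forall>i j n. i \<noteq> j \<longrightarrow> \<bar>\<Sum>k\<in>UNIV. \<kappa> k * (G $ i $ k * (G $ j $ k * G $ n $ k))\<bar> \<le> \<eta>) \<longrightarrow>
     (\<exists>p s. p permutes UNIV \<and> (\<forall>k. s k \<in> {1, -1}) \<and>
       (\<forall>i k. \<bar>G $ i $ k - (if i = p k then s k else 0)\<bar> \<le> c * \<eta>))"
proof -
  define d where "d = real CARD('d)"
  have d: "1 \<le> d" by (simp add: d_def Suc_leI)
  obtain q where q: "0 < q" "\<And>k. \<kappa> k \<noteq> 0 \<Longrightarrow> q \<le> \<bar>\<kappa> k\<bar>"
  proof
    \<comment> \<open>The inserted 1 keeps the minimum defined when no \<kappa> differs from 0,
      which can happen in dimension 1.\<close>
    let ?S = "insert 1 ((\<lambda>k. \<bar>\<kappa> k\<bar>) ` {k. \<kappa> k \<noteq> 0})"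
    show "0 < Min ?S" by (subst Min_gr_iff) auto
    show "Min ?S \<le> \<bar>\<kappa> k\<bar>" if "\<kappa> k \<noteq> 0" for k using that by (intro Min_le) auto
  qed
  define \<gamma> where "\<gamma> = g / d"
  have \<gamma>: "0 < \<gamma>" using g d by (simp add: \<gamma>_def)
  define a2 where "a2 = d / (g * q * \<gamma>)"
  define a3 where "a3 = (1 + d * (\<Gamma> * a2)) / \<gamma>"
  define a4 where "a4 = a2 + a3"
  have a: "0 \<le> a2" "0 \<le> a3" "0 \<le> a4" "a2 \<le> a4" "a3 \<le> a4"
    using d g q \<gamma> \<Gamma> by (auto simp: a2_def a3_def a4_def)
  \<comment> \<open>The first bound keeps every row of \<open>G\<close> at squared norm at least
    1/2; the second makes all small entries at most \<open>1 / (2 * d)\<close>. Together they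
    exclude a row without a large entry.\<close>
  define \<eta>0 where "\<eta>0 = min (1/2) (1 / (2 * d * (a4 + 1)))"
  have \<eta>0: "0 < \<eta>0" using d a by (simp add: \<eta>0_def)
  define c where "c = 1 + d * a4 + a4"
  have c: "0 < c" using d a by (simp add: c_def add_pos_nonneg)
  show ?thesis
  proof (rule exI[of _ c], rule conjI[OF c], rule exI[of _ \<eta>0], rule conjI[OF \<eta>0], intro allI impI)
    fix G :: "real^'d^'d" and \<eta> :: real
    assume "0 \<le> \<eta> \<and> \<eta> \<le> \<eta>0 \<and> (\<forall>i k. \<bar>G $ i $ k\<bar> \<le> \<Gamma>) \<and>
     (\<forall>v. g * norm v \<le> norm (G *v v)) \<and>
     (\<forall>i j. \<bar>(\<Sum>k\<in>UNIV. G $ i $ k * G $ j $ k) - of_bool (i = j)\<bar> \<le> \<eta>) \<and>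
     (\<forall>i j n. i \<noteq> j \<longrightarrow> \<bar>\<Sum>k\<in>UNIV. \<kappa> k * (G $ i $ k * (G $ j $ k * G $ n $ k))\<bar> \<le> \<eta>)"
    then have \<eta>: "0 \<le> \<eta>" "\<eta> \<le> \<eta>0" and G\<Gamma>: "\<forall>i k. \<bar>G $ i $ k\<bar> \<le> \<Gamma>"
      and low: "\<forall>v. g * norm v \<le> norm (G *v v)"
      and GG: "\<forall>i j. \<bar>(\<Sum>k\<in>UNIV. G $ i $ k * G $ j $ k) - of_bool (i = j)\<bar> \<le> \<eta>"
      and G3: "\<forall>i j n. i \<noteq> j \<longrightarrow> \<bar>\<Sum>k\<in>UNIV. \<kappa> k * (G $ i $ k * (G $ j $ k * G $ n $ k))\<bar> \<le> \<eta>"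
      by blast+
    obtain p where p: "\<And>k. \<gamma> \<le> \<bar>G $ p k $ k\<bar>"
      using column_big_entry[of g G] low unfolding \<gamma>_def d_def by metis
    have prod: "\<bar>G $ i $ k * G $ j $ k\<bar> \<le> d * \<eta> / (g * q)" if "i \<noteq> j" "\<kappa> k \<noteq> 0" for i j k
    proof -
      \<comment> \<open>For fixed rows \<open>i \<noteq> j\<close> the third-order sums are the
        entries of \<open>G *v y\<close>. They are at most \<eta>, and \<open>G\<close> is bounded
        below, so \<open>y\<close> itself is small, entry by entry.\<close>
      define y where "y = (\<chi> k. \<kappa> k * (G $ i $ k * G $ j $ k))"
      have "g * norm y \<le> norm (G *v y)" using low by blast
      also have "\<dots> \<le> (\<Sum>n\<in>UNIV. \<bar>(G *v y) $ n\<bar>)" by (rule norm_le_l1_cart)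
      also have "\<dots> \<le> (\<Sum>n\<in>(UNIV::'d set). \<eta>)"
      proof (rule sum_mono)
        fix n
        have "(G *v y) $ n = (\<Sum>k\<in>UNIV. \<kappa> k * (G $ i $ k * (G $ j $ k * G $ n $ k)))"
          by (simp add: matrix_vector_mult_def y_def mult_ac)
        then show "\<bar>(G *v y) $ n\<bar> \<le> \<eta>" using G3 that(1) by simp
      qed
      finally have "g * norm y \<le> d * \<eta>" by (simp add: d_def)
      moreover have "q * \<bar>G $ i $ k * G $ j $ k\<bar> \<le> norm y"
      proof -
        have "q * \<bar>G $ i $ k * G $ j $ k\<bar> \<le> \<bar>\<kappa> k\<bar> * \<bar>G $ i $ k * G $ j $ k\<bar>"
          using q(2)[OF that(2)] by (intro mult_right_mono) auto
        also have "\<dots> = \<bar>y $ k\<bar>" by (simp add: y_def abs_mult)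
        also have "\<dots> \<le> norm y" by (rule component_le_norm_cart)
        finally show ?thesis .
      qed
      then have "g * (q * \<bar>G $ i $ k * G $ j $ k\<bar>) \<le> g * norm y" using g by (intro mult_left_mono) auto
      ultimately have "g * (q * \<bar>G $ i $ k * G $ j $ k\<bar>) \<le> d * \<eta>" by linarith
      then show ?thesis using g q(1) by (simp add: field_simps)
    qed
    have div: "\<bar>x\<bar> \<le> e / \<gamma>" if "\<bar>G $ p k $ k * x\<bar> \<le> e" for x e k
    proof -
      have "\<gamma> * \<bar>x\<bar> \<le> \<bar>G $ p k $ k\<bar> * \<bar>x\<bar>" by (intro mult_right_mono p) auto
      also have "\<dots> \<le> e" using that by (simp add: abs_mult)
      finally show ?thesis using \<gamma> by (simp add: field_simps)
    qed
    \<comment> \<open>Row \<open>p k\<close> has a large entry in column \<open>k\<close>, so a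
      small product with it leaves a small second factor.\<close>
    have small2: "\<bar>G $ i $ k\<bar> \<le> a2 * \<eta>" if "i \<noteq> p k" "\<kappa> k \<noteq> 0" for i k
      using div[OF prod[of "p k" i k]] that by (simp add: a2_def mult_ac)
    have small: "\<bar>G $ i $ k\<bar> \<le> a4 * \<eta>" if i: "i \<noteq> p k" for i k
    proof (cases "\<kappa> k = 0")
      case False
      then show ?thesis using small2[OF i False] mult_right_mono[OF a(4) \<eta>(1)] by linarith
    next
      case True
      have other: "\<kappa> l \<noteq> 0" if "l \<noteq> k" for l
      proof
        assume "\<kappa> l = 0"
        then have "card {k, l} \<le> card {k. \<kappa> k = 0}" using True by (intro card_mono) auto
        then show False using \<kappa> that by simp
      qed
      \<comment> \<open>In every other column \<open>l\<close> the third-order argument applies, and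
        its large entry cannot sit in both rows \<open>p k\<close> and \<open>i\<close>; so one of
        the two factors is small. Almost orthogonality of these rows then isolates the product in
        column \<open>k\<close>.\<close>
      have pr: "\<bar>G $ p k $ l * G $ i $ l\<bar> \<le> \<Gamma> * (a2 * \<eta>)" if "l \<noteq> k" for l
      proof (cases "p k = p l")
        case True
        then have "\<bar>G $ i $ l\<bar> \<le> a2 * \<eta>" using i other[OF that] by (intro small2) auto
        then show ?thesis unfolding abs_mult using G\<Gamma> \<Gamma> by (intro mult_mono) auto
      next
        case False
        then have "\<bar>G $ p k $ l\<bar> \<le> a2 * \<eta>" using other[OF that] by (intro small2) auto
        then show ?thesis unfolding abs_mult mult.commute[of "\<bar>G $ p k $ l\<bar>"]
          using G\<Gamma> \<Gamma> by (intro mult_mono) auto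
      qed
      have split: "(\<Sum>l\<in>UNIV. G $ p k $ l * G $ i $ l) = G $ p k $ k * G $ i $ k + (\<Sum>l\<in>UNIV - {k}. G $ p k $ l * G $ i $ l)"
        by (simp add: sum.remove)
      have "\<bar>\<Sum>l\<in>UNIV - {k}. G $ p k $ l * G $ i $ l\<bar> \<le> (\<Sum>l\<in>UNIV - {k}. \<Gamma> * (a2 * \<eta>))"
        by (rule order_trans[OF sum_abs sum_mono]) (use pr in auto)
      also have "\<dots> \<le> d * (\<Gamma> * (a2 * \<eta>))"
        using a \<eta> \<Gamma> by (auto simp: d_def intro!: mult_right_mono card_mono)
      finally have "\<bar>\<Sum>l\<in>UNIV - {k}. G $ p k $ l * G $ i $ l\<bar> \<le> d * (\<Gamma> * (a2 * \<eta>))" .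
      moreover have "\<bar>\<Sum>l\<in>UNIV. G $ p k $ l * G $ i $ l\<bar> \<le> \<eta>" using GG[rule_format, of "p k" i] i by simp
      ultimately have "\<bar>G $ p k $ k * G $ i $ k\<bar> \<le> \<eta> + d * (\<Gamma> * (a2 * \<eta>))" using split by linarith
      from div[OF this] have "\<bar>G $ i $ k\<bar> \<le> a3 * \<eta>" by (simp add: a3_def algebra_simps)
      then show ?thesis using mult_right_mono[OF a(5) \<eta>(1)] by linarith
    qed
    have a4\<eta>: "a4 * \<eta> \<le> 1 / (2 * d)"
    proof -
      have "a4 * \<eta> \<le> (a4 + 1) * (1 / (2 * d * (a4 + 1)))"
        using \<eta> a by (intro mult_mono) (auto simp: \<eta>0_def)
      also have "\<dots> = 1 / (2 * d)"
      proof -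
        have "a4 + 1 \<noteq> 0" using a by simp
        then show ?thesis using d by (simp add: divide_simps)
      qed
      finally show ?thesis .
    qed
    have "1 / (2 * d) \<le> 1" using d by simp
    then have one: "a4 * \<eta> \<le> 1" using a4\<eta> by linarith
    have sq: "(G $ i $ k)\<^sup>2 \<le> a4 * \<eta>" if "i \<noteq> p k" for i k
    proof -
      have "(G $ i $ k)\<^sup>2 = \<bar>G $ i $ k\<bar> * \<bar>G $ i $ k\<bar>" by (simp add: power2_eq_square)
      also have "\<dots> \<le> (a4 * \<eta>) * 1" using small[OF that] one by (intro mult_mono) auto
      finally show ?thesis by simp
    qed
    have rowsq: "\<bar>(\<Sum>k\<in>UNIV. (G $ i $ k)\<^sup>2) - 1\<bar> \<le> \<eta>" for i
      using GG[rule_format, of i i] by (simp add: power2_eq_square)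
    \<comment> \<open>A row missed by \<open>p\<close> would contain only small entries, at most
      \<open>1 / (2 * d)\<close> each, hence have squared norm at most \<open>1 / (4 * d)\<close>,
      against a norm close to 1.\<close>
    have "surj p"
    proof (rule ccontr)
      assume "\<not> surj p"
      then obtain i where i: "\<And>k. i \<noteq> p k" by (metis surjI)
      have "(G $ i $ k)\<^sup>2 \<le> (1 / (2 * d))\<^sup>2" for k
        using power_mono[OF order_trans[OF small[OF i] a4\<eta>] abs_ge_zero, where n = 2] by simp
      then have "(\<Sum>k\<in>UNIV. (G $ i $ k)\<^sup>2) \<le> d * (1 / (2 * d))\<^sup>2"
        unfolding d_def using sum_bounded_above[of UNIV "\<lambda>k. (G $ i $ k)\<^sup>2"] by simp
      also have "\<dots> = 1 / (4 * d)" using d by (simp add: power2_eq_square field_simps)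
      also have "\<dots> < 1/2" using d by (simp add: field_simps)
      finally have "(\<Sum>k\<in>UNIV. (G $ i $ k)\<^sup>2) < 1/2" .
      moreover have "1/2 \<le> (\<Sum>k\<in>UNIV. (G $ i $ k)\<^sup>2)"
      proof -
        have "\<eta> \<le> 1/2" using \<eta>(2) by (simp add: \<eta>0_def)
        then show ?thesis using rowsq[of i] by linarith
      qed
      ultimately show False by simp
    qed
    then have bij: "bij p" by (simp add: bij_def finite_UNIV_surj_inj)
    then have perm: "p permutes UNIV" by (auto intro: bij_imp_permutes)
    define s where "s = (\<lambda>k. if 0 \<le> G $ p k $ k then 1 else (-1::real))"
    have diag: "\<bar>G $ p k $ k - s k\<bar> \<le> (1 + d * a4) * \<eta>" for k
    proof -
      have split: "(\<Sum>l\<in>UNIV. (G $ p k $ l)\<^sup>2) = (G $ p k $ k)\<^sup>2 + (\<Sum>l\<in>UNIV - {k}. (G $ p k $ l)\<^sup>2)"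
        by (simp add: sum.remove)
      have "(\<Sum>l\<in>UNIV - {k}. (G $ p k $ l)\<^sup>2) \<le> (\<Sum>l\<in>UNIV - {k}. a4 * \<eta>)"
        using bij by (intro sum_mono sq) (auto simp: bij_def inj_eq)
      also have "\<dots> \<le> d * (a4 * \<eta>)"
        using a \<eta> by (auto simp: d_def intro!: mult_right_mono card_mono)
      finally have "\<bar>(G $ p k $ k)\<^sup>2 - 1\<bar> \<le> \<eta> + d * (a4 * \<eta>)"
        using split rowsq[of "p k"] sum_nonneg[of "UNIV - {k}" "\<lambda>l. (G $ p k $ l)\<^sup>2"] by auto
      \<comment> \<open>A number and its sign add up to at least 1 in absolute value, so the
        distance to the sign is at most the distance of the square to 1.\<close>
      moreover have "\<bar>G $ p k $ k - s k\<bar> \<le> \<bar>(G $ p k $ k)\<^sup>2 - 1\<bar>"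
      proof -
        define x where "x = G $ p k $ k"
        have "\<bar>x\<^sup>2 - 1\<bar> = \<bar>x - s k\<bar> * \<bar>x + s k\<bar>"
          by (simp add: s_def abs_mult[symmetric] power2_eq_square algebra_simps)
        moreover have "1 \<le> \<bar>x + s k\<bar>" unfolding s_def x_def[symmetric] by auto
        ultimately show ?thesis unfolding x_def[symmetric]
          using mult_left_mono[of 1 "\<bar>x + s k\<bar>" "\<bar>x - s k\<bar>"] by simp
      qed
      ultimately show ?thesis by (simp add: algebra_simps)
    qed
    show "\<exists>p s. p permutes UNIV \<and> (\<forall>k. s k \<in> {1, -1}) \<and>
       (\<forall>i k. \<bar>G $ i $ k - (if i = p k then s k else 0)\<bar> \<le> c * \<eta>)"
    proof (intro exI[of _ p] exI[of _ s] conjI perm allI)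
      show "s k \<in> {1, -1}" for k by (simp add: s_def)
      fix i k
      have c1: "(1 + d * a4) * \<eta> \<le> c * \<eta>" "a4 * \<eta> \<le> c * \<eta>"
        using a d \<eta> by (auto simp: c_def intro!: mult_right_mono)
      show "\<bar>G $ i $ k - (if i = p k then s k else 0)\<bar> \<le> c * \<eta>"
        using diag[of k] small[of i k] c1 by (cases "i = p k") auto
    qed
  qed
qed

section \<open>Stability of the contrast minimisers\<close>

text \<open>The moments of an orthogonal law after its coordinates are scaled to unit second
  moments; \<kappa> collects the standardised third moments. The value 0 for other word lengths is a
  mere default.\<close>

definition unit_mom :: "('d \<Rightarrow> real) \<Rightarrow> 'd list \<Rightarrow> real" where
  "unit_mom \<kappa> w = (case w of [i, j] \<Rightarrow> of_bool (i = j) | [i, j, k] \<Rightarrow> of_bool (i = j \<and> j = k) * \<kappa> i | _ \<Rightarrow> 0)"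

text \<open>The contrast with its normalising factors left out, as a function of an arbitrary moment
  functional. In the third-order part the last index is free, because it only selects one of the
  matrices.\<close>

definition offdiag_energy :: "('d::finite list \<Rightarrow> real) \<Rightarrow> real" where
  "offdiag_energy t = (\<Sum>i\<in>UNIV. \<Sum>j\<in>UNIV. of_bool (i \<noteq> j) * (t [i, j])\<^sup>2) +
     (\<Sum>n\<in>UNIV. \<Sum>i\<in>UNIV. \<Sum>j\<in>UNIV. of_bool (i \<noteq> j) * (t [i, j, n])\<^sup>2)"

definition sym_mom :: "('d::finite list \<Rightarrow> real) \<Rightarrow> real^'d^'d" where
  "sym_mom m = (\<chi> i j. (m [i, j] + m [j, i]) / 2)"

definition signed_perm :: "('d::finite \<Rightarrow> 'd) \<Rightarrow> ('d \<Rightarrow> real) \<Rightarrow> real^'d^'d" where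
  "signed_perm p s = (\<chi> i k. if i = p k then s k else 0)"

lemma unit_mom_simps [simp]:
  "unit_mom \<kappa> [i, j] = of_bool (i = j)" "unit_mom \<kappa> [i, j, k] = of_bool (i = j \<and> j = k) * \<kappa> i"
  by (auto simp: unit_mom_def)

lemma lin_mom_sum:
  "lin_mom B (\<lambda>v. \<Sum>l\<in>S. c l * m l v) w = (\<Sum>l\<in>S. c l * lin_mom B (m l) w)"
proof (induction w arbitrary: m)
  case (Cons i w)
  have "lin_mom B (\<lambda>v. \<Sum>l\<in>S. c l * m l v) (i # w) = (\<Sum>k\<in>UNIV. \<Sum>l\<in>S. B $ i $ k * (c l * lin_mom B (\<lambda>v. m l (k # v)) w))"
    by (simp add: Cons.IH[of "\<lambda>l v. m l (_ # v)"] sum_distrib_left)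
  also have "\<dots> = (\<Sum>l\<in>S. \<Sum>k\<in>UNIV. B $ i $ k * (c l * lin_mom B (\<lambda>v. m l (k # v)) w))"
    by (rule sum.swap)
  also have "\<dots> = (\<Sum>l\<in>S. c l * lin_mom B (m l) (i # w))"
    by (simp add: sum_distrib_left mult_ac)
  finally show ?case .
qed simp

lemma lin_mom_comp: "lin_mom B (lin_mom A m) w = lin_mom (B ** A) m w"
proof (induction w arbitrary: m)
  case (Cons i w)
  have "lin_mom B (lin_mom A m) (i # w) = (\<Sum>k\<in>UNIV. B $ i $ k * lin_mom B (\<lambda>v. \<Sum>l\<in>UNIV. A $ k $ l * lin_mom A (\<lambda>u. m (l # u)) v) w)"
    by simp
  also have "\<dots> = (\<Sum>k\<in>UNIV. \<Sum>l\<in>UNIV. B $ i $ k * A $ k $ l * lin_mom (B ** A) (\<lambda>u. m (l # u)) w)"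
    unfolding lin_mom_sum by (simp add: Cons.IH sum_distrib_left mult.assoc)
  also have "\<dots> = (\<Sum>l\<in>UNIV. \<Sum>k\<in>UNIV. B $ i $ k * A $ k $ l * lin_mom (B ** A) (\<lambda>u. m (l # u)) w)"
    by (rule sum.swap)
  also have "\<dots> = lin_mom (B ** A) m (i # w)"
    by (simp add: matrix_matrix_mult_def sum_distrib_right)
  finally show ?case .
qed simp

lemma lin_mom_unit2: "lin_mom G (unit_mom \<kappa>) [i, j] = (\<Sum>k\<in>UNIV. G $ i $ k * G $ j $ k)"
  by (simp add: of_bool_def if_distrib cong: if_cong)

lemma lin_mom_unit3: "lin_mom G (unit_mom \<kappa>) [i, j, n] = (\<Sum>k\<in>UNIV. \<kappa> k * (G $ i $ k * (G $ j $ k * G $ n $ k)))"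
proof -
  have "lin_mom G (unit_mom \<kappa>) [i, j, n] =
     (\<Sum>k\<in>UNIV. G $ i $ k * (\<Sum>l\<in>UNIV. G $ j $ l * (\<Sum>q\<in>UNIV. G $ n $ q * (of_bool (k = l \<and> l = q) * \<kappa> k))))"
    by simp
  also have "\<dots> = (\<Sum>k\<in>UNIV. G $ i $ k * (\<Sum>l\<in>UNIV. if k = l then G $ j $ l * (G $ n $ l * \<kappa> k) else 0))"
  proof (intro sum.cong refl arg_cong2[where f = "(*)"])
    fix k l
    have "(\<Sum>q\<in>UNIV. G $ n $ q * (of_bool (k = l \<and> l = q) * \<kappa> k)) = (\<Sum>q\<in>UNIV. if q = l then (if k = l then G $ n $ l * \<kappa> k else 0) else 0)"
      by (intro sum.cong) auto
    then show "G $ j $ l * (\<Sum>q\<in>UNIV. G $ n $ q * (of_bool (k = l \<and> l = q) * \<kappa> k)) = (if k = l then G $ j $ l * (G $ n $ l * \<kappa> k) else 0)"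
      by simp
  qed
  also have "\<dots> = (\<Sum>k\<in>UNIV. \<kappa> k * (G $ i $ k * (G $ j $ k * G $ n $ k)))"
    by (simp add: mult_ac)
  finally show ?thesis .
qed

lemma offdiag_energy_ge:
  assumes "i \<noteq> j"
  shows "(t [i, j])\<^sup>2 \<le> offdiag_energy t" "(t [i, j, n])\<^sup>2 \<le> offdiag_energy t"
proof -
  have nn: "0 \<le> (\<Sum>i\<in>UNIV. \<Sum>j\<in>UNIV. of_bool (i \<noteq> j) * (t [i, j])\<^sup>2)"
    "\<And>n. 0 \<le> (\<Sum>i\<in>UNIV. \<Sum>j\<in>UNIV. of_bool (i \<noteq> j) * (t [i, j, n])\<^sup>2)"
    by (intro sum_nonneg; simp)+
  have le: "x i j \<le> (\<Sum>i\<in>UNIV. \<Sum>j\<in>UNIV. x i j)" if "\<And>i j. 0 \<le> x i j" for x :: "'a \<Rightarrow> 'a \<Rightarrow> real" and i j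
    by (rule order_trans[OF member_le_sum[of j UNIV "x i"] member_le_sum[of i UNIV "\<lambda>i. \<Sum>j\<in>UNIV. x i j"]])
       (auto intro: sum_nonneg that)
  have "(t [i, j])\<^sup>2 \<le> (\<Sum>i\<in>UNIV. \<Sum>j\<in>UNIV. of_bool (i \<noteq> j) * (t [i, j])\<^sup>2)"
    using le[of "\<lambda>i j. of_bool (i \<noteq> j) * (t [i, j])\<^sup>2" i j] assms by simp
  then show "(t [i, j])\<^sup>2 \<le> offdiag_energy t"
    unfolding offdiag_energy_def using sum_nonneg[of UNIV "\<lambda>n. \<Sum>i\<in>UNIV. \<Sum>j\<in>UNIV. of_bool (i \<noteq> j) * (t [i, j, n])\<^sup>2"] nn(2)
    by fastforce
  have "(t [i, j, n])\<^sup>2 \<le> (\<Sum>i\<in>UNIV. \<Sum>j\<in>UNIV. of_bool (i \<noteq> j) * (t [i, j, n])\<^sup>2)"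
    using le[of "\<lambda>i j. of_bool (i \<noteq> j) * (t [i, j, n])\<^sup>2" i j] assms by simp
  also have "\<dots> \<le> (\<Sum>n\<in>UNIV. \<Sum>i\<in>UNIV. \<Sum>j\<in>UNIV. of_bool (i \<noteq> j) * (t [i, j, n])\<^sup>2)"
    by (rule member_le_sum) (use nn in auto)
  finally show "(t [i, j, n])\<^sup>2 \<le> offdiag_energy t" unfolding offdiag_energy_def using nn(1) by linarith
qed

lemma offdiag_energy_le:
  fixes t :: "'d::finite list \<Rightarrow> real"
  assumes "\<And>i j. i \<noteq> j \<Longrightarrow> \<bar>t [i, j]\<bar> \<le> e" "\<And>i j n. i \<noteq> j \<Longrightarrow> \<bar>t [i, j, n]\<bar> \<le> e" "0 \<le> e"
  shows "offdiag_energy t \<le> (2 * (real CARD('d))^2 * e)\<^sup>2"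
proof -
  define d where "d = real CARD('d)"
  have d: "1 \<le> d" by (simp add: d_def Suc_leI)
  have le: "(\<Sum>i\<in>UNIV. \<Sum>j\<in>UNIV. of_bool (i \<noteq> j) * (u i j)\<^sup>2) \<le> d^2 * e^2"
    if "\<And>i j. i \<noteq> j \<Longrightarrow> \<bar>u i j\<bar> \<le> e" for u :: "'d \<Rightarrow> 'd \<Rightarrow> real"
  proof -
    have "(\<Sum>i\<in>UNIV. \<Sum>j\<in>UNIV. of_bool (i \<noteq> j) * (u i j)\<^sup>2) \<le> (\<Sum>i\<in>(UNIV::'d set). \<Sum>j\<in>(UNIV::'d set). e^2)"
      using power_mono[OF that, of _ _ 2] by (intro sum_mono) auto
    then show ?thesis by (simp add: d_def power2_eq_square)
  qed
  have "(\<Sum>n\<in>UNIV. \<Sum>i\<in>UNIV. \<Sum>j\<in>UNIV. of_bool (i \<noteq> j) * (t [i, j, n])\<^sup>2) \<le> (\<Sum>n\<in>(UNIV::'d set). d^2 * e^2)"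
    by (intro sum_mono le) (use assms in auto)
  then have "offdiag_energy t \<le> d^2 * e^2 + d * (d^2 * e^2)"
    unfolding offdiag_energy_def using le[of "\<lambda>i j. t [i, j]"] assms by (simp add: d_def)
  also have "\<dots> \<le> (2 * d^2 * e)\<^sup>2"
  proof -
    have "d^2 \<le> d^4" "d^3 \<le> d^4" using d by (auto intro: power_increasing)
    then have "d^2 * e^2 \<le> d^4 * e^2" "d^3 * e^2 \<le> d^4 * e^2" by (auto intro: mult_right_mono)
    moreover have "0 \<le> d^4 * e^2" by simp
    moreover have "(2 * d^2 * e)\<^sup>2 = 4 * (d^4 * e^2)" by (simp add: power_mult_distrib)
    moreover have "d * (d^2 * e^2) = d^3 * e^2" by (simp add: power3_eq_cube power2_eq_square)
    ultimately show ?thesis by linarith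
  qed
  finally show ?thesis by (simp add: d_def)
qed

text \<open>A quadratic form only sees the symmetric part of its matrix. Hence whitening by the
  symmetrised second moments fixes the values at words \<open>[i, i]\<close>, although
  \<open>m [i, j]\<close> and \<open>m [j, i]\<close> may differ.\<close>

lemma lin_mom_sym_diag:
  "lin_mom B m [i, i] = (B ** sym_mom m ** transpose B) $ i $ i"
proof -
  define X where "X = (\<Sum>k\<in>UNIV. \<Sum>l\<in>UNIV. B $ i $ k * (B $ i $ l * m [k, l]))"
  define Y where "Y = (\<Sum>k\<in>UNIV. \<Sum>l\<in>UNIV. B $ i $ k * (B $ i $ l * m [l, k]))"
  have XY: "X = Y" unfolding X_def Y_def by (subst sum.swap) (simp add: mult_ac)
  have "lin_mom B m [i, i] = X" by (simp add: X_def sum_distrib_left)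
  also have "X = (X + Y) / 2" using XY by simp
  also have "\<dots> = (\<Sum>k\<in>UNIV. \<Sum>l\<in>UNIV. B $ i $ k * (B $ i $ l * ((m [k, l] + m [l, k]) / 2)))"
    unfolding X_def Y_def sum.distrib[symmetric] sum_divide_distrib
    by (intro sum.cong refl) (simp add: algebra_simps add_divide_distrib)
  also have "\<dots> = (\<Sum>l\<in>UNIV. \<Sum>k\<in>UNIV. B $ i $ k * (B $ i $ l * ((m [k, l] + m [l, k]) / 2)))"
    by (rule sum.swap)
  also have "\<dots> = (B ** sym_mom m ** transpose B) $ i $ i"
    unfolding matrix_matrix_mult_def transpose_def sym_mom_def
    by (simp only: vec_lambda_beta sum_distrib_right) (intro sum.cong refl, simp)
  finally show ?thesis .
qed

text \<open>A unit row forces the spectral norm to be at least 1, so the bound on the condition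
  number is also a bound on the norm of the inverse.\<close>

lemma Xi1_bounds:
  fixes \<theta> :: "real^'d^'d::finite"
  assumes "\<theta> \<in> Xi1 \<kappa>0" "0 < \<kappa>0"
  shows "norm \<theta> \<le> real CARD('d)" "norm v \<le> \<kappa>0 * norm (\<theta> *v v)"
proof -
  have rows: "\<And>i. norm (\<theta> $ i) = 1" and inv: "invertible \<theta>" and c: "cond2 \<theta> \<le> \<kappa>0"
    using assms by (auto simp: Xi1_def GL_def)
  have "norm \<theta> \<le> (\<Sum>i\<in>UNIV. norm (\<theta> $ i))" unfolding norm_vec_def by (rule L2_set_le_sum) simp
  then show "norm \<theta> \<le> real CARD('d)" by (simp add: rows)
  have bl: "bounded_linear ((*v) M)" for M :: "real^'d^'d" by simp
  let ?i = "undefined :: 'd"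
  have "1 = (\<theta> *v (\<theta> $ ?i)) $ ?i" using rows[of ?i] by (simp add: matrix_vector_mul_component norm_eq_1)
  also have "\<dots> \<le> norm (\<theta> *v (\<theta> $ ?i))" using component_le_norm_cart[of "\<theta> *v (\<theta> $ ?i)" ?i] by linarith
  also have "\<dots> \<le> onorm ((*v) \<theta>) * norm (\<theta> $ ?i)" by (rule onorm[OF bl])
  finally have 1: "1 \<le> spectral_norm \<theta>" by (simp add: rows spectral_norm_def)
  have "0 \<le> spectral_norm (matrix_inv \<theta>)" unfolding spectral_norm_def by (rule onorm_pos_le[OF bl])
  then have "spectral_norm (matrix_inv \<theta>) \<le> cond2 \<theta>" unfolding cond2_def using 1 mult_right_mono by fastforce
  then have k: "onorm ((*v) (matrix_inv \<theta>)) \<le> \<kappa>0" using c by (simp add: spectral_norm_def)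
  have "norm v = norm (matrix_inv \<theta> *v (\<theta> *v v))"
    using inv by (simp add: matrix_vector_mul_assoc matrix_inv_left)
  also have "\<dots> \<le> onorm ((*v) (matrix_inv \<theta>)) * norm (\<theta> *v v)" by (rule onorm[OF bl])
  also have "\<dots> \<le> \<kappa>0 * norm (\<theta> *v v)" using k by (rule mult_right_mono) simp
  finally show "norm v \<le> \<kappa>0 * norm (\<theta> *v v)" .
qed

lemma orthogonal_in_Xi1:
  fixes Q :: "real^'d^'d::finite"
  assumes "orthogonal_matrix Q" "1 \<le> \<kappa>0"
  shows "Q \<in> Xi1 \<kappa>0"
proof -
  have Q: "transpose Q ** Q = mat 1" "Q ** transpose Q = mat 1"
    using assms(1) by (auto simp: orthogonal_matrix_def)
  have n: "norm (Q *v v) = norm v" for v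
    using assms(1) by (metis orthogonal_transformation orthogonal_transformation_matrix matrix_of_matrix_vector_mul matrix_vector_mul_linear)
  have nt: "norm (transpose Q *v v) = norm v" for v
    using assms(1) by (metis orthogonal_matrix_transpose orthogonal_transformation orthogonal_transformation_matrix matrix_of_matrix_vector_mul matrix_vector_mul_linear)
  have inv: "invertible Q" using Q by (auto simp: invertible_def)
  have qi: "matrix_inv Q = transpose Q" by (rule matrix_inv_unique) (rule Q)+
  have "norm (Q $ i) = 1" for i
  proof -
    have "(Q ** transpose Q) $ i $ i = Q $ i \<bullet> Q $ i"
      by (simp add: matrix_matrix_mult_def transpose_def inner_vec_def)
    then show ?thesis using Q by (simp add: mat_def norm_eq_1)
  qed
  moreover have "spectral_norm Q \<le> 1" "spectral_norm (transpose Q) \<le> 1"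
    unfolding spectral_norm_def by (rule onorm_bound; simp add: n nt del: transpose_matrix_vector)+
  moreover have "0 \<le> spectral_norm (transpose Q)" unfolding spectral_norm_def by (rule onorm_pos_le) simp
  ultimately have "cond2 Q \<le> 1 * 1" unfolding cond2_def qi by (intro mult_mono) auto
  then show ?thesis using \<open>\<And>i. norm (Q $ i) = 1\<close> inv assms(2) by (simp add: Xi1_def GL_def)
qed

text \<open>The transposed \<open>Q = R\<^sub>* A\<close> is the competitor that is plugged into the minimality of \<open>\<theta>\<close>; it lies
  in \<open>Xi1\<close> because it is orthogonal.\<close>

theorem contrast_minimisers_near_signed_permutations:
  fixes A :: "real^'d^'d::finite" and \<kappa> :: "'d \<Rightarrow> real"
  assumes A: "invertible A" and \<kappa>: "card {k. \<kappa> k = 0} \<le> 1" and \<kappa>0: "1 \<le> \<kappa>0"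
  shows "\<exists>c>0. \<exists>\<eta>0>0. \<exists>Q. orthogonal_matrix Q \<and> (\<forall>m \<eta>. 0 \<le> \<eta> \<and> \<eta> \<le> \<eta>0 \<and>
      (\<forall>w. length w \<in> {2, 3} \<longrightarrow> \<bar>m w - lin_mom A (unit_mom \<kappa>) w\<bar> \<le> \<eta>) \<longrightarrow>
      posdef (sym_mom m) \<and>
      (\<forall>R \<theta>. posdef R \<and> R ** R = matrix_inv (sym_mom m) \<and> \<theta> \<in> Xi1 \<kappa>0 \<longrightarrow>
         (\<forall>i. lin_mom (\<theta> ** R) m [i, i] = 1) \<and>
         (offdiag_energy (lin_mom (\<theta> ** R) m) \<le> offdiag_energy (lin_mom (Q ** R) m) \<longrightarrow>
         (\<exists>p s. p permutes UNIV \<and> (\<forall>k. s k \<in> {1, -1}) \<and>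
            norm (\<theta> ** R ** A - signed_perm p s) \<le> c * \<eta>))))"
proof -
  define d where "d = real CARD('d)"
  have d: "1 \<le> d" by (simp add: d_def Suc_leI)
  define Cs where "Cs = A ** transpose A"
  have trCs: "transpose Cs = Cs" by (simp add: Cs_def matrix_transpose_mul)
  have Cs_entry: "Cs $ i $ j = lin_mom A (unit_mom \<kappa>) [i, j]" for i j
    unfolding lin_mom_unit2 by (simp add: Cs_def matrix_matrix_mult_def transpose_def)
  have "posdef Cs" unfolding posdef_def
  proof (intro conjI allI impI trCs)
    fix v :: "real^'d" assume v: "v \<noteq> 0"
    have i: "invertible (transpose A)" by (rule invertible_transpose[OF A])
    have "transpose A *v v \<noteq> 0"
    proof
      assume "transpose A *v v = 0"
      then have "matrix_inv (transpose A) *v (transpose A *v v) = 0" by simp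
      then show False using v by (simp add: matrix_vector_mul_assoc matrix_inv_left[OF i] del: transpose_matrix_vector)
    qed
    moreover have "v \<bullet> (Cs *v v) = (transpose A *v v) \<bullet> (transpose A *v v)"
      unfolding Cs_def matrix_vector_mul_assoc[symmetric] by (metis dot_lmul_matrix vector_transpose_matrix transpose_transpose)
    ultimately show "0 < v \<bullet> (Cs *v v)" by simp
  qed
  then obtain c0 where c0: "0 < c0" "\<And>v. c0 * (norm v)\<^sup>2 \<le> v \<bullet> (Cs *v v)" using posdef_lower_bound by blast
  obtain Rs where Rs: "posdef Rs" "Rs ** Rs = matrix_inv Cs"
    using posdef_sqrt_exists[OF posdef_matrix_inv[OF \<open>posdef Cs\<close>]] by blast
  obtain r0 where r0: "0 < r0" "\<And>v. r0 * (norm v)\<^sup>2 \<le> v \<bullet> (Rs *v v)" using posdef_lower_bound[OF Rs(1)] by blast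
  have Csi: "invertible Cs" by (rule posdef_invertible) fact
  define Q where "Q = transpose (Rs ** A)"
  have Rst: "transpose Rs = Rs" using Rs(1) by (simp add: posdef_def)
  have "Rs ** (Rs ** Cs) = mat 1" using Rs(2) Csi by (simp add: matrix_mul_assoc matrix_inv_left)
  then have "(Rs ** Cs) ** Rs = mat 1" by (simp add: matrix_left_right_inverse)
  then have orthQ: "orthogonal_matrix Q"
    unfolding orthogonal_matrix Q_def by (simp add: matrix_transpose_mul Rst Cs_def matrix_mul_assoc)
  \<comment> \<open>At exact moments the competitor turns the mixing into the identity, and its
    off-diagonal energy is 0.\<close>
  have QRA: "Q ** Rs ** A = mat 1"
    using orthQ unfolding orthogonal_matrix_def Q_def by (simp add: matrix_mul_assoc[symmetric])
  \<comment> \<open>Lipschitz constant of the whitening matrix in the moment error: the norm of a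
    matrix with entries at most \<eta>, then inversion with lower bound \<open>c0 / 2\<close>, then
    the square root with lower bound \<open>r0\<close>.\<close>
  define \<rho> where "\<rho> = (d\<^sup>2 / (c0 / 2))\<^sup>2 * d\<^sup>2 / r0"
  have \<rho>: "0 < \<rho>" using d c0 r0 by (simp add: \<rho>_def)
  obtain a where a: "0 < a" "\<And>v. a * norm v \<le> norm (A *v v)"
  proof (rule that)
    show "0 < 1 / (norm (matrix_inv A) + 1)" by (simp add: add_nonneg_pos)
    fix v
    have "norm v = norm (matrix_inv A *v (A *v v))" using A by (simp add: matrix_vector_mul_assoc matrix_inv_left)
    also have "\<dots> \<le> norm (matrix_inv A) * norm (A *v v)" by (rule norm_matrix_vector_le)
    also have "\<dots> \<le> (norm (matrix_inv A) + 1) * norm (A *v v)" by (intro mult_right_mono) auto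
    finally have "norm v \<le> (norm (matrix_inv A) + 1) * norm (A *v v)" .
    moreover have "0 < norm (matrix_inv A) + 1" by (simp add: add_nonneg_pos)
    ultimately show "1 / (norm (matrix_inv A) + 1) * norm v \<le> norm (A *v v)" by (simp add: divide_le_eq mult.commute)
  qed
  define b where "b = d * (norm Rs + 1)"
  \<comment> \<open>\<open>b\<close> bounds the norm of \<open>T ** R\<close> for \<open>T\<close>
    in \<open>Xi1\<close>, so \<open>d * b\<close> bounds its row sums; each of at most three
    letters costs this factor.\<close>
  define b3 where "b3 = (d * b) ^ 3"
  define \<Gamma> where "\<Gamma> = b * norm A"
  define \<delta>1 where "\<delta>1 = norm Q * \<rho> * norm A"
  define km where "km = (\<Sum>k\<in>UNIV. \<bar>\<kappa> k\<bar>)"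
  define g0 where "g0 = 1 + \<delta>1"
  define b5 where "b5 = d * \<delta>1 * g0 + d * (km * (\<delta>1 * g0 * g0))"
  define b6 where "b6 = 2 * d^2 * (b3 + b5)"
  define g where "g = r0 / 2 / \<kappa>0 * a"
  \<comment> \<open>Roles of the constants just defined: \<open>b5 * \<eta>\<close> bounds the
    off-diagonal exact moments at \<open>Q ** R ** A\<close>, which lies within
    \<open>\<delta>1 * \<eta>\<close> of the identity; \<open>b6\<close> adds the moment error
    \<open>b3\<close> and passes to the root of the energy; \<open>g\<close> multiplies the lower
    bounds of \<open>R\<close>, of a matrix in \<open>Xi1\<close> and of \<open>A\<close>.\<close>
  have b: "1 \<le> b" using d mult_mono[of 1 d 1 "norm Rs + 1"] by (simp add: b_def)
  have db: "1 \<le> d * b" using mult_mono[of 1 d 1 b] d b by simp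
  have b3: "1 \<le> b3" unfolding b3_def by (rule one_le_power[OF db])
  have \<delta>1: "0 \<le> \<delta>1" using \<rho> by (simp add: \<delta>1_def)
  have km: "0 \<le> km" "\<And>k. \<bar>\<kappa> k\<bar> \<le> km" unfolding km_def by (auto intro!: sum_nonneg member_le_sum)
  have b5: "0 \<le> b5" using d \<delta>1 km by (simp add: b5_def g0_def)
  have b6: "0 \<le> b6" using b3 b5 by (simp add: b6_def)
  have \<Gamma>: "0 \<le> \<Gamma>" using b by (simp add: \<Gamma>_def)
  have g: "0 < g" using r0 a \<kappa>0 by (simp add: g_def)
  obtain c \<eta>1 where c: "0 < c" "0 < \<eta>1" "\<And>G \<eta>. 0 \<le> \<eta> \<and> \<eta> \<le> \<eta>1 \<and> (\<forall>i k. \<bar>G $ i $ k\<bar> \<le> \<Gamma>) \<and>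
     (\<forall>v. g * norm v \<le> norm (G *v v)) \<and>
     (\<forall>i j. \<bar>(\<Sum>k\<in>UNIV. G $ i $ k * G $ j $ k) - of_bool (i = j)\<bar> \<le> \<eta>) \<and>
     (\<forall>i j n. i \<noteq> j \<longrightarrow> \<bar>\<Sum>k\<in>UNIV. \<kappa> k * (G $ i $ k * (G $ j $ k * G $ n $ k))\<bar> \<le> \<eta>) \<Longrightarrow>
     (\<exists>p s. p permutes UNIV \<and> (\<forall>k. s k \<in> {1, -1}) \<and>
       (\<forall>i k. \<bar>G $ i $ k - (if i = p k then s k else 0)\<bar> \<le> c * \<eta>))"
    using near_signed_permutation[OF \<kappa> g \<Gamma>] by blast
  define b7 where "b7 = b3 + b6"
  have b7: "0 < b7" using b3 b6 by (simp add: b7_def)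
  \<comment> \<open>The second cap keeps half of the lower bound of the second-moment matrix; the
    two caps with \<rho> keep \<open>R\<close> within norm 1 of \<open>Rs\<close> and with half of
    its lower bound; the last one makes \<open>near_signed_permutation\<close> applicable with error
    \<open>b7 * \<eta>\<close>.\<close>
  define \<eta>0 where "\<eta>0 = min (min 1 (c0 / 2 / d\<^sup>2)) (min (min (1 / \<rho>) (r0 / 2 / \<rho>)) (\<eta>1 / b7))"
  have \<eta>0: "0 < \<eta>0" using c0 d \<rho> r0 c b7 by (simp add: \<eta>0_def)
  define cc where "cc = d\<^sup>2 * (c * b7)"
  have cc: "0 < cc" using d c b7 by (simp add: cc_def)
  show ?thesis
  proof (rule exI[of _ cc], rule conjI[OF cc], rule exI[of _ \<eta>0], rule conjI[OF \<eta>0], rule exI[of _ Q],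
      rule conjI[OF orthQ], intro allI impI conjI)
    fix m :: "'d list \<Rightarrow> real" and \<eta> :: real
    assume "0 \<le> \<eta> \<and> \<eta> \<le> \<eta>0 \<and> (\<forall>w. length w \<in> {2, 3} \<longrightarrow> \<bar>m w - lin_mom A (unit_mom \<kappa>) w\<bar> \<le> \<eta>)"
    then have \<eta>: "0 \<le> \<eta>" "\<eta> \<le> \<eta>0" and mw: "\<And>w. length w \<in> {2, 3} \<Longrightarrow> \<bar>m w - lin_mom A (unit_mom \<kappa>) w\<bar> \<le> \<eta>" by auto
    have \<eta>1: "\<eta> \<le> 1" "\<eta> * d\<^sup>2 \<le> c0 / 2" "\<rho> * \<eta> \<le> 1" "\<rho> * \<eta> \<le> r0 / 2" "b7 * \<eta> \<le> \<eta>1"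
      using \<eta>(2) d \<rho> b7 by (auto simp: \<eta>0_def field_simps)
    define C where "C = sym_mom m"
    have ent: "\<bar>(C - Cs) $ i $ j\<bar> \<le> \<eta>" for i j
    proof -
      have "Cs $ j $ i = Cs $ i $ j" using trCs by (metis transpose_def vec_lambda_beta)
      moreover have "2 * (C - Cs) $ i $ j = m [i, j] + m [j, i] - 2 * Cs $ i $ j"
        by (simp add: C_def sym_mom_def field_simps)
      moreover have "\<bar>m [i, j] - Cs $ i $ j\<bar> \<le> \<eta>" "\<bar>m [j, i] - Cs $ j $ i\<bar> \<le> \<eta>"
        unfolding Cs_entry by (rule mw; simp)+
      ultimately show ?thesis by linarith
    qed
    have nC: "norm (C - Cs) \<le> d\<^sup>2 * \<eta>" unfolding d_def by (rule norm_le_entries[OF ent])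
    have low: "c0 / 2 * (norm v)\<^sup>2 \<le> v \<bullet> (C *v v)" for v
    proof -
      have "\<bar>v \<bullet> ((C - Cs) *v v)\<bar> \<le> norm v * (norm (C - Cs) * norm v)"
        by (rule order_trans[OF Cauchy_Schwarz_ineq2 mult_left_mono[OF norm_matrix_vector_le]]) simp
      also have "\<dots> \<le> norm v * (c0 / 2 * norm v)"
        using nC \<eta>1(2) by (intro mult_left_mono mult_right_mono) (auto simp: mult.commute)
      finally have "\<bar>v \<bullet> ((C - Cs) *v v)\<bar> \<le> c0 / 2 * (norm v)\<^sup>2" by (simp add: power2_eq_square mult.left_commute)
      moreover have "v \<bullet> (C *v v) = v \<bullet> (Cs *v v) + v \<bullet> ((C - Cs) *v v)"
        by (simp add: matrix_vector_mult_diff_rdistrib inner_diff_right)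
      ultimately show ?thesis using c0(2)[of v] by linarith
    qed
    have trC: "transpose C = C" by (simp add: C_def sym_mom_def transpose_def vec_eq_iff add.commute)
    have "posdef C" unfolding posdef_def
    proof (intro conjI allI impI trC)
      fix v :: "real^'d" assume "v \<noteq> 0"
      then have "0 < c0 / 2 * (norm v)\<^sup>2" using c0 by simp
      then show "0 < v \<bullet> (C *v v)" using low[of v] by linarith
    qed
    then show "posdef (sym_mom m)" by (simp add: C_def)
    have c2: "0 < c0 / 2" using c0 by simp
    have "c0 / 2 * (norm v)\<^sup>2 \<le> v \<bullet> (Cs *v v)" for v
      using c0 by (intro order_trans[OF _ c0(2)] mult_right_mono) auto
    then have inv_diff: "norm (matrix_inv Cs - matrix_inv C) \<le> (d\<^sup>2 / (c0 / 2))\<^sup>2 * (d\<^sup>2 * \<eta>)"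
      using matrix_inv_diff_le[OF c2 lower_bound_norm[of "c0 / 2" Cs] lower_bound_norm[of "c0 / 2" C]] low nC c0 d
      by (auto simp: d_def norm_minus_commute intro: order_trans mult_left_mono)
    fix R \<theta> :: "real^'d^'d"
    assume "posdef R \<and> R ** R = matrix_inv (sym_mom m) \<and> \<theta> \<in> Xi1 \<kappa>0"
    then have R: "posdef R" "R ** R = matrix_inv C" and \<theta>: "\<theta> \<in> Xi1 \<kappa>0" by (auto simp: C_def)
    have Rt: "transpose R = R" and Rnn: "0 \<le> v \<bullet> (R *v v)" for v
      using R(1) by (auto simp: posdef_def) (cases "v = 0", auto intro: less_imp_le)
    have Rd: "norm (R - Rs) \<le> \<rho> * \<eta>"
    proof -
      have "r0 * norm (Rs - R) \<le> norm (matrix_inv Cs - matrix_inv C)"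
        using sqrt_lipschitz[OF Rst r0(2) Rt Rnn] Rs(2) R(2) by simp
      then have "r0 * norm (Rs - R) \<le> (d\<^sup>2 / (c0 / 2))\<^sup>2 * (d\<^sup>2 * \<eta>)" using inv_diff by linarith
      then have "norm (Rs - R) \<le> ((d\<^sup>2 / (c0 / 2))\<^sup>2 * (d\<^sup>2 * \<eta>)) / r0"
        unfolding pos_le_divide_eq[OF r0(1)] by (simp only: mult.commute[of _ r0])
      then show ?thesis
        unfolding \<rho>_def by (simp only: norm_minus_commute[of R] times_divide_eq_left mult.assoc)
    qed
    have nR: "norm R \<le> norm Rs + 1" using Rd \<eta>1(3) norm_triangle_sub[of R Rs] by linarith
    have lowR: "r0 / 2 * norm v \<le> norm (R *v v)" for v
    proof -
      have "norm (Rs *v v) \<le> norm (R *v v) + norm ((R - Rs) *v v)"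
        using norm_triangle_ineq4[of "R *v v" "(R - Rs) *v v"] by (simp add: matrix_vector_mult_diff_rdistrib)
      moreover have "norm ((R - Rs) *v v) \<le> r0 / 2 * norm v"
        using norm_matrix_vector_le[of "R - Rs" v] Rd \<eta>1(4) mult_right_mono[of "norm (R - Rs)" "r0 / 2" "norm v"] by simp
      moreover have "r0 * norm v \<le> norm (Rs *v v)" by (rule lower_bound_norm[OF r0(2)])
      ultimately show ?thesis by simp
    qed
    have RCR: "R ** C ** R = mat 1"
    proof -
      have "R ** (R ** C) = mat 1"
        using R(2) posdef_invertible[OF \<open>posdef C\<close>] by (simp add: matrix_mul_assoc matrix_inv_left)
      then show ?thesis by (simp add: matrix_left_right_inverse)
    qed
    have nB: "norm (T ** R) \<le> b" if "T \<in> Xi1 \<kappa>0" for T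
      unfolding b_def using Xi1_bounds(1)[OF that] \<kappa>0 nR
      by (intro order_trans[OF norm_matrix_mult_le mult_mono]) (auto simp: d_def)
    have near: "\<bar>lin_mom (T ** R) m w - lin_mom (T ** R ** A) (unit_mom \<kappa>) w\<bar> \<le> b3 * \<eta>"
      if T: "T \<in> Xi1 \<kappa>0" and w: "length w \<in> {2, 3}" for T w
    proof -
      have rs: "(\<Sum>k\<in>UNIV. \<bar>(T ** R) $ i $ k\<bar>) \<le> d * b" for i
        using sum_bounded_above[of UNIV "\<lambda>k. \<bar>(T ** R) $ i $ k\<bar>" b] order_trans[OF abs_entry_le_norm nB[OF T]]
        by (simp add: d_def)
      have "\<bar>lin_mom (T ** R) m w - lin_mom (T ** R) (lin_mom A (unit_mom \<kappa>)) w\<bar> \<le> (d * b) ^ length w * \<eta>"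
        by (rule lin_mom_diff_le[OF rs]) (use mw w in auto)
      also have "\<dots> \<le> b3 * \<eta>"
        unfolding b3_def using w \<eta> db by (intro mult_right_mono power_increasing) auto
      finally show ?thesis unfolding lin_mom_comp .
    qed
    \<comment> \<open>Whitening cancels \<open>R ** C ** R\<close>, so what remains on the diagonal
      are the squared row norms of \<open>T\<close>, which are 1 in \<open>Xi1\<close>.\<close>
    have diag1: "lin_mom (T ** R) m [i, i] = 1" if T: "T \<in> Xi1 \<kappa>0" for T i
    proof -
      have "(T ** R) ** C ** transpose (T ** R) = T ** (R ** C ** R) ** transpose T"
        by (simp add: matrix_transpose_mul Rt matrix_mul_assoc)
      also have "\<dots> = T ** transpose T" by (simp add: RCR)
      finally have "lin_mom (T ** R) m [i, i] = (T ** transpose T) $ i $ i"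
        unfolding lin_mom_sym_diag C_def by simp
      also have "\<dots> = T $ i \<bullet> T $ i" by (simp add: matrix_matrix_mult_def transpose_def inner_vec_def)
      also have "\<dots> = 1" using T by (simp add: Xi1_def norm_eq_1)
      finally show ?thesis .
    qed
    show "lin_mom (\<theta> ** R) m [i, i] = 1" for i by (rule diag1[OF \<theta>])
    assume min: "offdiag_energy (lin_mom (\<theta> ** R) m) \<le> offdiag_energy (lin_mom (Q ** R) m)"
    have QXi: "Q \<in> Xi1 \<kappa>0" by (rule orthogonal_in_Xi1[OF orthQ \<kappa>0])
    define G0 where "G0 = Q ** R ** A"
    have G0: "\<bar>G0 $ i $ j - of_bool (i = j)\<bar> \<le> \<delta>1 * \<eta>" for i j
    proof -
      have "G0 - mat 1 = Q ** (R - Rs) ** A"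
        unfolding G0_def QRA[symmetric] by (simp add: matrix_diff_ldistrib matrix_diff_rdistrib)
      then have "norm (G0 - mat 1) \<le> norm Q * norm (R - Rs) * norm A"
        by (simp only:) (rule order_trans[OF norm_matrix_mult_le mult_right_mono[OF norm_matrix_mult_le norm_ge_zero]])
      also have "\<dots> \<le> norm Q * (\<rho> * \<eta>) * norm A" by (intro mult_right_mono mult_left_mono Rd) auto
      finally have "norm (G0 - mat 1) \<le> \<delta>1 * \<eta>" by (simp add: \<delta>1_def mult_ac)
      then have "\<bar>(G0 - mat 1) $ i $ j\<bar> \<le> \<delta>1 * \<eta>" by (rule order_trans[OF abs_entry_le_norm])
      then show ?thesis by (simp add: mat_def of_bool_def)
    qed
    have G0s: "\<bar>G0 $ i $ j\<bar> \<le> \<delta>1 * \<eta>" if "i \<noteq> j" for i j using G0[of i j] that by simp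
    have G0b: "\<bar>G0 $ i $ j\<bar> \<le> g0" for i j
    proof -
      have "\<delta>1 * \<eta> \<le> \<delta>1 * 1" using \<delta>1 \<eta>1(1) by (intro mult_left_mono) auto
      then show ?thesis using G0[of i j] unfolding g0_def of_bool_def by (auto split: if_splits)
    qed
    have g0: "0 \<le> g0" using \<delta>1 by (simp add: g0_def)
    have \<delta>\<eta>: "0 \<le> \<delta>1 * \<eta>" using \<delta>1 \<eta> by simp
    \<comment> \<open>For \<open>i \<noteq> j\<close> at least one of the two entries is off the
      diagonal of \<open>G0\<close>, hence of order \<eta>; the other is bounded by
      \<open>g0\<close>.\<close>
    have pr: "\<bar>G0 $ i $ k * G0 $ j $ k\<bar> \<le> \<delta>1 * g0 * \<eta>" if "i \<noteq> j" for i j k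
    proof (cases "i = k")
      case True
      then have "\<bar>G0 $ j $ k\<bar> * \<bar>G0 $ i $ k\<bar> \<le> (\<delta>1 * \<eta>) * g0" using that by (intro mult_mono G0s G0b \<delta>\<eta>) auto
      then show ?thesis by (simp add: abs_mult mult_ac)
    next
      case False
      then have "\<bar>G0 $ i $ k\<bar> * \<bar>G0 $ j $ k\<bar> \<le> (\<delta>1 * \<eta>) * g0" by (intro mult_mono G0s G0b \<delta>\<eta>) auto
      then show ?thesis by (simp add: abs_mult mult_ac)
    qed
    have sumle: "\<bar>\<Sum>k\<in>UNIV. x k\<bar> \<le> d * e" if "\<And>k. \<bar>x k\<bar> \<le> e" for x :: "'d \<Rightarrow> real" and e
      using order_trans[OF sum_abs sum_bounded_above[of UNIV "\<lambda>k. \<bar>x k\<bar>" e]] that by (simp add: d_def)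
    have o2: "\<bar>lin_mom G0 (unit_mom \<kappa>) [i, j]\<bar> \<le> b5 * \<eta>" if "i \<noteq> j" for i j
    proof -
      have "\<bar>lin_mom G0 (unit_mom \<kappa>) [i, j]\<bar> \<le> d * (\<delta>1 * g0 * \<eta>)"
        unfolding lin_mom_unit2 by (rule sumle[OF pr[OF that]])
      also have "\<dots> = d * \<delta>1 * g0 * \<eta>" by simp
      also have "\<dots> \<le> b5 * \<eta>"
        unfolding b5_def using d km \<delta>1 g0 by (intro mult_right_mono \<eta>) simp
      finally show ?thesis .
    qed
    have o3: "\<bar>lin_mom G0 (unit_mom \<kappa>) [i, j, n]\<bar> \<le> b5 * \<eta>" if "i \<noteq> j" for i j n
    proof -
      have "\<bar>\<kappa> k * (G0 $ i $ k * (G0 $ j $ k * G0 $ n $ k))\<bar> \<le> km * (\<delta>1 * g0 * \<eta> * g0)" for k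
      proof -
        have "\<bar>G0 $ i $ k * G0 $ j $ k\<bar> * \<bar>G0 $ n $ k\<bar> \<le> \<delta>1 * g0 * \<eta> * g0"
          using \<delta>1 g0 \<eta> by (intro mult_mono pr[OF that] G0b) auto
        then have "\<bar>\<kappa> k\<bar> * (\<bar>G0 $ i $ k * G0 $ j $ k\<bar> * \<bar>G0 $ n $ k\<bar>) \<le> km * (\<delta>1 * g0 * \<eta> * g0)"
          by (rule mult_mono[OF km(2) _ km(1)]) simp
        then show ?thesis by (simp add: abs_mult mult_ac)
      qed
      then have "\<bar>lin_mom G0 (unit_mom \<kappa>) [i, j, n]\<bar> \<le> d * (km * (\<delta>1 * g0 * \<eta> * g0))"
        unfolding lin_mom_unit3 by (rule sumle)
      also have "\<dots> = d * (km * (\<delta>1 * g0 * g0)) * \<eta>" by (simp add: mult_ac)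
      also have "\<dots> \<le> b5 * \<eta>"
        unfolding b5_def using d km \<delta>1 g0 by (intro mult_right_mono \<eta>) simp
      finally show ?thesis .
    qed
    have "offdiag_energy (lin_mom (Q ** R) m) \<le> (2 * (real CARD('d))^2 * ((b3 + b5) * \<eta>))\<^sup>2"
    proof (rule offdiag_energy_le)
      fix i j :: 'd assume ij: "i \<noteq> j"
      show "\<bar>lin_mom (Q ** R) m [i, j]\<bar> \<le> (b3 + b5) * \<eta>"
        using near[OF QXi, of "[i, j]"] o2[OF ij] unfolding G0_def by (simp add: distrib_right del: lin_mom.simps)
      show "\<bar>lin_mom (Q ** R) m [i, j, n]\<bar> \<le> (b3 + b5) * \<eta>" for n
        using near[OF QXi, of "[i, j, n]"] o3[OF ij, of n] unfolding G0_def by (simp add: distrib_right del: lin_mom.simps)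
    qed (use b3 b5 \<eta> in auto)
    \<comment> \<open>Comparison with the competitor transfers its energy bound to \<theta>. From
      here on only the size of the energy at \<theta> matters.\<close>
    then have en: "offdiag_energy (lin_mom (\<theta> ** R) m) \<le> (b6 * \<eta>)\<^sup>2"
      using min by (simp add: b6_def d_def mult_ac)
    define G where "G = \<theta> ** R ** A"
    have t: "\<bar>x\<bar> \<le> b6 * \<eta>" if "x\<^sup>2 \<le> offdiag_energy (lin_mom (\<theta> ** R) m)" for x
      using order_trans[OF that en] b6 \<eta> by (metis abs_le_square_iff abs_of_nonneg mult_nonneg_nonneg)
    have "\<exists>p s. p permutes UNIV \<and> (\<forall>k. s k \<in> {1, -1}) \<and>
       (\<forall>i k. \<bar>G $ i $ k - (if i = p k then s k else 0)\<bar> \<le> c * (b7 * \<eta>))"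
    proof (rule c(3), intro conjI allI impI)
      show "0 \<le> b7 * \<eta>" "b7 * \<eta> \<le> \<eta>1" using b7 \<eta> \<eta>1 by auto
      show "\<bar>G $ i $ k\<bar> \<le> \<Gamma>" for i k
        unfolding G_def \<Gamma>_def
        by (rule order_trans[OF abs_entry_le_norm order_trans[OF norm_matrix_mult_le mult_right_mono[OF nB[OF \<theta>]]]]) simp
      show "g * norm v \<le> norm (G *v v)" for v
      proof -
        have "r0 / 2 * (a * norm v) \<le> r0 / 2 * norm (A *v v)" using a r0 by (intro mult_left_mono) auto
        also have "\<dots> \<le> norm (R *v (A *v v))" by (rule lowR)
        also have "\<dots> \<le> \<kappa>0 * norm (\<theta> *v (R *v (A *v v)))" by (rule Xi1_bounds(2)[OF \<theta>]) (use \<kappa>0 in simp)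
        finally have "r0 / 2 * (a * norm v) \<le> \<kappa>0 * norm (G *v v)" by (simp add: G_def matrix_vector_mul_assoc matrix_mul_assoc)
        then show ?thesis using \<kappa>0 by (simp add: g_def field_simps)
      qed
      show "\<bar>(\<Sum>k\<in>UNIV. G $ i $ k * G $ j $ k) - of_bool (i = j)\<bar> \<le> b7 * \<eta>" for i j
      proof (cases "i = j")
        case True
        then show ?thesis using near[OF \<theta>, of "[i, i]"] diag1[OF \<theta>, of i] b6 \<eta>
          unfolding G_def[symmetric] lin_mom_unit2 b7_def by (simp add: distrib_right del: lin_mom.simps) (smt (verit) mult_nonneg_nonneg)
      next
        case False
        then show ?thesis using near[OF \<theta>, of "[i, j]"] t[OF offdiag_energy_ge(1)[OF False]]
          unfolding G_def[symmetric] lin_mom_unit2 b7_def by (simp add: distrib_right del: lin_mom.simps)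
      qed
      show "\<bar>\<Sum>k\<in>UNIV. \<kappa> k * (G $ i $ k * (G $ j $ k * G $ n $ k))\<bar> \<le> b7 * \<eta>" if ij: "i \<noteq> j" for i j n
        using near[OF \<theta>, of "[i, j, n]"] t[OF offdiag_energy_ge(2)[OF ij, of "lin_mom (\<theta> ** R) m" n]]
        unfolding G_def[symmetric] lin_mom_unit3 b7_def by (simp add: distrib_right del: lin_mom.simps)
    qed
    then obtain p s where ps: "p permutes UNIV" "\<forall>k. s k \<in> {1, -1}"
      "\<And>i k. \<bar>G $ i $ k - (if i = p k then s k else 0)\<bar> \<le> c * (b7 * \<eta>)" by blast
    have "norm (G - signed_perm p s) \<le> (real CARD('d))\<^sup>2 * (c * (b7 * \<eta>))"
      by (rule norm_le_entries) (use ps(3) in \<open>simp add: signed_perm_def\<close>)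
    then show "\<exists>p s. p permutes UNIV \<and> (\<forall>k. s k \<in> {1, -1}) \<and> norm (\<theta> ** R ** A - signed_perm p s) \<le> cc * \<eta>"
      using ps(1,2) unfolding G_def by (intro exI[of _ p] exI[of _ s]) (simp add: cc_def d_def mult_ac)
  qed
qed

section \<open>The contrast as a function of the moments\<close>

lemma dot_lawsD:
  assumes "\<mu> \<in> dot_laws"
  shows "\<mu> \<in> laws" "\<mu> \<in> ac_laws" "length w \<in> {2, 3} \<Longrightarrow> integrable \<mu> (sig w)"
  using assms by (auto simp: dot_laws_def ac_laws_def)

lemma matrix_row_sum_bound: "(\<Sum>k\<in>UNIV. \<bar>B $ i $ k\<bar>) \<le> real CARD('d) * norm (B :: real^'d^'d::finite)"
  using sum_bounded_above[of UNIV "\<lambda>k. \<bar>B $ i $ k\<bar>" "norm B"] abs_entry_le_norm by auto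

lemma esig_pushforward_linear:
  fixes \<mu> :: "'d::finite law"
  assumes "\<mu> \<in> dot_laws" "length w \<in> {2, 3}"
  shows "esig (pushforward ((*v) B) \<mu>) w = lin_mom B (esig \<mu>) w"
  using pushforward_moments(3)[OF assms(1) matrix_row_sum_bound, of "(*v) B" B "\<lambda>u. 0" 0 0 0 w] assms(2) by auto

text \<open>Writing the iterated integral in both orders of integration and adding shows that twice
  its value is the squared increment of the \<open>i\<close>-th component over the unit
  interval.\<close>

lemma sig_diag_nonneg: "0 \<le> sig [i, i] x"
proof (cases "x \<in> ac_paths")
  case True
  let ?a = "\<lambda>t. path_deriv x t $ i"
  let ?X = "\<lambda>t. apply_bcontfun x t $ i"
  have a: "L1_01 ?a" by (rule L1_01_path_deriv[OF True])
  have S: "sig [i, i] x = (LBINT t:{0..1}. ?a t * (LBINT u:{t..1}. ?a u))"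
    by (simp add: sig_eq_simplex_int[OF True])
  have 1: "sig [i, i] x = (LBINT t:{0..1}. ?a t * (?X 1 - ?X t))"
    unfolding S by (rule set_lebesgue_integral_cong) (use path_deriv_ftc[OF True] in auto)
  have 2: "sig [i, i] x = (LBINT t:{0..1}. ?a t * (?X t - ?X 0))"
    unfolding S simplex_int_swap[OF a a order_refl]
    by (rule set_lebesgue_integral_cong) (use path_deriv_ftc[OF True] in auto)
  have bd: "\<bar>?X s - ?X t\<bar> \<le> 2 * norm x" for s t
    using component_le_norm_cart[of "apply_bcontfun x s" i] component_le_norm_cart[of "apply_bcontfun x t" i]
      norm_bounded[of x s] norm_bounded[of x t] by (simp add: vector_component_simps)
  have m: "(\<lambda>t. c - ?X t) \<in> borel_measurable borel" "(\<lambda>t. ?X t - c) \<in> borel_measurable borel" for c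
    by (intro borel_measurable_continuous_onI continuous_intros; simp)+
  have si: "set_integrable lborel {0..1} (\<lambda>t. ?a t * (?X 1 - ?X t))" "set_integrable lborel {0..1} (\<lambda>t. ?a t * (?X t - ?X 0))"
    using L1_01_mult[OF a m(1) bd] L1_01_mult[OF a m(2) bd] by (simp_all add: L1_01_def)
  have "sig [i, i] x + sig [i, i] x = (LBINT t:{0..1}. ?a t * (?X 1 - ?X t) + ?a t * (?X t - ?X 0))"
    by (subst 1, subst 2) (rule set_integral_add(2)[OF si, symmetric])
  also have "\<dots> = (LBINT t:{0..1}. ?a t * (?X 1 - ?X 0))"
    by (rule set_lebesgue_integral_cong) (auto simp: algebra_simps)
  also have "\<dots> = (?X 1 - ?X 0) * (?X 1 - ?X 0)"
    using path_deriv_ftc[OF True, of 0 1] by simp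
  finally show ?thesis by (smt (verit) zero_le_square)
qed (simp add: sig_def)

text \<open>\<open>dot_laws\<close> only asks for nonzero second moments; their sign is what makes
  the square roots in \<open>Nmat\<close> nonzero reals and the weights of the premetric
  positive.\<close>

lemma esig_diag_pos:
  assumes "\<mu> \<in> dot_laws"
  shows "0 < esig \<mu> [i, i]"
proof -
  have "0 \<le> esig \<mu> [i, i]"
    unfolding esig_def by (rule integral_nonneg_AE) (simp add: sig_diag_nonneg)
  moreover have "esig \<mu> [i, i] \<noteq> 0" using assms by (simp add: dot_laws_def)
  ultimately show ?thesis by linarith
qed

lemma Cmat_eq_sym_mom: "Cmat \<mu> = sym_mom (esig \<mu>)"
  by (simp add: Cmat_def sym_mom_def coord0_def transpose_def vec_eq_iff)

lemma Rmat_sqrt: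
  fixes \<mu> :: "'d::finite law"
  assumes "posdef (Cmat \<mu>)"
  shows "posdef (Rmat \<mu>)" "Rmat \<mu> ** Rmat \<mu> = matrix_inv (Cmat \<mu>)"
proof -
  obtain R where R: "posdef R" "R ** R = matrix_inv (Cmat \<mu>)"
    using posdef_sqrt_exists[OF posdef_matrix_inv[OF assms]] by blast
  have "Rmat \<mu> = R"
    unfolding Rmat_def
  proof (rule the_equality)
    show "transpose R = R \<and> (\<forall>v. v \<noteq> 0 \<longrightarrow> 0 < v \<bullet> (R *v v)) \<and> R ** R = matrix_inv (Cmat \<mu>)"
      using R unfolding posdef_def by blast
    fix S assume "transpose S = S \<and> (\<forall>v. v \<noteq> 0 \<longrightarrow> 0 < v \<bullet> (S *v v)) \<and> S ** S = matrix_inv (Cmat \<mu>)"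
    then have S: "posdef S" "S ** S = matrix_inv (Cmat \<mu>)" unfolding posdef_def by blast+
    show "S = R" by (rule posdef_sqrt_unique[OF S(1) R(1)]) (simp only: R(2) S(2))
  qed
  then show "posdef (Rmat \<mu>)" "Rmat \<mu> ** Rmat \<mu> = matrix_inv (Cmat \<mu>)" using R by auto
qed

lemma offdiag_norm_sq: "(offdiag_norm T)\<^sup>2 = (\<Sum>i\<in>UNIV. \<Sum>j\<in>UNIV. of_bool (i \<noteq> j) * (T $ i $ j)\<^sup>2)"
  unfolding offdiag_norm_def norm_vec_sq by (intro sum.cong refl) (auto simp: diag_mat_def)

lemma offdiag_energy_cong:
  "(\<And>w. length w \<in> {2, 3} \<Longrightarrow> t w = t' w) \<Longrightarrow> offdiag_energy t = offdiag_energy t'"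
  by (simp add: offdiag_energy_def)

text \<open>With unit diagonal second moments the matrix \<open>Nmat\<close> of the push-forward is
  the identity, so all normalising factors of the contrast disappear.\<close>

lemma contrast_eq_offdiag_energy:
  fixes \<mu> :: "'d::finite law"
  assumes \<mu>: "\<mu> \<in> dot_laws" and unit: "\<And>i. lin_mom (\<theta> ** Rmat \<mu>) (esig \<mu>) [i, i] = 1"
  shows "contrast \<mu> \<theta> = offdiag_energy (lin_mom (\<theta> ** Rmat \<mu>) (esig \<mu>))"
proof -
  define \<mu>' where "\<mu>' = pushforward ((*v) (\<theta> ** Rmat \<mu>)) \<mu>"
  have es: "esig \<mu>' w = lin_mom (\<theta> ** Rmat \<mu>) (esig \<mu>) w" if "length w \<in> {2, 3}" for w
    unfolding \<mu>'_def by (rule esig_pushforward_linear[OF \<mu> that])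
  have one: "esig \<mu>' [i, i] = 1" for i using es[of "[i, i]"] unit[of i] by (simp del: lin_mom.simps)
  have "Nmat \<mu>' = mat 1" unfolding Nmat_def one by (simp add: diag_mat_def mat_def vec_eq_iff)
  then have N: "matrix_inv (Nmat \<mu>') = mat 1" by (simp add: matrix_inv_unique)
  have "contrast \<mu> \<theta> = (offdiag_norm (coord0 \<mu>'))\<^sup>2 + (\<Sum>\<nu>\<in>UNIV. (offdiag_norm (coord \<mu>' \<nu>))\<^sup>2)"
    unfolding contrast_def x0_mat_def x_mat_def Let_def \<mu>'_def[symmetric] N one by simp
  also have "\<dots> = offdiag_energy (esig \<mu>')"
    by (simp add: offdiag_norm_sq offdiag_energy_def coord0_def coord_def)
  also have "\<dots> = offdiag_energy (lin_mom (\<theta> ** Rmat \<mu>) (esig \<mu>))"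
    by (rule offdiag_energy_cong[OF es])
  finally show ?thesis .
qed

section \<open>The premetrics\<close>

lemma diag_conj_entry: "(diag_mat a ** X ** diag_mat b) $ i $ j = a $ i * X $ i $ j * (b $ j :: real)"
  by (simp add: matrix_matrix_mult_def diag_mat_def if_distrib[of "\<lambda>x. x * _"] if_distrib[of "\<lambda>x. _ * x"] cong: if_cong)

lemma diag_mat_mult: "diag_mat a ** diag_mat b = diag_mat (\<chi> i. a $ i * b $ i)"
  by (simp add: vec_eq_iff matrix_matrix_mult_def diag_mat_def if_distrib[of "\<lambda>x. x * _"] if_distrib[of "\<lambda>x. _ * x"] cong: if_cong)

lemma diag_mat_inverse:
  assumes "\<And>i. a $ i \<noteq> 0"
  shows "diag_mat a ** diag_mat (\<chi> i. 1 / a $ i) = mat 1" "diag_mat (\<chi> i. 1 / a $ i) ** diag_mat a = mat 1"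
  unfolding diag_mat_mult using assms by (simp_all add: diag_mat_def mat_def vec_eq_iff)

lemma law_premetric_bound:
  fixes \<mu>s :: "'d::finite law"
  assumes "\<And>i. 0 < esig \<mu>s [i, i]"
  shows "0 \<le> law_premetric \<mu>s \<mu>" and
    "\<exists>L>0. \<forall>\<mu> w. length w \<in> {2, 3} \<longrightarrow> \<bar>esig \<mu> w - esig \<mu>s w\<bar> \<le> L * law_premetric \<mu>s \<mu>"
proof -
  let ?\<Lambda> = "\<lambda>i. esig \<mu>s [i, i]"
  let ?N = "matrix_inv (Nmat \<mu>s)"
  have N: "?N = diag_mat (\<chi> i. 1 / sqrt (?\<Lambda> i))"
    unfolding Nmat_def using diag_mat_inverse[of "\<chi> i. sqrt (?\<Lambda> i)"] assms
    by (intro matrix_inv_unique) (simp_all add: less_imp_neq[symmetric])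
  have sq: "(law_premetric \<mu>s \<mu>)\<^sup>2 = (norm (?N ** (coord0 \<mu> - coord0 \<mu>s) ** ?N))\<^sup>2 +
      (\<Sum>\<nu>\<in>UNIV. inverse (?\<Lambda> \<nu>) * (norm (?N ** (coord \<mu> \<nu> - coord \<mu>s \<nu>) ** ?N))\<^sup>2)"
    and nn: "0 \<le> law_premetric \<mu>s \<mu>" for \<mu>
    unfolding law_premetric_def using assms
    by (auto intro!: real_sqrt_pow2 real_sqrt_ge_zero add_nonneg_nonneg sum_nonneg mult_nonneg_nonneg simp: less_imp_le)
  show "0 \<le> law_premetric \<mu>s \<mu>" by (rule nn)
  \<comment> \<open>A crude common bound for 1 and all the scalings. Undoing the conjugation costs
    \<open>s ^ 2\<close>, and the weight of the third-order terms costs one more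
    \<open>s\<close>.\<close>
  define s where "s = (\<Sum>i\<in>UNIV. 1 + ?\<Lambda> i)"
  have s: "sqrt (?\<Lambda> i) \<le> s" "1 \<le> s" for i
  proof -
    have le: "1 + ?\<Lambda> i \<le> s" unfolding s_def using assms
      by (intro member_le_sum) (auto simp: less_imp_le add_nonneg_nonneg)
    have "sqrt (?\<Lambda> i) \<le> sqrt ((1 + ?\<Lambda> i)\<^sup>2)"
      using assms[of i] by (intro real_sqrt_le_mono) (simp add: power2_eq_square algebra_simps)
    then show "sqrt (?\<Lambda> i) \<le> s" using le assms[of i] by simp
    show "1 \<le> s" using le assms[of i] by linarith
  qed
  have ent: "\<bar>X $ i $ j\<bar> \<le> s\<^sup>2 * norm (?N ** X ** ?N)" for X i j
  proof -
    have "\<bar>X $ i $ j\<bar> = sqrt (?\<Lambda> i) * sqrt (?\<Lambda> j) * \<bar>(?N ** X ** ?N) $ i $ j\<bar>"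
      unfolding N diag_conj_entry using assms[of i] assms[of j] by (simp add: abs_mult)
    also have "\<dots> \<le> (s * s) * norm (?N ** X ** ?N)"
      using s assms by (intro mult_mono abs_entry_le_norm) (auto simp: less_imp_le)
    finally show ?thesis by (simp add: power2_eq_square)
  qed
  have n0: "norm (?N ** (coord0 \<mu> - coord0 \<mu>s) ** ?N) \<le> law_premetric \<mu>s \<mu>" for \<mu>
  proof (rule power2_le_imp_le[OF _ nn])
    show "(norm (?N ** (coord0 \<mu> - coord0 \<mu>s) ** ?N))\<^sup>2 \<le> (law_premetric \<mu>s \<mu>)\<^sup>2"
      unfolding sq using assms by (auto intro!: sum_nonneg mult_nonneg_nonneg simp: less_imp_le)
  qed
  have n1: "norm (?N ** (coord \<mu> \<nu> - coord \<mu>s \<nu>) ** ?N) \<le> s * law_premetric \<mu>s \<mu>" for \<mu> \<nu>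
  proof -
    let ?n = "\<lambda>\<nu>. norm (?N ** (coord \<mu> \<nu> - coord \<mu>s \<nu>) ** ?N)"
    have "inverse (?\<Lambda> \<nu>) * (?n \<nu>)\<^sup>2 \<le> (\<Sum>\<nu>\<in>UNIV. inverse (?\<Lambda> \<nu>) * (?n \<nu>)\<^sup>2)"
      using assms by (intro member_le_sum) (auto simp: less_imp_le)
    also have "\<dots> \<le> (law_premetric \<mu>s \<mu>)\<^sup>2" unfolding sq by simp
    finally have "(?n \<nu>)\<^sup>2 \<le> ?\<Lambda> \<nu> * (law_premetric \<mu>s \<mu>)\<^sup>2"
      using assms[of \<nu>] by (simp add: field_simps)
    also have "\<dots> = (sqrt (?\<Lambda> \<nu>) * law_premetric \<mu>s \<mu>)\<^sup>2"
      using assms[of \<nu>] by (simp add: power_mult_distrib)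
    finally have "?n \<nu> \<le> sqrt (?\<Lambda> \<nu>) * law_premetric \<mu>s \<mu>"
      by (rule power2_le_imp_le) (use nn assms in \<open>auto simp: less_imp_le\<close>)
    also have "\<dots> \<le> s * law_premetric \<mu>s \<mu>" by (intro mult_right_mono s nn)
    finally show ?thesis .
  qed
  have s0: "0 < s" using s(2) by linarith
  show "\<exists>L>0. \<forall>\<mu> w. length w \<in> {2, 3} \<longrightarrow> \<bar>esig \<mu> w - esig \<mu>s w\<bar> \<le> L * law_premetric \<mu>s \<mu>"
  proof (intro exI[of _ "s ^ 3"] conjI allI impI)
    show "0 < s ^ 3" using s0 by simp
    fix \<mu> and w :: "'d list" assume "length w \<in> {2, 3}"
    then consider i j where "w = [i, j]" | i j k where "w = [i, j, k]"
      by (auto simp: length_Suc_conv numeral_2_eq_2 numeral_3_eq_3)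
    then show "\<bar>esig \<mu> w - esig \<mu>s w\<bar> \<le> s ^ 3 * law_premetric \<mu>s \<mu>"
    proof cases
      case 1
      have "\<bar>esig \<mu> w - esig \<mu>s w\<bar> \<le> s\<^sup>2 * law_premetric \<mu>s \<mu>"
        using ent[of "coord0 \<mu> - coord0 \<mu>s" i j] mult_left_mono[OF n0[of \<mu>], of "s\<^sup>2"]
        by (simp add: 1 coord0_def)
      also have "\<dots> \<le> s ^ 3 * law_premetric \<mu>s \<mu>"
        using s(2) by (intro mult_right_mono nn power_increasing) auto
      finally show ?thesis .
    next
      case 2
      have "\<bar>esig \<mu> w - esig \<mu>s w\<bar> \<le> s\<^sup>2 * (s * law_premetric \<mu>s \<mu>)"
        using ent[of "coord \<mu> k - coord \<mu>s k" i j] mult_left_mono[OF n1[of \<mu> k], of "s\<^sup>2"]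
        by (simp add: 2 coord_def)
      then show ?thesis by (simp add: power3_eq_cube power2_eq_square mult.assoc)
    qed
  qed
qed

section \<open>Regularity of the remainder of a nearby diffeomorphism\<close>

lemma C1_diffeos_continuous: "f \<in> C1_diffeos \<Longrightarrow> continuous_on UNIV f"
  by (auto simp: C1_diffeos_def C1_map_def intro!: continuous_at_imp_continuous_on differentiable_imp_continuous_within)

text \<open>Both constants are kept because they act in different places: \<open>H\<close> controls
  the moments of the push-forward, \<open>j\<close> the deviance.\<close>

definition lip_hoelder :: "real \<Rightarrow> real \<Rightarrow> real \<Rightarrow> (real^'d \<Rightarrow> real^'d::finite) \<Rightarrow> bool" where
  "lip_hoelder \<gamma> j H R \<longleftrightarrow> 0 \<le> j \<and> 0 \<le> H \<and> (\<forall>u v. norm (R u - R v) \<le> j * norm (u - v)) \<and>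
     (\<forall>u v. norm (R u - R v) \<le> H * norm (u - v) powr \<gamma>)"

text \<open>An increment \<open>D\<close> of \<open>R\<close> is bounded by twice the sup-norm and
  by the Lipschitz bound; \<open>D = D powr \<alpha> * D powr (1 - \<alpha>)\<close> uses the first
  for one factor and the second for the other. The sup-norm then occurs with exponent \<alpha>,
  paired with a Lipschitz constant of at least that exponent, so only their product has to be
  small.\<close>

lemma diffeo_premetric_lip_hoelder:
  fixes \<theta>1 \<theta>2 :: "real^'d \<Rightarrow> real^'d::finite"
  assumes "\<theta>1 \<in> C1_diffeos" "\<theta>2 \<in> C1_diffeos" and lt: "diffeo_premetric \<theta>1 \<theta>2 < 1"
    and \<alpha>: "0 < \<alpha>" "\<alpha> < 1/2"
  defines "\<delta> \<equiv> diffeo_premetric \<theta>1 \<theta>2"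
  shows "lip_hoelder (1 - \<alpha>) \<delta> (2 * \<delta> powr \<alpha>) (\<lambda>x. inv \<theta>1 (\<theta>2 x) - x)"
proof -
  define R where "R = (\<lambda>x. inv \<theta>1 (\<theta>2 x) - x)"
  have diff: "R differentiable (at x)" for x
  proof -
    have "\<theta>2 differentiable (at x)" "inv \<theta>1 differentiable (at (\<theta>2 x))"
      using assms by (auto simp: C1_diffeos_def C1_map_def)
    then have "(inv \<theta>1 \<circ> \<theta>2) differentiable (at x)" by (intro differentiable_chain_at)
    then show ?thesis unfolding R_def by (intro differentiable_diff) (auto simp: o_def)
  qed
  define s where "s = sup_norm R"
  define j where "j = jac_sup_norm R"
  have \<delta>eq: "\<delta> = enn2real (min ((s + 1) * j) 1)"
    by (simp add: \<delta>_def diffeo_premetric_def s_def j_def R_def o_def Let_def)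
  have ne: "(s + 1) * j < 1"
  proof (rule ccontr)
    assume "\<not> ?thesis"
    then have "min ((s + 1) * j) 1 = 1" by (simp add: min_def)
    then have "\<delta> = 1" using \<delta>eq by simp
    then show False using lt by (simp add: \<delta>_def)
  qed
  then have \<delta>: "ennreal \<delta> = (s + 1) * j" using \<delta>eq by (auto simp: min_def ennreal_enn2real_if top_unique)
  have \<delta>0: "0 \<le> \<delta>" unfolding \<delta>eq by simp
  have \<delta>1: "\<delta> < 1" using lt by (simp add: \<delta>_def)
  have jle: "j \<le> ennreal \<delta>" unfolding \<delta> using mult_right_mono[of 1 "s + 1" j] by simp
  then have jfin: "j \<noteq> \<top>" by (auto simp: top_unique)
  define jr where "jr = enn2real j"
  have jr: "j = ennreal jr" "0 \<le> jr" using jfin by (auto simp: jr_def less_top)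
  have jr\<delta>: "jr \<le> \<delta>" using jle \<delta>0 by (simp add: jr)
  have jac: "spectral_norm (jacobian R (at x)) \<le> jr" for x
  proof -
    have "ennreal (spectral_norm (jacobian R (at x))) \<le> j"
      unfolding j_def jac_sup_norm_def by (rule SUP_upper) simp
    then show ?thesis using jr by (simp add: ennreal_le_iff)
  qed
  have lip: "norm (R u - R v) \<le> jr * norm (u - v)" for u v
  proof (rule differentiable_bound[of UNIV R "\<lambda>x. (*v) (jacobian R (at x))"])
    show "(R has_derivative (*v) (jacobian R (at x))) (at x within UNIV)" for x
      using jacobian_works[of R "at x"] diff[of x] by simp
    show "onorm ((*v) (jacobian R (at x))) \<le> jr" for x using jac[of x] by (simp add: spectral_norm_def)
  qed auto
  have hoelder: "norm (R u - R v) \<le> 2 * \<delta> powr \<alpha> * norm (u - v) powr (1 - \<alpha>)" for u v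
  proof (cases "jr = 0")
    case True
    then show ?thesis using lip[of u v] by simp
  next
    case False
    \<comment> \<open>A positive Lipschitz constant times an infinite sup-norm would be infinite,
      against the bound 1 on the product.\<close>
    have sfin: "s \<noteq> \<top>"
    proof
      assume "s = \<top>"
      then have "(s + 1) * j = \<top>" using False jr by (simp add: ennreal_top_mult)
      then show False using ne by simp
    qed
    define sr where "sr = enn2real s"
    have sr: "s = ennreal sr" "0 \<le> sr" using sfin by (auto simp: sr_def less_top)
    have bound: "norm (R x) \<le> sr" for x
    proof -
      have "ennreal (norm (R x)) \<le> s" unfolding s_def sup_norm_def by (rule SUP_upper) simp
      then show ?thesis using sr by (simp add: ennreal_le_iff)
    qed
    have "ennreal \<delta> = ennreal ((sr + 1) * jr)" unfolding \<delta> sr jr using sr jr by (simp add: ennreal_mult)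
    then have \<delta>v: "\<delta> = (sr + 1) * jr" using \<delta>0 sr jr by (simp add: ennreal_inj)
    define D where "D = norm (R u - R v)"
    have D: "0 \<le> D" "D \<le> 2 * sr" "D \<le> jr * norm (u - v)"
      using norm_triangle_ineq4[of "R u" "R v"] bound[of u] bound[of v] lip[of u v] by (auto simp: D_def)
    have "D = D powr \<alpha> * D powr (1 - \<alpha>)" using D(1) by (cases "D = 0") (auto simp: powr_add[symmetric])
    also have "\<dots> \<le> (2 * sr) powr \<alpha> * (jr * norm (u - v)) powr (1 - \<alpha>)"
      using D \<alpha> by (intro mult_mono powr_mono2) auto
    also have "\<dots> = 2 powr \<alpha> * (sr powr \<alpha> * jr powr (1 - \<alpha>)) * norm (u - v) powr (1 - \<alpha>)"
      using sr jr by (simp add: powr_mult mult_ac)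
    also have "\<dots> \<le> 2 * (\<delta> powr \<alpha>) * norm (u - v) powr (1 - \<alpha>)"
    proof (intro mult_right_mono mult_mono)
      show "2 powr \<alpha> \<le> (2::real)" using \<alpha> powr_mono[of \<alpha> 1 2] by simp
      \<comment> \<open>Here \<alpha> < 1/2, that is \<beta> > 5/2, enters: the surplus exponent
        \<open>1 - 2 * \<alpha>\<close> is positive and \<open>jr < 1\<close>, so the surplus factor
        is at most 1.\<close>
      have "jr powr (1 - \<alpha>) = jr powr \<alpha> * jr powr (1 - 2 * \<alpha>)" using jr False by (simp add: powr_add[symmetric])
      also have "\<dots> \<le> jr powr \<alpha> * 1"
        using jr jr\<delta> \<delta>1 \<alpha> by (intro mult_left_mono powr_le1) auto
      finally have "sr powr \<alpha> * jr powr (1 - \<alpha>) \<le> sr powr \<alpha> * jr powr \<alpha>" by (intro mult_left_mono) auto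
      also have "\<dots> = (sr * jr) powr \<alpha>" using sr jr by (simp add: powr_mult)
      also have "\<dots> \<le> \<delta> powr \<alpha>"
      proof (rule powr_mono2)
        have "(sr + 1) * jr = sr * jr + jr" by (simp add: algebra_simps)
        then show "sr * jr \<le> \<delta>" using jr(2) \<delta>v by linarith
        show "0 \<le> sr * jr" using sr(2) jr(2) by (rule mult_nonneg_nonneg)
        show "0 \<le> \<alpha>" using \<alpha>(1) by linarith
      qed
      finally show "sr powr \<alpha> * jr powr (1 - \<alpha>) \<le> \<delta> powr \<alpha>" .
    qed auto
    finally show ?thesis by (simp add: D_def)
  qed
  have lip': "norm (R u - R v) \<le> \<delta> * norm (u - v)" for u v
    by (rule order_trans[OF lip mult_right_mono[OF jr\<delta>]]) simp
  show ?thesis unfolding lip_hoelder_def R_def[symmetric] using \<delta>0 lip' hoelder by simp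
qed

text \<open>The map in the conclusion is the remainder of \<open>id + R\<close> after
  \<open>id + S\<close>. The estimate plays the role of a triangle inequality when neighbourhoods of
  a cause are shown to be open.\<close>

lemma lip_hoelder_compose:
  assumes S: "lip_hoelder \<gamma> jS HS S" and R: "lip_hoelder \<gamma> jR HR R" and \<gamma>: "0 \<le> \<gamma>" "\<gamma> \<le> 1"
  shows "lip_hoelder \<gamma> (jS + jR * (1 + jS)) (HS + HR * (1 + jS)) (\<lambda>u. S u + R (u + S u))"
proof -
  have S': "0 \<le> jS" "0 \<le> HS" "\<And>u v. norm (S u - S v) \<le> jS * norm (u - v)"
    "\<And>u v. norm (S u - S v) \<le> HS * norm (u - v) powr \<gamma>" using S by (auto simp: lip_hoelder_def)
  have R': "0 \<le> jR" "0 \<le> HR" "\<And>u v. norm (R u - R v) \<le> jR * norm (u - v)"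
    "\<And>u v. norm (R u - R v) \<le> HR * norm (u - v) powr \<gamma>" using R by (auto simp: lip_hoelder_def)
  have id: "norm ((u + S u) - (v + S v)) \<le> (1 + jS) * norm (u - v)" for u v
    using norm_triangle_ineq[of "u - v" "S u - S v"] S'(3)[of u v] by (simp add: algebra_simps)
  have tri: "norm ((S u + R (u + S u)) - (S v + R (v + S v))) \<le> norm (S u - S v) + norm (R (u + S u) - R (v + S v))" for u v
    using norm_triangle_ineq[of "S u - S v" "R (u + S u) - R (v + S v)"] by (simp add: algebra_simps)
  have "norm (R (u + S u) - R (v + S v)) \<le> jR * ((1 + jS) * norm (u - v))" for u v
    by (rule order_trans[OF R'(3) mult_left_mono[OF id R'(1)]])
  moreover have "norm (R (u + S u) - R (v + S v)) \<le> HR * ((1 + jS) * norm (u - v) powr \<gamma>)" for u v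
  proof -
    have "norm (R (u + S u) - R (v + S v)) \<le> HR * ((1 + jS) * norm (u - v)) powr \<gamma>"
      by (rule order_trans[OF R'(4) mult_left_mono[OF powr_mono2[OF \<gamma>(1) norm_ge_zero id] R'(2)]])
    also have "((1 + jS) * norm (u - v)) powr \<gamma> = (1 + jS) powr \<gamma> * norm (u - v) powr \<gamma>"
      using S'(1) by (simp add: powr_mult)
    also have "(1 + jS) powr \<gamma> \<le> 1 + jS" using powr_mono[of \<gamma> 1 "1 + jS"] \<gamma> S'(1) by simp
    finally show ?thesis using R'(2) by (simp add: mult_left_mono mult_right_mono)
  qed
  ultimately show ?thesis unfolding lip_hoelder_def
    using S' R' order_trans[OF tri add_mono[OF S'(3)]] order_trans[OF tri add_mono[OF S'(4)]]
    by (auto simp: distrib_right mult.assoc intro!: add_nonneg_nonneg mult_nonneg_nonneg)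
qed

section \<open>Signed permutations\<close>

definition signed_permutation :: "real^'d^'d::finite \<Rightarrow> bool" where
  "signed_permutation W \<longleftrightarrow> (\<exists>p s. p permutes UNIV \<and> (\<forall>k. s k \<in> {1, -1}) \<and> W = signed_perm p s)"

lemma signed_permutation_orthogonal:
  assumes "signed_permutation W"
  shows "transpose W ** W = mat 1" "W ** transpose W = mat 1"
proof -
  obtain p s where p: "p permutes UNIV" "\<forall>k. s k \<in> {1, -1}" and W: "W = signed_perm p s"
    using assms unfolding signed_permutation_def by blast
  have "(transpose W ** W) $ k $ l = mat 1 $ k $ l" for k l
  proof -
    have "(transpose W ** W) $ k $ l = (\<Sum>i\<in>UNIV. if i = p k then (if p k = p l then s k * s l else 0) else 0)"
      unfolding W matrix_matrix_mult_def transpose_def signed_perm_def vec_lambda_beta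
      by (intro sum.cong refl) auto
    also have "\<dots> = (if p k = p l then s k * s l else 0)" by simp
    also have "\<dots> = mat 1 $ k $ l"
      using p(2)[rule_format, of k] permutes_inj[OF p(1)] by (auto simp: mat_def inj_eq)
    finally show ?thesis .
  qed
  then show "transpose W ** W = mat 1" by (simp add: vec_eq_iff)
  then show "W ** transpose W = mat 1" by (simp add: matrix_left_right_inverse)
qed

lemma signed_permutation_transpose:
  assumes "signed_permutation W"
  shows "signed_permutation (transpose W)"
proof -
  obtain p s where p: "p permutes UNIV" "\<forall>k. s k \<in> {1, -1}" and W: "W = signed_perm p s"
    using assms unfolding signed_permutation_def by blast
  have "transpose W = signed_perm (inv p) (\<lambda>k. s (inv p k))"
    unfolding W signed_perm_def transpose_def vec_eq_iff
    using permutes_inverses[OF p(1)] by auto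
  moreover have "inv p permutes UNIV" by (rule permutes_inv[OF p(1)])
  ultimately show ?thesis using p(2) unfolding signed_permutation_def
    by (intro exI[of _ "inv p"] exI[of _ "\<lambda>k. s (inv p k)"] conjI allI) simp_all
qed

lemma norm_signed_permutation_mult_vec:
  assumes "signed_permutation W"
  shows "norm (W *v v) = norm v"
proof -
  have "(norm (W *v v))\<^sup>2 = v \<bullet> (transpose W *v (W *v v))"
    unfolding power2_norm_eq_inner by (metis dot_lmul_matrix inner_commute transpose_matrix_vector)
  also have "\<dots> = (norm v)\<^sup>2"
    unfolding matrix_vector_mul_assoc signed_permutation_orthogonal[OF assms] by (simp add: power2_norm_eq_inner)
  finally show ?thesis by simp
qed

lemma norm_signed_permutation: "signed_permutation W \<Longrightarrow> norm (W :: real^'d^'d::finite) \<le> (real CARD('d))\<^sup>2"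
  using norm_le_operator[of W 1] by (simp add: norm_signed_permutation_mult_vec)

lemma lin_mom_signed_perm:
  assumes p: "p permutes UNIV"
  shows "lin_mom (signed_perm p s) t w = prod_list (map (\<lambda>i. s (inv p i)) w) * t (map (inv p) w)"
proof (induction w arbitrary: t)
  case (Cons i w)
  have eq: "(i = p k) = (k = inv p i)" for k using permutes_inverses[OF p] by metis
  have "lin_mom (signed_perm p s) t (i # w) =
     (\<Sum>k\<in>UNIV. if k = inv p i then s k * lin_mom (signed_perm p s) (\<lambda>v. t (k # v)) w else 0)"
    by (simp add: signed_perm_def eq if_distrib[of "\<lambda>x. x * _"] cong: if_cong)
  then show ?case by (simp add: Cons.IH)
qed simp

text \<open>A signed permutation permutes the letters of a word and multiplies the moment by signs;
  squares forget the signs, and reindexing keeps off-diagonal words off-diagonal.\<close>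

lemma offdiag_energy_signed_permutation:
  assumes "signed_permutation W"
  shows "offdiag_energy (lin_mom W t) = offdiag_energy t"
proof -
  obtain p s where p: "p permutes UNIV" and s: "\<forall>k. s k \<in> {1, -1}" and W: "W = signed_perm p s"
    using assms unfolding signed_permutation_def by blast
  let ?q = "inv p"
  have bq: "bij ?q" by (rule permutes_bij[OF permutes_inv[OF p]])
  have s2: "(s k)\<^sup>2 = 1" for k using s[rule_format, of k] by auto
  have re: "(\<Sum>i\<in>UNIV. g (?q i)) = (\<Sum>i\<in>UNIV. g i)" for g :: "'a \<Rightarrow> real"
    by (rule sum.reindex_bij_betw[OF bq])
  have ne: "(i \<noteq> j) = (?q i \<noteq> ?q j)" for i j using bq by (auto simp: bij_def inj_eq)
  have "(lin_mom W t w)\<^sup>2 = (t (map ?q w))\<^sup>2" for w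
  proof -
    have "(prod_list (map (\<lambda>i. s (?q i)) w))\<^sup>2 = 1" by (induction w) (auto simp: power_mult_distrib s2)
    then show ?thesis unfolding W lin_mom_signed_perm[OF p] by (simp add: power_mult_distrib)
  qed
  then have "offdiag_energy (lin_mom W t) =
     (\<Sum>i\<in>UNIV. \<Sum>j\<in>UNIV. of_bool (?q i \<noteq> ?q j) * (t [?q i, ?q j])\<^sup>2) +
     (\<Sum>n\<in>UNIV. \<Sum>i\<in>UNIV. \<Sum>j\<in>UNIV. of_bool (?q i \<noteq> ?q j) * (t [?q i, ?q j, ?q n])\<^sup>2)"
    unfolding offdiag_energy_def using ne by (simp del: lin_mom.simps)
  also have "\<dots> = offdiag_energy t"
    unfolding offdiag_energy_def
    by (subst re[of "\<lambda>i. \<Sum>j\<in>UNIV. of_bool (i \<noteq> ?q j) * (t [i, ?q j])\<^sup>2" for i], subst re[of "\<lambda>j. of_bool (i \<noteq> j) * (t [i, j])\<^sup>2" for i],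
        subst re[of "\<lambda>n. \<Sum>i\<in>UNIV. \<Sum>j\<in>UNIV. of_bool (?q i \<noteq> ?q j) * (t [?q i, ?q j, n])\<^sup>2"],
        subst re[of "\<lambda>i. \<Sum>j\<in>UNIV. of_bool (i \<noteq> ?q j) * (t [i, ?q j, n])\<^sup>2" for n],
        subst re[of "\<lambda>j. of_bool (i \<noteq> j) * (t [i, j, n])\<^sup>2" for i n]) (rule refl)
  finally show ?thesis .
qed

lemma Xi1_signed_permutation:
  fixes W :: "real^'d^'d::finite"
  assumes W: "signed_permutation W" and \<theta>: "\<theta> \<in> Xi1 \<kappa>0"
  shows "W ** \<theta> \<in> Xi1 \<kappa>0"
proof -
  have inv: "invertible \<theta>" and rows: "\<And>i. norm (\<theta> $ i) = 1" and c: "cond2 \<theta> \<le> \<kappa>0"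
    using \<theta> by (auto simp: Xi1_def GL_def)
  note o = signed_permutation_orthogonal[OF W]
  have Wi: "invertible W" using o unfolding invertible_def by blast
  have i: "matrix_inv (W ** \<theta>) = matrix_inv \<theta> ** transpose W"
  proof (rule matrix_inv_unique)
    have "W ** \<theta> ** (matrix_inv \<theta> ** transpose W) = W ** (\<theta> ** matrix_inv \<theta>) ** transpose W"
      by (simp add: matrix_mul_assoc)
    then show "W ** \<theta> ** (matrix_inv \<theta> ** transpose W) = mat 1" using inv o by (simp add: matrix_inv_right)
    have "matrix_inv \<theta> ** transpose W ** (W ** \<theta>) = matrix_inv \<theta> ** (transpose W ** W) ** \<theta>"
      by (simp add: matrix_mul_assoc)
    then show "matrix_inv \<theta> ** transpose W ** (W ** \<theta>) = mat 1" using inv o by (simp add: matrix_inv_left)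
  qed
  have 1: "spectral_norm (W ** \<theta>) = spectral_norm \<theta>"
    unfolding spectral_norm_def onorm_def
    by (simp add: matrix_vector_mul_assoc[symmetric] norm_signed_permutation_mult_vec[OF W])
  have bl: "bounded_linear ((*v) M)" for M :: "real^'d^'d" by simp
  have 2: "spectral_norm (matrix_inv (W ** \<theta>)) \<le> spectral_norm (matrix_inv \<theta>)"
    unfolding spectral_norm_def i
  proof (rule onorm_bound)
    fix v
    have "norm ((matrix_inv \<theta> ** transpose W) *v v) \<le> onorm ((*v) (matrix_inv \<theta>)) * norm (transpose W *v v)"
      unfolding matrix_vector_mul_assoc[symmetric] by (rule onorm[OF bl])
    then show "norm ((matrix_inv \<theta> ** transpose W) *v v) \<le> onorm ((*v) (matrix_inv \<theta>)) * norm v"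
      unfolding norm_signed_permutation_mult_vec[OF signed_permutation_transpose[OF W]] .
  qed (rule onorm_pos_le[OF bl])
  have 3: "0 \<le> spectral_norm \<theta>" unfolding spectral_norm_def by (rule onorm_pos_le[OF bl])
  have "cond2 (W ** \<theta>) \<le> cond2 \<theta>" unfolding cond2_def 1 by (rule mult_left_mono[OF 2 3])
  moreover have "norm ((W ** \<theta>) $ i) = 1" for i
  proof -
    obtain p s where p: "p permutes UNIV" and s: "\<forall>k. s k \<in> {1, -1}" and Weq: "W = signed_perm p s"
      using W unfolding signed_permutation_def by blast
    have eq: "(i = p k) = (k = inv p i)" for k using permutes_inverses[OF p] by metis
    have "(W ** \<theta>) $ i = s (inv p i) *\<^sub>R \<theta> $ inv p i"
      unfolding Weq by (simp add: vec_eq_iff matrix_matrix_mult_def signed_perm_def eq if_distrib[of "\<lambda>x. x * _"] cong: if_cong)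
    then show ?thesis using rows s[rule_format, of "inv p i"] by auto
  qed
  ultimately show ?thesis using c invertible_mult[OF Wi inv] by (auto simp: Xi1_def GL_def)
qed

section \<open>The inversion map near an identifiable cause\<close>

lemma lin_mom_cong:
  fixes A :: "real^'d^'d::finite"
  assumes "\<And>v. length v = length w \<Longrightarrow> m v = m' v"
  shows "lin_mom A m w = lin_mom A m' w"
proof -
  have "\<bar>lin_mom A m w - lin_mom A m' w\<bar> \<le> (real CARD('d) * norm A) ^ length w * 0"
    by (rule lin_mom_diff_le[OF matrix_row_sum_bound]) (use assms in auto)
  then show ?thesis by simp
qed

text \<open>The inverse of \<open>Nmat \<mu>\<close> for positive second moments, written out so
  that its product with a signed permutation is visibly monomial.\<close>

definition scale_mat :: "('d::finite) law \<Rightarrow> real^'d^'d" where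
  "scale_mat \<mu> = diag_mat (\<chi> i. 1 / sqrt (esig \<mu> [i, i]))"

lemma Nmat_scale_mat:
  assumes "\<And>i. 0 < esig \<mu> [i, i]"
  shows "Nmat \<mu> ** scale_mat \<mu> = mat 1" "scale_mat \<mu> ** Nmat \<mu> = mat 1"
  unfolding Nmat_def scale_mat_def using diag_mat_inverse[of "\<chi> i. sqrt (esig \<mu> [i, i])"] assms
  by (simp_all add: less_imp_neq[symmetric])

text \<open>Scaling by \<open>Nmat \<mu>\<close> undoes the standardisation. For third moments it
  contributes the cube of the square root, which the definition of the coefficients divides
  by.\<close>

lemma orthogonal_law_moments:
  fixes \<mu> :: "'d::finite law"
  assumes o: "orthogonal_law \<mu>" and pos: "\<And>i. 0 < esig \<mu> [i, i]" and w: "length w \<in> {2, 3}"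
  shows "esig \<mu> w = lin_mom (Nmat \<mu>) (unit_mom (\<lambda>i. esig \<mu> [i, i, i] / sqrt (esig \<mu> [i, i]) ^ 3)) w"
proof -
  have N: "Nmat \<mu> $ i $ k = (if i = k then sqrt (esig \<mu> [i, i]) else 0)" for i k
    by (simp add: Nmat_def diag_mat_def)
  consider i j where "w = [i, j]" | i j k where "w = [i, j, k]"
    using w by (auto simp: length_Suc_conv numeral_2_eq_2 numeral_3_eq_3)
  then show ?thesis
  proof cases
    case 1
    have "lin_mom (Nmat \<mu>) (unit_mom (\<lambda>i. esig \<mu> [i, i, i] / sqrt (esig \<mu> [i, i]) ^ 3)) w =
      (\<Sum>k\<in>UNIV. if k = i then (if i = j then esig \<mu> [i, i] else 0) else 0)"
      unfolding 1 lin_mom_unit2 N using pos[of i] by (intro sum.cong) auto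
    also have "\<dots> = of_bool (i = j) * esig \<mu> [i, j]" by auto
    also have "\<dots> = esig \<mu> w"
      unfolding 1 by (rule o[unfolded orthogonal_law_def, THEN conjunct1, rule_format, symmetric])
    finally show ?thesis by (rule sym)
  next
    case 2
    have "lin_mom (Nmat \<mu>) (unit_mom (\<lambda>i. esig \<mu> [i, i, i] / sqrt (esig \<mu> [i, i]) ^ 3)) w =
      (\<Sum>l\<in>UNIV. if l = i then (if i = j \<and> j = k then esig \<mu> [i, i, i] else 0) else 0)"
      unfolding 2 lin_mom_unit3
    proof (rule sum.cong[OF refl])
      fix l
      define q where "q = sqrt (esig \<mu> [l, l])"
      have q: "q \<noteq> 0" using pos[of l] by (simp add: q_def)
      have N': "Nmat \<mu> $ i $ l = (if i = l then q else 0)" "Nmat \<mu> $ j $ l = (if j = l then q else 0)"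
        "Nmat \<mu> $ k $ l = (if k = l then q else 0)" by (auto simp: N q_def)
      have "x / q ^ 3 * (q * (q * q)) = x" for x using q by (simp add: power3_eq_cube)
      then show "esig \<mu> [l, l, l] / sqrt (esig \<mu> [l, l]) ^ 3 * (Nmat \<mu> $ i $ l * (Nmat \<mu> $ j $ l * Nmat \<mu> $ k $ l))
        = (if l = i then (if i = j \<and> j = k then esig \<mu> [i, i, i] else 0) else 0)"
        unfolding q_def[symmetric] N' by simp
    qed
    also have "\<dots> = of_bool (i = j \<and> j = k) * esig \<mu> [i, j, k]" by auto
    also have "\<dots> = esig \<mu> w"
      unfolding 2 by (rule o[unfolded orthogonal_law_def, THEN conjunct2, rule_format, symmetric])
    finally show ?thesis by (rule sym)
  qed
qed

text \<open>Invariance of the set of minimisers under signed permutations is what makes the inversion map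
  lower semicontinuous as well.\<close>

lemma inversion_estimate:
  fixes \<mu>s :: "'d::finite law"
  assumes \<mu>s: "\<mu>s \<in> S_star" and A: "invertible A" and \<kappa>0: "1 \<le> \<kappa>0"
  shows "\<exists>c>0. \<exists>\<eta>0>0. \<forall>\<zeta> \<eta> \<Phi>. \<zeta> \<in> ac_laws \<and> (\<forall>w. length w \<in> {2, 3} \<longrightarrow> integrable \<zeta> (sig w)) \<and>
      0 \<le> \<eta> \<and> \<eta> \<le> \<eta>0 \<and> (\<forall>w. length w \<in> {2, 3} \<longrightarrow> \<bar>esig \<zeta> w - lin_mom A (esig \<mu>s) w\<bar> \<le> \<eta>) \<and>
      inversion_map \<kappa>0 \<Phi> \<longrightarrow>
      (\<forall>B\<in>\<Phi> \<zeta>. (\<exists>W. signed_permutation W \<and> norm (B ** A - W ** scale_mat \<mu>s) \<le> c * \<eta>) \<and>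
         (\<forall>W. signed_permutation W \<longrightarrow> W ** B \<in> \<Phi> \<zeta>))"
proof -
  have dot: "\<mu>s \<in> dot_laws" and orth: "orthogonal_law \<mu>s" and card: "card {i. esig \<mu>s [i, i, i] = 0} \<le> 1"
    using \<mu>s by (auto simp: S_star_def)
  have pos: "0 < esig \<mu>s [i, i]" for i by (rule esig_diag_pos[OF dot])
  define \<kappa> where "\<kappa> = (\<lambda>i. esig \<mu>s [i, i, i] / sqrt (esig \<mu>s [i, i]) ^ 3)"
  have "{i. \<kappa> i = 0} = {i. esig \<mu>s [i, i, i] = 0}"
    using pos by (auto simp: \<kappa>_def less_imp_neq[symmetric])
  then have \<kappa>: "card {i. \<kappa> i = 0} \<le> 1" using card by simp
  define A' where "A' = A ** Nmat \<mu>s"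
  have "invertible (Nmat \<mu>s)" unfolding invertible_def using Nmat_scale_mat[OF pos] by blast
  then have A': "invertible A'" unfolding A'_def by (rule invertible_mult[OF A])
  have mom: "lin_mom A (esig \<mu>s) w = lin_mom A' (unit_mom \<kappa>) w" if "length w \<in> {2, 3}" for w
    unfolding A'_def lin_mom_comp[symmetric] \<kappa>_def
    by (rule lin_mom_cong, rule orthogonal_law_moments[OF orth pos]) (use that in simp)
  obtain c \<eta>0 Q where c: "0 < c" "0 < \<eta>0" and orthQ: "orthogonal_matrix Q" and main: "\<forall>m \<eta>. 0 \<le> \<eta> \<and> \<eta> \<le> \<eta>0 \<and>
      (\<forall>w. length w \<in> {2, 3} \<longrightarrow> \<bar>m w - lin_mom A' (unit_mom \<kappa>) w\<bar> \<le> \<eta>) \<longrightarrow>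
      posdef (sym_mom m) \<and>
      (\<forall>R \<theta>. posdef R \<and> R ** R = matrix_inv (sym_mom m) \<and> \<theta> \<in> Xi1 \<kappa>0 \<longrightarrow>
         (\<forall>i. lin_mom (\<theta> ** R) m [i, i] = 1) \<and>
         (offdiag_energy (lin_mom (\<theta> ** R) m) \<le> offdiag_energy (lin_mom (Q ** R) m) \<longrightarrow>
         (\<exists>p s. p permutes UNIV \<and> (\<forall>k. s k \<in> {1, -1}) \<and>
            norm (\<theta> ** R ** A' - signed_perm p s) \<le> c * \<eta>)))"
    using contrast_minimisers_near_signed_permutations[OF A' \<kappa> \<kappa>0] by blast
  define c' where "c' = c * (norm (scale_mat \<mu>s) + 1)"
  have c': "0 < c'" using c by (simp add: c'_def add_nonneg_pos)
  show ?thesis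
  proof (rule exI[of _ c'], rule conjI[OF c'], rule exI[of _ \<eta>0], rule conjI[OF c(2)], intro allI impI)
    fix \<zeta> :: "'d law" and \<eta> :: real and \<Phi> :: "'d law \<Rightarrow> (real^'d^'d) set"
    assume as: "\<zeta> \<in> ac_laws \<and> (\<forall>w. length w \<in> {2, 3} \<longrightarrow> integrable \<zeta> (sig w)) \<and>
      0 \<le> \<eta> \<and> \<eta> \<le> \<eta>0 \<and> (\<forall>w. length w \<in> {2, 3} \<longrightarrow> \<bar>esig \<zeta> w - lin_mom A (esig \<mu>s) w\<bar> \<le> \<eta>) \<and>
      inversion_map \<kappa>0 \<Phi>"
    then have \<eta>: "0 \<le> \<eta>" "\<eta> \<le> \<eta>0" and inv: "inversion_map \<kappa>0 \<Phi>" by auto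
    have close: "\<forall>w. length w \<in> {2, 3} \<longrightarrow> \<bar>esig \<zeta> w - lin_mom A' (unit_mom \<kappa>) w\<bar> \<le> \<eta>"
      using as mom by metis
    from main[rule_format, of \<eta> "esig \<zeta>"] \<eta> close
    have pC: "posdef (Cmat \<zeta>)" and R: "\<And>R \<theta>. posdef R \<Longrightarrow> R ** R = matrix_inv (Cmat \<zeta>) \<Longrightarrow> \<theta> \<in> Xi1 \<kappa>0 \<Longrightarrow>
         (\<forall>i. lin_mom (\<theta> ** R) (esig \<zeta>) [i, i] = 1) \<and>
         (offdiag_energy (lin_mom (\<theta> ** R) (esig \<zeta>)) \<le> offdiag_energy (lin_mom (Q ** R) (esig \<zeta>)) \<longrightarrow>
         (\<exists>p s. p permutes UNIV \<and> (\<forall>k. s k \<in> {1, -1}) \<and>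
            norm (\<theta> ** R ** A' - signed_perm p s) \<le> c * \<eta>))"
      unfolding Cmat_eq_sym_mom by blast+
    note Rm = Rmat_sqrt[OF pC]
    \<comment> \<open>Membership of \<zeta> in \<open>dot_laws\<close> is not assumed: the diagonal
      of a positive definite matrix is nonzero. Only then does \<open>inversion_map\<close>
      prescribe the value at \<zeta>.\<close>
    have "esig \<zeta> [i, i] \<noteq> 0" for i
    proof -
      have "0 < axis i 1 \<bullet> (Cmat \<zeta> *v axis i 1)" using pC unfolding posdef_def by (simp add: axis_eq_0_iff)
      then show ?thesis
        by (simp add: inner_axis' matrix_vector_mul_component inner_axis Cmat_eq_sym_mom sym_mom_def)
    qed
    then have \<zeta>dot: "\<zeta> \<in> dot_laws" using as by (simp add: dot_laws_def)
    have unit: "lin_mom (\<theta> ** Rmat \<zeta>) (esig \<zeta>) [i, i] = 1" if "\<theta> \<in> Xi1 \<kappa>0" for \<theta> i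
      using R[OF Rm that] by blast
    have con: "contrast \<zeta> \<theta> = offdiag_energy (lin_mom (\<theta> ** Rmat \<zeta>) (esig \<zeta>))" if "\<theta> \<in> Xi1 \<kappa>0" for \<theta>
      by (rule contrast_eq_offdiag_energy[OF \<zeta>dot unit[OF that]])
    have \<Phi>: "\<Phi> \<zeta> = {\<theta> ** Rmat \<zeta> | \<theta>. is_arg_min (contrast \<zeta>) (\<lambda>\<theta>. \<theta> \<in> Xi1 \<kappa>0) \<theta>}"
      using inv \<zeta>dot posdef_invertible[OF pC] by (simp add: inversion_map_def)
    show "\<forall>B\<in>\<Phi> \<zeta>. (\<exists>W. signed_permutation W \<and> norm (B ** A - W ** scale_mat \<mu>s) \<le> c' * \<eta>) \<and>
         (\<forall>W. signed_permutation W \<longrightarrow> W ** B \<in> \<Phi> \<zeta>)"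
    proof (intro ballI conjI allI impI)
      fix B assume "B \<in> \<Phi> \<zeta>"
      then obtain \<theta> where B: "B = \<theta> ** Rmat \<zeta>" and \<theta>: "\<theta> \<in> Xi1 \<kappa>0"
        and min: "\<And>\<theta>'. \<theta>' \<in> Xi1 \<kappa>0 \<Longrightarrow> contrast \<zeta> \<theta> \<le> contrast \<zeta> \<theta>'"
        unfolding \<Phi> by (auto simp: is_arg_min_linorder)
      have Q: "Q \<in> Xi1 \<kappa>0" by (rule orthogonal_in_Xi1[OF orthQ \<kappa>0])
      have "offdiag_energy (lin_mom (\<theta> ** Rmat \<zeta>) (esig \<zeta>)) \<le> offdiag_energy (lin_mom (Q ** Rmat \<zeta>) (esig \<zeta>))"
        using min[OF Q] unfolding con[OF \<theta>] con[OF Q] .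
      then obtain W where W: "signed_permutation W" "norm (B ** A' - W) \<le> c * \<eta>"
        using R[OF Rm \<theta>] unfolding B signed_permutation_def by blast
      have "B ** A - W ** scale_mat \<mu>s = (B ** A' - W) ** scale_mat \<mu>s"
        unfolding A'_def using Nmat_scale_mat(1)[OF pos]
        by (simp add: matrix_diff_rdistrib matrix_mul_assoc[symmetric])
      then have "norm (B ** A - W ** scale_mat \<mu>s) \<le> norm (B ** A' - W) * norm (scale_mat \<mu>s)"
        using norm_matrix_mult_le by metis
      also have "\<dots> \<le> (c * \<eta>) * (norm (scale_mat \<mu>s) + 1)" using W(2) by (intro mult_mono) (auto intro: order_trans[OF norm_ge_zero])
      finally show "\<exists>W. signed_permutation W \<and> norm (B ** A - W ** scale_mat \<mu>s) \<le> c' * \<eta>"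
        using W(1) by (auto simp: c'_def mult_ac)
      fix W' :: "real^'d^'d" assume W': "signed_permutation W'"
      have \<theta>': "W' ** \<theta> \<in> Xi1 \<kappa>0" by (rule Xi1_signed_permutation[OF W' \<theta>])
      have "contrast \<zeta> (W' ** \<theta>) = offdiag_energy (lin_mom W' (lin_mom (\<theta> ** Rmat \<zeta>) (esig \<zeta>)))"
        unfolding con[OF \<theta>'] by (rule offdiag_energy_cong) (simp add: lin_mom_comp matrix_mul_assoc)
      also have "\<dots> = contrast \<zeta> \<theta>" unfolding offdiag_energy_signed_permutation[OF W'] con[OF \<theta>] ..
      finally have "is_arg_min (contrast \<zeta>) (\<lambda>\<theta>. \<theta> \<in> Xi1 \<kappa>0) (W' ** \<theta>)"
        using min \<theta>' by (simp add: is_arg_min_linorder)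
      then show "W' ** B \<in> \<Phi> \<zeta>" unfolding \<Phi> B by (auto simp: matrix_mul_assoc)
    qed
  qed
qed

text \<open>\<open>L\<close> is chosen before the laws, the map and \<open>K\<close>, so it depends
  on \<open>A\<close> alone. The two error sources add up: \<open>e\<close> is the error of the
  moments of \<mu>, and the term with \<open>H\<close> comes from the nonlinearity of
  \<open>f\<close>.\<close>

lemma pushforward_moments_close:
  fixes A :: "real^'d^'d::finite"
  shows "\<exists>L>0. \<forall>\<mu>s \<mu> f R j H \<gamma> K e. \<mu> \<in> dot_laws \<and> (\<forall>u. f u = A *v (u + R u)) \<and> lip_hoelder \<gamma> j H R \<and> j \<le> 1 \<and>
     0 \<le> \<gamma> \<and> \<gamma> \<le> 1 \<and> 0 \<le> K \<and> (H = 0 \<or> (\<integral>\<^sup>+x. ennreal (one_var x powr (2 + \<gamma>)) \<partial>\<mu>) \<le> ennreal K) \<and>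
     (\<forall>w. length w \<in> {2, 3} \<longrightarrow> \<bar>esig \<mu> w - esig \<mu>s w\<bar> \<le> e) \<longrightarrow>
     pushforward f \<mu> \<in> ac_laws \<and> (\<forall>w. length w \<in> {2, 3} \<longrightarrow> integrable (pushforward f \<mu>) (sig w) \<and>
       \<bar>esig (pushforward f \<mu>) w - lin_mom A (esig \<mu>s) w\<bar> \<le> L * (e + H * (1 + K)))"
proof -
  define d where "d = real CARD('d)"
  define a where "a = d * norm A"
  define L where "L = (1 + a) ^ 3 * (12 * d)"
  have d: "1 \<le> d" by (simp add: d_def Suc_leI)
  have a: "0 \<le> a" using d by (simp add: a_def)
  have L: "0 < L" using d a by (simp add: L_def add_pos_nonneg)
  show ?thesis
  proof (intro exI[of _ L] conjI L allI impI, goal_cases)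
    case (1 \<mu>s \<mu> f R j H \<gamma> K e)
    then have \<mu>: "\<mu> \<in> dot_laws" and f: "\<And>u. f u = A *v (u + R u)" and lh: "lip_hoelder \<gamma> j H R" and j: "j \<le> 1"
      and \<gamma>: "0 \<le> \<gamma>" "\<gamma> \<le> 1" and K: "0 \<le> K" "H = 0 \<or> (\<integral>\<^sup>+x. ennreal (one_var x powr (2 + \<gamma>)) \<partial>\<mu>) \<le> ennreal K"
      by blast+
    have lip: "norm (R u - R v) \<le> norm (u - v)" for u v
      using lh j mult_right_mono[of j 1 "norm (u - v)"] by (auto simp: lip_hoelder_def intro: order_trans)
    have ho: "norm (R u - R v) \<le> H * norm (u - v) powr \<gamma>" and H: "0 \<le> H" for u v
      using lh by (auto simp: lip_hoelder_def)
    show ?case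
      by (rule pushforward_moments(1)[OF \<mu> matrix_row_sum_bound f lip ho H \<gamma> K(2,1)])
  next
    case (2 \<mu>s \<mu> f R j H \<gamma> K e w)
    then have \<mu>: "\<mu> \<in> dot_laws" and f: "\<And>u. f u = A *v (u + R u)" and lh: "lip_hoelder \<gamma> j H R" and j: "j \<le> 1"
      and \<gamma>: "0 \<le> \<gamma>" "\<gamma> \<le> 1" and K: "0 \<le> K" "H = 0 \<or> (\<integral>\<^sup>+x. ennreal (one_var x powr (2 + \<gamma>)) \<partial>\<mu>) \<le> ennreal K"
      by blast+
    have lip: "norm (R u - R v) \<le> norm (u - v)" for u v
      using lh j mult_right_mono[of j 1 "norm (u - v)"] by (auto simp: lip_hoelder_def intro: order_trans)
    have ho: "norm (R u - R v) \<le> H * norm (u - v) powr \<gamma>" and H: "0 \<le> H" for u v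
      using lh by (auto simp: lip_hoelder_def)
    show ?case
      by (rule pushforward_moments(2)[OF \<mu> matrix_row_sum_bound f lip ho H \<gamma> K(2,1) 2(2)])
  next
    case (3 \<mu>s \<mu> f R j H \<gamma> K e w)
    then have \<mu>: "\<mu> \<in> dot_laws" and f: "\<And>u. f u = A *v (u + R u)" and lh: "lip_hoelder \<gamma> j H R" and j: "j \<le> 1"
      and \<gamma>: "0 \<le> \<gamma>" "\<gamma> \<le> 1" and K: "0 \<le> K" "H = 0 \<or> (\<integral>\<^sup>+x. ennreal (one_var x powr (2 + \<gamma>)) \<partial>\<mu>) \<le> ennreal K"
      and e: "\<And>w. length w \<in> {2, 3} \<Longrightarrow> \<bar>esig \<mu> w - esig \<mu>s w\<bar> \<le> e"
      by blast+
    have lip: "norm (R u - R v) \<le> norm (u - v)" for u v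
      using lh j mult_right_mono[of j 1 "norm (u - v)"] by (auto simp: lip_hoelder_def intro: order_trans)
    have ho: "norm (R u - R v) \<le> H * norm (u - v) powr \<gamma>" and H: "0 \<le> H" for u v
      using lh by (auto simp: lip_hoelder_def)
    have e0: "0 \<le> e" using e[of w] 3(2) by linarith
    have pw: "a ^ length w \<le> (1 + a) ^ 3"
    proof -
      have "a ^ length w \<le> (1 + a) ^ length w" using a by (intro power_mono) auto
      also have "\<dots> \<le> (1 + a) ^ 3" using 3(2) a by (intro power_increasing) auto
      finally show ?thesis .
    qed
    have "\<bar>esig (pushforward f \<mu>) w - lin_mom A (esig \<mu>) w\<bar> \<le> a ^ length w * (12 * d * H) * (1 + K)"
      unfolding a_def d_def
      by (rule pushforward_moments(3)[OF \<mu> matrix_row_sum_bound f lip ho H \<gamma> K(2,1) 3(2)])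
    also have "\<dots> \<le> (1 + a) ^ 3 * (12 * d * H) * (1 + K)"
      using pw d H K by (intro mult_right_mono) auto
    also have "\<dots> = L * (H * (1 + K))" by (simp add: L_def mult_ac)
    finally have 1: "\<bar>esig (pushforward f \<mu>) w - lin_mom A (esig \<mu>) w\<bar> \<le> L * (H * (1 + K))" .
    have "\<bar>lin_mom A (esig \<mu>) w - lin_mom A (esig \<mu>s) w\<bar> \<le> a ^ length w * e"
      unfolding a_def d_def by (rule lin_mom_diff_le[OF matrix_row_sum_bound]) (use e 3(2) in auto)
    also have "\<dots> \<le> L * e"
    proof (rule mult_right_mono[OF _ e0])
      have "(1 + a) ^ 3 * 1 \<le> (1 + a) ^ 3 * (12 * d)" using d a by (intro mult_left_mono) auto
      then show "a ^ length w \<le> L" using pw by (simp add: L_def)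
    qed
    finally show ?case using 1 by (simp add: distrib_left)
  qed
qed

section \<open>The deviance\<close>

lemma mult_diag_mat_entry: "(X ** diag_mat a) $ i $ k = X $ i $ k * (a $ k :: real)"
  by (simp add: matrix_matrix_mult_def diag_mat_def if_distrib[of "\<lambda>x. _ * x"] cong: if_cong)

lemma diag_mat_mult_entry: "(diag_mat a ** X) $ i $ k = (a $ i :: real) * X $ i $ k"
  by (simp add: matrix_matrix_mult_def diag_mat_def if_distrib[of "\<lambda>x. x * _"] cong: if_cong)

text \<open>\<open>monomial_mats\<close> has the diagonal factor on the left. Moving it across the
  permutation relabels its entries by \<open>inv p\<close> and lets it absorb the signs.\<close>

lemma signed_permutation_scaled_monomial:
  assumes W: "signed_permutation W" and a: "\<And>i. a $ i \<noteq> 0"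
  shows "W ** diag_mat a \<in> monomial_mats"
proof -
  obtain p s where p: "p permutes UNIV" and s: "\<forall>k. s k \<in> {1, -1}" and Weq: "W = signed_perm p s"
    using W unfolding signed_permutation_def by blast
  let ?v = "\<chi> i. s (inv p i) * a $ inv p i"
  have eq: "(i = p k) = (k = inv p i)" for i k using permutes_inverses[OF p] by metis
  have "W ** diag_mat a = diag_mat ?v ** perm_mat (inv p)"
    unfolding Weq
    by (simp add: vec_eq_iff mult_diag_mat_entry diag_mat_mult_entry perm_mat_def signed_perm_def eq)
  moreover have "?v $ i \<noteq> 0" for i using a[of "inv p i"] s[rule_format, of "inv p i"] by auto
  ultimately show ?thesis unfolding monomial_mats_def using permutes_inv[OF p] by blast
qed

text \<open>For \<open>u = y - z\<close> one has \<open>y + R y = u + (R y - R z)\<close>, so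
  centring at the zero leaves a remainder of size at most \<open>j * norm u\<close>, without a
  constant term; this is why the quotient stays bounded near \<open>u = 0\<close>. The left inverse
  \<open>M'\<close> turns \<open>norm u\<close> into a multiple of the norm of
  \<open>M *v u\<close>, the denominator.\<close>

lemma deviance_term_bound:
  fixes A B M M' E :: "real^'d^'d::finite"
  assumes f: "\<And>u. f u = A *v (u + R u)" and lip: "\<And>u v. norm (R u - R v) \<le> j * norm (u - v)"
    and z: "z + R z = 0" and A: "invertible A"
    and B: "B = M ** (mat 1 + E) ** matrix_inv A" and M: "M \<in> monomial_mats" "M' ** M = mat 1"
    and E: "norm E \<le> \<epsilon>" and j: "0 \<le> j"
  shows "(INF (M, v) \<in> monomial_mats \<times> UNIV. SUP u \<in> (\<lambda>z. v + z) ` D.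
       ennreal (if M *v u = 0 then 0 else norm (B *v f (u - v) - M *v u) / norm (M *v u)))
     \<le> ennreal (norm M * norm M' * (\<epsilon> + j * (1 + \<epsilon>)))"
proof (rule INF_lower2[of "(M, - z)"], simp add: M, unfold prod.case, rule SUP_least)
  fix u
  define y where "y = u - (- z)"
  have \<epsilon>: "0 \<le> \<epsilon>" using E norm_ge_zero order_trans by blast
  have c0: "0 \<le> norm M * norm M' * (\<epsilon> + j * (1 + \<epsilon>))" using \<epsilon> j by simp
  have u: "u = y - z" by (simp add: y_def)
  define r where "r = R y - R z"
  have r: "norm r \<le> j * norm u" unfolding r_def u by (rule lip)
  have Rz: "R z = - z" using z by (metis add_eq_0_iff)
  have "B *v f y = M *v ((mat 1 + E) *v (y + R y))"
    unfolding B f using A by (simp add: matrix_vector_mul_assoc[symmetric])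
      (simp add: matrix_vector_mul_assoc matrix_inv_left)
  also have "y + R y = u + r" by (simp add: u r_def Rz)
  finally have eq: "B *v f y - M *v u = M *v (r + E *v (u + r))"
    by (simp add: matrix_vector_mult_add_rdistrib matrix_vector_right_distrib)
  have "norm (E *v (u + r)) \<le> \<epsilon> * (norm u + j * norm u)"
    by (rule order_trans[OF norm_matrix_vector_le mult_mono[OF E]])
       (use norm_triangle_ineq[of u r] r \<epsilon> in auto)
  then have "norm (r + E *v (u + r)) \<le> j * norm u + \<epsilon> * (norm u + j * norm u)"
    using norm_triangle_ineq[of r "E *v (u + r)"] r by linarith
  also have "\<dots> = (\<epsilon> + j * (1 + \<epsilon>)) * norm u" by (simp add: algebra_simps)
  finally have num: "norm (B *v f y - M *v u) \<le> norm M * ((\<epsilon> + j * (1 + \<epsilon>)) * norm u)"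
    unfolding eq by (intro order_trans[OF norm_matrix_vector_le mult_left_mono]) auto
  have "norm u = norm (M' *v (M *v u))" by (simp add: matrix_vector_mul_assoc M(2))
  also have "\<dots> \<le> norm M' * norm (M *v u)" by (rule norm_matrix_vector_le)
  finally have den: "norm u \<le> norm M' * norm (M *v u)" .
  have "norm (B *v f y - M *v u) \<le> norm M * ((\<epsilon> + j * (1 + \<epsilon>)) * (norm M' * norm (M *v u)))"
    using num den \<epsilon> j by (intro order_trans[OF num mult_left_mono[OF mult_left_mono]]) auto
  then have "norm (B *v f y - M *v u) / norm (M *v u) \<le> norm M * norm M' * (\<epsilon> + j * (1 + \<epsilon>))" if "M *v u \<noteq> 0"
    using that by (simp add: divide_le_eq mult_ac)
  then show "ennreal (if M *v u = 0 then 0 else norm (B *v f (u - (- z)) - M *v u) / norm (M *v u))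
    \<le> ennreal (norm M * norm M' * (\<epsilon> + j * (1 + \<epsilon>)))"
    unfolding y_def[symmetric] using c0 by (auto intro: ennreal_leI)
qed

section \<open>Robustness\<close>

text \<open>All consequences at one cause with the constants fixed, in terms of the moment error
  \<open>e\<close> and the constants \<open>j\<close> and \<open>H\<close> instead of the
  premetrics. This form serves both quantitative statements and the continuity proof, whose
  neighbourhoods are not premetric balls.\<close>

definition robust_at ::
  "('d::finite) law \<Rightarrow> real^'d^'d \<Rightarrow> real \<Rightarrow> real \<Rightarrow> real \<Rightarrow> real \<Rightarrow> real \<Rightarrow> real \<Rightarrow> real \<Rightarrow> bool" where
  "robust_at \<mu>s A \<kappa>0 K \<gamma> C \<eta>0 c3 c4 \<longleftrightarrow> (\<forall>\<mu> f R j H e \<Phi> z. \<mu> \<in> dot_laws \<longrightarrow> (\<forall>u. f u = A *v (u + R u)) \<longrightarrow>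
      lip_hoelder \<gamma> j H R \<longrightarrow> j \<le> 1 \<longrightarrow> z + R z = 0 \<longrightarrow>
      (H = 0 \<or> (\<integral>\<^sup>+x. ennreal (one_var x powr (2 + \<gamma>)) \<partial>\<mu>) \<le> ennreal K) \<longrightarrow>
      (\<forall>w. length w \<in> {2, 3} \<longrightarrow> \<bar>esig \<mu> w - esig \<mu>s w\<bar> \<le> e) \<longrightarrow> inversion_map \<kappa>0 \<Phi> \<longrightarrow> e + H \<le> \<eta>0 \<longrightarrow>
      (\<forall>B\<in>inversion \<Phi> (\<mu>, f).
        (\<exists>W. signed_permutation W \<and> norm (B - W ** (scale_mat \<mu>s ** matrix_inv A)) \<le> C * (e + H)) \<and>
        (\<forall>W. signed_permutation W \<longrightarrow> W ** B \<in> inversion \<Phi> (\<mu>, f))) \<and>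
      (\<forall>\<epsilon>\<ge>C * (e + H). (\<forall>\<theta>\<in>inversion \<Phi> (\<mu>, f). \<exists>M\<in>monomial_mats. \<exists>E. norm M \<le> c3 \<and> norm E \<le> \<epsilon> \<and>
            \<theta> = M ** (mat 1 + E) ** matrix_inv A) \<and>
          deviance \<Phi> (\<mu>, f) \<le> ennreal (c4 * (\<epsilon> + j * (1 + \<epsilon>)))))"

lemma robust_atD:
  assumes "robust_at \<mu>s A \<kappa>0 K \<gamma> C \<eta>0 c3 c4" "\<mu> \<in> dot_laws" "\<And>u. f u = A *v (u + R u)"
    "lip_hoelder \<gamma> j H R" "j \<le> 1" "z + R z = 0"
    "H = 0 \<or> (\<integral>\<^sup>+x. ennreal (one_var x powr (2 + \<gamma>)) \<partial>\<mu>) \<le> ennreal K"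
    "\<And>w. length w \<in> {2, 3} \<Longrightarrow> \<bar>esig \<mu> w - esig \<mu>s w\<bar> \<le> e" "inversion_map \<kappa>0 \<Phi>" "e + H \<le> \<eta>0"
  shows "\<And>B. B \<in> inversion \<Phi> (\<mu>, f) \<Longrightarrow>
        \<exists>W. signed_permutation W \<and> norm (B - W ** (scale_mat \<mu>s ** matrix_inv A)) \<le> C * (e + H)"
    and "\<And>B W. B \<in> inversion \<Phi> (\<mu>, f) \<Longrightarrow> signed_permutation W \<Longrightarrow> W ** B \<in> inversion \<Phi> (\<mu>, f)"
    and "\<And>\<epsilon>. C * (e + H) \<le> \<epsilon> \<Longrightarrow> (\<forall>\<theta>\<in>inversion \<Phi> (\<mu>, f). \<exists>M\<in>monomial_mats. \<exists>E. norm M \<le> c3 \<and> norm E \<le> \<epsilon> \<and>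
            \<theta> = M ** (mat 1 + E) ** matrix_inv A) \<and>
          deviance \<Phi> (\<mu>, f) \<le> ennreal (c4 * (\<epsilon> + j * (1 + \<epsilon>)))"
proof -
  have "(\<forall>B\<in>inversion \<Phi> (\<mu>, f).
        (\<exists>W. signed_permutation W \<and> norm (B - W ** (scale_mat \<mu>s ** matrix_inv A)) \<le> C * (e + H)) \<and>
        (\<forall>W. signed_permutation W \<longrightarrow> W ** B \<in> inversion \<Phi> (\<mu>, f))) \<and>
      (\<forall>\<epsilon>\<ge>C * (e + H). (\<forall>\<theta>\<in>inversion \<Phi> (\<mu>, f). \<exists>M\<in>monomial_mats. \<exists>E. norm M \<le> c3 \<and> norm E \<le> \<epsilon> \<and>
            \<theta> = M ** (mat 1 + E) ** matrix_inv A) \<and>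
          deviance \<Phi> (\<mu>, f) \<le> ennreal (c4 * (\<epsilon> + j * (1 + \<epsilon>))))"
    by (rule assms(1)[unfolded robust_at_def, rule_format, of \<mu> f R j H z e \<Phi>]) (use assms in auto)
  note * = this
  show "\<And>B. B \<in> inversion \<Phi> (\<mu>, f) \<Longrightarrow>
        \<exists>W. signed_permutation W \<and> norm (B - W ** (scale_mat \<mu>s ** matrix_inv A)) \<le> C * (e + H)"
    using * by blast
  show "\<And>B W. B \<in> inversion \<Phi> (\<mu>, f) \<Longrightarrow> signed_permutation W \<Longrightarrow> W ** B \<in> inversion \<Phi> (\<mu>, f)"
    using * by blast
  show "\<And>\<epsilon>. C * (e + H) \<le> \<epsilon> \<Longrightarrow> (\<forall>\<theta>\<in>inversion \<Phi> (\<mu>, f). \<exists>M\<in>monomial_mats. \<exists>E. norm M \<le> c3 \<and> norm E \<le> \<epsilon> \<and>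
            \<theta> = M ** (mat 1 + E) ** matrix_inv A) \<and>
          deviance \<Phi> (\<mu>, f) \<le> ennreal (c4 * (\<epsilon> + j * (1 + \<epsilon>)))"
    using * by blast
qed

lemma robust_estimate:
  fixes \<mu>s :: "'d::finite law"
  assumes \<mu>s: "\<mu>s \<in> S_star" and A: "invertible A" and \<kappa>0: "1 \<le> \<kappa>0" and K: "0 \<le> K" and \<gamma>: "0 \<le> \<gamma>" "\<gamma> \<le> 1"
  shows "\<exists>C>0. \<exists>\<eta>0>0. \<exists>c3>0. \<exists>c4>0. robust_at \<mu>s A \<kappa>0 K \<gamma> C \<eta>0 c3 c4"
proof -
  have dot: "\<mu>s \<in> dot_laws" using \<mu>s by (simp add: S_star_def)
  have pos: "0 < esig \<mu>s [i, i]" for i by (rule esig_diag_pos[OF dot])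
  define d2 where "d2 = (real CARD('d))\<^sup>2"
  define S where "S = scale_mat \<mu>s"
  define N where "N = Nmat \<mu>s"
  have NS: "N ** S = mat 1" unfolding N_def S_def by (rule Nmat_scale_mat(1)[OF pos])
  obtain c \<eta>1 where c: "0 < c" "0 < \<eta>1" and inv: "\<forall>\<zeta> \<eta> \<Phi>. \<zeta> \<in> ac_laws \<and> (\<forall>w. length w \<in> {2, 3} \<longrightarrow> integrable \<zeta> (sig w)) \<and>
      0 \<le> \<eta> \<and> \<eta> \<le> \<eta>1 \<and> (\<forall>w. length w \<in> {2, 3} \<longrightarrow> \<bar>esig \<zeta> w - lin_mom A (esig \<mu>s) w\<bar> \<le> \<eta>) \<and>
      inversion_map \<kappa>0 \<Phi> \<longrightarrow>
      (\<forall>B\<in>\<Phi> \<zeta>. (\<exists>W. signed_permutation W \<and> norm (B ** A - W ** S) \<le> c * \<eta>) \<and>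
         (\<forall>W. signed_permutation W \<longrightarrow> W ** B \<in> \<Phi> \<zeta>))"
    using inversion_estimate[OF \<mu>s A \<kappa>0] unfolding S_def by blast
  obtain L where L: "0 < L" and push: "\<forall>\<mu>s \<mu> f R j H \<gamma> K e. \<mu> \<in> dot_laws \<and> (\<forall>u. f u = A *v (u + R u)) \<and> lip_hoelder \<gamma> j H R \<and> j \<le> 1 \<and>
     0 \<le> \<gamma> \<and> \<gamma> \<le> 1 \<and> 0 \<le> K \<and> (H = 0 \<or> (\<integral>\<^sup>+x. ennreal (one_var x powr (2 + \<gamma>)) \<partial>\<mu>) \<le> ennreal K) \<and>
     (\<forall>w. length w \<in> {2, 3} \<longrightarrow> \<bar>esig \<mu> w - esig \<mu>s w\<bar> \<le> e) \<longrightarrow>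
     pushforward f \<mu> \<in> ac_laws \<and> (\<forall>w. length w \<in> {2, 3} \<longrightarrow> integrable (pushforward f \<mu>) (sig w) \<and>
       \<bar>esig (pushforward f \<mu>) w - lin_mom A (esig \<mu>s) w\<bar> \<le> L * (e + H * (1 + K)))"
    using pushforward_moments_close[of A] by blast
  define L1 where "L1 = L * (1 + K)"
  have L1: "0 < L1" using L K by (simp add: L1_def)
  define C0 where "C0 = c * L1"
  \<comment> \<open>One constant for two estimates: removing \<open>A\<close> from
    \<open>B ** A\<close> costs the norm of its inverse, and dividing by the monomial factor costs
    at most \<open>norm N * d2\<close>.\<close>
  define C where "C = C0 * (norm (matrix_inv A) + norm N * d2 + 1)"
  define \<eta>0 where "\<eta>0 = \<eta>1 / L1"
  define c3 where "c3 = d2 * norm S + 1"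
  define c4 where "c4 = c3 * (norm N * d2 + 1)"
  have d2: "0 \<le> d2" by (simp add: d2_def)
  have C0: "0 < C0" using c L1 by (simp add: C0_def)
  have "0 \<le> norm (matrix_inv A) + norm N * d2" using d2 by simp
  then have C: "0 < C" using C0 by (simp add: C_def)
  have \<eta>0: "0 < \<eta>0" using c L1 by (simp add: \<eta>0_def)
  have c3: "0 < c3" using d2 by (simp add: c3_def add_nonneg_pos)
  have c4: "0 < c4" using c3 d2 by (simp add: c4_def add_nonneg_pos)
  have "robust_at \<mu>s A \<kappa>0 K \<gamma> C \<eta>0 c3 c4"
    unfolding robust_at_def
  proof (rule allI)+
    fix \<mu> :: "'d law" and f R :: "real^'d \<Rightarrow> real^'d" and j H e :: real and \<Phi> :: "'d law \<Rightarrow> (real^'d^'d) set" and z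
    show "\<mu> \<in> dot_laws \<longrightarrow> (\<forall>u. f u = A *v (u + R u)) \<longrightarrow>
      lip_hoelder \<gamma> j H R \<longrightarrow> j \<le> 1 \<longrightarrow> z + R z = 0 \<longrightarrow>
      (H = 0 \<or> (\<integral>\<^sup>+x. ennreal (one_var x powr (2 + \<gamma>)) \<partial>\<mu>) \<le> ennreal K) \<longrightarrow>
      (\<forall>w. length w \<in> {2, 3} \<longrightarrow> \<bar>esig \<mu> w - esig \<mu>s w\<bar> \<le> e) \<longrightarrow> inversion_map \<kappa>0 \<Phi> \<longrightarrow> e + H \<le> \<eta>0 \<longrightarrow>
      (\<forall>B\<in>inversion \<Phi> (\<mu>, f).
        (\<exists>W. signed_permutation W \<and> norm (B - W ** (scale_mat \<mu>s ** matrix_inv A)) \<le> C * (e + H)) \<and>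
        (\<forall>W. signed_permutation W \<longrightarrow> W ** B \<in> inversion \<Phi> (\<mu>, f))) \<and>
      (\<forall>\<epsilon>\<ge>C * (e + H). (\<forall>\<theta>\<in>inversion \<Phi> (\<mu>, f). \<exists>M\<in>monomial_mats. \<exists>E. norm M \<le> c3 \<and> norm E \<le> \<epsilon> \<and>
            \<theta> = M ** (mat 1 + E) ** matrix_inv A) \<and>
          deviance \<Phi> (\<mu>, f) \<le> ennreal (c4 * (\<epsilon> + j * (1 + \<epsilon>))))"
    proof (rule impI)+
      assume \<mu>: "\<mu> \<in> dot_laws" and f: "\<forall>u. f u = A *v (u + R u)" and lh: "lip_hoelder \<gamma> j H R" and j: "j \<le> 1"
        and z: "z + R z = 0" and HK: "H = 0 \<or> (\<integral>\<^sup>+x. ennreal (one_var x powr (2 + \<gamma>)) \<partial>\<mu>) \<le> ennreal K"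
        and e: "\<forall>w. length w \<in> {2, 3} \<longrightarrow> \<bar>esig \<mu> w - esig \<mu>s w\<bar> \<le> e" and \<Phi>: "inversion_map \<kappa>0 \<Phi>"
        and le: "e + H \<le> \<eta>0"
      have e0: "0 \<le> e" using e[rule_format, of "[undefined, undefined]"] by simp
      have H0: "0 \<le> H" and j0: "0 \<le> j" and lip: "\<And>u v. norm (R u - R v) \<le> j * norm (u - v)"
        using lh by (auto simp: lip_hoelder_def)
      define \<zeta> where "\<zeta> = pushforward f \<mu>"
      define \<eta> where "\<eta> = L1 * (e + H)"
      have \<eta>: "0 \<le> \<eta>" "\<eta> \<le> \<eta>1"
        using L1 e0 H0 le by (auto simp: \<eta>_def \<eta>0_def field_simps)
      have "\<zeta> \<in> ac_laws \<and> (\<forall>w. length w \<in> {2, 3} \<longrightarrow> integrable \<zeta> (sig w) \<and>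
         \<bar>esig \<zeta> w - lin_mom A (esig \<mu>s) w\<bar> \<le> L * (e + H * (1 + K)))"
        unfolding \<zeta>_def by (rule push[rule_format, of \<mu> f R \<gamma> j H K]) (use \<mu> f lh j \<gamma> K HK e in blast)
      moreover have "L * (e + H * (1 + K)) \<le> \<eta>"
      proof -
        have "e + H * (1 + K) \<le> (1 + K) * (e + H)" using e0 H0 K by (simp add: algebra_simps)
        then have "L * (e + H * (1 + K)) \<le> L * ((1 + K) * (e + H))" using L by (intro mult_left_mono) auto
        then show ?thesis by (simp add: \<eta>_def L1_def mult.assoc)
      qed
      ultimately have pre: "\<zeta> \<in> ac_laws \<and> (\<forall>w. length w \<in> {2, 3} \<longrightarrow> integrable \<zeta> (sig w)) \<and>
        0 \<le> \<eta> \<and> \<eta> \<le> \<eta>1 \<and> (\<forall>w. length w \<in> {2, 3} \<longrightarrow> \<bar>esig \<zeta> w - lin_mom A (esig \<mu>s) w\<bar> \<le> \<eta>) \<and>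
        inversion_map \<kappa>0 \<Phi>"
        using \<eta> \<Phi> by (meson order_trans)
      have est: "\<forall>B\<in>\<Phi> \<zeta>. (\<exists>W. signed_permutation W \<and> norm (B ** A - W ** S) \<le> c * \<eta>) \<and>
           (\<forall>W. signed_permutation W \<longrightarrow> W ** B \<in> \<Phi> \<zeta>)"
        using inv pre by blast
      have c\<eta>: "c * \<eta> = C0 * (e + H)" by (simp add: \<eta>_def C0_def mult.assoc)
      have eH: "0 \<le> C0 * (e + H)" using C0 e0 H0 by simp
      have I: "inversion \<Phi> (\<mu>, f) = \<Phi> \<zeta>" by (simp add: inversion_def \<zeta>_def)
      have fact1: "\<exists>W. signed_permutation W \<and> norm (B - W ** (S ** matrix_inv A)) \<le> C * (e + H)"
        if BI: "B \<in> \<Phi> \<zeta>" for B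
      proof -
        obtain W where W: "signed_permutation W" "norm (B ** A - W ** S) \<le> C0 * (e + H)"
          using est BI unfolding c\<eta> by blast
        have "B - W ** (S ** matrix_inv A) = (B ** A - W ** S) ** matrix_inv A"
          using A by (simp add: matrix_diff_rdistrib matrix_mul_assoc[symmetric] matrix_inv_right)
        then have "norm (B - W ** (S ** matrix_inv A)) \<le> norm (B ** A - W ** S) * norm (matrix_inv A)"
          by (simp only: norm_matrix_mult_le)
        also have "\<dots> \<le> C0 * (e + H) * (norm (matrix_inv A) + norm N * d2 + 1)"
          using W(2) d2 eH by (intro mult_mono) auto
        also have "\<dots> = C * (e + H)" by (simp add: C_def mult_ac)
        finally show ?thesis using W(1) by blast
      qed
      have fact2: "\<exists>M M' E. M \<in> monomial_mats \<and> M' ** M = mat 1 \<and> norm M \<le> c3 \<and> norm M' \<le> norm N * d2 + 1 \<and>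
         norm E \<le> C * (e + H) \<and> B = M ** (mat 1 + E) ** matrix_inv A" if BI: "B \<in> \<Phi> \<zeta>" for B
      proof -
        obtain W where W: "signed_permutation W" "norm (B ** A - W ** S) \<le> C0 * (e + H)"
          using est BI unfolding c\<eta> by blast
        define M where "M = W ** S"
        define M' where "M' = N ** transpose W"
        \<comment> \<open>Relative error of \<open>B ** A\<close> with respect to \<open>M\<close>.
          Since \<open>M'\<close> is the inverse of \<open>M\<close>, this gives
          \<open>M ** (mat 1 + E) = B ** A\<close>.\<close>
        define E where "E = M' ** (B ** A - M)"
        have "M \<in> monomial_mats"
          unfolding M_def S_def scale_mat_def using pos
          by (intro signed_permutation_scaled_monomial[OF W(1)]) (simp add: less_imp_neq[symmetric])
        moreover have M'M: "M' ** M = mat 1"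
        proof -
          have "M' ** M = N ** (transpose W ** W) ** S" by (simp add: M_def M'_def matrix_mul_assoc)
          then show ?thesis using signed_permutation_orthogonal(1)[OF W(1)] NS by simp
        qed
        moreover have "norm M \<le> c3"
        proof -
          have "norm M \<le> norm W * norm S" unfolding M_def by (rule norm_matrix_mult_le)
          also have "\<dots> \<le> d2 * norm S" using norm_signed_permutation[OF W(1)] unfolding d2_def by (rule mult_right_mono) simp
          finally show ?thesis by (simp add: c3_def)
        qed
        moreover have nM': "norm M' \<le> norm N * d2"
        proof -
          have "norm M' \<le> norm N * norm (transpose W)" unfolding M'_def by (rule norm_matrix_mult_le)
          also have "\<dots> \<le> norm N * d2"
            using norm_signed_permutation[OF W(1)] unfolding d2_def norm_transpose by (rule mult_left_mono) simp
          finally show ?thesis .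
        qed
        moreover have "norm E \<le> C * (e + H)"
        proof -
          have "norm E \<le> norm M' * norm (B ** A - M)" unfolding E_def by (rule norm_matrix_mult_le)
          also have "\<dots> \<le> (norm (matrix_inv A) + norm N * d2 + 1) * (C0 * (e + H))"
            using nM' W(2) eH unfolding M_def by (intro mult_mono) (auto intro: order_trans add_nonneg_nonneg simp: d2)
          also have "\<dots> = C * (e + H)" by (simp add: C_def mult_ac)
          finally show ?thesis .
        qed
        moreover have "B = M ** (mat 1 + E) ** matrix_inv A"
        proof -
          have "M ** M' = mat 1" using M'M by (simp add: matrix_left_right_inverse)
          then have "M ** E = B ** A - M" by (simp add: E_def matrix_mul_assoc)
          then have "M ** (mat 1 + E) = B ** A" by (simp add: matrix_add_ldistrib)
          then show ?thesis using A by (simp add: matrix_mul_assoc[symmetric] matrix_inv_right)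
        qed
        ultimately show ?thesis by (intro exI[of _ M] exI[of _ M'] exI[of _ E] conjI) auto
      qed
      show "(\<forall>B\<in>inversion \<Phi> (\<mu>, f).
          (\<exists>W. signed_permutation W \<and> norm (B - W ** (scale_mat \<mu>s ** matrix_inv A)) \<le> C * (e + H)) \<and>
          (\<forall>W. signed_permutation W \<longrightarrow> W ** B \<in> inversion \<Phi> (\<mu>, f))) \<and>
        (\<forall>\<epsilon>\<ge>C * (e + H). (\<forall>\<theta>\<in>inversion \<Phi> (\<mu>, f). \<exists>M\<in>monomial_mats. \<exists>E. norm M \<le> c3 \<and> norm E \<le> \<epsilon> \<and>
              \<theta> = M ** (mat 1 + E) ** matrix_inv A) \<and>
            deviance \<Phi> (\<mu>, f) \<le> ennreal (c4 * (\<epsilon> + j * (1 + \<epsilon>))))"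
        unfolding I
      proof (intro conjI ballI allI impI)
        fix B assume "B \<in> \<Phi> \<zeta>"
        then show "\<exists>W. signed_permutation W \<and> norm (B - W ** (scale_mat \<mu>s ** matrix_inv A)) \<le> C * (e + H)"
          unfolding S_def[symmetric] by (rule fact1)
        fix W :: "real^'d^'d" assume "signed_permutation W"
        then show "W ** B \<in> \<Phi> \<zeta>" using est \<open>B \<in> \<Phi> \<zeta>\<close> by blast
      next
        fix \<epsilon> \<theta> assume "C * (e + H) \<le> \<epsilon>" "\<theta> \<in> \<Phi> \<zeta>"
        then show "\<exists>M\<in>monomial_mats. \<exists>E. norm M \<le> c3 \<and> norm E \<le> \<epsilon> \<and> \<theta> = M ** (mat 1 + E) ** matrix_inv A"
          using fact2[of \<theta>] by (meson order_trans)
      next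
        fix \<epsilon> assume \<epsilon>: "C * (e + H) \<le> \<epsilon>"
        have \<epsilon>0: "0 \<le> \<epsilon>" using \<epsilon> C e0 H0 by (intro order_trans[OF _ \<epsilon>]) simp
        show "deviance \<Phi> (\<mu>, f) \<le> ennreal (c4 * (\<epsilon> + j * (1 + \<epsilon>)))"
          unfolding deviance_def prod.case \<zeta>_def[symmetric]
        proof (rule SUP_least)
          fix B assume "B \<in> \<Phi> \<zeta>"
          then obtain M M' E where M: "M \<in> monomial_mats" "M' ** M = mat 1" "norm M \<le> c3" "norm M' \<le> norm N * d2 + 1"
            and E: "norm E \<le> C * (e + H)" "B = M ** (mat 1 + E) ** matrix_inv A" using fact2 by blast
          have "(INF (M, v) \<in> monomial_mats \<times> UNIV. SUP u \<in> (\<lambda>z. v + z) ` spatial_supp \<mu>.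
             ennreal (if M *v u = 0 then 0 else norm (B *v f (u - v) - M *v u) / norm (M *v u)))
             \<le> ennreal (norm M * norm M' * (\<epsilon> + j * (1 + \<epsilon>)))"
            by (rule deviance_term_bound[OF f[rule_format] lip z A E(2) M(1,2) order_trans[OF E(1) \<epsilon>] j0])
          also have "\<dots> \<le> ennreal (c4 * (\<epsilon> + j * (1 + \<epsilon>)))"
            unfolding c4_def using M(3,4) c3 \<epsilon>0 j0
            by (intro ennreal_leI mult_right_mono mult_mono) auto
          finally show "(INF (M, v) \<in> monomial_mats \<times> UNIV. SUP u \<in> (\<lambda>z. v + z) ` spatial_supp \<mu>.
             ennreal (if M *v u = 0 then 0 else norm (B *v f (u - v) - M *v u) / norm (M *v u)))
             \<le> ennreal (c4 * (\<epsilon> + j * (1 + \<epsilon>)))" .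
        qed
      qed
    qed
  qed
  then show ?thesis using C \<eta>0 c3 c4 by blast
qed

section \<open>The quantitative statements\<close>

lemma ica_settingD:
  assumes "ica_setting \<SS> K \<beta> p \<alpha> b \<Delta> \<Phi>"
  shows "\<SS> \<subseteq> dot_laws" "0 < \<alpha>" "\<alpha> < 1/2" "0 \<le> K" "1 \<le> b + \<Delta>" "inversion_map (b + \<Delta>) \<Phi>"
    "\<mu> \<in> \<SS> \<Longrightarrow> (\<integral>\<^sup>+x. ennreal (one_var x powr (2 + (1 - \<alpha>))) \<partial>\<mu>) \<le> ennreal K"
proof -
  have c: "core_integrable \<SS> K \<beta> p \<alpha>" using assms by (simp add: ica_setting_def)
  \<comment> \<open>From \<open>p = 1 / (\<beta> - 2)\<close> one gets \<alpha> = 3 - \<beta>, so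
    the moment of order \<open>2 + (1 - \<alpha>)\<close> that the estimates ask for is the one of
    order \<beta>.\<close>
  then have \<beta>: "5/2 < \<beta>" "\<beta> < 3" and \<alpha>: "\<alpha> = 3 - \<beta>"
    by (auto simp: core_integrable_def inverse_eq_divide)
  show "\<SS> \<subseteq> dot_laws" "1 \<le> b + \<Delta>" "inversion_map (b + \<Delta>) \<Phi>" using assms by (auto simp: ica_setting_def)
  show "0 \<le> K" using c by (simp add: core_integrable_def)
  show "0 < \<alpha>" "\<alpha> < 1/2" using \<beta> \<alpha> by auto
  assume "\<mu> \<in> \<SS>"
  then have "(\<integral>\<^sup>+x. ennreal (one_var x powr \<beta>) \<partial>\<mu>) \<le> (SUP \<mu>\<in>\<SS>. \<integral>\<^sup>+x. ennreal (one_var x powr \<beta>) \<partial>\<mu>)"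
    by (rule SUP_upper)
  also have "\<dots> = ennreal K" using c by (simp add: core_integrable_def)
  finally show "(\<integral>\<^sup>+x. ennreal (one_var x powr (2 + (1 - \<alpha>))) \<partial>\<mu>) \<le> ennreal K" by (simp add: \<alpha>)
qed

lemma ica_causesD:
  assumes "(\<mu>s, A) \<in> ica_causes b \<SS>"
  shows "\<mu>s \<in> S_star" "invertible A" "\<mu>s \<in> \<SS>" "(*v) A \<in> C1_diffeos"
  using assms by (auto simp: ica_causes_def I_star_def GL_def domain_E_def)

lemma diffeo_remainder:
  fixes A :: "real^'d^'d::finite" and f R :: "real^'d \<Rightarrow> real^'d"
  assumes "bij ((*v) A)" and R: "\<And>x. R x = inv ((*v) A) (f x) - x"
  shows "f u = A *v (u + R u)"
proof -
  have "A *v inv ((*v) A) (f u) = f u" using assms(1) by (simp add: bij_def surj_f_inv_f)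
  then show ?thesis by (simp add: R)
qed

text \<open>The preimage of 0 under \<open>f\<close> works, because \<open>A\<close> is
  injective.\<close>

lemma remainder_zero:
  fixes A :: "real^'d^'d::finite"
  assumes A: "invertible A" and f: "\<And>u. f u = A *v (u + R u)" and "bij f"
  shows "\<exists>z. z + R z = 0"
proof -
  have "A *v (inv f 0 + R (inv f 0)) = 0" using assms(3) f by (metis bij_def surj_f_inv_f)
  then have "matrix_inv A *v (A *v (inv f 0 + R (inv f 0))) = 0" by simp
  then show ?thesis using A by (auto simp: matrix_vector_mul_assoc matrix_inv_left)
qed

lemma diffeo_premetric_self:
  assumes "bij \<theta>"
  shows "diffeo_premetric \<theta> \<theta> = 0"
proof -
  have R: "(\<lambda>x. (inv \<theta> \<circ> \<theta>) x - x) = (\<lambda>x. 0)" using assms by (simp add: bij_def inv_f_f)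
  have "((\<lambda>x::real^'a. 0::real^'a) has_derivative (\<lambda>h. 0)) (at x)" for x by simp
  then have "frechet_derivative (\<lambda>x::real^'a. 0::real^'a) (at x) = (\<lambda>h. 0)" for x
    using frechet_derivative_at by metis
  then have "jacobian (\<lambda>x::real^'a. 0::real^'a) (at x) = 0" for x
    by (simp add: jacobian_def matrix_def vec_eq_iff)
  moreover have "((*v) (0 :: real^'a^'a)) = (\<lambda>x. 0)" by auto
  then have "spectral_norm (0 :: real^'a^'a) = 0" by (simp add: spectral_norm_def onorm_zero)
  ultimately have "jac_sup_norm (\<lambda>x::real^'a. 0::real^'a) = 0" by (simp add: jac_sup_norm_def)
  then show ?thesis unfolding diffeo_premetric_def R Let_def by simp
qed

lemma diffeo_premetric_nonneg: "0 \<le> diffeo_premetric \<theta>1 \<theta>2"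
  by (simp add: diffeo_premetric_def Let_def)

text \<open>The ratio is below 1, so its square, which the exponent \<open>2 / q\<close> produces,
  is at most the ratio itself; the ratio alone already gives \<epsilon>.\<close>

lemma radius_bound:
  fixes \<epsilon> c q \<delta> :: real
  assumes "0 < \<epsilon>" "0 < c" and q: "0 < q" and \<delta>: "0 \<le> \<delta>" "\<delta> < (\<epsilon> / (c + \<epsilon>)) powr (2 / q)"
  shows "c * \<delta> powr q \<le> \<epsilon>"
proof -
  define x where "x = \<epsilon> / (c + \<epsilon>)"
  have x: "0 < x" "x < 1" using assms by (auto simp: x_def)
  have "\<delta> powr q \<le> (x powr (2 / q)) powr q" using \<delta> q by (intro powr_mono2) (auto simp: x_def)
  also have "\<dots> = x\<^sup>2" using x q by (simp add: powr_powr powr_numeral)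
  also have "\<dots> \<le> x" using x by (simp add: power2_eq_square mult_left_le)
  finally have "c * \<delta> powr q \<le> c * x" using assms(2) by (intro mult_left_mono) auto
  also have "\<dots> \<le> \<epsilon>" using assms(1,2) by (simp add: x_def field_simps)
  finally show ?thesis .
qed

lemma robust_quantitative:
  fixes \<mu>s :: "'d::finite law"
  shows "\<exists>c0>0. \<exists>c1>0. \<exists>c2>0. \<exists>c3>0. \<exists>c4>0.
        \<forall>\<SS> b \<Delta> \<Phi>. ica_setting \<SS> K \<beta> p \<alpha> b \<Delta> \<Phi> \<and> \<kappa>0 = b + \<Delta> \<and> (\<mu>s, A) \<in> ica_causes b \<SS> \<longrightarrow>
        (\<forall>\<epsilon>>0. \<forall>\<mu> f.
          (\<mu>, f) \<in> cause_ball \<SS> (\<mu>s, (*v) A)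
             (min c0 (c1 powr (2 / \<alpha>) * (\<epsilon> / (c2 + \<epsilon>)) powr (2 / \<alpha>))) \<longrightarrow>
          (\<forall>\<theta> \<in> inversion \<Phi> (\<mu>, f). \<exists>M \<in> monomial_mats. \<exists>E. norm M \<le> c3 \<and> norm E \<le> \<epsilon> \<and>
              \<theta> = M ** (mat 1 + E) ** matrix_inv A) \<and>
          deviance \<Phi> (\<mu>, f) \<le> ennreal (c4 * (\<epsilon> + diffeo_premetric ((*v) A) f * (1 + \<epsilon>))))"
\<comment> \<open>The constants come before \<open>\<SS>\<close>, \<open>b\<close>,
  \<open>\<Delta>\<close> and \<open>\<Phi>\<close>. If no admissible choice exists, any constants
  do. Otherwise one choice is taken merely to learn the ranges of \<alpha>, \<open>K\<close> and
  \<kappa>0 and the properties of the cause; the constants themselves are built from the outer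
  parameters.\<close>
proof (cases "\<exists>\<SS> b \<Delta> \<Phi>. ica_setting \<SS> K \<beta> p \<alpha> b \<Delta> \<Phi> \<and> \<kappa>0 = b + \<Delta> \<and> (\<mu>s, A) \<in> ica_causes b \<SS>")
  case False
  then have no: "\<not> (ica_setting \<SS> K \<beta> p \<alpha> b \<Delta> \<Phi> \<and> \<kappa>0 = b + \<Delta> \<and> (\<mu>s, A) \<in> ica_causes b \<SS>)" for \<SS> b \<Delta> \<Phi>
    by blast
  show ?thesis
    by ((rule exI[of _ 1], rule conjI[OF zero_less_one])+, (rule allI)+, rule impI, erule notE[OF no])
next
  case True
  then obtain \<SS> b \<Delta> \<Phi> where set: "ica_setting \<SS> K \<beta> p \<alpha> b \<Delta> \<Phi>" and \<kappa>: "\<kappa>0 = b + \<Delta>"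
    and causes: "(\<mu>s, A) \<in> ica_causes b \<SS>" by blast
  have \<mu>s: "\<mu>s \<in> S_star" and A: "invertible A" and Ad: "(*v) A \<in> C1_diffeos"
    by (rule ica_causesD[OF causes])+
  have \<alpha>: "0 < \<alpha>" "\<alpha> < 1/2" and K: "0 \<le> K" by (rule ica_settingD[OF set])+
  have \<kappa>0: "1 \<le> \<kappa>0" unfolding \<kappa> by (rule ica_settingD(5)[OF set])
  have dot: "\<mu>s \<in> dot_laws" using \<mu>s by (simp add: S_star_def)
  note pos = esig_diag_pos[OF dot]
  obtain L where L: "0 < L" "\<And>\<mu> w. length w \<in> {2, 3} \<Longrightarrow> \<bar>esig \<mu> w - esig \<mu>s w\<bar> \<le> L * law_premetric \<mu>s \<mu>"
    using law_premetric_bound(2)[OF pos] by blast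
  have \<gamma>: "0 \<le> 1 - \<alpha>" "1 - \<alpha> \<le> 1" using \<alpha> by auto
  obtain C \<eta>0 c3 c4 where c: "0 < C" "0 < \<eta>0" "0 < c3" "0 < c4" and est: "robust_at \<mu>s A \<kappa>0 K (1 - \<alpha>) C \<eta>0 c3 c4"
    using robust_estimate[OF \<mu>s A \<kappa>0 K \<gamma>] by blast
  \<comment> \<open>The first cap keeps \<delta> below 1, which the Hoelder estimate for the
    remainder and the step from \<delta> to \<open>\<delta> powr \<alpha>\<close> require; the
    second keeps the total error below \<eta>0.\<close>
  define c0 where "c0 = min (1/2) ((\<eta>0 / (L + 2)) powr (1 / \<alpha>))"
  have c0: "0 < c0" using c L by (simp add: c0_def)
  define c2 where "c2 = C * (L + 2)"
  have c2: "0 < c2" using c L by (simp add: c2_def)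
  show ?thesis
  proof (rule exI[of _ c0], rule conjI[OF c0], rule exI[of _ 1], rule conjI[OF zero_less_one], rule exI[of _ c2], rule conjI[OF c2],
      rule exI[of _ c3], rule conjI[OF c(3)], rule exI[of _ c4], rule conjI[OF c(4)], intro allI impI)
    fix \<SS> b \<Delta> \<Phi> \<epsilon> \<mu> f
    assume set: "ica_setting \<SS> K \<beta> p \<alpha> b \<Delta> \<Phi> \<and> \<kappa>0 = b + \<Delta> \<and> (\<mu>s, A) \<in> ica_causes b \<SS>"
      and \<epsilon>: "0 < \<epsilon>" and ball: "(\<mu>, f) \<in> cause_ball \<SS> (\<mu>s, (*v) A)
             (min c0 (1 powr (2 / \<alpha>) * (\<epsilon> / (c2 + \<epsilon>)) powr (2 / \<alpha>)))"
    then have "ica_setting \<SS> K \<beta> p \<alpha> b \<Delta> \<Phi>" and \<kappa>: "\<kappa>0 = b + \<Delta>" by auto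
    note S = ica_settingD[OF this(1)]
    define \<delta>l where "\<delta>l = law_premetric \<mu>s \<mu>"
    define \<delta>f where "\<delta>f = diffeo_premetric ((*v) A) f"
    define \<delta> where "\<delta> = \<delta>l + \<delta>f"
    have \<mu>: "\<mu> \<in> \<SS>" and f: "f \<in> C1_diffeos" and \<delta>lt: "\<delta> < c0" "\<delta> < (\<epsilon> / (c2 + \<epsilon>)) powr (2 / \<alpha>)"
      using ball by (auto simp: cause_ball_def domain_E_def cause_premetric_def \<delta>_def \<delta>l_def \<delta>f_def)
    have nn: "0 \<le> \<delta>l" "0 \<le> \<delta>f" "0 \<le> \<delta>"
      unfolding \<delta>_def \<delta>l_def \<delta>f_def using law_premetric_bound(1)[OF pos] diffeo_premetric_nonneg
      by (auto intro: add_nonneg_nonneg)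
    have \<delta>1: "\<delta> < 1" using \<delta>lt by (simp add: c0_def)
    define R where "R = (\<lambda>x. inv ((*v) A) (f x) - x)"
    have bA: "bij ((*v) A)" and bf: "bij f" using Ad f by (auto simp: C1_diffeos_def)
    have fR: "f u = A *v (u + R u)" for u by (rule diffeo_remainder[OF bA]) (simp add: R_def)
    have \<delta>f1: "\<delta>f < 1" using \<delta>1 nn by (simp add: \<delta>_def)
    have lh: "lip_hoelder (1 - \<alpha>) \<delta>f (2 * \<delta>f powr \<alpha>) R"
      unfolding R_def \<delta>f_def by (rule diffeo_premetric_lip_hoelder[OF Ad f _ \<alpha>]) (use \<delta>f1 in \<open>simp add: \<delta>f_def\<close>)
    obtain z where z: "z + R z = 0" using remainder_zero[OF A fR bf] by blast
    have "\<delta> \<le> \<delta> powr \<alpha>"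
    proof (cases "\<delta> = 0")
      case False
      then have "\<delta> powr 1 \<le> \<delta> powr \<alpha>" using nn \<delta>1 \<alpha> by (intro powr_mono') auto
      then show ?thesis using nn by simp
    qed simp
    then have "L * \<delta>l \<le> L * \<delta> powr \<alpha>" using L nn by (intro mult_left_mono) (auto simp: \<delta>_def)
    moreover have "2 * \<delta>f powr \<alpha> \<le> 2 * \<delta> powr \<alpha>" using nn \<alpha> by (intro mult_left_mono powr_mono2) (auto simp: \<delta>_def)
    ultimately have eH: "L * \<delta>l + 2 * \<delta>f powr \<alpha> \<le> (L + 2) * \<delta> powr \<alpha>" by (simp add: distrib_right)
    have "\<delta> powr \<alpha> \<le> ((\<eta>0 / (L + 2)) powr (1 / \<alpha>)) powr \<alpha>"
      using \<delta>lt nn \<alpha> by (intro powr_mono2) (auto simp: c0_def)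
    then have "\<delta> powr \<alpha> \<le> \<eta>0 / (L + 2)" using \<alpha> c L by (simp add: powr_powr)
    then have "(L + 2) * \<delta> powr \<alpha> \<le> \<eta>0" using L by (simp add: field_simps)
    then have le: "L * \<delta>l + 2 * \<delta>f powr \<alpha> \<le> \<eta>0" using eH by linarith
    have "C * (L * \<delta>l + 2 * \<delta>f powr \<alpha>) \<le> C * ((L + 2) * \<delta> powr \<alpha>)" using eH c by (intro mult_left_mono) auto
    also have "\<dots> = c2 * \<delta> powr \<alpha>" by (simp add: c2_def)
    also have "\<dots> \<le> \<epsilon>" by (rule radius_bound[OF \<epsilon> c2 \<alpha>(1) nn(3) \<delta>lt(2)])
    finally have C\<epsilon>: "C * (L * \<delta>l + 2 * \<delta>f powr \<alpha>) \<le> \<epsilon>" .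
    have \<mu>d: "\<mu> \<in> dot_laws" using S(1) \<mu> by blast
    show "(\<forall>\<theta> \<in> inversion \<Phi> (\<mu>, f). \<exists>M \<in> monomial_mats. \<exists>E. norm M \<le> c3 \<and> norm E \<le> \<epsilon> \<and>
              \<theta> = M ** (mat 1 + E) ** matrix_inv A) \<and>
          deviance \<Phi> (\<mu>, f) \<le> ennreal (c4 * (\<epsilon> + diffeo_premetric ((*v) A) f * (1 + \<epsilon>)))"
      unfolding \<delta>f_def[symmetric]
      by (rule robust_atD(3)[OF est \<mu>d fR lh less_imp_le[OF \<delta>f1] z disjI2[OF S(7)[OF \<mu>]]
            L(2)[of _ \<mu>, folded \<delta>l_def] S(6)[folded \<kappa>] le C\<epsilon>])
  qed
qed

text \<open>With \<open>R = 0\<close> the Hoelder constant is 0, so \<open>robust_at\<close> applies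
  with \<open>K = 0\<close> and \<open>\<gamma> = 0\<close>: no moment bound on \<mu> enters, and
  the constants know nothing of the core-integrability data. The error is now linear in the
  premetric, hence the exponent 2 in place of \<open>2 / \<alpha>\<close>.\<close>

lemma robust_quantitative_linear:
  fixes \<mu>s :: "'d::finite law"
  shows "\<exists>c0>0. \<exists>c1>0. \<exists>c2>0. \<exists>c3>0. \<exists>c4>0.
        \<forall>\<SS> K \<beta> p \<alpha> b \<Delta> \<Phi>. ica_setting \<SS> K \<beta> p \<alpha> b \<Delta> \<Phi> \<and> \<kappa>0 = b + \<Delta> \<and> (\<mu>s, A) \<in> ica_causes b \<SS> \<longrightarrow>
        (\<forall>\<epsilon>>0. \<forall>\<mu> \<in> dot_laws.
          law_premetric \<mu>s \<mu> < min c0 (c1\<^sup>2 * (\<epsilon> / (c2 + \<epsilon>))\<^sup>2) \<longrightarrow>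
          (\<forall>\<theta> \<in> inversion \<Phi> (\<mu>, (*v) A). \<exists>M \<in> monomial_mats. \<exists>E. norm M \<le> c3 \<and> norm E \<le> \<epsilon> \<and>
              \<theta> = M ** (mat 1 + E) ** matrix_inv A) \<and>
          deviance \<Phi> (\<mu>, (*v) A) \<le>
            ennreal (c4 * (\<epsilon> + diffeo_premetric ((*v) A) ((*v) A) * (1 + \<epsilon>))) \<and>
          c4 * (\<epsilon> + diffeo_premetric ((*v) A) ((*v) A) * (1 + \<epsilon>)) = c4 * \<epsilon>)"
\<comment> \<open>The distinction mentions only \<mu>s, \<open>A\<close> and \<kappa>0, so that the
  constants may precede the quantifiers over \<open>\<SS>\<close>, \<open>K\<close> and the
  exponents.\<close>
proof (cases "\<mu>s \<in> S_star \<and> invertible A \<and> (*v) A \<in> C1_diffeos \<and> 1 \<le> \<kappa>0")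
  case False
  have no: "\<not> (ica_setting \<SS> K \<beta> p \<alpha> b \<Delta> \<Phi> \<and> \<kappa>0 = b + \<Delta> \<and> (\<mu>s, A) \<in> ica_causes b \<SS>)" for \<SS> K \<beta> p \<alpha> b \<Delta> \<Phi>
  proof
    assume h: "ica_setting \<SS> K \<beta> p \<alpha> b \<Delta> \<Phi> \<and> \<kappa>0 = b + \<Delta> \<and> (\<mu>s, A) \<in> ica_causes b \<SS>"
    then have "1 \<le> \<kappa>0" using ica_settingD(5)[of \<SS> K \<beta> p \<alpha> b \<Delta> \<Phi>] by simp
    then show False using False h ica_causesD[of \<mu>s A b \<SS>] by simp
  qed
  show ?thesis
    by ((rule exI[of _ 1], rule conjI[OF zero_less_one])+, (rule allI)+, rule impI, erule notE[OF no])
next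
  case True
  then have \<mu>s: "\<mu>s \<in> S_star" and A: "invertible A" and Ad: "(*v) A \<in> C1_diffeos" and \<kappa>0: "1 \<le> \<kappa>0" by auto
  have dot: "\<mu>s \<in> dot_laws" using \<mu>s by (simp add: S_star_def)
  note pos = esig_diag_pos[OF dot]
  obtain L where L: "0 < L" "\<And>\<mu> w. length w \<in> {2, 3} \<Longrightarrow> \<bar>esig \<mu> w - esig \<mu>s w\<bar> \<le> L * law_premetric \<mu>s \<mu>"
    using law_premetric_bound(2)[OF pos] by blast
  obtain C \<eta>0 c3 c4 where c: "0 < C" "0 < \<eta>0" "0 < c3" "0 < c4" and est: "robust_at \<mu>s A \<kappa>0 0 0 C \<eta>0 c3 c4"
    using robust_estimate[OF \<mu>s A \<kappa>0 order_refl order_refl zero_le_one] by blast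
  define c0 where "c0 = \<eta>0 / L"
  have c0: "0 < c0" using c L by (simp add: c0_def)
  define c2 where "c2 = C * L"
  have c2: "0 < c2" using c L by (simp add: c2_def)
  have d0: "diffeo_premetric ((*v) A) ((*v) A) = 0" by (rule diffeo_premetric_self) (use Ad in \<open>simp add: C1_diffeos_def\<close>)
  show ?thesis
  proof (rule exI[of _ c0], rule conjI[OF c0], rule exI[of _ 1], rule conjI[OF zero_less_one], rule exI[of _ c2], rule conjI[OF c2],
      rule exI[of _ c3], rule conjI[OF c(3)], rule exI[of _ c4], rule conjI[OF c(4)], intro allI impI ballI)
    fix \<SS> K \<beta> p \<alpha> b \<Delta> \<Phi> \<epsilon> \<mu>
    assume set: "ica_setting \<SS> K \<beta> p \<alpha> b \<Delta> \<Phi> \<and> \<kappa>0 = b + \<Delta> \<and> (\<mu>s, A) \<in> ica_causes b \<SS>"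
      and \<epsilon>: "0 < \<epsilon>" and \<mu>: "\<mu> \<in> dot_laws" and lt: "law_premetric \<mu>s \<mu> < min c0 (1\<^sup>2 * (\<epsilon> / (c2 + \<epsilon>))\<^sup>2)"
    define \<delta> where "\<delta> = law_premetric \<mu>s \<mu>"
    have \<delta>0: "0 \<le> \<delta>" unfolding \<delta>_def by (rule law_premetric_bound(1)[OF pos])
    have "\<delta> < (\<epsilon> / (c2 + \<epsilon>)) powr (2 / 1)" using lt \<epsilon> c2 by (simp add: \<delta>_def powr_numeral)
    from radius_bound[OF \<epsilon> c2 zero_less_one \<delta>0 this] have "C * (L * \<delta> + 0) \<le> \<epsilon>"
      using \<delta>0 by (simp add: c2_def mult_ac)
    moreover have "L * \<delta> + 0 \<le> \<eta>0" using lt L by (simp add: \<delta>_def c0_def field_simps)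
    moreover have "lip_hoelder 0 0 0 (\<lambda>u::real^'d. 0::real^'d)" by (simp add: lip_hoelder_def)
    moreover have "inversion_map \<kappa>0 \<Phi>" using set ica_settingD(6) by blast
    ultimately have "(\<forall>\<theta> \<in> inversion \<Phi> (\<mu>, (*v) A). \<exists>M \<in> monomial_mats. \<exists>E. norm M \<le> c3 \<and> norm E \<le> \<epsilon> \<and>
              \<theta> = M ** (mat 1 + E) ** matrix_inv A) \<and>
          deviance \<Phi> (\<mu>, (*v) A) \<le> ennreal (c4 * (\<epsilon> + 0 * (1 + \<epsilon>)))"
      using L(2)[of _ \<mu>, folded \<delta>_def]
      by (intro robust_atD(3)[OF est \<mu>, where R = "\<lambda>u. 0" and e = "L * \<delta>" and H = 0 and z = 0]) auto
    then show "(\<forall>\<theta> \<in> inversion \<Phi> (\<mu>, (*v) A). \<exists>M \<in> monomial_mats. \<exists>E. norm M \<le> c3 \<and> norm E \<le> \<epsilon> \<and>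
              \<theta> = M ** (mat 1 + E) ** matrix_inv A) \<and>
          deviance \<Phi> (\<mu>, (*v) A) \<le>
            ennreal (c4 * (\<epsilon> + diffeo_premetric ((*v) A) ((*v) A) * (1 + \<epsilon>))) \<and>
          c4 * (\<epsilon> + diffeo_premetric ((*v) A) ((*v) A) * (1 + \<epsilon>)) = c4 * \<epsilon>"
      unfolding d0 by simp
  qed
qed

section \<open>Continuity\<close>

text \<open>Premetric balls need not be neighbourhoods of their centre in the topology of \<open>E_topology\<close>: a ball
  around \<open>f\<close> contains all \<open>f \<circ> T\<close> with \<open>T\<close> a translation, however far. Small Lipschitz and Hoelder
  constants of the remainder, in contrast, are stable under composition and define open sets.\<close>

definition cause_nbhd ::
  "('d::finite) law set \<Rightarrow> 'd law \<Rightarrow> real^'d^'d \<Rightarrow> real \<Rightarrow> real \<Rightarrow> 'd cause set" where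
  "cause_nbhd \<SS> \<mu>s A \<gamma> r = {(\<mu>, f) \<in> domain_E \<SS>.
     (\<exists>e<r. \<forall>w. length w \<in> {2, 3} \<longrightarrow> \<bar>esig \<mu> w - esig \<mu>s w\<bar> \<le> e) \<and>
     (\<exists>R j H. j < r \<and> H < r \<and> (\<forall>u. f u = A *v (u + R u)) \<and> lip_hoelder \<gamma> j H R)}"

text \<open>A map near \<open>f2\<close> is \<open>f2\<close> after \<open>id + R\<close> with small
  \<open>R\<close>, and composing with the remainder of \<open>f2\<close> increases the constants
  only slightly. The strict inequalities in \<open>cause_nbhd\<close> leave room for this.\<close>

lemma openin_cause_nbhd:
  fixes \<mu>s :: "'d::finite law"
  assumes S: "\<SS> \<subseteq> dot_laws" and \<alpha>: "0 < \<alpha>" "\<alpha> < 1/2"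
  shows "openin (E_topology \<SS>) (cause_nbhd \<SS> \<mu>s A (1 - \<alpha>) r)"
  unfolding openin_E_topology
proof (intro conjI ballI)
  show "cause_nbhd \<SS> \<mu>s A (1 - \<alpha>) r \<subseteq> domain_E \<SS>" by (auto simp: cause_nbhd_def)
  fix q assume q: "q \<in> cause_nbhd \<SS> \<mu>s A (1 - \<alpha>) r"
  obtain \<mu>2 f2 where qe: "q = (\<mu>2, f2)" by (cases q)
  obtain e2 R2 j2 H2 where \<mu>2: "\<mu>2 \<in> \<SS>" and f2: "f2 \<in> C1_diffeos" and e2: "e2 < r"
      "\<And>w. length w \<in> {2, 3} \<Longrightarrow> \<bar>esig \<mu>2 w - esig \<mu>s w\<bar> \<le> e2"
    and jH: "j2 < r" "H2 < r" and f2R: "\<And>u. f2 u = A *v (u + R2 u)" and lh2: "lip_hoelder (1 - \<alpha>) j2 H2 R2"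
    using q unfolding qe cause_nbhd_def domain_E_def by blast
  have j0: "0 \<le> j2" "0 \<le> H2" using lh2 by (auto simp: lip_hoelder_def)
  have pos: "0 < esig \<mu>2 [i, i]" for i using S \<mu>2 esig_diag_pos by blast
  obtain L where L: "0 < L" "\<And>\<mu> w. length w \<in> {2, 3} \<Longrightarrow> \<bar>esig \<mu> w - esig \<mu>2 w\<bar> \<le> L * law_premetric \<mu>2 \<mu>"
    using law_premetric_bound(2)[OF pos] by blast
  have lim0: "((\<lambda>x::real. x) \<longlongrightarrow> 0) (at_right 0)" by (rule tendsto_ident_at)
  have powlim: "((\<lambda>x::real. x powr \<alpha>) \<longlongrightarrow> 0) (at_right 0)"
    using tendsto_powr'[OF lim0 tendsto_const[of \<alpha>]] \<alpha> by (simp add: eventually_at_right_less eventually_mono[OF eventually_at_right_less])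
  \<comment> \<open>All three quantities that must stay below \<open>r\<close> tend, as the radius
    shrinks, to their values at the given point, so one small radius serves them all.\<close>
  have ev: "\<forall>\<^sub>F x in at_right (0::real). 0 < x \<and> x < 1 \<and> L * x + e2 < r \<and> x + j2 * (1 + x) < r \<and> 2 * x powr \<alpha> + H2 * (1 + x) < r"
  proof (intro eventually_conj)
    show "\<forall>\<^sub>F x in at_right (0::real). 0 < x" by (rule eventually_at_right_less)
    show "\<forall>\<^sub>F x in at_right (0::real). x < 1" using order_tendstoD(2)[OF lim0, of 1] by simp
    have "((\<lambda>x. L * x + e2) \<longlongrightarrow> L * 0 + e2) (at_right 0)" by (intro tendsto_intros lim0)
    then show "\<forall>\<^sub>F x in at_right (0::real). L * x + e2 < r" using e2(1) by (intro order_tendstoD(2)) auto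
    have "((\<lambda>x. x + j2 * (1 + x)) \<longlongrightarrow> 0 + j2 * (1 + 0)) (at_right 0)" by (intro tendsto_intros lim0)
    then show "\<forall>\<^sub>F x in at_right (0::real). x + j2 * (1 + x) < r" using jH(1) by (intro order_tendstoD(2)) auto
    have "((\<lambda>x. 2 * x powr \<alpha> + H2 * (1 + x)) \<longlongrightarrow> 2 * 0 + H2 * (1 + 0)) (at_right 0)" by (intro tendsto_intros lim0 powlim)
    then show "\<forall>\<^sub>F x in at_right (0::real). 2 * x powr \<alpha> + H2 * (1 + x) < r" using jH(2) by (intro order_tendstoD(2)) auto
  qed
  obtain x where x: "0 < x" "x < 1" "L * x + e2 < r" "x + j2 * (1 + x) < r" "2 * x powr \<alpha> + H2 * (1 + x) < r"
    using eventually_happens'[OF trivial_limit_at_right_real ev] by blast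
  show "\<exists>x>0. cause_ball \<SS> q x \<subseteq> cause_nbhd \<SS> \<mu>s A (1 - \<alpha>) r"
  proof (intro exI[of _ x] conjI x(1) subsetI)
    fix q3 assume q3: "q3 \<in> cause_ball \<SS> q x"
    obtain \<mu>3 f3 where q3e: "q3 = (\<mu>3, f3)" by (cases q3)
    define \<delta>l where "\<delta>l = law_premetric \<mu>2 \<mu>3"
    define \<delta>f where "\<delta>f = diffeo_premetric f2 f3"
    have \<mu>3: "\<mu>3 \<in> \<SS>" and f3: "f3 \<in> C1_diffeos" and lt: "\<delta>l + \<delta>f < x"
      using q3 by (auto simp: q3e qe cause_ball_def domain_E_def cause_premetric_def \<delta>l_def \<delta>f_def)
    have nn: "0 \<le> \<delta>l" "0 \<le> \<delta>f"
      unfolding \<delta>l_def \<delta>f_def by (rule law_premetric_bound(1)[OF pos], rule diffeo_premetric_nonneg)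
    have \<delta>x: "\<delta>l < x" "\<delta>f < x" "\<delta>f < 1" using lt nn x by auto
    have close: "\<bar>esig \<mu>3 w - esig \<mu>s w\<bar> \<le> L * \<delta>l + e2" if w: "length w \<in> {2, 3}" for w
      using L(2)[OF w, of \<mu>3] e2(2)[OF w] unfolding \<delta>l_def[symmetric] by linarith
    have "L * \<delta>l + e2 < r" using x(3) mult_strict_left_mono[OF \<delta>x(1) L(1)] by linarith
    define R where "R = (\<lambda>x. inv f2 (f3 x) - x)"
    have lh: "lip_hoelder (1 - \<alpha>) \<delta>f (2 * \<delta>f powr \<alpha>) R"
      unfolding R_def \<delta>f_def by (rule diffeo_premetric_lip_hoelder[OF f2 f3 _ \<alpha>]) (use \<delta>x in \<open>simp add: \<delta>f_def\<close>)
    have "lip_hoelder (1 - \<alpha>) (\<delta>f + j2 * (1 + \<delta>f)) (2 * \<delta>f powr \<alpha> + H2 * (1 + \<delta>f)) (\<lambda>u. R u + R2 (u + R u))"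
      by (rule lip_hoelder_compose[OF lh lh2]) (use \<alpha> in auto)
    moreover have "f3 u = A *v (u + (R u + R2 (u + R u)))" for u
    proof -
      have "f3 u = f2 (u + R u)" using f2 by (simp add: R_def C1_diffeos_def bij_def surj_f_inv_f)
      then show ?thesis by (simp add: f2R add.assoc)
    qed
    moreover have "\<delta>f + j2 * (1 + \<delta>f) < r"
      using x(4) \<delta>x mult_left_mono[of "1 + \<delta>f" "1 + x" j2] j0 by linarith
    moreover have "2 * \<delta>f powr \<alpha> + H2 * (1 + \<delta>f) < r"
    proof -
      have "\<delta>f powr \<alpha> \<le> x powr \<alpha>" using nn \<delta>x \<alpha> by (intro powr_mono2) auto
      then show ?thesis using x(5) \<delta>x mult_left_mono[of "1 + \<delta>f" "1 + x" H2] j0 by linarith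
    qed
    ultimately have "\<exists>R j H. j < r \<and> H < r \<and> (\<forall>u. f3 u = A *v (u + R u)) \<and> lip_hoelder (1 - \<alpha>) j H R"
      by (intro exI[of _ "\<lambda>u. R u + R2 (u + R u)"] exI conjI allI)
    then show "q3 \<in> cause_nbhd \<SS> \<mu>s A (1 - \<alpha>) r"
      unfolding q3e cause_nbhd_def domain_E_def using \<mu>3 f3 close \<open>L * \<delta>l + e2 < r\<close> by blast
  qed
qed

lemma domain_E_subset_causal_space:
  assumes "\<SS> \<subseteq> dot_laws"
  shows "domain_E \<SS> \<subseteq> causal_space"
proof (rule subsetI)
  fix q assume "q \<in> domain_E \<SS>"
  then obtain \<mu> f where q: "q = (\<mu>, f)" "\<mu> \<in> \<SS>" "f \<in> C1_diffeos" by (auto simp: domain_E_def)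
  have b: "inv f (f x) = x" for x using q(3) by (simp add: C1_diffeos_def bij_def inv_f_f)
  have c: "continuous_on S f" for S using continuous_on_subset[OF C1_diffeos_continuous[OF q(3)]] by blast
  have "continuous_on UNIV (inv f)"
    using q(3) by (auto simp: C1_diffeos_def C1_map_def intro!: continuous_at_imp_continuous_on differentiable_imp_continuous_within)
  then have "continuous_on S (inv f)" for S using continuous_on_subset by blast
  then have "homeomorphism (spatial_supp \<mu>) (f ` spatial_supp \<mu>) f (inv f)"
    unfolding homeomorphism_def using b c by (auto simp: image_image)
  then show "q \<in> causal_space" using q assms dot_lawsD(1) unfolding causal_space_def by auto
qed

lemma topspace_causal_topology:
  assumes "\<SS> \<subseteq> dot_laws"
  shows "topspace (causal_topology \<SS>) = causal_space"
proof -
  have "openin (E_topology \<SS>) (domain_E \<SS>)"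
    unfolding openin_E_topology cause_ball_def by (auto intro: exI[of _ 1])
  then have "openin (causal_topology \<SS>) causal_space"
    unfolding openin_causal_topology
    using domain_E_subset_causal_space[OF assms] by (simp add: Int_absorb1)
  then show ?thesis
    using openin_causal_topology openin_subset topspace_def by (metis openin_topspace subset_antisym)
qed

lemma openin_causal_nbhd:
  assumes "\<SS> \<subseteq> dot_laws" "0 < \<alpha>" "\<alpha> < 1/2"
  shows "openin (causal_topology \<SS>) (cause_nbhd \<SS> \<mu>s A (1 - \<alpha>) r)"
proof -
  have "cause_nbhd \<SS> \<mu>s A (1 - \<alpha>) r \<subseteq> domain_E \<SS>" by (auto simp: cause_nbhd_def)
  then show ?thesis
    unfolding openin_causal_topology
    using openin_cause_nbhd[OF assms, of \<mu>s A r] domain_E_subset_causal_space[OF assms(1)]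
    by (simp add: Int_absorb2 Diff_eq_empty_iff subset_trans)
qed

lemma inversion_in_compact_GL_sets:
  assumes "inversion_map \<kappa>0 \<Phi>" "q \<in> causal_space"
  shows "inversion \<Phi> q \<in> compact_GL_sets"
proof -
  obtain \<mu> f g where q: "q = (\<mu>, f)" "\<mu> \<in> laws" "homeomorphism (spatial_supp \<mu>) (f ` spatial_supp \<mu>) f g"
    using assms(2) unfolding causal_space_def by auto
  then have "pushforward f \<mu> \<in> laws"
    using homeomorphism_cont1 by (intro pushforward_in_laws) auto
  then show ?thesis using assms(1) q by (auto simp: inversion_def inversion_map_def)
qed

lemma hausdorff_dist_le:
  fixes K L :: "(real^'d^'d) set"
  assumes K: "K \<in> compact_GL_sets" and L: "L \<in> compact_GL_sets"
    and 1: "\<And>a. a \<in> K \<Longrightarrow> \<exists>b\<in>L. dist a b \<le> r" and 2: "\<And>b. b \<in> L \<Longrightarrow> \<exists>a\<in>K. dist b a \<le> r"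
  shows "hausdorff_dist K L \<le> r"
proof -
  have "infdist a L \<le> r" if "a \<in> K" for a
    using 1[OF that] infdist_le order_trans by blast
  moreover have "infdist b K \<le> r" if "b \<in> L" for b
    using 2[OF that] infdist_le order_trans by blast
  moreover have "compact K" "K \<noteq> {}" "compact L" "L \<noteq> {}" using K L by (auto simp: compact_GL_sets_def)
  ultimately show ?thesis unfolding hausdorff_dist_def by (auto intro!: cSUP_least)
qed

lemma signed_permutation_pair_norm:
  fixes X :: "real^'d^'d::finite"
  assumes "signed_permutation V" "signed_permutation W"
  shows "norm (V ** (W ** X)) \<le> ((real CARD('d))\<^sup>2)\<^sup>2 * norm X"
proof -
  let ?c = "(real CARD('d))\<^sup>2"
  have "norm (V ** (W ** X)) \<le> norm V * (norm W * norm X)"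
    by (rule order_trans[OF norm_matrix_mult_le mult_left_mono[OF norm_matrix_mult_le norm_ge_zero]])
  also have "\<dots> \<le> ?c * (?c * norm X)"
    using assms[THEN norm_signed_permutation] by (intro mult_mono) auto
  finally show ?thesis by (simp add: power2_eq_square mult.assoc)
qed

lemma continuity_at_ica_cause:
  fixes \<mu>s :: "'d::finite law"
  assumes set: "ica_setting \<SS> K \<beta> p \<alpha> b \<Delta> \<Phi>" and causes: "(\<mu>s, A) \<in> ica_causes b \<SS>"
  shows "topcontinuous_at (causal_topology \<SS>) hausdorff_topology (inversion \<Phi>) (\<mu>s, (*v) A)"
    and "topcontinuous_at (causal_topology \<SS>) euclidean (deviance \<Phi>) (\<mu>s, (*v) A)"
proof -
  note S = ica_settingD[OF set] and D = ica_causesD[OF causes]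
  have \<gamma>: "0 \<le> 1 - \<alpha>" "1 - \<alpha> \<le> 1" using S by auto
  obtain C \<eta>0 c3 c4 where c: "0 < C" "0 < \<eta>0" "0 < c3" "0 < c4"
    and est: "robust_at \<mu>s A (b + \<Delta>) K (1 - \<alpha>) C \<eta>0 c3 c4"
    using robust_estimate[OF D(1,2) S(5,4) \<gamma>] by blast
  let ?p = "(\<mu>s, (*v) A)"
  let ?U = "cause_nbhd \<SS> \<mu>s A (1 - \<alpha>)"
  let ?N = "scale_mat \<mu>s ** matrix_inv A"
  have pE: "?p \<in> domain_E \<SS>" using D by (simp add: domain_E_def)
  have ptop: "?p \<in> causal_space" using pE domain_E_subset_causal_space[OF S(1)] by blast
  have lh0: "lip_hoelder (1 - \<alpha>) 0 0 (\<lambda>u::real^'d. 0::real^'d)" by (simp add: lip_hoelder_def)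
  have pU: "?p \<in> ?U r" if "0 < r" for r
    unfolding cause_nbhd_def mem_Collect_eq prod.case
    using pE that lh0 by (intro conjI exI[of _ "0::real"] exI[of _ "\<lambda>u::real^'d. 0::real^'d"]) auto
  have near: "(\<forall>B\<in>inversion \<Phi> q. \<exists>W. signed_permutation W \<and> norm (B - W ** ?N) \<le> C * (2 * r)) \<and>
      (\<forall>B\<in>inversion \<Phi> q. \<forall>W. signed_permutation W \<longrightarrow> W ** B \<in> inversion \<Phi> q) \<and>
      deviance \<Phi> q \<le> ennreal (c4 * (C * (2 * r) + r * (1 + C * (2 * r))))"
    if q: "q \<in> ?U r" and r: "0 < r" "2 * r \<le> \<eta>0" "r \<le> 1" for q r
  proof -
    obtain \<mu> f where qe: "q = (\<mu>, f)" by (cases q)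
    obtain e R j H where \<mu>: "\<mu> \<in> \<SS>" and f: "f \<in> C1_diffeos" and e: "e < r"
        "\<And>w. length w \<in> {2, 3} \<Longrightarrow> \<bar>esig \<mu> w - esig \<mu>s w\<bar> \<le> e"
      and jH: "j < r" "H < r" and fR: "\<And>u. f u = A *v (u + R u)" and lh: "lip_hoelder (1 - \<alpha>) j H R"
      using q unfolding qe cause_nbhd_def domain_E_def by blast
    have \<mu>d: "\<mu> \<in> dot_laws" using S(1) \<mu> by blast
    have "bij f" using f by (simp add: C1_diffeos_def)
    then obtain z where z: "z + R z = 0" using remainder_zero[OF D(2) fR] by blast
    have j1: "j \<le> 1" and le: "e + H \<le> \<eta>0" using jH e r by auto
    note est' = robust_atD[OF est \<mu>d fR lh j1 z disjI2[OF S(7)[OF \<mu>]] e(2) S(6) le]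
    have CeH: "C * (e + H) \<le> C * (2 * r)" using c jH e by (intro mult_left_mono) auto
    have "deviance \<Phi> (\<mu>, f) \<le> ennreal (c4 * (C * (2 * r) + j * (1 + C * (2 * r))))"
      using est'(3)[OF _ CeH] by blast
    also have "\<dots> \<le> ennreal (c4 * (C * (2 * r) + r * (1 + C * (2 * r))))"
      using c r jH by (intro ennreal_leI mult_left_mono add_left_mono mult_right_mono) auto
    finally have "deviance \<Phi> q \<le> ennreal (c4 * (C * (2 * r) + r * (1 + C * (2 * r))))" unfolding qe .
    moreover have "\<exists>W. signed_permutation W \<and> norm (B - W ** ?N) \<le> C * (2 * r)" if B: "B \<in> inversion \<Phi> q" for B
      using est'(1)[OF _ B[unfolded qe]] CeH by (meson order_trans)
    ultimately show ?thesis using est'(2) unfolding qe by blast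
  qed
  have z0: "(0::real^'d) + 0 = 0" by simp
  have lin: "\<And>u. A *v u = A *v (u + 0)" by simp
  have e0: "\<bar>esig \<mu>s w - esig \<mu>s w\<bar> \<le> 0" for w by simp
  have dots: "\<mu>s \<in> dot_laws" using S(1) D(3) by blast
  have le0: "0 + 0 \<le> \<eta>0" using c by simp
  \<comment> \<open>The estimate with zero error at the cause itself: every element of the inversion
    set is exactly a signed permutation times \<open>?N\<close>, and the deviance is 0.\<close>
  note base = robust_atD[OF est dots lin lh0 zero_le_one z0 disjI1[OF refl] e0 S(6) le0]
  have dev0: "deviance \<Phi> ?p = 0" using base(3)[of 0] by simp
  interpret M: Metric_space "compact_GL_sets :: (real^'d^'d) set set" hausdorff_dist
    by (rule Metric_space_hausdorff)
  have inv_top: "inversion \<Phi> q \<in> compact_GL_sets" if "q \<in> causal_space" for q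
    by (rule inversion_in_compact_GL_sets[OF S(6) that])
  show "topcontinuous_at (causal_topology \<SS>) hausdorff_topology (inversion \<Phi>) ?p"
    unfolding topcontinuous_at_def topspace_causal_topology[OF S(1)] hausdorff_topology_def M.topspace_mtopology
  proof (intro conjI ptop allI impI)
    show "inversion \<Phi> \<in> causal_space \<rightarrow> compact_GL_sets" using inv_top by blast
    fix V assume "openin M.mtopology V \<and> inversion \<Phi> ?p \<in> V"
    then obtain \<epsilon> where \<epsilon>: "0 < \<epsilon>" "M.mball (inversion \<Phi> ?p) \<epsilon> \<subseteq> V"
      unfolding M.openin_mtopology by blast
    let ?d4 = "((real CARD('d))\<^sup>2)\<^sup>2"
    have d4: "1 \<le> ?d4" by (intro one_le_power) (simp add: Suc_leI)
    \<comment> \<open>The factor \<open>?d4\<close> accounts for two signed permutations, each of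
      Frobenius norm at most the squared dimension, by which elements of the sets are moved into
      place.\<close>
    define r where "r = min (min 1 (\<eta>0 / 2)) (\<epsilon> / (4 * (?d4 * C)))"
    have dC: "0 < ?d4 * C" using d4 c by simp
    have r: "0 < r" "2 * r \<le> \<eta>0" "r \<le> 1" using c \<epsilon> dC by (auto simp: r_def)
    have "r \<le> \<epsilon> / (4 * (?d4 * C))" by (simp add: r_def)
    then have "4 * (?d4 * C) * r \<le> \<epsilon>" using dC by (simp add: le_divide_eq mult.commute)
    then have small: "?d4 * (C * (2 * r)) < \<epsilon>" using \<epsilon> by (simp add: mult_ac)
    show "\<exists>U. openin (causal_topology \<SS>) U \<and> ?p \<in> U \<and> (\<forall>y\<in>U. inversion \<Phi> y \<in> V)"
    proof (intro exI[of _ "?U r"] conjI ballI openin_causal_nbhd S(1-3) pU r(1))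
      fix q assume q: "q \<in> ?U r"
      then have qtop: "q \<in> causal_space"
        using domain_E_subset_causal_space[OF S(1)] by (auto simp: cause_nbhd_def)
      note n = near[OF q r]
      have "hausdorff_dist (inversion \<Phi> ?p) (inversion \<Phi> q) \<le> ?d4 * (C * (2 * r))"
      proof (rule hausdorff_dist_le[OF inv_top[OF ptop] inv_top[OF qtop]])
        fix a assume "a \<in> inversion \<Phi> ?p"
        then obtain V where V: "signed_permutation V" "a = V ** ?N"
          using base(1)[of a] by auto
        obtain B where B: "B \<in> inversion \<Phi> q" using inv_top[OF qtop] by (auto simp: compact_GL_sets_def)
        obtain W where W: "signed_permutation W" "norm (B - W ** ?N) \<le> C * (2 * r)" using n B by blast
        note Wt = signed_permutation_transpose[OF W(1)]
        \<comment> \<open>An element \<open>B\<close> close to \<open>W ** ?N\<close> need not be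
          close to \<open>a\<close>; applying \<open>transpose W\<close> and then \<open>V\<close>
          carries it near \<open>a\<close>, without leaving the invariant set.\<close>
        have "V ** (transpose W ** B) \<in> inversion \<Phi> q" using n B V(1) Wt by blast
        moreover have "dist a (V ** (transpose W ** B)) \<le> ?d4 * (C * (2 * r))"
        proof -
          have "V ** (transpose W ** B) - a = V ** (transpose W ** (B - W ** ?N))"
            unfolding V(2) matrix_diff_ldistrib matrix_mul_assoc[of "transpose W" W] signed_permutation_orthogonal(1)[OF W(1)]
            by simp
          then have "dist a (V ** (transpose W ** B)) = norm (V ** (transpose W ** (B - W ** ?N)))"
            by (metis dist_commute dist_norm)
          also have "\<dots> \<le> ?d4 * norm (B - W ** ?N)" by (rule signed_permutation_pair_norm[OF V(1) Wt])
          also have "\<dots> \<le> ?d4 * (C * (2 * r))" using W(2) by (rule mult_left_mono) simp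
          finally show ?thesis .
        qed
        ultimately show "\<exists>b\<in>inversion \<Phi> q. dist a b \<le> ?d4 * (C * (2 * r))" by blast
      next
        have Cr: "0 \<le> C * (2 * r)" using c r by simp
        fix B assume B: "B \<in> inversion \<Phi> q"
        obtain W where W: "signed_permutation W" "norm (B - W ** ?N) \<le> C * (2 * r)" using n B by blast
        obtain a where a: "a \<in> inversion \<Phi> ?p" using inv_top[OF ptop] by (auto simp: compact_GL_sets_def)
        obtain V where V: "signed_permutation V" "a = V ** ?N" using base(1)[OF a] by auto
        \<comment> \<open>Conversely, invariance of the set at the cause shows that it contains
          \<open>W ** ?N\<close> for every signed permutation \<open>W\<close>, in particular for
          the one near \<open>B\<close>.\<close>
        have "W ** (transpose V ** a) \<in> inversion \<Phi> ?p"
          using base(2)[OF base(2)[OF a signed_permutation_transpose[OF V(1)]] W(1)] .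
        moreover have "W ** (transpose V ** a) = W ** ?N"
          unfolding V(2) matrix_mul_assoc[of "transpose V" V] signed_permutation_orthogonal(1)[OF V(1)] by simp
        moreover
        have "C * (2 * r) \<le> ?d4 * (C * (2 * r))" using mult_right_mono[OF d4 Cr] by simp
        then have "dist B (W ** ?N) \<le> ?d4 * (C * (2 * r))" using W(2) unfolding dist_norm by (rule order_trans[rotated])
        ultimately show "\<exists>a\<in>inversion \<Phi> ?p. dist B a \<le> ?d4 * (C * (2 * r))" by metis
      qed
      then have "inversion \<Phi> q \<in> M.mball (inversion \<Phi> ?p) \<epsilon>"
        using small inv_top[OF ptop] inv_top[OF qtop] by (simp add: M.in_mball)
      then show "inversion \<Phi> q \<in> V" using \<epsilon>(2) by blast
    qed
  qed
  show "topcontinuous_at (causal_topology \<SS>) euclidean (deviance \<Phi>) ?p"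
    unfolding topcontinuous_at_def topspace_causal_topology[OF S(1)]
  proof (intro conjI ptop allI impI)
    show "deviance \<Phi> \<in> causal_space \<rightarrow> topspace euclidean" by simp
    fix V :: "ennreal set" assume "openin euclidean V \<and> deviance \<Phi> ?p \<in> V"
    then have V: "open V" "0 \<in> V" using dev0 by auto
    \<comment> \<open>The deviance is 0 at the cause, so a neighbourhood of its value contains an
      interval starting at 0; a smaller endpoint is chosen because \<open>y\<close> may be
      infinite.\<close>
    obtain y where y: "0 < y" "{0..<y} \<subseteq> V" using open_right[OF V, of 1] by auto
    obtain y' where y': "0 < y'" "y' < y" using dense[OF y(1)] by blast
    then have y'fin: "y' \<noteq> \<top>" by auto
    define e where "e = enn2real y'"
    have e: "y' = ennreal e" "0 < e" using y' y'fin by (auto simp: e_def less_top enn2real_positive_iff)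
    define r where "r = min (min 1 (\<eta>0 / 2)) (e / (c4 * (4 * C + 1)))"
    have cc: "0 < c4 * (4 * C + 1)" using c by (simp add: add_pos_pos)
    have r: "0 < r" "2 * r \<le> \<eta>0" "r \<le> 1" using c e cc by (auto simp: r_def)
    have "r \<le> e / (c4 * (4 * C + 1))" by (simp add: r_def)
    then have re: "c4 * (4 * C + 1) * r \<le> e" using cc by (simp add: le_divide_eq mult.commute)
    have "r * (1 + C * (2 * r)) \<le> r * (1 + C * 2)" using r c by (intro mult_left_mono add_left_mono) auto
    then have "C * (2 * r) + r * (1 + C * (2 * r)) \<le> (4 * C + 1) * r" by (simp add: algebra_simps)
    then have "c4 * (C * (2 * r) + r * (1 + C * (2 * r))) \<le> c4 * ((4 * C + 1) * r)"
      using c by (intro mult_left_mono) auto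
    then have le: "c4 * (C * (2 * r) + r * (1 + C * (2 * r))) \<le> e" using re by (simp add: mult.assoc)
    show "\<exists>U. openin (causal_topology \<SS>) U \<and> ?p \<in> U \<and> (\<forall>y\<in>U. deviance \<Phi> y \<in> V)"
    proof (intro exI[of _ "?U r"] conjI ballI openin_causal_nbhd S(1-3) pU r(1))
      fix q assume q: "q \<in> ?U r"
      have "deviance \<Phi> q \<le> ennreal (c4 * (C * (2 * r) + r * (1 + C * (2 * r))))" using near[OF q r] by blast
      also have "\<dots> \<le> ennreal e" by (rule ennreal_leI[OF le])
      also have "\<dots> < y" using y' e by simp
      finally show "deviance \<Phi> q \<in> V" using y(2) by auto
    qed
  qed
qed

theorem theorem5p12:
  assumes "2 \<le> CARD('d::finite)"
  shows
    "(\<forall>(\<SS>::'d law set) K \<beta> p \<alpha> b \<Delta> \<Phi>. ica_setting \<SS> K \<beta> p \<alpha> b \<Delta> \<Phi> \<longrightarrow>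
        (\<forall>(\<mu>s, A) \<in> ica_causes b \<SS>.
           topcontinuous_at (causal_topology \<SS>) hausdorff_topology (inversion \<Phi>) (\<mu>s, (*v) A) \<and>
           topcontinuous_at (causal_topology \<SS>) euclidean (deviance \<Phi>) (\<mu>s, (*v) A)))
     \<and>
     (\<forall>(\<mu>s::'d law) A K \<beta> p \<alpha> \<kappa>0. \<exists>c0>0. \<exists>c1>0. \<exists>c2>0. \<exists>c3>0. \<exists>c4>0.
        \<forall>\<SS> b \<Delta> \<Phi>. ica_setting \<SS> K \<beta> p \<alpha> b \<Delta> \<Phi> \<and> \<kappa>0 = b + \<Delta> \<and> (\<mu>s, A) \<in> ica_causes b \<SS> \<longrightarrow>
        (\<forall>\<epsilon>>0. \<forall>\<mu> f.
          (\<mu>, f) \<in> cause_ball \<SS> (\<mu>s, (*v) A)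
             (min c0 (c1 powr (2 / \<alpha>) * (\<epsilon> / (c2 + \<epsilon>)) powr (2 / \<alpha>))) \<longrightarrow>
          (\<forall>\<theta> \<in> inversion \<Phi> (\<mu>, f). \<exists>M \<in> monomial_mats. \<exists>E. norm M \<le> c3 \<and> norm E \<le> \<epsilon> \<and>
              \<theta> = M ** (mat 1 + E) ** matrix_inv A) \<and>
          deviance \<Phi> (\<mu>, f) \<le> ennreal (c4 * (\<epsilon> + diffeo_premetric ((*v) A) f * (1 + \<epsilon>)))))
     \<and>
     (\<forall>(\<mu>s::'d law) A \<kappa>0. \<exists>c0>0. \<exists>c1>0. \<exists>c2>0. \<exists>c3>0. \<exists>c4>0.
        \<forall>\<SS> K \<beta> p \<alpha> b \<Delta> \<Phi>. ica_setting \<SS> K \<beta> p \<alpha> b \<Delta> \<Phi> \<and> \<kappa>0 = b + \<Delta> \<and> (\<mu>s, A) \<in> ica_causes b \<SS> \<longrightarrow>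
        (\<forall>\<epsilon>>0. \<forall>\<mu> \<in> dot_laws.
          law_premetric \<mu>s \<mu> < min c0 (c1\<^sup>2 * (\<epsilon> / (c2 + \<epsilon>))\<^sup>2) \<longrightarrow>
          (\<forall>\<theta> \<in> inversion \<Phi> (\<mu>, (*v) A). \<exists>M \<in> monomial_mats. \<exists>E. norm M \<le> c3 \<and> norm E \<le> \<epsilon> \<and>
              \<theta> = M ** (mat 1 + E) ** matrix_inv A) \<and>
          deviance \<Phi> (\<mu>, (*v) A) \<le>
            ennreal (c4 * (\<epsilon> + diffeo_premetric ((*v) A) ((*v) A) * (1 + \<epsilon>))) \<and>
          c4 * (\<epsilon> + diffeo_premetric ((*v) A) ((*v) A) * (1 + \<epsilon>)) = c4 * \<epsilon>))"
proof (rule conjI[OF _ conjI])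
  show "\<forall>(\<SS>::'d law set) K \<beta> p \<alpha> b \<Delta> \<Phi>. ica_setting \<SS> K \<beta> p \<alpha> b \<Delta> \<Phi> \<longrightarrow>
        (\<forall>(\<mu>s, A) \<in> ica_causes b \<SS>.
           topcontinuous_at (causal_topology \<SS>) hausdorff_topology (inversion \<Phi>) (\<mu>s, (*v) A) \<and>
           topcontinuous_at (causal_topology \<SS>) euclidean (deviance \<Phi>) (\<mu>s, (*v) A))"
    using continuity_at_ica_cause by blast
qed (intro allI, rule robust_quantitative robust_quantitative_linear)+

end
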